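(* Assume that $G$ satisfies condition (G) (stated in the context) for some $\gamma\in\mathbf{N}$, $d>0$ and $L>0$. Let $0\le K<L$ with $[K]+1\le\gamma$ and $\varphi\in L^\infty\cap L^1_K$. Let $F=F(x,t,u)$ be a real-valued function on $\mathbf R^N\times(0,\infty)\times\mathbf R$ such that $$F(x,t,0)=0,\qquad |F(x,t,u_1)-F(x,t,u_2)|\le C_*(1+t)^A\max\{|u_1|^{p-1},|u_2|^{p-1}\}|u_1-u_2|$$ for $x\in\mathbf R^N$, $t>0$, $u_1,u_2\in\mathbf R$, where $C_*>0$, $A\in\mathbf R$, $p\ge1$, and assume $$A_p:=-A+N(p-1)/d-1>0.$$ Let $u$ be a global-in-time solution of $$u(x,t)=\int_{\mathbf R^N}G(x-y,t)\varphi(y)\,dy+\int_0^t\int_{\mathbf R^N}G(x-y,t-s)F(y,s,u(y,s))\,dy\,ds\quad\text{in }\mathbf R^N\times(0,\infty)$$ satisfying $$\sup_{t>0}(1+t)^{\frac Nd(1-\frac1q)}\|u(t)\|_q+\sup_{t>0}(1+t)^{-\frac{\ell}{d}}|||u(t)|||_\ell<\infty\quad\text{for any }q\in[1,\infty]\text{ and }\ell\in[0,K].$$ Write $f(x,t):=F(x,t,u(x,t))$. (i) For any $\alpha\in\mathbf M_K$, put $$c_\alpha(t):=M_\alpha(\varphi,0)+\int_0^tM_\alpha(f(s),s)\,ds.$$ If $A_p>|\alpha|/d$, then there exists a constant $c_\alpha$ such that $|c_\alpha(t)-c_\alpha|=O(t^{-A_p+|\alpha|/d})$ as $t\to\infty$.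 If $A_p\le|\alpha|/d$, then, as $t\to\infty$, $$c_\alpha(t)=\begin{cases}O(t^{-A_p+|\alpha|/d})&\text{if }A_p<|\alpha|/d,\\ O(\log t)&\text{if }A_p=|\alpha|/d.\end{cases}$$ (ii) Define functions $U_n=U_n(x,t)$ ($n=0,1,2,\dots$) inductively by $$U_0(x,t):=\sum_{|\alpha|\le K}c_\alpha(t)g_\alpha(x,t)$$ and, for $n=1,2,\dots$, with $F_{n-1}(x,t):=F(x,t,U_{n-1}(x,t))$, $$U_n(x,t):=U_0(x,t)+\int_0^te^{(t-s)\mathcal L}P_K(s)F_{n-1}(s)\,ds$$ $$=\sum_{|\alpha|\le K}\left[M_\alpha(\varphi,0)+\int_0^tM_\alpha(f(s)-F_{n-1}(s),s)\,ds\right]g_\alpha(x,t)+\int_0^te^{(t-s)\mathcal L}F_{n-1}(s)\,ds.$$ Then, for any $q\in[1,\infty]$, $\ell\in[0,K]$ and any $n=0,1,2,\dots$, $$\sup_{t>0}t^{\frac Nd(1-\frac1q)}\|U_n(t)\|_q+\sup_{t>0}(1+t)^{-\frac{\ell}{d}}|||U_n(t)|||_\ell<\infty$$ and $$t^{\frac Nd(1-\frac1q)}\|u(t)-U_n(t)\|_q+t^{-\frac{\ell}{d}}|||u(t)-U_n(t)|||_\ell=\begin{cases}o(t^{-\frac Kd})+O(t^{-(n+1)A_p})&\text{if }(n+1)A_p\ne K/d,\\ O(t^{-\frac Kd}\log t)&\text{if }(n+1)A_p=K/d,\end{cases}$$ as $t\to\infty$.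
   Context: $N\ge1$ is an integer and $\mathbf N=\{1,2,\dots\}$. All functions are understood to be measurable (for $F$: such that $(x,t)\mapsto F(x,t,w(x,t))$ is measurable for measurable $w$). For $k\ge0$, $[k]$ is the integer with $k-1<[k]\le k$. $\mathbf M=(\mathbf N\cup\{0\})^N$ is the set of multi-indices, with the usual $|\alpha|$, $\alpha!$, $x^\alpha$, $\partial_x^\alpha$; $\beta\le\alpha$ means $\beta_i\le\alpha_i$ for all $i$; $\mathbf M_k=\{\alpha\in\mathbf M:|\alpha|\le k\}$. $\|\cdot\|_r$ is the norm of $L^r=L^r(\mathbf R^N)$. For $k\ge0$, $L^1_k=L^1(\mathbf R^N,(1+|x|^k)dx)$ with norm $|||f|||_k=\int_{\mathbf R^N}|f(x)|(1+|x|^k)\,dx$. For a function $f$ on $\mathbf R^N\times(0,\infty)$, $f(t)$ denotes $f(\cdot,t)$. When $p=1$, $|u|^{p-1}$ is read as $1$. Condition (G) (for $\gamma\in\mathbf N$, $d>0$, $L>0$) on a kernel $G:\mathbf R^N\times(0,\infty)\to\mathbf R$: (i) $G\in C^\gamma(\mathbf R^N\times(0,\infty))$; (ii) $G(x,t)=t^{-N/d}G(x/t^{1/d},1)$ for $x\in\mathbf R^N$, $t>0$, and $\sup_{x\in\mathbf R^N}(1+|x|)^{N+L+j}|\nabla_x^jG(x,1)|<\infty$ for $j=0,\dots,\gamma$; (iii) $G(x,t)=\int_{\mathbf R^N}G(x-y,t-s)G(y,s)\,dy$ for $x\in\mathbf R^N$, $t>s>0$. Put $e^{t\mathcal L}\varphi(x)=\int_{\mathbf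 R^N}G(x-y,t)\varphi(y)\,dy$ for $t>0$, $g(x,t)=G(x,t+1)$, and $g_\alpha(x,t)=\frac{(-1)^{|\alpha|}}{\alpha!}\partial_x^\alpha g(x,t)$ for $|\alpha|\le\gamma$. For $f\in L^1_k$ with $0\le k<L$, $[k]\le\gamma$, and $t\ge0$, the numbers $M_\alpha(f,t)$ ($|\alpha|\le k$) are defined inductively by $M_0(f,t)=\int_{\mathbf R^N}f(x)\,dx$ and, for $\alpha\ne0$, $$M_\alpha(f,t)=\int_{\mathbf R^N}x^\alpha f(x)\,dx-\sum_{\beta\le\alpha,\ \beta\ne\alpha}M_\beta(f,t)\int_{\mathbf R^N}x^\alpha g_\beta(x,t)\,dx,$$ and $[P_k(t)f](x)=f(x)-\sum_{|\alpha|\le k}M_\alpha(f,t)g_\alpha(x,t)$. *)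

theory Defs
  imports
    "HOL-Analysis.Analysis"
    "HOL-Library.Landau_Symbols"
    "HOL-Probability.Essential_Supremum"
begin

section \<open>Multi-indices and derivatives\<close>

text \<open>The ambient space is \<^typ>\<open>real ^ 'n\<close>, so the dimension is \<^term>\<open>CARD('n)\<close>. A multi-index is a
  function \<^typ>\<open>'n \<Rightarrow> nat\<close>; the componentwise order on multi-indices is the library's pointwise order
  on functions.\<close>

type_synonym 'n multi_index = "'n \<Rightarrow> nat"

definition mi_abs :: "'n::finite multi_index \<Rightarrow> nat" where
  "mi_abs \<alpha> = (\<Sum>i\<in>UNIV. \<alpha> i)"

definition mi_fact :: "'n::finite multi_index \<Rightarrow> real" where
  "mi_fact \<alpha> = (\<Prod>i\<in>UNIV. fact (\<alpha> i))"

definition mi_power :: "real ^ 'n \<Rightarrow> 'n::finite multi_index \<Rightarrow> real" where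
  "mi_power x \<alpha> = (\<Prod>i\<in>UNIV. (x $ i) ^ \<alpha> i)"

definition mi_le :: "real \<Rightarrow> 'n::finite multi_index set" where
  "mi_le k = {\<alpha>. real (mi_abs \<alpha>) \<le> k}"

definition partial_deriv :: "'n::finite \<Rightarrow> (real ^ 'n \<Rightarrow> real) \<Rightarrow> (real ^ 'n \<Rightarrow> real)" where
  "partial_deriv i h = (\<lambda>x. deriv (\<lambda>s. h (x + s *\<^sub>R axis i 1)) 0)"

text \<open>The index type carries no order, so an arbitrary enumeration of the coordinates is fixed in order
  to write the mixed derivative as a composition of pure ones. It is only ever applied to functions of
  class \<open>C\<^sup>k\<close> with \<open>k\<close> at least the order of the derivative, for which the order of differentiation
  is irrelevant.\<close>

definition coord_enum :: "'n::finite list" where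
  "coord_enum = (SOME is. distinct is \<and> set is = UNIV)"

definition mi_deriv :: "'n::finite multi_index \<Rightarrow> (real ^ 'n \<Rightarrow> real) \<Rightarrow> (real ^ 'n \<Rightarrow> real)" where
  "mi_deriv \<alpha> h = foldr (\<lambda>i. partial_deriv i ^^ \<alpha> i) coord_enum h"

text \<open>The Euclidean norm of the array of all derivatives of order \<open>j\<close>; any other choice of norm changes
  it only by constant factors.\<close>

definition grad_norm :: "nat \<Rightarrow> (real ^ 'n::finite \<Rightarrow> real) \<Rightarrow> real ^ 'n \<Rightarrow> real" where
  "grad_norm j h x = sqrt (\<Sum>\<alpha> | mi_abs \<alpha> = j. (mi_deriv \<alpha> h x)\<^sup>2)"

text \<open>\<open>k\<close>-fold continuous differentiability on an open set: the Frechet derivative exists and all its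
  directional components are of class \<open>C\<^bsup>k-1\<^esup>\<close>.\<close>

primrec Ck_on :: "nat \<Rightarrow> ('a::euclidean_space \<Rightarrow> real) \<Rightarrow> 'a set \<Rightarrow> bool" where
  "Ck_on 0 f S \<longleftrightarrow> continuous_on S f"
| "Ck_on (Suc k) f S \<longleftrightarrow> (\<forall>x\<in>S. f differentiable at x) \<and>
     (\<forall>v. Ck_on k (\<lambda>x. frechet_derivative f (at x) v) S)"


section \<open>Function spaces\<close>

definition Lp_space :: "ereal \<Rightarrow> (real ^ 'n::finite \<Rightarrow> real) set" where
  "Lp_space q = {f \<in> borel_measurable lebesgue.
     if q = \<infinity> then esssup lebesgue (\<lambda>x. ereal \<bar>f x\<bar>) < \<infinity>
     else integrable lebesgue (\<lambda>x. \<bar>f x\<bar> powr real_of_ereal q)}"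

definition Lp_norm :: "ereal \<Rightarrow> (real ^ 'n::finite \<Rightarrow> real) \<Rightarrow> real" where
  "Lp_norm q f =
     (if q = \<infinity> then real_of_ereal (esssup lebesgue (\<lambda>x. ereal \<bar>f x\<bar>))
      else (LINT x|lebesgue. \<bar>f x\<bar> powr real_of_ereal q) powr (1 / real_of_ereal q))"

text \<open>For \<open>k = 0\<close> the convention \<^term>\<open>0 powr 0 = (0::real)\<close> alters the weight only at the origin, which is
  a null set.\<close>

definition L1w_space :: "real \<Rightarrow> (real ^ 'n::finite \<Rightarrow> real) set" where
  "L1w_space k = {f \<in> borel_measurable lebesgue.
     integrable lebesgue (\<lambda>x. \<bar>f x\<bar> * (1 + norm x powr k))}"

definition L1w_norm :: "real \<Rightarrow> (real ^ 'n::finite \<Rightarrow> real) \<Rightarrow> real" where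
  "L1w_norm k f = (LINT x|lebesgue. \<bar>f x\<bar> * (1 + norm x powr k))"

text \<open>Lebesgue measure on the half space \<open>t > 0\<close> of space-time.\<close>

abbreviation spacetime :: "((real ^ 'n::finite) \<times> real) measure" where
  "spacetime \<equiv> lebesgue_on (UNIV \<times> {0<..})"

text \<open>\<open>\<bar>u\<bar>\<^bsup>p-1\<^esup>\<close>, read as \<open>1\<close> for \<open>p = 1\<close>, also at \<open>u = 0\<close>.\<close>

definition abs_pow_pred :: "real \<Rightarrow> real \<Rightarrow> real" where
  "abs_pow_pred p u = (if p = 1 then 1 else \<bar>u\<bar> powr (p - 1))"


section \<open>The kernel, its semigroup, and the projection\<close>

text \<open>Functions on \<open>\<real>\<^sup>N \<times> (0,\<infinity>)\<close> are represented by total curried functions, whose values for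
  nonpositive times are never used.\<close>

definition condition_G ::
  "nat \<Rightarrow> real \<Rightarrow> real \<Rightarrow> (real ^ 'n::finite \<Rightarrow> real \<Rightarrow> real) \<Rightarrow> bool" where
  "condition_G \<gamma> d L G \<longleftrightarrow>
     Ck_on \<gamma> (\<lambda>(x, t). G x t) (UNIV \<times> {0<..}) \<and>
     (\<forall>x t. t > 0 \<longrightarrow>
        G x t = t powr (- real CARD('n) / d) * G (x /\<^sub>R (t powr (1 / d))) 1) \<and>
     (\<forall>j\<le>\<gamma>. bdd_above (range (\<lambda>x.
        (1 + norm x) powr (real CARD('n) + L + real j) * grad_norm j (\<lambda>y. G y 1) x))) \<and>
     (\<forall>x t s. 0 < s \<longrightarrow> s < t \<longrightarrow>
        G x t = (LINT y|lebesgue. G (x - y) (t - s) * G y s))"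

definition kernel_semigroup ::
  "(real ^ 'n::finite \<Rightarrow> real \<Rightarrow> real) \<Rightarrow> real \<Rightarrow> (real ^ 'n \<Rightarrow> real) \<Rightarrow> real ^ 'n \<Rightarrow> real" where
  "kernel_semigroup G t \<phi> x = (LINT y|lebesgue. G (x - y) t * \<phi> y)"

definition g_fun ::
  "(real ^ 'n::finite \<Rightarrow> real \<Rightarrow> real) \<Rightarrow> 'n multi_index \<Rightarrow> real ^ 'n \<Rightarrow> real \<Rightarrow> real" where
  "g_fun G \<alpha> x t = (-1) ^ mi_abs \<alpha> / mi_fact \<alpha> * mi_deriv \<alpha> (\<lambda>y. G y (t + 1)) x"

lemma mi_abs_strict_mono:
  assumes "\<beta> \<le> \<alpha>" "\<beta> \<noteq> \<alpha>"
  shows "mi_abs \<beta> < mi_abs \<alpha>"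
proof -
  obtain i where "\<beta> i \<noteq> \<alpha> i"
    using assms(2) by (auto simp: fun_eq_iff)
  with assms(1) have "\<beta> i < \<alpha> i"
    by (simp add: le_fun_def order_less_le)
  with assms(1) show ?thesis
    unfolding mi_abs_def by (intro sum_strict_mono_ex1) (auto simp: le_fun_def)
qed

text \<open>For \<open>\<alpha> = 0\<close> the sum below is empty and the first integral is \<open>\<integral>f\<close>.\<close>

function moment ::
  "(real ^ 'n::finite \<Rightarrow> real \<Rightarrow> real) \<Rightarrow> 'n multi_index \<Rightarrow> (real ^ 'n \<Rightarrow> real) \<Rightarrow> real \<Rightarrow> real" where
  "moment G \<alpha> f t = (LINT x|lebesgue. mi_power x \<alpha> * f x) -
     (\<Sum>\<beta> | \<beta> \<le> \<alpha> \<and> \<beta> \<noteq> \<alpha>.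
        moment G \<beta> f t * (LINT x|lebesgue. mi_power x \<alpha> * g_fun G \<beta> x t))"
  by pat_completeness auto
termination
  by (relation "Wellfounded.measure (\<lambda>(_, \<alpha>, _, _). mi_abs \<alpha>)") (auto simp: mi_abs_strict_mono)

declare moment.simps [simp del]

definition proj_P ::
  "(real ^ 'n::finite \<Rightarrow> real \<Rightarrow> real) \<Rightarrow> real \<Rightarrow> real \<Rightarrow> (real ^ 'n \<Rightarrow> real) \<Rightarrow> real ^ 'n \<Rightarrow> real" where
  "proj_P G k t f x = f x - (\<Sum>\<alpha>\<in>mi_le k. moment G \<alpha> f t * g_fun G \<alpha> x t)"


section \<open>Asymptotic profiles\<close>

definition c_coeff ::
  "(real ^ 'n::finite \<Rightarrow> real \<Rightarrow> real) \<Rightarrow> (real ^ 'n \<Rightarrow> real) \<Rightarrow> (real ^ 'n \<Rightarrow> real \<Rightarrow> real) \<Rightarrow>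
   'n multi_index \<Rightarrow> real \<Rightarrow> real" where
  "c_coeff G \<phi> f \<alpha> t =
     moment G \<alpha> \<phi> 0 + (LINT s:{0<..<t}|lebesgue. moment G \<alpha> (\<lambda>x. f x s) s)"

definition profile0 ::
  "(real ^ 'n::finite \<Rightarrow> real \<Rightarrow> real) \<Rightarrow> real \<Rightarrow> (real ^ 'n \<Rightarrow> real) \<Rightarrow>
   (real ^ 'n \<Rightarrow> real \<Rightarrow> real) \<Rightarrow> real ^ 'n \<Rightarrow> real \<Rightarrow> real" where
  "profile0 G K \<phi> f x t = (\<Sum>\<alpha>\<in>mi_le K. c_coeff G \<phi> f \<alpha> t * g_fun G \<alpha> x t)"

text \<open>The argument \<open>f\<close> stands for \<open>f(x,t) = F(x,t,u(x,t))\<close>.\<close>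

primrec profile ::
  "(real ^ 'n::finite \<Rightarrow> real \<Rightarrow> real) \<Rightarrow> (real ^ 'n \<Rightarrow> real \<Rightarrow> real \<Rightarrow> real) \<Rightarrow> real \<Rightarrow>
   (real ^ 'n \<Rightarrow> real) \<Rightarrow> (real ^ 'n \<Rightarrow> real \<Rightarrow> real) \<Rightarrow> nat \<Rightarrow> real ^ 'n \<Rightarrow> real \<Rightarrow> real" where
  "profile G F K \<phi> f 0 = profile0 G K \<phi> f"
| "profile G F K \<phi> f (Suc n) = (\<lambda>x t. profile0 G K \<phi> f x t +
     (LINT s:{0<..<t}|lebesgue.
        kernel_semigroup G (t - s) (proj_P G K s (\<lambda>y. F y s (profile G F K \<phi> f n y s))) x))"

end

theory Submission
  imports Defs
begin

text \<open>
  \<open>e\<^sup>t\<^sup>L\<close> applied to a function whose moments up to order \<open>K\<close> vanish decays by the extra factor \<open>o(t\<^bsup>-K/d\<^esup>)\<close>, because the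
  kernel \<open>G(x - y, t)\<close> may be replaced by its Taylor remainder in \<open>y\<close>. Since \<open>e\<^sup>t\<^sup>L\<close> maps \<open>g\<^sub>\<alpha>(s)\<close> to \<open>g\<^sub>\<alpha>(s + t)\<close>,
  splitting off the moments of the initial value and of the source gives
  \<open>u - U\<^sub>n\<^sub>+\<^sub>1 = e\<^sup>t\<^sup>L P\<^sub>K(0) \<phi> + \<integral>\<^sub>0\<^sup>t e\<^bsup>(t-s)L\<^esup> P\<^sub>K(s) (F(u) - F(U\<^sub>n)) ds\<close>. By the Lipschitz condition the last source is smaller
  than \<open>u - U\<^sub>n\<close> by a factor \<open>(1 + s)\<^bsup>-A\<^sub>p-1\<^esup>\<close>, so each step gains \<open>t\<^bsup>-A\<^sub>p\<^esup>\<close> until the rate \<open>t\<^bsup>-K/d\<^esup>\<close> of the linear part is reached.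
\<close>

section \<open>Iterated partial derivatives\<close>

text \<open>Condition (G) does not normalise the kernel, while the moments cancel only if its
  integral is 1. The semigroup law decides: the integral is 1 or the kernel vanishes, and then every
  convolution is 0. All norms of the theorem lie between a sup norm and an \<open>L^1\<close> norm
  with weight \<open>(1 + |x|/r)^K\<close> at the length \<open>r = (1 + t)^(1/d)\<close>, so one
  predicate \<open>Bd\<close> with one constant carries the argument. At this scale moments of order
  \<open>|\<alpha>|\<close> grow like \<open>r^|\<alpha>|\<close> and \<open>g_\<alpha>\<close>
  decays by the same power, so projecting costs a constant. The step from \<open>O\<close> to
  \<open>o\<close> rests on \<open>k + 1 > K\<close> for the integer part \<open>k\<close> of
  \<open>K\<close>: the Taylor remainder is of order \<open>(|y|/r)^(k+1)\<close> for small
  \<open>|y|/r\<close> and \<open>(|y|/r)^K\<close> for large. Times \<open>r^K\<close> it is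
  dominated by \<open>|y|^K\<close> and tends to 0 pointwise, so dominated convergence applies to
  data with a finite \<open>K\<close>-th moment and to sources whose \<open>K\<close>-th moment is
  integrable in space-time. The latter needs source decay with surplus above \<open>K/d\<close>;
  below, the time integral grows like a power, and at equality like a logarithm, the exceptional
  case of the theorem.\<close>

lemma Ck_on_lower: "Ck_on (Suc m) f S \<Longrightarrow> Ck_on m f S"
proof (induction m arbitrary: f)
  case 0
  then have "\<forall>x\<in>S. isCont f x" by (simp add: differentiable_imp_continuous_within)
  then show ?case by (simp add: continuous_at_imp_continuous_on)
next
  case (Suc m)
  then show ?case by simp
qed

lemma Ck_on_antimono: "Ck_on n f S \<Longrightarrow> m \<le> n \<Longrightarrow> Ck_on m f S"
  by (induction n) (auto simp: le_Suc_eq dest: Ck_on_lower simp del: Ck_on.simps)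

lemma Ck_on_continuous: "Ck_on m f S \<Longrightarrow> continuous_on S f"
  using Ck_on_antimono[of m f S 0] by simp

text \<open>Condition (G) gives smoothness jointly in space and time, the expansion differentiates
  in space only. The derivative of a slice in direction \<open>v\<close> is the slice of the
  derivative in direction \<open>(v, 0)\<close>, which lets the induction go through.\<close>

lemma Ck_on_slice:
  fixes f :: "'a::euclidean_space \<times> real \<Rightarrow> real"
  assumes "Ck_on m f (UNIV \<times> {0<..})" "t > 0"
  shows "Ck_on m (\<lambda>x. f (x, t)) UNIV"
  using assms(1)
proof (induction m arbitrary: f)
  case 0
  then show ?case using assms(2)
    by (auto intro!: continuous_on_compose2[of _ f UNIV "\<lambda>x. (x, t)"] continuous_intros)
next
  case (Suc m)
  have d: "((\<lambda>x. f (x, t)) has_derivative (\<lambda>v. frechet_derivative f (at (x, t)) (v, 0))) (at x)" for x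
  proof -
    have "f differentiable at (x, t)" using Suc.prems assms(2) by auto
    then have "(f has_derivative frechet_derivative f (at (x, t))) (at (x, t))"
      by (simp add: frechet_derivative_works)
    moreover have "((\<lambda>x. (x, t)) has_derivative (\<lambda>v. (v, 0))) (at x)"
      by (auto intro!: derivative_eq_intros)
    ultimately show ?thesis
      using has_derivative_compose[of "\<lambda>x. (x,t)" "\<lambda>v. (v,0)" x UNIV f] by simp
  qed
  then have e: "frechet_derivative (\<lambda>x. f (x, t)) (at x) = (\<lambda>v. frechet_derivative f (at (x, t)) (v, 0))" for x
    using frechet_derivative_at by metis
  have "Ck_on m (\<lambda>x. frechet_derivative f (at (x, t)) (v, 0)) UNIV" for v
    using Suc.IH[of "\<lambda>z. frechet_derivative f (at z) (v, 0)"] Suc.prems by simp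
  with d e show ?case by (auto simp: differentiable_def)
qed

lemma partial_deriv_has_derivative:
  assumes "h differentiable at x"
  shows "partial_deriv i h x = frechet_derivative h (at x) (axis i 1)"
proof -
  have h: "(h has_derivative frechet_derivative h (at x)) (at x)"
    using assms by (simp add: frechet_derivative_works)
  have "((\<lambda>s::real. x + s *\<^sub>R axis i 1) has_derivative (\<lambda>s. s *\<^sub>R axis i 1)) (at 0)"
    by (auto intro!: derivative_eq_intros)
  from has_derivative_compose[OF this, of h] h
  have "((\<lambda>s. h (x + s *\<^sub>R axis i 1)) has_derivative (\<lambda>s. frechet_derivative h (at x) (s *\<^sub>R axis i 1))) (at 0)"
    by simp
  moreover have "frechet_derivative h (at x) (s *\<^sub>R axis i 1) = s * frechet_derivative h (at x) (axis i 1)" for s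
    using linear_scale[OF linear_frechet_derivative[OF assms], of s "axis i 1"] by simp
  ultimately have "((\<lambda>s. h (x + s *\<^sub>R axis i 1)) has_field_derivative frechet_derivative h (at x) (axis i 1)) (at 0)"
    unfolding has_field_derivative_def by (subst mult_commute_abs[symmetric]) (simp add: mult.commute)
  then show ?thesis unfolding partial_deriv_def by (rule DERIV_imp_deriv)
qed

lemma Ck_on_partial_deriv:
  assumes "Ck_on (Suc m) h UNIV"
  shows "Ck_on m (partial_deriv i h) UNIV"
proof -
  have "partial_deriv i h = (\<lambda>x. frechet_derivative h (at x) (axis i 1))"
    using assms by (auto simp: partial_deriv_has_derivative)
  then show ?thesis using assms by simp
qed

lemma Ck_on_foldr_partial_deriv:
  "Ck_on (length w + m) h UNIV \<Longrightarrow> Ck_on m (foldr partial_deriv w h) UNIV"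
proof (induction w arbitrary: m)
  case (Cons i w)
  then show ?case using Ck_on_partial_deriv[of m "foldr partial_deriv w h" i] Cons.IH[of "Suc m"] by simp
qed simp

lemma has_derivative_partial_deriv:
  assumes "Ck_on (Suc m) h UNIV"
  shows "(h has_derivative (\<lambda>v. \<Sum>i\<in>UNIV. v $ i * partial_deriv i h x)) (at x)"
proof -
  have dh: "h differentiable at x" using assms by simp
  have lin: "linear (frechet_derivative h (at x))" using linear_frechet_derivative[OF dh] .
  have "frechet_derivative h (at x) v = (\<Sum>i\<in>UNIV. v $ i * partial_deriv i h x)" for v
  proof -
    have "v = (\<Sum>i\<in>UNIV. v $ i *\<^sub>R axis i 1)"
      using basis_expansion[of v] by (simp add: scalar_mult_eq_scaleR)
    then have "frechet_derivative h (at x) v = (\<Sum>i\<in>UNIV. v $ i * frechet_derivative h (at x) (axis i 1))"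
      using linear_sum[OF lin, of "\<lambda>i. v $ i *\<^sub>R axis i 1" UNIV] linear_scale[OF lin] by simp
    then show ?thesis by (simp add: partial_deriv_has_derivative[OF dh])
  qed
  then have "frechet_derivative h (at x) = (\<lambda>v. \<Sum>i\<in>UNIV. v $ i * partial_deriv i h x)" by blast
  then show ?thesis using dh by (simp add: frechet_derivative_works)
qed

lemma DERIV_partial_line:
  assumes "Ck_on (Suc m) h UNIV"
  shows "((\<lambda>s. h (x + s *\<^sub>R v)) has_field_derivative (\<Sum>i\<in>UNIV. v $ i * partial_deriv i h (x + s *\<^sub>R v))) (at s)"
proof -
  have "((\<lambda>s::real. x + s *\<^sub>R v) has_derivative (\<lambda>s. s *\<^sub>R v)) (at s)"
    by (auto intro!: derivative_eq_intros)
  from has_derivative_compose[OF this has_derivative_partial_deriv[OF assms]]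
  have "((\<lambda>s. h (x + s *\<^sub>R v)) has_derivative (\<lambda>r. \<Sum>i\<in>UNIV. (r *\<^sub>R v) $ i * partial_deriv i h (x + s *\<^sub>R v))) (at s)" .
  moreover have "(\<lambda>r. \<Sum>i\<in>UNIV. (r *\<^sub>R v) $ i * partial_deriv i h (x + s *\<^sub>R v)) =
      (*) (\<Sum>i\<in>UNIV. v $ i * partial_deriv i h (x + s *\<^sub>R v))"
    by (auto simp: fun_eq_iff sum_distrib_left mult_ac)
  ultimately show ?thesis by (simp add: has_field_derivative_def)
qed

lemma DERIV_partial_axis:
  assumes "Ck_on (Suc m) h UNIV"
  shows "((\<lambda>s. h (x + s *\<^sub>R axis i 1)) has_field_derivative partial_deriv i h (x + s *\<^sub>R axis i 1)) (at s)"
proof -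
  have "(\<Sum>j\<in>UNIV. axis i 1 $ j * partial_deriv j h z) = partial_deriv i h z" for z
    by (subst sum.remove[of _ i]) (auto simp: axis_def)
  with DERIV_partial_line[OF assms, of x "axis i 1" s] show ?thesis by simp
qed

text \<open>The double difference quotient of \<open>h\<close> along the axes \<open>i\<close> and \<open>j\<close> is, by two applications of the mean value
  theorem, a value of either mixed derivative at a nearby point.\<close>

lemma mixed_difference_mvt:
  fixes h :: "real^'n::finite \<Rightarrow> real"
  assumes C: "Ck_on 2 h UNIV" and e: "e > 0"
  obtains a b where "0 < a" "a < e" "0 < b" "b < e"
    "h (x + e *\<^sub>R axis i 1 + e *\<^sub>R axis j 1) - h (x + e *\<^sub>R axis i 1) - h (x + e *\<^sub>R axis j 1) + h x
     = e * e * partial_deriv j (partial_deriv i h) (x + a *\<^sub>R axis i 1 + b *\<^sub>R axis j 1)"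
proof -
  have C1: "Ck_on (Suc 1) h UNIV" using C by (simp add: numeral_2_eq_2)
  have C2: "Ck_on (Suc 0) (partial_deriv i h) UNIV" using Ck_on_partial_deriv[OF C1] by simp
  define \<Phi> where "\<Phi> s = h (x + e *\<^sub>R axis j 1 + s *\<^sub>R axis i 1) - h (x + s *\<^sub>R axis i 1)" for s
  have d: "(\<Phi> has_field_derivative (partial_deriv i h (x + e *\<^sub>R axis j 1 + s *\<^sub>R axis i 1)
     - partial_deriv i h (x + s *\<^sub>R axis i 1))) (at s)" for s
    unfolding \<Phi>_def by (intro DERIV_diff DERIV_partial_axis[OF C1])
  from MVT2[OF e d] obtain a where a: "0 < a" "a < e"
    "\<Phi> e - \<Phi> 0 = (e - 0) * (partial_deriv i h (x + e *\<^sub>R axis j 1 + a *\<^sub>R axis i 1) - partial_deriv i h (x + a *\<^sub>R axis i 1))"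
    by blast
  from MVT2[OF e, where f="\<lambda>s. partial_deriv i h (x + a *\<^sub>R axis i 1 + s *\<^sub>R axis j 1)"
      and f'="\<lambda>s. partial_deriv j (partial_deriv i h) (x + a *\<^sub>R axis i 1 + s *\<^sub>R axis j 1)"]
  obtain b where b: "0 < b" "b < e"
    "partial_deriv i h (x + a *\<^sub>R axis i 1 + e *\<^sub>R axis j 1) - partial_deriv i h (x + a *\<^sub>R axis i 1 + 0 *\<^sub>R axis j 1)
      = (e - 0) * partial_deriv j (partial_deriv i h) (x + a *\<^sub>R axis i 1 + b *\<^sub>R axis j 1)"
    using DERIV_partial_axis[OF C2] by blast
  show ?thesis
    using a b by (intro that[of a b]) (auto simp: \<Phi>_def algebra_simps)
qed

text \<open>The double difference quotient is symmetric in the two directions. With step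
  \<open>1/(n+1)\<close> it equals either mixed derivative at a point tending to \<open>x\<close>,
  so continuity makes both of them the limit of one sequence.\<close>

lemma partial_deriv_commute:
  fixes h :: "real^'n::finite \<Rightarrow> real"
  assumes C: "Ck_on 2 h UNIV"
  shows "partial_deriv i (partial_deriv j h) x = partial_deriv j (partial_deriv i h) x"
proof -
  have cont: "continuous_on UNIV (partial_deriv k (partial_deriv l h))" for k l
    using Ck_on_foldr_partial_deriv[of "[k,l]" 0 h] C by (simp add: numeral_2_eq_2)
  have lim: "(\<lambda>n. (h (x + inverse (real (Suc n)) *\<^sub>R axis k 1 + inverse (real (Suc n)) *\<^sub>R axis l 1)
    - h (x + inverse (real (Suc n)) *\<^sub>R axis k 1) - h (x + inverse (real (Suc n)) *\<^sub>R axis l 1) + h x) * (Suc n)^2)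
    \<longlonglongrightarrow> partial_deriv l (partial_deriv k h) x" for k l
  proof -
    have "\<exists>a b. 0 < a \<and> a < inverse (real (Suc n)) \<and> 0 < b \<and> b < inverse (real (Suc n)) \<and>
       (h (x + inverse (real (Suc n)) *\<^sub>R axis k 1 + inverse (real (Suc n)) *\<^sub>R axis l 1)
    - h (x + inverse (real (Suc n)) *\<^sub>R axis k 1) - h (x + inverse (real (Suc n)) *\<^sub>R axis l 1) + h x) * (Suc n)^2
      = partial_deriv l (partial_deriv k h) (x + a *\<^sub>R axis k 1 + b *\<^sub>R axis l 1)" for n
    proof -
      have "inverse (real (Suc n)) > 0" by simp
      from mixed_difference_mvt[OF C this, of x k l] obtain a b
        where ab: "0 < a" "a < inverse (real (Suc n))" "0 < b" "b < inverse (real (Suc n))"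
        "h (x + inverse (real (Suc n)) *\<^sub>R axis k 1 + inverse (real (Suc n)) *\<^sub>R axis l 1)
    - h (x + inverse (real (Suc n)) *\<^sub>R axis k 1) - h (x + inverse (real (Suc n)) *\<^sub>R axis l 1) + h x
      = inverse (real (Suc n)) * inverse (real (Suc n)) * partial_deriv l (partial_deriv k h) (x + a *\<^sub>R axis k 1 + b *\<^sub>R axis l 1)"
        by blast
      have "inverse (real (Suc n)) * inverse (real (Suc n)) * c * (real (Suc n))^2 = c" for c
        by (simp add: power2_eq_square field_simps del: of_nat_Suc)
      then show ?thesis using ab by (intro exI[of _ a] exI[of _ b]) (simp del: of_nat_Suc)
    qed
    then obtain a b where ab: "\<And>n. 0 < a n \<and> a n < inverse (real (Suc n)) \<and> 0 < b n \<and> b n < inverse (real (Suc n)) \<and>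
       (h (x + inverse (real (Suc n)) *\<^sub>R axis k 1 + inverse (real (Suc n)) *\<^sub>R axis l 1)
    - h (x + inverse (real (Suc n)) *\<^sub>R axis k 1) - h (x + inverse (real (Suc n)) *\<^sub>R axis l 1) + h x) * (Suc n)^2
      = partial_deriv l (partial_deriv k h) (x + a n *\<^sub>R axis k 1 + b n *\<^sub>R axis l 1)"
      by metis
    have "a \<longlonglongrightarrow> 0" "b \<longlonglongrightarrow> 0"
      by (rule real_tendsto_sandwich[OF _ _ tendsto_const LIMSEQ_inverse_real_of_nat];
          use ab in \<open>force intro!: always_eventually less_imp_le\<close>)+
    then have "(\<lambda>n. x + a n *\<^sub>R axis k 1 + b n *\<^sub>R axis l 1) \<longlonglongrightarrow> x + 0 *\<^sub>R axis k 1 + 0 *\<^sub>R axis l 1"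
      by (intro tendsto_intros)
    then have "(\<lambda>n. partial_deriv l (partial_deriv k h) (x + a n *\<^sub>R axis k 1 + b n *\<^sub>R axis l 1))
       \<longlonglongrightarrow> partial_deriv l (partial_deriv k h) x"
      using cont[of l k] by (auto simp: continuous_on_eq_continuous_at intro: isCont_tendsto_compose)
    then show ?thesis using ab by simp
  qed
  have "(\<lambda>n. (h (x + inverse (real (Suc n)) *\<^sub>R axis j 1 + inverse (real (Suc n)) *\<^sub>R axis i 1)
    - h (x + inverse (real (Suc n)) *\<^sub>R axis j 1) - h (x + inverse (real (Suc n)) *\<^sub>R axis i 1) + h x) * (Suc n)^2)
    \<longlonglongrightarrow> partial_deriv j (partial_deriv i h) x"
    using lim[of i j] by (simp add: algebra_simps)
  from LIMSEQ_unique[OF lim[of j i] this] show ?thesis .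
qed

text \<open>Induction on \<open>w\<close>: its first letter occurs somewhere in \<open>v\<close>,
  and \<open>move\<close> brings it to the front by swapping it with one neighbour at a time. Each
  swap uses that the derivative along the remaining letters is still \<open>C^2\<close>, which the
  length bound guarantees.\<close>

lemma foldr_partial_deriv_cong_mset:
  fixes h :: "real^'n::finite \<Rightarrow> real"
  assumes "mset w = mset v" "Ck_on (length w) h UNIV"
  shows "foldr partial_deriv w h = foldr partial_deriv v h"
  using assms
proof (induction w arbitrary: v)
  case (Cons i w)
  have move: "foldr partial_deriv (a @ i # b) h = foldr partial_deriv (i # a @ b) h"
    if "Ck_on (Suc (length a + length b)) h UNIV" for a b
    using that
  proof (induction a)
    case (Cons j a)
    have "foldr partial_deriv (a @ i # b) h = partial_deriv i (foldr partial_deriv (a @ b) h)"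
      using Cons Ck_on_lower by (auto simp del: Ck_on.simps)
    moreover have "Ck_on 2 (foldr partial_deriv (a @ b) h) UNIV"
      using Cons.prems Ck_on_foldr_partial_deriv[of "a @ b" 2 h] by (simp add: numeral_2_eq_2)
    ultimately show ?case
      using partial_deriv_commute[of "foldr partial_deriv (a @ b) h" j i] by (simp only: append_Cons foldr.simps o_apply)
  qed simp
  from Cons.prems(1) have "i \<in> set v" by (metis list.set_intros(1) set_mset_mset)
  then obtain a b where v: "v = a @ i # b" by (auto simp: in_set_conv_decomp)
  then have "mset w = mset (a @ b)" using Cons.prems by simp
  moreover have "Ck_on (length w) h UNIV" using Cons.prems(2) Ck_on_lower by (simp del: Ck_on.simps)
  ultimately have "foldr partial_deriv w h = foldr partial_deriv (a @ b) h" using Cons.IH by blast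
  moreover have "length w = length a + length b" using \<open>mset w = mset (a @ b)\<close> by (metis length_append size_mset)
  ultimately show ?case using move[of a b] v Cons.prems(2) by simp
qed simp

section \<open>Multi-indices as words\<close>

text \<open>The letters are listed in the order of \<open>coord_enum\<close>, so that
  \<open>mi_deriv\<close> is literally the iterated derivative along this word.\<close>

definition mi_word :: "'n::finite multi_index \<Rightarrow> 'n list" where
  "mi_word \<alpha> = concat (map (\<lambda>i. replicate (\<alpha> i) i) coord_enum)"

lemma coord_enum: "distinct (coord_enum :: 'n::finite list)" "set (coord_enum :: 'n list) = UNIV"
proof -
  have "\<exists>is :: 'n list. distinct is \<and> set is = UNIV"
    using finite_distinct_list[of "UNIV :: 'n set"] by auto
  from someI_ex[OF this]
  show "distinct (coord_enum :: 'n::finite list)" "set (coord_enum :: 'n list) = UNIV"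
    unfolding coord_enum_def by auto
qed

lemma mi_deriv_word: "mi_deriv \<alpha> h = foldr partial_deriv (mi_word \<alpha>) h"
proof -
  have r: "foldr f (replicate n i) x = (f i ^^ n) x" for f :: "'c \<Rightarrow> 'b \<Rightarrow> 'b" and n i x
    by (induction n) auto
  have "foldr (\<lambda>i. partial_deriv i ^^ \<alpha> i) is h = foldr partial_deriv (concat (map (\<lambda>i. replicate (\<alpha> i) i) is)) h" for "is"
    by (induction "is") (auto simp: r)
  then show ?thesis unfolding mi_deriv_def mi_word_def .
qed

lemma count_mi_word: "count (mset (mi_word \<alpha>)) = \<alpha>"
proof
  fix i
  have "count (mset (concat (map (\<lambda>i. replicate (\<alpha> i) i) is))) i = (if i \<in> set is then \<alpha> i else 0)"
    if "distinct is" for "is"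
    using that by (induction "is") auto
  from this[OF coord_enum(1)] show "count (mset (mi_word \<alpha>)) i = \<alpha> i"
    unfolding mi_word_def by (simp add: coord_enum)
qed

lemma mi_abs_count_word: "mi_abs (count (mset w)) = length w"
  unfolding mi_abs_def
proof (induction w)
  case (Cons i w)
  then show ?case by (simp add: sum.distrib if_distrib[of Suc] flip: sum.remove) (subst sum.remove[of _ i]; simp add: sum.remove[of UNIV i])
qed simp

lemma length_mi_word: "length (mi_word \<alpha>) = mi_abs \<alpha>"
  using mi_abs_count_word[of "mi_word \<alpha>"] by (simp add: count_mi_word)

text \<open>Condition (G) bounds derivatives indexed by multi-indices, the Taylor formula produces
  derivatives along words; this is the bridge between the two.\<close>

lemma foldr_partial_deriv_eq_mi_deriv:
  fixes h :: "real^'n::finite \<Rightarrow> real"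
  assumes "Ck_on (length w) h UNIV"
  shows "foldr partial_deriv w h = mi_deriv (count (mset w)) h"
  unfolding mi_deriv_word using assms
  by (intro foldr_partial_deriv_cong_mset) (auto simp: multiset_eq_iff count_mi_word)

lemma prod_list_mi_power: "prod_list (map (\<lambda>i. y $ i) w) = mi_power y (count (mset w))"
proof (induction w)
  case (Cons j w)
  have "mi_power y (count (mset (j # w))) = y $ j * mi_power y (count (mset w))"
    unfolding mi_power_def
    by (subst (1 2) prod.remove[of _ j]) (auto intro!: prod.cong)
  then show ?case using Cons by (simp only: list.map prod_list.Cons)
qed (simp add: mi_power_def)

section \<open>Dilations and Taylor's formula\<close>

lemma partial_deriv_dilation:
  fixes h :: "real^'n::finite \<Rightarrow> real"
  assumes "Ck_on (Suc m) h UNIV"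
  shows "partial_deriv i (\<lambda>y. c * h (b *\<^sub>R y)) x = c * b * partial_deriv i h (b *\<^sub>R x)"
proof -
  have "((\<lambda>s. h (b *\<^sub>R x + (b * s) *\<^sub>R axis i 1)) has_field_derivative
      partial_deriv i h (b *\<^sub>R x + (b * 0) *\<^sub>R axis i 1) * b) (at 0)"
    by (rule DERIV_chain2[where g="\<lambda>s. b * s", OF DERIV_partial_axis[OF assms]])
       (auto intro!: derivative_eq_intros)
  then have "((\<lambda>s. c * h (b *\<^sub>R (x + s *\<^sub>R axis i 1))) has_field_derivative
      c * (partial_deriv i h (b *\<^sub>R x) * b)) (at 0)"
    by (intro DERIV_cmult) (simp add: algebra_simps)
  from DERIV_imp_deriv[OF this] show ?thesis unfolding partial_deriv_def by simp
qed

text \<open>Every letter contributes one factor \<open>b\<close>. With \<open>b = t^(-1/d)\<close>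
  this is the origin of the additional decay of \<open>g_\<alpha>\<close> by
  \<open>|\<alpha>|/d\<close>.\<close>

lemma foldr_partial_deriv_dilation:
  fixes h :: "real^'n::finite \<Rightarrow> real"
  assumes "Ck_on (length w) h UNIV"
  shows "foldr partial_deriv w (\<lambda>y. c * h (b *\<^sub>R y)) = (\<lambda>x. c * b ^ length w * foldr partial_deriv w h (b *\<^sub>R x))"
  using assms
proof (induction w)
  case (Cons i w)
  have "Ck_on (Suc 0) (foldr partial_deriv w h) UNIV"
    using Ck_on_foldr_partial_deriv[of w "Suc 0" h] Cons.prems by simp
  moreover have "foldr partial_deriv w (\<lambda>y. c * h (b *\<^sub>R y)) = (\<lambda>x. c * b ^ length w * foldr partial_deriv w h (b *\<^sub>R x))"
    using Cons Ck_on_lower by (auto simp del: Ck_on.simps)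
  ultimately show ?case
    using partial_deriv_dilation[of 0 "foldr partial_deriv w h" i "c * b ^ length w" b]
    by (simp only: foldr.simps o_apply) (simp del: Ck_on.simps add: fun_eq_iff mult_ac)
qed simp

text \<open>The homogeneous parts of the Taylor polynomial are sums over words rather
  than over multi-indices, which removes the multinomial coefficients.\<close>

definition words :: "nat \<Rightarrow> 'n::finite list set" where
  "words j = {w. length w = j}"

lemma finite_words[simp]: "finite (words j :: 'n::finite list set)"
  using finite_lists_length_eq[of "UNIV :: 'n::finite set" j] by (simp add: words_def)

text \<open>This is \<open>(- y . grad)^j h\<close> at \<open>x\<close>. The sign is that of the
  displacement from \<open>x\<close> to \<open>x - y\<close> in a convolution kernel; the factor
  \<open>1 / j!\<close> is added where the terms are summed.\<close>

definition taylor_part :: "nat \<Rightarrow> (real^'n::finite \<Rightarrow> real) \<Rightarrow> real^'n \<Rightarrow> real^'n \<Rightarrow> real" where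
  "taylor_part j h x y = (\<Sum>w\<in>words j. prod_list (map (\<lambda>i. - y $ i) w) * foldr partial_deriv w h x)"

lemma taylor_part_0[simp]: "taylor_part 0 h x y = h x"
  by (simp add: taylor_part_def words_def)

text \<open>Differentiating along the segment prepends one letter to each word, and words of length
  \<open>j + 1\<close> are exactly the pairs of a letter and a word of length
  \<open>j\<close>.\<close>

lemma DERIV_taylor_part:
  assumes "Ck_on (Suc j) h UNIV"
  shows "((\<lambda>s. taylor_part j h (x - s *\<^sub>R y) y) has_field_derivative taylor_part (Suc j) h (x - s *\<^sub>R y) y) (at s)"
proof -
  have W: "words (Suc j) = (\<lambda>(i, w). i # w) ` (UNIV \<times> words j)"
    by (auto simp: words_def image_iff length_Suc_conv)
  have "((\<lambda>s. foldr partial_deriv w h (x + s *\<^sub>R (- y))) has_field_derivative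
      (\<Sum>i\<in>UNIV. (- y) $ i * partial_deriv i (foldr partial_deriv w h) (x + s *\<^sub>R (- y)))) (at s)" if "w \<in> words j" for w
    using Ck_on_foldr_partial_deriv[of w "Suc 0" h] assms that
    by (intro DERIV_partial_line[of 0]) (simp add: words_def)
  then have "((\<lambda>s. taylor_part j h (x + s *\<^sub>R (- y)) y) has_field_derivative
     (\<Sum>w\<in>words j. prod_list (map (\<lambda>i. - y $ i) w) * (\<Sum>i\<in>UNIV. (- y) $ i * partial_deriv i (foldr partial_deriv w h) (x + s *\<^sub>R (- y))))) (at s)"
    unfolding taylor_part_def by (intro DERIV_sum DERIV_cmult) auto
  also have "(\<Sum>w\<in>words j. prod_list (map (\<lambda>i. - y $ i) w) * (\<Sum>i\<in>UNIV. (- y) $ i * partial_deriv i (foldr partial_deriv w h) (x + s *\<^sub>R (- y))))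
    = (\<Sum>i\<in>UNIV. \<Sum>w\<in>words j. prod_list (map (\<lambda>i. - y $ i) (i # w)) * foldr partial_deriv (i # w) h (x + s *\<^sub>R (- y)))"
    by (subst sum.swap) (auto intro!: sum.cong simp: sum_distrib_left mult_ac)
  also have "\<dots> = taylor_part (Suc j) h (x + s *\<^sub>R (- y)) y"
    unfolding taylor_part_def W
    by (subst sum.reindex, force simp: inj_on_def) (simp only: sum.cartesian_product case_prod_unfold o_def)
  finally show ?thesis by simp
qed

text \<open>Maclaurin's formula with Lagrange remainder in the single variable \<open>s\<close>,
  applied to \<open>h (x - s y)\<close> on the interval from 0 to 1; the terms of order
  \<open>m\<close> are its \<open>m\<close>-th derivatives.\<close>

lemma taylor_remainder:
  assumes "Ck_on (Suc k) h UNIV"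
  obtains s where "0 < s" "s < 1"
    "h (x - y) - (\<Sum>j\<le>k. taylor_part j h x y / fact j) = taylor_part (Suc k) h (x - s *\<^sub>R y) y / fact (Suc k)"
proof -
  have "\<exists>s::real. 0 < s \<and> s < 1 \<and> taylor_part 0 h (x - 1 *\<^sub>R y) y =
     (\<Sum>m<Suc k. (taylor_part m h (x - 0 *\<^sub>R y) y / fact m) * 1 ^ m) + (taylor_part (Suc k) h (x - s *\<^sub>R y) y / fact (Suc k)) * 1 ^ Suc k"
  proof (rule Maclaurin)
    show "\<forall>m s. m < Suc k \<and> 0 \<le> s \<and> s \<le> 1 \<longrightarrow>
      ((\<lambda>s. taylor_part m h (x - s *\<^sub>R y) y) has_real_derivative taylor_part (Suc m) h (x - s *\<^sub>R y) y) (at s)"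
      using assms Ck_on_antimono[of "Suc k" h UNIV] by (auto intro!: DERIV_taylor_part simp del: Ck_on.simps)
  qed auto
  then show ?thesis using that by (auto simp: lessThan_Suc_atMost algebra_simps)
qed

lemma abs_prod_list_le: "\<bar>prod_list (map (\<lambda>i. - (y::real^'n::finite) $ i) w)\<bar> \<le> norm y ^ length w"
  by (induction w) (auto simp: abs_mult intro!: mult_mono component_le_norm_cart)

lemma abs_taylor_part_le:
  fixes h :: "real^'n::finite \<Rightarrow> real"
  assumes "\<And>w. length w = j \<Longrightarrow> \<bar>foldr partial_deriv w h x\<bar> \<le> B"
  shows "\<bar>taylor_part j h x y\<bar> \<le> real (card (words j :: 'n list set)) * norm y ^ j * B"
proof -
  have "\<bar>taylor_part j h x y\<bar> \<le> (\<Sum>w\<in>(words j :: 'n list set). norm y ^ j * B)"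
    unfolding taylor_part_def
    by (intro order_trans[OF sum_abs] sum_mono)
       (auto simp: abs_mult words_def intro!: mult_mono assms order_trans[OF abs_prod_list_le])
  then show ?thesis by (simp add: mult_ac)
qed

lemma abs_mi_power_le: "\<bar>mi_power y \<alpha>\<bar> \<le> norm y ^ mi_abs \<alpha>"
  unfolding mi_power_def mi_abs_def power_sum abs_prod power_abs
  by (intro prod_mono) (auto intro!: power_mono component_le_norm_cart)

lemma finite_mi_le[simp]: "finite (mi_le k :: 'n::finite multi_index set)"
proof -
  have "mi_le k \<subseteq> (\<lambda>w. count (mset w)) ` (\<Union>j\<le>nat \<lfloor>k\<rfloor>. (words j :: 'n list set))"
  proof
    fix \<alpha> :: "'n multi_index" assume "\<alpha> \<in> mi_le k"
    then have "mi_abs \<alpha> \<le> nat \<lfloor>k\<rfloor>" by (simp add: mi_le_def le_nat_floor)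
    then show "\<alpha> \<in> (\<lambda>w. count (mset w)) ` (\<Union>j\<le>nat \<lfloor>k\<rfloor>. (words j :: 'n list set))"
      by (intro image_eqI[of _ _ "mi_word \<alpha>"]) (auto simp: count_mi_word words_def length_mi_word)
  qed
  then show ?thesis by (rule finite_subset) auto
qed

lemma mi_le_downward: "\<alpha> \<in> mi_le k \<Longrightarrow> \<beta> \<le> \<alpha> \<Longrightarrow> \<beta> \<in> mi_le k"
  unfolding mi_le_def mi_abs_def le_fun_def mem_Collect_eq
  by (rule order_trans[rotated], assumption, unfold of_nat_le_iff, rule sum_mono) simp


section \<open>Lebesgue integrals on Euclidean space\<close>

lemma nn_integral_lborel_affine:
  fixes f :: "'a::euclidean_space \<Rightarrow> ennreal"
  assumes [measurable]: "f \<in> borel_measurable borel" and c: "c \<noteq> 0"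
  shows "(\<integral>\<^sup>+x. f x \<partial>lborel) = ennreal (\<bar>c\<bar> ^ DIM('a)) * (\<integral>\<^sup>+x. f (t + c *\<^sub>R x) \<partial>lborel)"
  by (subst lborel_affine[OF c, of t])
     (simp add: nn_integral_density nn_integral_distr nn_integral_cmult)

lemma nn_integral_lborel_translate:
  fixes f :: "'a::euclidean_space \<Rightarrow> ennreal"
  assumes [measurable]: "f \<in> borel_measurable borel"
  shows "(\<integral>\<^sup>+x. f (x - t) \<partial>lborel) = (\<integral>\<^sup>+x. f x \<partial>lborel)"
  using nn_integral_lborel_affine[OF assms, of 1 "- t"] by simp

lemma nn_integral_lborel_reflect:
  fixes f :: "'a::euclidean_space \<Rightarrow> ennreal"
  assumes [measurable]: "f \<in> borel_measurable borel"
  shows "(\<integral>\<^sup>+x. f (t - x) \<partial>lborel) = (\<integral>\<^sup>+x. f x \<partial>lborel)"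
  using nn_integral_lborel_affine[OF assms, of "-1" t] by simp

lemma nn_integral_lborel_dilate:
  fixes f :: "'a::euclidean_space \<Rightarrow> ennreal"
  assumes [measurable]: "f \<in> borel_measurable borel" and r: "r > 0"
  shows "(\<integral>\<^sup>+x. f (x /\<^sub>R r) \<partial>lborel) = ennreal (r ^ DIM('a)) * (\<integral>\<^sup>+x. f x \<partial>lborel)"
  using nn_integral_lborel_affine[of "\<lambda>x. f (x /\<^sub>R r)" r 0] r by simp

lemma integral_lborel_affine:
  fixes f :: "'a::euclidean_space \<Rightarrow> real"
  assumes [measurable]: "f \<in> borel_measurable borel" and c: "c \<noteq> 0"
  shows "(LINT x|lborel. f x) = \<bar>c\<bar> ^ DIM('a) * (LINT x|lborel. f (t + c *\<^sub>R x))"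
  by (subst lborel_affine[OF c, of t])
     (simp add: integral_density integral_distr)

lemma integrable_lborel_affine:
  fixes f :: "'a::euclidean_space \<Rightarrow> real"
  assumes f: "integrable lborel f" and c: "c \<noteq> 0"
  shows "integrable lborel (\<lambda>x. f (t + c *\<^sub>R x))"
proof -
  have [measurable]: "f \<in> borel_measurable borel" using f by auto
  have "(\<integral>\<^sup>+x. ennreal (norm (f x)) \<partial>lborel) < \<infinity>" using f by (simp add: integrable_iff_bounded)
  then have "(\<integral>\<^sup>+x. ennreal (norm (f (t + c *\<^sub>R x))) \<partial>lborel) < \<infinity>"
    by (subst (asm) nn_integral_lborel_affine[OF _ c, of _ t]) (use c in \<open>auto simp: ennreal_mult_less_top\<close>)
  then show ?thesis by (simp add: integrable_iff_bounded)
qed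

section \<open>Differentiation under the integral and integrable power weights\<close>

text \<open>The mean value theorem bounds the difference quotients by the majorant \<open>w\<close>
  of the derivative, so dominated convergence applies along every sequence of steps tending to
  0.\<close>

lemma DERIV_integral:
  fixes f :: "real \<Rightarrow> 'a \<Rightarrow> real"
  assumes int: "\<And>s. \<bar>s\<bar> < 1 \<Longrightarrow> integrable M (f s)"
    and der: "\<And>x s. \<bar>s\<bar> < 1 \<Longrightarrow> ((\<lambda>s. f s x) has_real_derivative f' s x) (at s)"
    and bd: "\<And>x s. \<bar>s\<bar> < 1 \<Longrightarrow> \<bar>f' s x\<bar> \<le> w x"
    and w: "integrable M w" and meas: "f' 0 \<in> borel_measurable M"
  shows "((\<lambda>s. LINT x|M. f s x) has_real_derivative (LINT x|M. f' 0 x)) (at 0)"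
proof -
  have lip: "\<bar>(f h x - f 0 x) / h\<bar> \<le> w x" if h: "\<bar>h\<bar> < 1" "h \<noteq> 0" for h x
  proof -
    have "\<bar>f h x - f 0 x\<bar> \<le> w x * \<bar>h\<bar>"
    proof -
      have "\<exists>z. \<bar>z\<bar> < 1 \<and> f h x - f 0 x = h * f' z x"
      proof (cases "h > 0")
        case True
        with h have "\<exists>z. 0 < z \<and> z < h \<and> f h x - f 0 x = (h - 0) * f' z x"
          by (intro MVT2 der) auto
        then obtain z where "0 < z" "z < h" "f h x - f 0 x = (h - 0) * f' z x" by blast
        then show ?thesis using h by (intro exI[of _ z]) auto
      next
        case False
        with h have "\<exists>z. h < z \<and> z < 0 \<and> f 0 x - f h x = (0 - h) * f' z x"
          by (intro MVT2 der) auto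
        then obtain z where "h < z" "z < 0" "f 0 x - f h x = (0 - h) * f' z x" by blast
        then show ?thesis using h by (intro exI[of _ z]) auto
      qed
      then obtain z where z: "\<bar>z\<bar> < 1" "f h x - f 0 x = h * f' z x" by blast
      then show ?thesis using mult_left_mono[OF bd[OF z(1), of x], of "\<bar>h\<bar>"] by (simp add: abs_mult mult.commute)
    qed
    then show ?thesis using h by (simp add: abs_divide divide_le_eq)
  qed
  have "((\<lambda>h. ((LINT x|M. f h x) - (LINT x|M. f 0 x)) / h) \<longlongrightarrow> (LINT x|M. f' 0 x)) (at 0)"
    unfolding tendsto_at_iff_sequentially comp_def
  proof (intro allI impI)
    fix h :: "nat \<Rightarrow> real" assume h0: "\<forall>i. h i \<in> UNIV - {0}" and "h \<longlonglongrightarrow> 0"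
    then have "\<forall>\<^sub>F i in sequentially. \<bar>h i\<bar> < 1"
      using tendstoD[of h 0 sequentially 1] by (simp add: dist_real_def)
    \<comment> \<open>The bounds are available only for steps below 1, so finitely many terms of the
      sequence are dropped.\<close>
    then obtain n where "\<forall>i\<ge>n. \<bar>h i\<bar> < 1" unfolding eventually_sequentially by blast
    then have n: "\<bar>h (i + n)\<bar> < 1" for i by simp
    have hn: "(\<lambda>i. h (i + n)) \<longlonglongrightarrow> 0" by (rule LIMSEQ_ignore_initial_segment) fact
    have "(\<lambda>i. LINT x|M. (f (h (i + n)) x - f 0 x) / h (i + n)) \<longlonglongrightarrow> (LINT x|M. f' 0 x)"
    proof (rule integral_dominated_convergence[where w=w])
      show "AE x in M. (\<lambda>i. (f (h (i + n)) x - f 0 x) / h (i + n)) \<longlonglongrightarrow> f' 0 x"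
      proof (rule AE_I2)
        fix x
        have "((\<lambda>s. (f s x - f 0 x) / s) \<longlongrightarrow> f' 0 x) (at 0)"
          using der[of 0 x] by (simp add: has_field_derivative_iff)
        moreover have "filterlim (\<lambda>i. h (i + n)) (at 0) sequentially"
          using h0 hn by (simp add: filterlim_at)
        ultimately show "(\<lambda>i. (f (h (i + n)) x - f 0 x) / h (i + n)) \<longlonglongrightarrow> f' 0 x"
          by (rule filterlim_compose)
      qed
      show "\<And>i. (\<lambda>x. (f (h (i + n)) x - f 0 x) / h (i + n)) \<in> borel_measurable M"
        using int[OF n] int[of 0] by (intro borel_measurable_divide borel_measurable_diff) auto
      show "\<And>i. AE x in M. norm ((f (h (i + n)) x - f 0 x) / h (i + n)) \<le> w x"
        using lip[OF n] h0 by simp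
    qed (rule meas, rule w)
    moreover have "(LINT x|M. (f (h (i + n)) x - f 0 x) / h (i + n)) = ((LINT x|M. f (h (i + n)) x) - (LINT x|M. f 0 x)) / h (i + n)" for i
      using int[OF n[of i]] int[of 0] by simp
    ultimately show "(\<lambda>i. ((LINT x|M. f (h i) x) - (LINT x|M. f 0 x)) / h i) \<longlonglongrightarrow> (LINT x|M. f' 0 x)"
      by (intro LIMSEQ_offset[of "\<lambda>i. ((LINT x|M. f (h i) x) - (LINT x|M. f 0 x)) / h i" n]) (simp only:)
  qed
  then show ?thesis by (simp add: has_field_derivative_iff)
qed

text \<open>Dyadic decomposition: a point with \<open>2^n <= 1 + |x| < 2^(n+1)\<close> lies in the
  ball of radius \<open>2^(n+1)\<close>, where it is charged \<open>2^(-n s)\<close>. The volumes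
  grow like \<open>2^(n N)\<close>, so the total is a geometric series of ratio
  \<open>2^(N - s) < 1\<close>.\<close>

lemma nn_integral_inverse_power_finite:
  fixes s :: real
  assumes s: "s > real DIM('a::euclidean_space)"
  shows "(\<integral>\<^sup>+x. ennreal ((1 + norm (x::'a)) powr (- s)) \<partial>lborel) < \<infinity>"
proof -
  define N where "N = DIM('a)"
  have sp: "s > 0" using s by (meson dual_order.strict_trans2 of_nat_0_le_iff)
  define B where "B n = ball (0::'a) (2 ^ Suc n)" for n :: nat
  have cover: "ennreal ((1 + norm x) powr (- s)) \<le> (\<Sum>n. ennreal (2 powr (- (real n * s))) * indicator (B n) x)" for x :: 'a
  proof -
    define n where "n = nat \<lfloor>log 2 (1 + norm x)\<rfloor>"
    have l0: "log 2 (1 + norm x) \<ge> 0" by (simp add: zero_le_log_cancel_iff add_pos_nonneg)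
    then have n: "real n \<le> log 2 (1 + norm x)" "log 2 (1 + norm x) < real n + 1"
      unfolding n_def by linarith+
    have "1 + norm x < 2 powr (real n + 1)" using n(2) by (simp add: log_less_iff add_pos_nonneg)
    also have "\<dots> = 2 ^ Suc n" by (simp add: powr_add powr_realpow)
    finally have xB: "x \<in> B n" by (simp add: B_def)
    have "2 powr (real n) \<le> 1 + norm x" using n(1) by (simp add: le_log_iff add_pos_nonneg)
    then have "(1 + norm x) powr (- s) \<le> (2 powr real n) powr (- s)"
      using sp by (intro powr_mono2') auto
    then have "ennreal ((1 + norm x) powr (- s)) \<le> ennreal (2 powr (- (real n * s))) * indicator (B n) x"
      using xB by (simp add: powr_powr ennreal_leI)
    also have "\<dots> \<le> (\<Sum>n. ennreal (2 powr (- (real n * s))) * indicator (B n) x)"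
      using sum_le_suminf[of "\<lambda>n. ennreal (2 powr (- (real n * s))) * indicator (B n) x" "{n}"]
      by (simp only: sum.insert[OF finite.emptyI] sum.empty empty_iff simp_thms not_False_eq_True finite.emptyI finite.insertI add_0_right summableI zero_le ball_simps)
    finally show ?thesis .
  qed
  define V where "V = measure lborel (ball (0::'a) 1)"
  have V: "emeasure lborel (B n) = ennreal ((2 ^ Suc n) ^ N * V)" for n
  proof -
    have "emeasure lborel (B n) = ennreal (measure lborel (B n))"
      unfolding B_def using emeasure_lborel_ball_finite[of "0::'a" "2 ^ Suc n"] by (intro emeasure_eq_ennreal_measure) auto
    also have "measure lborel (B n) = (2 ^ Suc n) ^ N * V"
      unfolding B_def N_def V_def by (rule content_ball_conv_unit_ball) simp
    finally show ?thesis .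
  qed
  have mB[measurable]: "B n \<in> sets lborel" for n by (simp add: B_def)
  have "(\<integral>\<^sup>+x. ennreal ((1 + norm (x::'a)) powr (- s)) \<partial>lborel)
      \<le> (\<integral>\<^sup>+x. (\<Sum>n. ennreal (2 powr (- (real n * s))) * indicator (B n) x) \<partial>lborel)"
    by (intro nn_integral_mono cover)
  also have "\<dots> = (\<Sum>n. ennreal (2 powr (- (real n * s))) * emeasure lborel (B n))"
    using mB by (subst nn_integral_suminf) (simp_all only: nn_integral_cmult_indicator, measurable)
  also have "\<dots> = (\<Sum>n. ennreal (2 ^ N * V * (2 powr (real N - s)) ^ n))"
  proof (intro suminf_cong)
    fix n
    have a: "2 powr (- (real n * s)) = (2 powr (- s)) ^ n"
      by (simp add: powr_realpow[symmetric] powr_powr mult.commute)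
    have b: "(2 ^ Suc n) ^ N = (2::real) ^ N * (2 ^ N) ^ n"
      by (simp only: power_Suc power_mult_distrib power_mult[symmetric] mult.commute[of n N])
    have c: "2 powr (real N - s) = 2 ^ N * 2 powr (- s)"
      using powr_realpow[of 2 N] powr_add[of 2 "real N" "- s"] by simp
    have "2 powr (- (real n * s)) * ((2 ^ Suc n) ^ N * V) = 2 ^ N * V * (2 powr (real N - s)) ^ n"
      unfolding a b c power_mult_distrib by (simp only: mult_ac)
    then show "ennreal (2 powr (- (real n * s))) * emeasure lborel (B n) = ennreal (2 ^ N * V * (2 powr (real N - s)) ^ n)"
      by (simp only: V ennreal_mult'[symmetric] powr_ge_zero)
  qed
  also have "\<dots> < \<infinity>"
  proof -
    have "2 powr (real N - s) < (2::real) powr 0" using s by (intro powr_less_mono) (auto simp: N_def)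
    then have "summable (\<lambda>n. 2 ^ N * V * (2 powr (real N - s)) ^ n)"
      by (intro summable_mult summable_geometric) auto
    then show ?thesis
      by (subst suminf_ennreal2) (auto simp: V_def)
  qed
  finally show ?thesis .
qed

lemma powr_one_plus_mult_le:
  assumes "0 \<le> (a::real)" "0 \<le> b" "c \<le> a + b" "0 \<le> c" "0 \<le> K"
  shows "(1 + c) powr K \<le> (1 + a) powr K * (1 + b) powr K"
proof -
  have "1 + c \<le> (1 + a) * (1 + b)" using assms by (simp add: algebra_simps mult_nonneg_nonneg)
      (smt (verit) mult_nonneg_nonneg)
  then have "(1 + c) powr K \<le> ((1 + a) * (1 + b)) powr K" using assms by (intro powr_mono2) auto
  then show ?thesis using assms by (simp add: powr_mult)
qed

lemma powr_one_plus_le: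
  assumes "0 \<le> (a::real)" "0 \<le> K"
  shows "(1 + a) powr K \<le> 2 powr K * (1 + a powr K)"
proof (cases "a \<le> 1")
  case True
  then have "(1 + a) powr K \<le> 2 powr K" using assms by (intro powr_mono2) auto
  then show ?thesis by (simp add: algebra_simps add_increasing2)
next
  case False
  then have "(1 + a) powr K \<le> (2 * a) powr K" using assms by (intro powr_mono2) auto
  then show ?thesis using False by (simp add: powr_mult algebra_simps add_increasing)
qed

section \<open>The kernel at unit time\<close>

text \<open>\<open>\<Gamma>\<close> stands for the kernel at time 1; at other times the kernel will
  be a dilation of it. All derivatives up to order \<open>\<gamma>\<close> are measured against one
  common weight with one constant \<open>CB\<close>.\<close>

locale decaying_profile =
  fixes \<Gamma> :: "real^'n::finite \<Rightarrow> real" and \<gamma> :: nat and L K CB :: real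
  assumes K_nonneg: "0 \<le> K" and K_less: "K < L" and K_order: "\<lfloor>K\<rfloor> + 1 \<le> int \<gamma>"
    and Ck: "Ck_on \<gamma> \<Gamma> UNIV"
    and decay: "\<And>w x. length w \<le> \<gamma> \<Longrightarrow>
      \<bar>foldr partial_deriv w \<Gamma> x\<bar> \<le> CB * (1 + norm x) powr (- (real CARD('n) + L))"
begin

text \<open>Degree of the Taylor polynomial. From \<open>k <= K\<close> all monomials in it have
  moments on the weighted space, and from \<open>K < k + 1 <= \<gamma>\<close> the remainder has an
  order strictly above \<open>K\<close> and only involves controlled derivatives.\<close>

definition k :: nat where "k = nat \<lfloor>K\<rfloor>"

lemma k_le: "real k \<le> K" and k_gr: "K < real k + 1" and k_gamma: "Suc k \<le> \<gamma>"
  using K_nonneg K_order unfolding k_def by linarith+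

definition W :: "real^'n \<Rightarrow> real" where
  "W x = (1 + norm x) powr (- (real CARD('n) + L))"

lemma W_nonneg[simp]: "0 \<le> W x" by (simp add: W_def)

lemma W_measurable[measurable]: "W \<in> borel_measurable borel"
  unfolding W_def[abs_def] by measurable

lemma decay_W: "length w \<le> \<gamma> \<Longrightarrow> \<bar>foldr partial_deriv w \<Gamma> x\<bar> \<le> CB * W x"
  unfolding W_def by (rule decay)

lemma L_pos: "L > 0" using K_nonneg K_less by simp

lemma CB_nonneg: "CB \<ge> 0"
  using decay_W[of "[]" 0] by (simp add: W_def)

lemma deriv_continuous: "length w \<le> \<gamma> \<Longrightarrow> continuous_on UNIV (foldr partial_deriv w \<Gamma>)"
  using Ck_on_foldr_partial_deriv[of w "\<gamma> - length w" \<Gamma>] Ck by (auto intro: Ck_on_continuous)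

lemma deriv_measurable[measurable (raw)]:
  assumes "length w \<le> \<gamma>"
  shows "foldr partial_deriv w \<Gamma> \<in> borel_measurable borel"
  using deriv_continuous[OF assms] by (rule borel_measurable_continuous_onI)

lemma Gam_measurable[measurable]: "\<Gamma> \<in> borel_measurable borel"
  using deriv_measurable[of "[]"] by simp

text \<open>Moving a point by at most 1 changes \<open>1 + |x|\<close> by at most a factor 2. This
  handles the unknown intermediate point of the Taylor remainder and the shifted points in a
  derivative under the integral.\<close>

lemma W_near: "norm (x - z) \<le> 1 \<Longrightarrow> W z \<le> 2 powr (real CARD('n) + L) * W x"
proof -
  assume "norm (x - z) \<le> 1"
  then have "1 + norm x \<le> 2 * (1 + norm z)"
    using norm_triangle_ineq[of z "x - z"] by (simp add: algebra_simps) (smt (verit) norm_ge_zero)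
  then have "W x \<ge> (2 * (1 + norm z)) powr (- (real CARD('n) + L))"
    unfolding W_def using L_pos by (intro powr_mono2') (auto intro: add_pos_nonneg)
  also have "(2 * (1 + norm z)) powr (- (real CARD('n) + L)) = 2 powr (- (real CARD('n) + L)) * W z"
    unfolding W_def by (rule powr_mult)
  finally have "2 powr (real CARD('n) + L) * (2 powr (- (real CARD('n) + L)) * W z) \<le> 2 powr (real CARD('n) + L) * W x"
    by (rule mult_left_mono) simp
  then show ?thesis by (simp only: mult.assoc[symmetric] powr_add[symmetric]) simp
qed

lemma W_le_1: "W x \<le> 1"
  using powr_mono2'[of "- (real CARD('n) + L)" 1 "1 + norm x"] L_pos by (simp add: W_def)

definition weight_mass :: real where
  "weight_mass = enn2real (\<integral>\<^sup>+x. ennreal ((1 + norm (x::real^'n)) powr K * W x) \<partial>lborel)"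

text \<open>Here \<open>K < L\<close> enters: weight times decay is a power of
  \<open>1 + |x|\<close> with exponent \<open>-(N + L - K)\<close>, and \<open>N + L - K\<close>
  exceeds the dimension.\<close>

lemma weight_mass: "(\<integral>\<^sup>+x. ennreal ((1 + norm (x::real^'n)) powr K * W x) \<partial>lborel) = ennreal weight_mass" and weight_mass_nonneg: "weight_mass \<ge> 0"
proof -
  have "(1 + norm x) powr K * W x = (1 + norm x) powr (- (real CARD('n) + L - K))" for x :: "real^'n"
    by (simp add: W_def powr_add[symmetric] algebra_simps)
  moreover have "(\<integral>\<^sup>+x. ennreal ((1 + norm (x::real^'n)) powr (- (real CARD('n) + L - K))) \<partial>lborel) < \<infinity>"
    using K_less by (intro nn_integral_inverse_power_finite) simp
  ultimately show "(\<integral>\<^sup>+x. ennreal ((1 + norm (x::real^'n)) powr K * W x) \<partial>lborel) = ennreal weight_mass"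
    unfolding weight_mass_def by (simp add: ennreal_enn2real)
qed (simp add: weight_mass_def)

lemma integrable_weight_W: "integrable lborel (\<lambda>x::real^'n. (1 + norm x) powr K * W x)"
proof (rule integrableI_bounded)
  show "(\<integral>\<^sup>+x. ennreal (norm ((1 + norm x) powr K * W x)) \<partial>lborel) < \<infinity>"
    using weight_mass by simp
qed measurable

lemma integrable_W_dominated:
  assumes [measurable]: "h \<in> borel_measurable borel" and "\<And>x. \<bar>h x\<bar> \<le> C * ((1 + norm x) powr K * W (x::real^'n))"
  shows "integrable lborel h"
  by (rule Bochner_Integration.integrable_bound[of _ "\<lambda>x. C * ((1 + norm x) powr K * W x)"])
     (use assms integrable_weight_W in \<open>auto intro!: integrable_mult_right order_trans[OF _ abs_ge_self]\<close>)

lemma mi_power_le_weight: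
  assumes "\<alpha> \<in> mi_le K" shows "\<bar>mi_power x \<alpha>\<bar> \<le> (1 + norm (x::real^'n)) powr K"
proof -
  have "\<bar>mi_power x \<alpha>\<bar> \<le> (1 + norm x) ^ mi_abs \<alpha>"
    by (rule order_trans[OF abs_mi_power_le]) (auto intro: power_mono)
  also have "\<dots> = (1 + norm x) powr mi_abs \<alpha>" by (subst powr_realpow) (auto intro: add_pos_nonneg)
  also have "\<dots> \<le> (1 + norm x) powr K" using assms by (intro powr_mono) (auto simp: mi_le_def)
  finally show ?thesis .
qed

lemma mi_power_measurable[measurable]: "(\<lambda>x. mi_power (x::real^'n) \<alpha>) \<in> borel_measurable borel"
  unfolding mi_power_def by measurable

section \<open>Moments of derivatives of the profile\<close>

lemma integrable_moment_deriv:
  assumes "\<alpha> \<in> mi_le K" "length w \<le> \<gamma>"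
  shows "integrable lborel (\<lambda>x. mi_power x \<alpha> * foldr partial_deriv w \<Gamma> x)"
proof (rule integrable_W_dominated[where C = CB])
  fix x :: "real^'n"
  have "\<bar>mi_power x \<alpha> * foldr partial_deriv w \<Gamma> x\<bar> \<le> (1 + norm x) powr K * (CB * W x)"
    unfolding abs_mult by (intro mult_mono mi_power_le_weight decay_W assms) auto
  then show "\<bar>mi_power x \<alpha> * foldr partial_deriv w \<Gamma> x\<bar> \<le> CB * ((1 + norm x) powr K * W x)"
    by (simp add: mult_ac)
qed (use assms in measurable)

text \<open>For \<open>\<alpha> i = 0\<close> the truncated subtraction returns
  \<open>\<alpha>\<close> itself, but the factor in front is then 0.\<close>

lemma DERIV_mi_power:
  "((\<lambda>s. mi_power (x + s *\<^sub>R axis i 1) \<alpha>) has_real_derivative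
     real (\<alpha> i) * mi_power (x + s *\<^sub>R axis i 1) (\<alpha>(i := \<alpha> i - 1))) (at s)" for x :: "real^'n"
proof -
  have e: "mi_power (x + s *\<^sub>R axis i 1) \<beta> = (x $ i + s) ^ \<beta> i * (\<Prod>j\<in>UNIV - {i}. x $ j ^ \<beta> j)" for s \<beta>
    unfolding mi_power_def by (subst prod.remove[of _ i]) (auto simp: axis_def intro!: prod.cong)
  have "((\<lambda>s. (x $ i + s) ^ \<alpha> i * (\<Prod>j\<in>UNIV - {i}. x $ j ^ \<alpha> j)) has_real_derivative
     real (\<alpha> i) * ((x $ i + s) ^ (\<alpha> i - 1) * (\<Prod>j\<in>UNIV - {i}. x $ j ^ \<alpha> j))) (at s)"
    by (auto intro!: derivative_eq_intros)
  then show ?thesis unfolding e by simp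
qed

lemma mi_le_decr: "\<alpha> \<in> mi_le K \<Longrightarrow> \<alpha>(i := \<alpha> i - 1) \<in> mi_le K" for \<alpha> :: "'n multi_index"
  by (erule mi_le_downward) (auto simp: le_fun_def)

text \<open>Integration by parts without boundary terms: the integral of
  \<open>H (x + s e_i)\<close> does not depend on \<open>s\<close> by translation invariance, so the
  integral of the derivative \<open>H'\<close> of the product vanishes, and the product rule splits
  it into the two terms.\<close>

lemma moment_deriv_by_parts:
  assumes \<alpha>: "\<alpha> \<in> mi_le K" and w: "Suc (length w) \<le> \<gamma>"
  shows "(LINT x|lborel. mi_power x \<alpha> * foldr partial_deriv (i # w) \<Gamma> x) =
     - real (\<alpha> i) * (LINT x|lborel. mi_power x (\<alpha>(i := \<alpha> i - 1)) * foldr partial_deriv w \<Gamma> x)"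
proof -
  let ?h = "foldr partial_deriv w \<Gamma>" and ?e = "axis i 1 :: real^'n" and ?\<beta> = "\<alpha>(i := \<alpha> i - 1)"
  have Ch: "Ck_on (Suc 0) ?h UNIV"
    using Ck_on_foldr_partial_deriv[of w "Suc 0" \<Gamma>] Ck_on_antimono[OF Ck, of "length w + Suc 0"] w by simp
  have [measurable]: "?h \<in> borel_measurable borel" "foldr partial_deriv (i # w) \<Gamma> \<in> borel_measurable borel"
    using w deriv_measurable[of w] deriv_measurable[of "i # w"] by auto
  define H where "H x = mi_power x \<alpha> * ?h x" for x
  define H' where "H' x = real (\<alpha> i) * (mi_power x ?\<beta> * ?h x) + mi_power x \<alpha> * foldr partial_deriv (i # w) \<Gamma> x" for x
  have [measurable]: "H \<in> borel_measurable borel" "H' \<in> borel_measurable borel"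
    unfolding H_def H'_def by measurable
  have iH: "integrable lborel H" unfolding H_def using w by (intro integrable_moment_deriv \<alpha>) simp
  have bH': "\<bar>H' x\<bar> \<le> (real (\<alpha> i) + 1) * CB * ((1 + norm x) powr K * W x)" for x
  proof -
    have "\<bar>H' x\<bar> \<le> real (\<alpha> i) * ((1 + norm x) powr K * (CB * W x)) + (1 + norm x) powr K * (CB * W x)"
      unfolding H'_def using w
      by (intro order_trans[OF abs_triangle_ineq] add_mono)
         (auto simp: abs_mult simp del: foldr.simps One_nat_def intro!: mult_mono mi_power_le_weight decay_W \<alpha> mi_le_decr)
    then show ?thesis by (simp add: algebra_simps)
  qed
  \<comment> \<open>Cost of comparing weight and decay at \<open>x + s e_i\<close> with those at
    \<open>x\<close> for \<open>|s| < 1\<close>: the first factor from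
    \<open>1 + |x + s e_i| <= 2 (1 + |x|)\<close>, the second from \<open>W_near\<close>.\<close>
  let ?c = "2 powr K * 2 powr (real CARD('n) + L)"
  have "((\<lambda>s. LINT x|lborel. H (x + s *\<^sub>R ?e)) has_real_derivative (LINT x|lborel. H' (x + 0 *\<^sub>R ?e))) (at 0)"
  proof (rule DERIV_integral[where w="\<lambda>x. (real (\<alpha> i) + 1) * CB * ?c * ((1 + norm x) powr K * W x)"])
    fix s :: real assume s: "\<bar>s\<bar> < 1"
    show "integrable lborel (\<lambda>x. H (x + s *\<^sub>R ?e))"
      using integrable_lborel_affine[OF iH, of 1 "s *\<^sub>R ?e"] by (simp add: add.commute)
    fix x
    show "((\<lambda>s. H (x + s *\<^sub>R ?e)) has_real_derivative H' (x + s *\<^sub>R ?e)) (at s)"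
      unfolding H_def H'_def
      by (rule derivative_eq_intros DERIV_mi_power DERIV_partial_axis[OF Ch])+ simp
    let ?z = "x + s *\<^sub>R ?e"
    have nz2: "1 + norm ?z \<le> 2 * (1 + norm x)" using norm_triangle_ineq[of x "s *\<^sub>R ?e"] s
      by (simp add: norm_axis_1) (smt (verit) norm_ge_zero)
    have n1: "norm (x - ?z) \<le> 1" using s by (simp add: norm_axis_1)
    have "(1 + norm ?z) powr K * W ?z \<le> (2 * (1 + norm x)) powr K * (2 powr (real CARD('n) + L) * W x)"
      using nz2 K_nonneg n1 by (intro mult_mono powr_mono2 W_near) auto
    then have "(1 + norm ?z) powr K * W ?z \<le> ?c * ((1 + norm x) powr K * W x)"
      by (simp only: powr_mult mult_ac)
    from mult_left_mono[OF this, of "(real (\<alpha> i) + 1) * CB"] bH'[of ?z] CB_nonneg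
    show "\<bar>H' (x + s *\<^sub>R ?e)\<bar> \<le> (real (\<alpha> i) + 1) * CB * ?c * ((1 + norm x) powr K * W x)"
      by (simp add: mult_ac)
  qed (use integrable_weight_W in \<open>auto intro!: integrable_mult_right\<close>)
  moreover have "(LINT x|lborel. H (x + s *\<^sub>R ?e)) = (LINT x|lborel. H x)" for s
    using integral_lborel_affine[of H 1 "s *\<^sub>R ?e"] by (simp add: add.commute)
  ultimately have "((\<lambda>s. LINT x|lborel. H x) has_real_derivative (LINT x|lborel. H' x)) (at 0)" by simp
  from DERIV_unique[OF this DERIV_const] have "(LINT x|lborel. H' x) = 0" .
  moreover have "(LINT x|lborel. H' x) = real (\<alpha> i) * (LINT x|lborel. mi_power x ?\<beta> * ?h x)
      + (LINT x|lborel. mi_power x \<alpha> * foldr partial_deriv (i # w) \<Gamma> x)"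
    unfolding H'_def using w integrable_moment_deriv[OF mi_le_decr[OF \<alpha>], of w i] integrable_moment_deriv[OF \<alpha>, of "i # w"]
    by (subst Bochner_Integration.integral_add) auto
  ultimately show ?thesis by simp
qed

text \<open>Every letter passed to the monomial lowers an exponent by one. If a letter occurs more
  often than the exponent allows, a factor 0 appears; if the word exhausts the monomial exactly, the
  factors multiply to the factorial. This makes the moment matrix of the \<open>g_\<beta>\<close>
  triangular.\<close>

lemma moment_deriv_word:
  assumes "\<alpha> \<in> mi_le K" "length w \<le> \<gamma>"
  shows "\<not> count (mset w) \<le> \<alpha> \<Longrightarrow> (LINT x|lborel. mi_power x \<alpha> * foldr partial_deriv w \<Gamma> x) = 0"
    and "count (mset w) = \<alpha> \<Longrightarrow> (LINT x|lborel. mi_power x \<alpha> * foldr partial_deriv w \<Gamma> x)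
       = (-1) ^ length w * mi_fact \<alpha> * (LINT x|lborel. \<Gamma> x)"
  using assms
proof (induction w arbitrary: \<alpha>)
  case Nil
  { case 1 then show ?case by (simp add: le_fun_def) }
  { case 2 then show ?case by (auto simp: mi_power_def mi_fact_def simp flip: 2(1)) }
next
  case (Cons i w)
  { case 1
    let ?\<beta> = "\<alpha>(i := \<alpha> i - 1)"
    \<comment> \<open>Either the letter \<open>i\<close> already meets the exponent 0, or the excess
      persists after removing it from word and exponent alike.\<close>
    have "\<alpha> i = 0 \<or> \<not> count (mset w) \<le> ?\<beta>"
    proof (rule ccontr)
      assume "\<not> ?thesis"
      then have a: "\<alpha> i > 0" "count (mset w) \<le> ?\<beta>" by auto
      have "count (mset (i # w)) j \<le> \<alpha> j" for j
        using a(1) le_funD[OF a(2), of j] by (auto split: if_splits)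
      with 1 show False by (auto simp: le_fun_def)
    qed
    moreover have "(LINT x|lborel. mi_power x ?\<beta> * foldr partial_deriv w \<Gamma> x) = 0" if "\<not> count (mset w) \<le> ?\<beta>"
      using Cons.IH(1)[OF that mi_le_decr] 1 by (simp add: fun_upd_def)
    ultimately show ?case
      using moment_deriv_by_parts[of \<alpha> w i] 1 by auto }
  { case 2
    let ?\<beta> = "\<alpha>(i := \<alpha> i - 1)"
    have b: "count (mset w) = ?\<beta>" "\<alpha> i > 0" 
    proof -
      have a: "count (mset w) j + (if j = i then 1 else 0) = \<alpha> j" for j using fun_cong[OF 2(1), of j] by auto
      show "\<alpha> i > 0" using a[of i] by simp
      show "count (mset w) = ?\<beta>" using a by (force simp: fun_eq_iff split: if_splits)
    qed
    have "mi_fact \<alpha> = real (\<alpha> i) * mi_fact ?\<beta>"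
      unfolding mi_fact_def using b(2)
      by (subst (1 2) prod.remove[of _ i]) (auto simp: fact_reduce intro!: prod.cong)
    then show ?case
      using moment_deriv_by_parts[of \<alpha> w i] 2(2,3) Cons.IH(2)[OF b(1) mi_le_decr[OF 2(2)]]
      by (simp add: mult_ac del: fun_upd_apply) }
qed

end


context decaying_profile begin

section \<open>Convolution kernels with Taylor correction\<close>

definition Tay :: "real^'n \<Rightarrow> real^'n \<Rightarrow> real" where
  "Tay x y = \<Gamma> (x - y) - (\<Sum>j\<le>k. taylor_part j \<Gamma> x y / fact j)"

text \<open>Size of the Taylor-corrected kernel as a function of \<open>|y|\<close>: order
  \<open>k + 1\<close> for small \<open>y\<close> by cancellation, and the power \<open>K\<close>,
  the most that the data can integrate, for large \<open>y\<close>.\<close>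

definition psi :: "real \<Rightarrow> real" where
  "psi \<rho> = (if \<rho> \<le> 1 then \<rho> ^ Suc k else \<rho> powr K)"

lemma psi_nonneg: "\<rho> \<ge> 0 \<Longrightarrow> psi \<rho> \<ge> 0"
  by (simp add: psi_def)

lemma psi_measurable[measurable]: "psi \<in> borel_measurable borel"
  unfolding psi_def[abs_def] by measurable

lemma psi_le_powr:
  assumes "\<rho> \<ge> 0" shows "psi \<rho> \<le> \<rho> powr K"
proof (cases "\<rho> \<le> 1 \<and> \<rho> > 0")
  case True
  then have "\<rho> ^ Suc k = \<rho> powr (real k + 1)" by (simp add: powr_realpow[symmetric] powr_add)
  also have "\<dots> \<le> \<rho> powr K" using True k_gr by (intro powr_mono') auto
  finally show ?thesis using True by (simp add: psi_def)
next
  case False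
  with assms show ?thesis by (auto simp: psi_def)
qed

lemma psi_mono:
  assumes "0 \<le> a" "a \<le> b" shows "psi a \<le> psi b"
proof (cases "b \<le> 1")
  case True
  with assms show ?thesis using power_mono[of a b "Suc k"] by (simp add: psi_def)
next
  case b: False
  show ?thesis
  proof (cases "a \<le> 1")
    case True
    then have "psi a \<le> 1" using assms power_le_one[of a "Suc k"] by (simp add: psi_def)
    also have "1 \<le> b powr K" using b K_nonneg by (intro ge_one_powr_ge_zero) auto
    finally show ?thesis using b by (simp add: psi_def)
  next
    case False
    with assms b K_nonneg show ?thesis by (auto simp: psi_def intro!: powr_mono2)
  qed
qed

lemma prod_list_neg: "prod_list (map (\<lambda>i. - (y::real^'n) $ i) w) = mi_power (- y) (count (mset w))"
  using prod_list_mi_power[of "- y" w] by simp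

lemma Tay_measurable[measurable]: "case_prod Tay \<in> borel_measurable (borel \<Otimes>\<^sub>M borel)"
proof -
  have [measurable]: "(\<lambda>z. taylor_part j \<Gamma> (fst z) (snd z)) \<in> borel_measurable (borel \<Otimes>\<^sub>M borel)" if "j \<le> k" for j
  proof -
    have [measurable]: "foldr partial_deriv w \<Gamma> \<in> borel_measurable borel" if "w \<in> words j" for w
      using that \<open>j \<le> k\<close> k_gamma by (intro deriv_measurable) (simp add: words_def)
    show ?thesis unfolding taylor_part_def prod_list_neg by measurable
  qed
  show ?thesis unfolding Tay_def[abs_def] case_prod_unfold by measurable
qed

text \<open>For \<open>|y| <= 1\<close> the Lagrange remainder is used, whose intermediate point is
  within distance 1 of \<open>x\<close>. For \<open>|y| > 1\<close> nothing cancels: kernel and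
  Taylor terms are estimated separately, with \<open>|y|^j <= |y|^K\<close> for
  \<open>j <= k\<close>.\<close>

lemma Tay_bound:
  obtains C where "C \<ge> 0"
    "\<And>x y :: real^'n. norm y \<le> 1 \<Longrightarrow> \<bar>Tay x y\<bar> \<le> C * norm y ^ Suc k * W x"
    "\<And>x y :: real^'n. norm y > 1 \<Longrightarrow> \<bar>Tay x y\<bar> \<le> C * (W (x - y) + norm y powr K * W x)"
proof -
  define c where "c j = real (card (words j :: 'n list set))" for j
  define C1 where "C1 = c (Suc k) * CB * 2 powr (real CARD('n) + L)"
  define C2 where "C2 = CB + (\<Sum>j\<le>k. c j * CB)"
  have c0: "c j \<ge> 0" for j by (simp add: c_def)
  have C0: "C1 \<ge> 0" "C2 \<ge> 0" unfolding C1_def C2_def using CB_nonneg c0 by (auto intro!: add_nonneg_nonneg sum_nonneg)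
  have small: "\<bar>Tay x y\<bar> \<le> C1 * norm y ^ Suc k * W x" if y: "norm (y::real^'n) \<le> 1" for x y
  proof -
    have "Ck_on (Suc k) \<Gamma> UNIV" using Ck k_gamma by (rule Ck_on_antimono)
    from taylor_remainder[OF this, of x y] obtain s where s: "0 < s" "s < 1"
      "Tay x y = taylor_part (Suc k) \<Gamma> (x - s *\<^sub>R y) y / fact (Suc k)" unfolding Tay_def by blast
    have "\<bar>Tay x y\<bar> \<le> \<bar>taylor_part (Suc k) \<Gamma> (x - s *\<^sub>R y) y\<bar> / 1"
      unfolding s(3) abs_divide by (intro divide_left_mono) (auto simp: fact_ge_1 simp del: fact_Suc)
    also have "\<dots> \<le> c (Suc k) * norm y ^ Suc k * (CB * W (x - s *\<^sub>R y))"
      unfolding c_def using k_gamma by (simp del: power_Suc, intro abs_taylor_part_le decay_W) simp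
    also have "\<dots> \<le> c (Suc k) * norm y ^ Suc k * (CB * (2 powr (real CARD('n) + L) * W x))"
    proof (intro mult_left_mono W_near)
      show "norm (x - (x - s *\<^sub>R y)) \<le> 1" using s y mult_le_one[of s "norm y"] by simp
    qed (use c0 CB_nonneg in auto)
    finally show ?thesis by (simp add: C1_def mult_ac)
  qed
  have large: "\<bar>Tay x y\<bar> \<le> C2 * (W (x - y) + norm y powr K * W x)" if y: "norm (y::real^'n) > 1" for x y
  proof -
    have "\<bar>taylor_part j \<Gamma> x y / fact j\<bar> \<le> c j * CB * (norm y powr K * W x)" if j: "j \<le> k" for j
    proof -
      have "\<bar>taylor_part j \<Gamma> x y / fact j\<bar> \<le> \<bar>taylor_part j \<Gamma> x y\<bar> / 1"
        unfolding abs_divide by (intro divide_left_mono) (auto simp: fact_ge_1)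
      also have "\<dots> \<le> c j * norm y ^ j * (CB * W x)"
        unfolding c_def using k_gamma j by (simp, intro abs_taylor_part_le decay_W) simp
      also have "norm y ^ j = norm y powr j" using y by (subst powr_realpow) auto
      also have "c j * norm y powr j * (CB * W x) \<le> c j * norm y powr K * (CB * W x)"
        using y j k_le c0 CB_nonneg by (intro mult_right_mono mult_left_mono powr_mono) auto
      finally show ?thesis by (simp add: mult_ac)
    qed
    then have "\<bar>Tay x y\<bar> \<le> CB * W (x - y) + (\<Sum>j\<le>k. c j * CB * (norm y powr K * W x))"
      unfolding Tay_def using decay_W[of "[]" "x - y"]
      by (intro order_trans[OF abs_triangle_ineq4] add_mono order_trans[OF sum_abs] sum_mono) auto
    also have "\<dots> = CB * W (x - y) + (\<Sum>j\<le>k. c j * CB) * (norm y powr K * W x)"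
      by (simp add: sum_distrib_right)
    also have "\<dots> \<le> C2 * W (x - y) + C2 * (norm y powr K * W x)"
      unfolding C2_def using CB_nonneg c0 by (intro add_mono mult_right_mono) (auto intro!: sum_nonneg)
    finally show ?thesis by (simp add: distrib_left)
  qed
  show ?thesis
  proof (rule that[of "C1 + C2"])
    fix x y :: "real^'n"
    { assume "norm y \<le> 1" then have "\<bar>Tay x y\<bar> \<le> C1 * (norm y ^ Suc k * W x)"
        using small[of y x] by (simp add: mult.assoc)
      also have "\<dots> \<le> (C1 + C2) * (norm y ^ Suc k * W x)" using C0 by (intro mult_right_mono) auto
      finally show "\<bar>Tay x y\<bar> \<le> (C1 + C2) * norm y ^ Suc k * W x" by (simp add: mult.assoc) }
    { assume "norm y > 1" then have "\<bar>Tay x y\<bar> \<le> C2 * (W (x - y) + norm y powr K * W x)" by (rule large)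
      also have "\<dots> \<le> (C1 + C2) * (W (x - y) + norm y powr K * W x)" using C0 by (intro mult_right_mono) auto
      finally show "\<bar>Tay x y\<bar> \<le> (C1 + C2) * (W (x - y) + norm y powr K * W x)" . }
  qed (use C0 in simp)
qed

lemma nn_integral_weight_W_translate:
  "(\<integral>\<^sup>+x. ennreal ((1 + norm x) powr K * W (x - y)) \<partial>lborel) \<le> ennreal ((1 + norm y) powr K * weight_mass)"
proof -
  have "(\<integral>\<^sup>+x. ennreal ((1 + norm x) powr K * W (x - y)) \<partial>lborel)
     \<le> (\<integral>\<^sup>+x. ennreal ((1 + norm y) powr K) * ennreal ((1 + norm (x - y)) powr K * W (x - y)) \<partial>lborel)"
  proof (intro nn_integral_mono)
    fix x
    have "(1 + norm x) powr K * W (x - y) \<le> ((1 + norm y) powr K * (1 + norm (x - y)) powr K) * W (x - y)"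
      using norm_triangle_ineq[of y "x - y"] K_nonneg by (intro mult_right_mono powr_one_plus_mult_le) auto
    then show "ennreal ((1 + norm x) powr K * W (x - y)) \<le> ennreal ((1 + norm y) powr K) * ennreal ((1 + norm (x - y)) powr K * W (x - y))"
      by (simp add: ennreal_mult[symmetric] ennreal_leI mult.assoc)
  qed
  also have "\<dots> = ennreal ((1 + norm y) powr K) * (\<integral>\<^sup>+x. ennreal ((1 + norm (x - y)) powr K * W (x - y)) \<partial>lborel)"
    by (intro nn_integral_cmult) measurable
  also have "(\<integral>\<^sup>+x. ennreal ((1 + norm (x - y)) powr K * W (x - y)) \<partial>lborel) = ennreal weight_mass"
    using nn_integral_lborel_translate[of "\<lambda>x. ennreal ((1 + norm x) powr K * W x)" y] weight_mass by simp
  finally show ?thesis using weight_mass_nonneg by (simp only: ennreal_mult powr_ge_zero)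
qed

text \<open>The two norms that make up \<open>Bd\<close>, for the corrected kernel as a function of
  \<open>x\<close>, have the same dependence on \<open>y\<close>. In the weighted norm the
  translated term \<open>W (x - y)\<close> costs \<open>(1 + |y|)^K\<close>, which for
  \<open>|y| > 1\<close> is at most \<open>2^K |y|^K\<close>.\<close>

lemma Tay_weight_ex: "\<exists>C\<ge>0. (\<forall>y. (\<integral>\<^sup>+x. ennreal ((1 + norm x) powr K * \<bar>Tay x y\<bar>) \<partial>lborel) \<le> ennreal (C * psi (norm y)))
    \<and> (\<forall>x y. \<bar>Tay x y\<bar> \<le> C * psi (norm y))"
proof -
  obtain C where C: "C \<ge> 0"
    "\<And>x y :: real^'n. norm y \<le> 1 \<Longrightarrow> \<bar>Tay x y\<bar> \<le> C * norm y ^ Suc k * W x"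
    "\<And>x y :: real^'n. norm y > 1 \<Longrightarrow> \<bar>Tay x y\<bar> \<le> C * (W (x - y) + norm y powr K * W x)"
    using Tay_bound by blast
  define B where "B = C * (2 powr K + 1) * weight_mass + 2 * C"
  have sup: "\<bar>Tay x y\<bar> \<le> 2 * C * psi (norm y)" for x y
  proof (cases "norm y \<le> 1")
    case True
    have "\<bar>Tay x y\<bar> \<le> C * norm y ^ Suc k * 1"
      using C(1) W_le_1[of x] by (intro order_trans[OF C(2)[OF True]] mult_left_mono) auto
    also have "\<dots> \<le> 2 * C * psi (norm y)" using True C(1) by (simp add: psi_def)
    finally show ?thesis .
  next
    case False
    then have y1: "norm y powr K \<ge> 1" using K_nonneg by (intro ge_one_powr_ge_zero) auto
    have "\<bar>Tay x y\<bar> \<le> C * (norm y powr K + norm y powr K * 1)"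
      using C(1) W_le_1[of x] W_le_1[of "x - y"] False y1
      by (intro order_trans[OF C(3)] mult_left_mono add_mono) auto
    then show ?thesis using False by (simp add: psi_def)
  qed
  have wt: "(\<integral>\<^sup>+x. ennreal ((1 + norm x) powr K * \<bar>Tay x y\<bar>) \<partial>lborel) \<le> ennreal (C * (2 powr K + 1) * weight_mass * psi (norm y))" for y
  proof (cases "norm y \<le> 1")
    case True
    have "(\<integral>\<^sup>+x. ennreal ((1 + norm x) powr K * \<bar>Tay x y\<bar>) \<partial>lborel)
       \<le> (\<integral>\<^sup>+x. ennreal (C * norm y ^ Suc k) * ennreal ((1 + norm x) powr K * W x) \<partial>lborel)"
    proof (intro nn_integral_mono)
      fix x
      have "(1 + norm x) powr K * \<bar>Tay x y\<bar> \<le> (1 + norm x) powr K * (C * norm y ^ Suc k * W x)"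
        by (intro mult_left_mono C(2) True) auto
      then show "ennreal ((1 + norm x) powr K * \<bar>Tay x y\<bar>) \<le> ennreal (C * norm y ^ Suc k) * ennreal ((1 + norm x) powr K * W x)"
        using C(1) by (simp add: ennreal_mult[symmetric] mult_ac ennreal_leI)
    qed
    also have "\<dots> = ennreal (C * norm y ^ Suc k * weight_mass)"
      using C(1) weight_mass_nonneg by (subst nn_integral_cmult, measurable) (simp only: weight_mass ennreal_mult[symmetric] mult_nonneg_nonneg zero_le_power norm_ge_zero)
    also have "\<dots> \<le> ennreal (C * (2 powr K + 1) * weight_mass * psi (norm y))"
    proof (rule ennreal_leI)
      have "(C * weight_mass * norm y ^ Suc k) * 1 \<le> (C * weight_mass * norm y ^ Suc k) * (2 powr K + 1)"
        using C(1) weight_mass_nonneg by (intro mult_left_mono) auto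
      then show "C * norm y ^ Suc k * weight_mass \<le> C * (2 powr K + 1) * weight_mass * psi (norm y)"
        using True by (simp add: psi_def mult_ac)
    qed
    finally show ?thesis .
  next
    case False
    have "(\<integral>\<^sup>+x. ennreal ((1 + norm x) powr K * \<bar>Tay x y\<bar>) \<partial>lborel)
       \<le> (\<integral>\<^sup>+x. ennreal C * ennreal ((1 + norm x) powr K * W (x - y)) + ennreal (C * norm y powr K) * ennreal ((1 + norm x) powr K * W x) \<partial>lborel)"
    proof (intro nn_integral_mono)
      fix x
      have "(1 + norm x) powr K * \<bar>Tay x y\<bar> \<le> (1 + norm x) powr K * (C * (W (x - y) + norm y powr K * W x))"
        using False by (intro mult_left_mono C(3)) auto
      then show "ennreal ((1 + norm x) powr K * \<bar>Tay x y\<bar>) \<le> ennreal C * ennreal ((1 + norm x) powr K * W (x - y)) + ennreal (C * norm y powr K) * ennreal ((1 + norm x) powr K * W x)"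
        using C(1) by (simp add: ennreal_mult[symmetric] ennreal_plus[symmetric] algebra_simps ennreal_leI del: ennreal_plus)
    qed
    also have "\<dots> = ennreal C * (\<integral>\<^sup>+x. ennreal ((1 + norm x) powr K * W (x - y)) \<partial>lborel)
        + ennreal (C * norm y powr K) * (\<integral>\<^sup>+x. ennreal ((1 + norm x) powr K * W x) \<partial>lborel)"
      by (subst nn_integral_add, measurable, subst (1 2) nn_integral_cmult, measurable)
    also have "\<dots> \<le> ennreal C * ennreal ((1 + norm y) powr K * weight_mass) + ennreal (C * norm y powr K) * ennreal weight_mass"
      unfolding weight_mass by (intro add_mono mult_left_mono nn_integral_weight_W_translate) auto
    also have "\<dots> = ennreal (C * ((1 + norm y) powr K * weight_mass) + C * norm y powr K * weight_mass)"
      using C(1) weight_mass_nonneg by (simp only: ennreal_mult[symmetric] ennreal_plus[symmetric] mult_nonneg_nonneg powr_ge_zero)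
    also have "\<dots> \<le> ennreal (C * (2 powr K + 1) * weight_mass * psi (norm y))"
    proof (rule ennreal_leI)
      have "(1 + norm y) powr K \<le> (2 * norm y) powr K" using False K_nonneg by (intro powr_mono2) auto
      then have "C * weight_mass * (1 + norm y) powr K \<le> C * weight_mass * (2 powr K * norm y powr K)"
        using C(1) weight_mass_nonneg by (intro mult_left_mono) (auto simp: powr_mult)
      then show "C * ((1 + norm y) powr K * weight_mass) + C * norm y powr K * weight_mass \<le> C * (2 powr K + 1) * weight_mass * psi (norm y)"
        using False by (simp add: psi_def algebra_simps)
    qed
    finally show ?thesis .
  qed
  have le: "2 * C \<le> B" "C * (2 powr K + 1) * weight_mass \<le> B" "B \<ge> 0" unfolding B_def using C(1) weight_mass_nonneg by auto
  show ?thesis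
  proof (intro exI[of _ B] conjI allI)
    fix x y
    show "(\<integral>\<^sup>+x. ennreal ((1 + norm x) powr K * \<bar>Tay x y\<bar>) \<partial>lborel) \<le> ennreal (B * psi (norm y))"
      by (rule order_trans[OF wt]) (intro ennreal_leI mult_right_mono psi_nonneg le norm_ge_zero)
    show "\<bar>Tay x y\<bar> \<le> B * psi (norm y)"
      by (rule order_trans[OF sup]) (intro mult_right_mono psi_nonneg le norm_ge_zero)
  qed (rule le)
qed

definition tay_const :: real where
  "tay_const = (SOME C. C \<ge> 0 \<and> (\<forall>y. (\<integral>\<^sup>+x. ennreal ((1 + norm x) powr K * \<bar>Tay x y\<bar>) \<partial>lborel) \<le> ennreal (C * psi (norm y)))
    \<and> (\<forall>x y. \<bar>Tay x y\<bar> \<le> C * psi (norm y)))"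

lemma tay_const_nonneg: "tay_const \<ge> 0"
  and Tay_weight: "(\<integral>\<^sup>+x. ennreal ((1 + norm x) powr K * \<bar>Tay x y\<bar>) \<partial>lborel) \<le> ennreal (tay_const * psi (norm y))"
  and Tay_sup: "\<bar>Tay x y\<bar> \<le> tay_const * psi (norm y)"
  using someI_ex[OF Tay_weight_ex, folded tay_const_def] by auto

definition conv_const :: real where "conv_const = CB * weight_mass"

lemma conv_const_nonneg: "conv_const \<ge> 0" by (simp add: conv_const_def CB_nonneg weight_mass_nonneg)

lemma nn_integral_weight_deriv:
  assumes "length w \<le> \<gamma>"
  shows "(\<integral>\<^sup>+x. ennreal ((1 + norm x) powr K * \<bar>foldr partial_deriv w \<Gamma> x\<bar>) \<partial>lborel) \<le> ennreal conv_const"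
proof -
  have "(\<integral>\<^sup>+x. ennreal ((1 + norm x) powr K * \<bar>foldr partial_deriv w \<Gamma> x\<bar>) \<partial>lborel)
     \<le> (\<integral>\<^sup>+x. ennreal CB * ennreal ((1 + norm x) powr K * W x) \<partial>lborel)"
  proof (intro nn_integral_mono)
    fix x
    have "(1 + norm x) powr K * \<bar>foldr partial_deriv w \<Gamma> x\<bar> \<le> (1 + norm x) powr K * (CB * W x)"
      by (intro mult_left_mono decay_W assms) auto
    then show "ennreal ((1 + norm x) powr K * \<bar>foldr partial_deriv w \<Gamma> x\<bar>) \<le> ennreal CB * ennreal ((1 + norm x) powr K * W x)"
      using CB_nonneg by (simp add: ennreal_mult[symmetric] mult_ac ennreal_leI)
  qed
  also have "\<dots> = ennreal conv_const"
    by (subst nn_integral_cmult, measurable) (simp only: weight_mass conv_const_def ennreal_mult[OF CB_nonneg weight_mass_nonneg])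
  finally show ?thesis .
qed

section \<open>Dilations and scaled norms\<close>

text \<open>The weight seen at length scale \<open>r\<close>: up to constants
  \<open>1 + (|x|/r)^K\<close>. It is submultiplicative and decreases in \<open>r\<close>, the two
  properties used throughout.\<close>

definition wt :: "real \<Rightarrow> real^'n \<Rightarrow> real" where
  "wt r x = (1 + norm x / r) powr K"

lemma wt_nonneg[simp]: "wt r x \<ge> 0" by (simp add: wt_def)

lemma wt_measurable[measurable]: "wt r \<in> borel_measurable borel"
  unfolding wt_def[abs_def] by measurable

lemma wt_ge_1: "r > 0 \<Longrightarrow> wt r x \<ge> 1"
  unfolding wt_def using K_nonneg by (intro ge_one_powr_ge_zero) auto

lemma wt_antimono: "0 < \<rho> \<Longrightarrow> \<rho> \<le> r \<Longrightarrow> wt r x \<le> wt \<rho> x"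
  unfolding wt_def using K_nonneg by (intro powr_mono2 add_mono divide_left_mono) auto

lemma wt_submult: "r > 0 \<Longrightarrow> wt r x \<le> wt r (x - y) * wt r y"
  unfolding wt_def using K_nonneg norm_triangle_ineq[of "x - y" y]
  by (intro powr_one_plus_mult_le) (auto simp: add_divide_distrib[symmetric] divide_right_mono)

text \<open>The dilation that preserves the integral; the kernel at time \<open>t\<close> is the
  profile dilated by \<open>t^(1/d)\<close>.\<close>

definition dil :: "real \<Rightarrow> (real^'n \<Rightarrow> real) \<Rightarrow> real^'n \<Rightarrow> real" where
  "dil \<rho> h x = h (x /\<^sub>R \<rho>) / \<rho> ^ CARD('n)"

lemma dil_measurable[measurable (raw)]:
  assumes [measurable]: "h \<in> borel_measurable borel" "f \<in> M \<rightarrow>\<^sub>M borel"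
  shows "(\<lambda>x. dil \<rho> h (f x)) \<in> borel_measurable M"
  unfolding dil_def by measurable

lemma nn_integral_wt_dil:
  assumes [measurable]: "h \<in> borel_measurable borel" and \<rho>: "\<rho> > 0"
  shows "(\<integral>\<^sup>+x. ennreal (wt \<rho> x * \<bar>dil \<rho> h x\<bar>) \<partial>lborel) = (\<integral>\<^sup>+x. ennreal ((1 + norm x) powr K * \<bar>h x\<bar>) \<partial>lborel)"
proof -
  have "(\<integral>\<^sup>+x. ennreal (wt \<rho> x * \<bar>dil \<rho> h x\<bar>) \<partial>lborel)
     = (\<integral>\<^sup>+x. ennreal ((1 + norm (x /\<^sub>R \<rho>)) powr K * \<bar>h (x /\<^sub>R \<rho>)\<bar> / \<rho> ^ CARD('n)) \<partial>lborel)"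
    using \<rho> by (intro nn_integral_cong) (simp add: wt_def dil_def field_simps)
  also have "\<dots> = ennreal (\<rho> ^ CARD('n)) * (\<integral>\<^sup>+x. ennreal ((1 + norm x) powr K * \<bar>h x\<bar> / \<rho> ^ CARD('n)) \<partial>lborel)"
    using nn_integral_lborel_dilate[of "\<lambda>x. ennreal ((1 + norm x) powr K * \<bar>h x\<bar> / \<rho> ^ CARD('n))" \<rho>] \<rho> by simp
  also have "\<dots> = (\<integral>\<^sup>+x. ennreal (\<rho> ^ CARD('n)) * ennreal ((1 + norm x) powr K * \<bar>h x\<bar> / \<rho> ^ CARD('n)) \<partial>lborel)"
    by (intro nn_integral_cmult[symmetric]) measurable
  also have "\<dots> = (\<integral>\<^sup>+x. ennreal ((1 + norm x) powr K * \<bar>h x\<bar>) \<partial>lborel)"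
    using \<rho> by (intro nn_integral_cong) (simp flip: ennreal_mult)
  finally show ?thesis .
qed

text \<open>Submultiplicativity moves the weight from \<open>x\<close> to \<open>x - y\<close> and
  \<open>y\<close>; since the scale \<open>\<rho>\<close> of the kernel is at most \<open>r\<close>,
  the weight at \<open>x - y\<close> may be replaced by the one of scale \<open>\<rho>\<close>, and
  the dilation then disappears. The constant is uniform in both scales.\<close>

lemma dil_conv_weight:
  assumes [measurable]: "h \<in> borel_measurable borel" and \<rho>: "\<rho> > 0" "\<rho> \<le> r"
    and h: "(\<integral>\<^sup>+x. ennreal ((1 + norm x) powr K * \<bar>h x\<bar>) \<partial>lborel) \<le> ennreal C"
  shows "(\<integral>\<^sup>+x. ennreal (wt r x * \<bar>dil \<rho> h (x - y)\<bar>) \<partial>lborel) \<le> ennreal C * ennreal (wt r y)"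
proof -
  have "(\<integral>\<^sup>+x. ennreal (wt r x * \<bar>dil \<rho> h (x - y)\<bar>) \<partial>lborel)
    \<le> (\<integral>\<^sup>+x. ennreal (wt r y) * ennreal (wt \<rho> (x - y) * \<bar>dil \<rho> h (x - y)\<bar>) \<partial>lborel)"
  proof (intro nn_integral_mono)
    fix x
    have "wt r x \<le> wt r (x - y) * wt r y" using \<rho> by (intro wt_submult) auto
    also have "\<dots> \<le> wt \<rho> (x - y) * wt r y" using \<rho> by (intro mult_right_mono wt_antimono) auto
    finally have "wt r x * \<bar>dil \<rho> h (x - y)\<bar> \<le> wt \<rho> (x - y) * wt r y * \<bar>dil \<rho> h (x - y)\<bar>"
      by (intro mult_right_mono) auto
    then show "ennreal (wt r x * \<bar>dil \<rho> h (x - y)\<bar>) \<le> ennreal (wt r y) * ennreal (wt \<rho> (x - y) * \<bar>dil \<rho> h (x - y)\<bar>)"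
      by (simp add: ennreal_mult[symmetric] mult_ac ennreal_leI)
  qed
  also have "\<dots> = ennreal (wt r y) * (\<integral>\<^sup>+x. ennreal (wt \<rho> (x - y) * \<bar>dil \<rho> h (x - y)\<bar>) \<partial>lborel)"
    by (intro nn_integral_cmult) measurable
  also have "(\<integral>\<^sup>+x. ennreal (wt \<rho> (x - y) * \<bar>dil \<rho> h (x - y)\<bar>) \<partial>lborel) = (\<integral>\<^sup>+x. ennreal (wt \<rho> x * \<bar>dil \<rho> h x\<bar>) \<partial>lborel)"
    by (rule nn_integral_lborel_translate) measurable
  also have "\<dots> = (\<integral>\<^sup>+x. ennreal ((1 + norm x) powr K * \<bar>h x\<bar>) \<partial>lborel)" using \<rho> by (simp add: nn_integral_wt_dil)
  also have "ennreal (wt r y) * \<dots> \<le> ennreal (wt r y) * ennreal C" using h by (rule mult_left_mono) simp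
  finally show ?thesis by (simp only: mult.commute)
qed

lemma Gam_conv_weight:
  "0 < \<rho> \<Longrightarrow> \<rho> \<le> r \<Longrightarrow> (\<integral>\<^sup>+x. ennreal (wt r x * \<bar>dil \<rho> \<Gamma> (x - y)\<bar>) \<partial>lborel) \<le> ennreal conv_const * ennreal (wt r y)"
  using nn_integral_weight_deriv[of "[]"] by (intro dil_conv_weight) auto

lemma Gam_conv_L1:
  assumes "0 < \<rho>" shows "(\<integral>\<^sup>+y. ennreal \<bar>dil \<rho> \<Gamma> (x - y)\<bar> \<partial>lborel) \<le> ennreal conv_const"
proof -
  have "(\<integral>\<^sup>+y. ennreal \<bar>dil \<rho> \<Gamma> (x - y)\<bar> \<partial>lborel) = (\<integral>\<^sup>+y. ennreal \<bar>dil \<rho> \<Gamma> y\<bar> \<partial>lborel)"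
    by (rule nn_integral_lborel_reflect) measurable
  also have "\<dots> \<le> (\<integral>\<^sup>+y. ennreal (wt \<rho> y * \<bar>dil \<rho> \<Gamma> y\<bar>) \<partial>lborel)"
  proof (intro nn_integral_mono ennreal_leI)
    fix y show "\<bar>dil \<rho> \<Gamma> y\<bar> \<le> wt \<rho> y * \<bar>dil \<rho> \<Gamma> y\<bar>"
      using mult_right_mono[OF wt_ge_1[OF assms, of y], of "\<bar>dil \<rho> \<Gamma> y\<bar>"] by simp
  qed
  also have "\<dots> \<le> ennreal conv_const" using nn_integral_weight_deriv[of "[]"] assms by (simp add: nn_integral_wt_dil)
  finally show ?thesis .
qed

lemma Tay_dil_weight:
  assumes \<rho>: "0 < \<rho>" "\<rho> \<le> r"
  shows "(\<integral>\<^sup>+x. ennreal (wt r x * \<bar>dil \<rho> (\<lambda>x. Tay x (y /\<^sub>R \<rho>)) x\<bar>) \<partial>lborel) \<le> ennreal (tay_const * psi (norm y / \<rho>))"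
proof -
  have "(\<integral>\<^sup>+x. ennreal (wt r x * \<bar>dil \<rho> (\<lambda>x. Tay x (y /\<^sub>R \<rho>)) x\<bar>) \<partial>lborel)
    \<le> (\<integral>\<^sup>+x. ennreal (wt \<rho> x * \<bar>dil \<rho> (\<lambda>x. Tay x (y /\<^sub>R \<rho>)) x\<bar>) \<partial>lborel)"
    using \<rho> by (intro nn_integral_mono ennreal_leI mult_right_mono wt_antimono) auto
  also have "\<dots> \<le> ennreal (tay_const * psi (norm y / \<rho>))"
    using Tay_weight[of "y /\<^sub>R \<rho>"] \<rho> by (subst nn_integral_wt_dil) (auto simp: field_simps)
  finally show ?thesis .
qed

lemma Tay_dil_sup:
  assumes "0 < \<rho>"
  shows "\<bar>dil \<rho> (\<lambda>x. Tay x (y /\<^sub>R \<rho>)) x\<bar> \<le> tay_const * psi (norm y / \<rho>) / \<rho> ^ CARD('n)"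
  using Tay_sup[of "x /\<^sub>R \<rho>" "y /\<^sub>R \<rho>"] assms by (simp add: dil_def field_simps abs_mult divide_right_mono)

lemma Gam_bounded: "\<bar>\<Gamma> x\<bar> \<le> CB"
  using decay_W[of "[]" x] W_le_1[of x] CB_nonneg mult_left_mono[of "W x" 1 CB] by simp

lemma integrable_bounded_mult:
  fixes q :: "real^'n \<Rightarrow> real"
  assumes [measurable]: "h \<in> borel_measurable borel" and "integrable lborel q" "\<And>x. \<bar>h x\<bar> \<le> c"
  shows "integrable lborel (\<lambda>x. h x * q x)"
proof (rule Bochner_Integration.integrable_bound[of lborel "\<lambda>x. c * q x"])
  have [measurable]: "q \<in> borel_measurable borel" using assms(2) by auto
  show "(\<lambda>x. h x * q x) \<in> borel_measurable lborel" by measurable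
  have "\<bar>h x\<bar> \<le> \<bar>c\<bar>" for x using assms(3)[of x] by linarith
  then show "AE x in lborel. norm (h x * q x) \<le> norm (c * q x)"
    by (simp add: abs_mult mult_right_mono)
qed (use assms(2) in simp)

text \<open>The Taylor polynomial may be subtracted from the kernel because it is orthogonal to \<open>q\<close>.\<close>

lemma conv_eq_Tay_conv:
  assumes \<rho>: "\<rho> > 0"
    and q: "\<And>\<alpha>. \<alpha> \<in> mi_le K \<Longrightarrow> integrable lborel (\<lambda>y. mi_power y \<alpha> * q y)"
    and q0: "\<And>\<alpha>. \<alpha> \<in> mi_le K \<Longrightarrow> (LINT y|lborel. mi_power y \<alpha> * q y) = 0"
  shows "(LINT y|lborel. dil \<rho> \<Gamma> (x - y) * q y) = (LINT y|lborel. dil \<rho> (\<lambda>x. Tay x (y /\<^sub>R \<rho>)) x * q y)"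
proof -
  \<comment> \<open>In \<open>y\<close> the Taylor terms are combinations of monomials of order
    \<open>j <= k <= K\<close>, exactly those whose moments against \<open>q\<close> are assumed to
    vanish.\<close>
  have e: "taylor_part j \<Gamma> (x /\<^sub>R \<rho>) (y /\<^sub>R \<rho>) * q y
     = (\<Sum>w\<in>words j. (- 1 / \<rho>) ^ j * foldr partial_deriv w \<Gamma> (x /\<^sub>R \<rho>) * (mi_power y (count (mset w)) * q y))" for j y
  proof -
    have "prod_list (map (\<lambda>i. - (y /\<^sub>R \<rho>) $ i) w) = (- 1 / \<rho>) ^ length w * mi_power y (count (mset w))" for w
      unfolding prod_list_mi_power[symmetric] by (induction w) (auto simp: field_simps)
    then show ?thesis
      unfolding taylor_part_def sum_distrib_right by (intro sum.cong) (auto simp: words_def mult_ac)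
  qed
  have mem: "count (mset w) \<in> mi_le K" if "w \<in> words j" "j \<le> k" for w :: "'n list" and j
    using that k_le by (auto simp: mi_le_def mi_abs_count_word words_def)
  have i: "integrable lborel (\<lambda>y. taylor_part j \<Gamma> (x /\<^sub>R \<rho>) (y /\<^sub>R \<rho>) * q y)"
    and z: "(LINT y|lborel. taylor_part j \<Gamma> (x /\<^sub>R \<rho>) (y /\<^sub>R \<rho>) * q y) = 0" if "j \<le> k" for j
    unfolding e using mem[OF _ that] q q0
    by (auto intro!: Bochner_Integration.integrable_sum integrable_mult_right simp: Bochner_Integration.integral_sum)
  \<comment> \<open>The zero multi-index lies in \<open>mi_le K\<close>, so the moment assumption
    contains the integrability of \<open>q\<close> itself.\<close>
  have "mi_power y (\<lambda>i. 0) = 1" for y :: "real^'n" by (simp add: mi_power_def)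
  moreover have "(\<lambda>i. 0) \<in> (mi_le K :: 'n multi_index set)" using K_nonneg by (simp add: mi_le_def mi_abs_def)
  ultimately have iq: "integrable lborel q" using q[of "\<lambda>i. 0"] by simp
  have iG: "integrable lborel (\<lambda>y. \<Gamma> ((x - y) /\<^sub>R \<rho>) * q y)"
    by (rule integrable_bounded_mult[OF _ iq Gam_bounded]) measurable
  have "dil \<rho> (\<lambda>x. Tay x (y /\<^sub>R \<rho>)) x * q y = (\<Gamma> ((x - y) /\<^sub>R \<rho>) * q y - (\<Sum>j\<le>k. taylor_part j \<Gamma> (x /\<^sub>R \<rho>) (y /\<^sub>R \<rho>) * q y / fact j)) / \<rho> ^ CARD('n)" for y
    by (simp add: dil_def Tay_def sum_distrib_right scaleR_diff_right left_diff_distrib)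
  then have "(LINT y|lborel. dil \<rho> (\<lambda>x. Tay x (y /\<^sub>R \<rho>)) x * q y)
     = ((LINT y|lborel. \<Gamma> ((x - y) /\<^sub>R \<rho>) * q y) - (\<Sum>j\<le>k. (LINT y|lborel. taylor_part j \<Gamma> (x /\<^sub>R \<rho>) (y /\<^sub>R \<rho>) * q y) / fact j)) / \<rho> ^ CARD('n)"
    using i iG by (simp, subst Bochner_Integration.integral_diff) (auto simp: Bochner_Integration.integral_sum)
  also have "\<dots> = (LINT y|lborel. \<Gamma> ((x - y) /\<^sub>R \<rho>) * q y) / \<rho> ^ CARD('n)" using z by simp
  also have "\<dots> = (LINT y|lborel. dil \<rho> \<Gamma> (x - y) * q y)" by (simp add: dil_def)
  finally show ?thesis ..
qed

end


context decaying_profile begin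

text \<open>\<open>Bd r h B\<close> bounds all the norms \<open>r\<^bsup>N(1-1/q)\<^esup> \<parallel>h\<parallel>\<^sub>q\<close> and \<open>r\<^sup>-\<^sup>l |||h|||\<^sub>l\<close> (for \<open>r \<ge> 1\<close>) at once, up to constants.\<close>

definition Bd :: "real \<Rightarrow> (real^'n \<Rightarrow> real) \<Rightarrow> real \<Rightarrow> bool" where
  "Bd r h B \<longleftrightarrow> 0 \<le> B \<and> h \<in> borel_measurable lebesgue \<and>
     (AE x in lborel. \<bar>h x\<bar> \<le> B / r ^ CARD('n)) \<and>
     (\<integral>\<^sup>+x. ennreal (wt r x * \<bar>h x\<bar>) \<partial>lborel) \<le> ennreal B"

lemma Bd_nonneg: "Bd r h B \<Longrightarrow> 0 \<le> B"
  and Bd_measurable: "Bd r h B \<Longrightarrow> h \<in> borel_measurable lebesgue"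
  and Bd_AE: "Bd r h B \<Longrightarrow> AE x in lborel. \<bar>h x\<bar> \<le> B / r ^ CARD('n)"
  and Bd_nn: "Bd r h B \<Longrightarrow> (\<integral>\<^sup>+x. ennreal (wt r x * \<bar>h x\<bar>) \<partial>lborel) \<le> ennreal B"
  by (auto simp: Bd_def)

lemma Bd_mono: "Bd r h B \<Longrightarrow> B \<le> B' \<Longrightarrow> r > 0 \<Longrightarrow> Bd r h B'"
  unfolding Bd_def
  by (auto elim!: eventually_mono intro: order_trans[OF _ divide_right_mono[OF _ zero_le_power]] order_trans ennreal_leI)

lemma Bd_dominated:
  assumes v: "Bd r v B" and q: "q \<in> borel_measurable lebesgue"
    and le: "AE x in lborel. \<bar>q x\<bar> \<le> c * \<bar>v x\<bar>" and c: "c \<ge> 0" and r: "r > 0"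
  shows "Bd r q (c * B)"
  unfolding Bd_def
proof (intro conjI)
  show "AE x in lborel. \<bar>q x\<bar> \<le> c * B / r ^ CARD('n)"
    using le Bd_AE[OF v]
  proof eventually_elim
    case (elim x)
    then have "\<bar>q x\<bar> \<le> c * (B / r ^ CARD('n))" using mult_left_mono[OF elim(2) c] by simp
    then show ?case by simp
  qed
  have "(\<integral>\<^sup>+x. ennreal (wt r x * \<bar>q x\<bar>) \<partial>lborel) \<le> (\<integral>\<^sup>+x. ennreal c * ennreal (wt r x * \<bar>v x\<bar>) \<partial>lborel)"
    using le
  proof (intro nn_integral_mono_AE, eventually_elim)
    case (elim x)
    then have "wt r x * \<bar>q x\<bar> \<le> wt r x * (c * \<bar>v x\<bar>)" by (intro mult_left_mono) auto
    then show ?case using c by (simp add: ennreal_mult'[symmetric] mult_ac ennreal_leI)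
  qed
  \<comment> \<open>\<open>v\<close> is only Lebesgue measurable, so the constant is pulled out of
    the integral over the completed measure.\<close>
  also have "\<dots> = (\<integral>\<^sup>+x. ennreal c * ennreal (wt r x * \<bar>v x\<bar>) \<partial>lebesgue)" by (simp add: nn_integral_completion)
  also have "\<dots> = ennreal c * (\<integral>\<^sup>+x. ennreal (wt r x * \<bar>v x\<bar>) \<partial>lebesgue)"
  proof (rule nn_integral_cmult)
    have [measurable]: "v \<in> borel_measurable lebesgue" "wt r \<in> borel_measurable lebesgue"
      using Bd_measurable[OF v] by (auto intro: measurable_completion)
    show "(\<lambda>x. ennreal (wt r x * \<bar>v x\<bar>)) \<in> borel_measurable lebesgue" by measurable
  qed
  also have "\<dots> \<le> ennreal c * ennreal B"
    using Bd_nn[OF v] by (intro mult_left_mono) (simp_all add: nn_integral_completion)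
  also have "\<dots> = ennreal (c * B)" using c by (simp add: ennreal_mult')
  finally show "(\<integral>\<^sup>+x. ennreal (wt r x * \<bar>q x\<bar>) \<partial>lborel) \<le> ennreal (c * B)" .
qed (use q c Bd_nonneg[OF v] in auto)

lemma Bd_cmult: "Bd r v B \<Longrightarrow> r > 0 \<Longrightarrow> Bd r (\<lambda>x. c * v x) (\<bar>c\<bar> * B)"
  by (rule Bd_dominated[of r v]) (auto simp: abs_mult dest: Bd_measurable intro: borel_measurable_times)

lemma Bd_add:
  assumes u: "Bd r u a" and v: "Bd r v b" and r: "r > 0"
  shows "Bd r (\<lambda>x. u x + v x) (a + b)"
  unfolding Bd_def
proof (intro conjI)
  have [measurable]: "u \<in> borel_measurable lebesgue" "v \<in> borel_measurable lebesgue" "wt r \<in> borel_measurable lebesgue"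
    using Bd_measurable[OF v] Bd_measurable[OF u] by (auto intro: measurable_completion)
  show "(\<lambda>x. u x + v x) \<in> borel_measurable lebesgue" by measurable
  show "AE x in lborel. \<bar>u x + v x\<bar> \<le> (a + b) / r ^ CARD('n)"
    using Bd_AE[OF u] Bd_AE[OF v] by eventually_elim (simp add: add_divide_distrib)
  have "(\<integral>\<^sup>+x. ennreal (wt r x * \<bar>u x + v x\<bar>) \<partial>lborel) \<le>
     (\<integral>\<^sup>+x. ennreal (wt r x * \<bar>u x\<bar>) + ennreal (wt r x * \<bar>v x\<bar>) \<partial>lborel)"
  proof (intro nn_integral_mono)
    fix x
    have "wt r x * \<bar>u x + v x\<bar> \<le> wt r x * \<bar>u x\<bar> + wt r x * \<bar>v x\<bar>"
      using mult_left_mono[OF abs_triangle_ineq[of "u x" "v x"], of "wt r x"] by (simp add: distrib_left)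
    then show "ennreal (wt r x * \<bar>u x + v x\<bar>) \<le> ennreal (wt r x * \<bar>u x\<bar>) + ennreal (wt r x * \<bar>v x\<bar>)"
      by (simp add: ennreal_plus[symmetric] ennreal_leI del: ennreal_plus)
  qed
  also have "\<dots> = (\<integral>\<^sup>+x. ennreal (wt r x * \<bar>u x\<bar>) + ennreal (wt r x * \<bar>v x\<bar>) \<partial>lebesgue)"
    by (simp add: nn_integral_completion)
  also have "\<dots> = (\<integral>\<^sup>+x. ennreal (wt r x * \<bar>u x\<bar>) \<partial>lebesgue) + (\<integral>\<^sup>+x. ennreal (wt r x * \<bar>v x\<bar>) \<partial>lebesgue)"
    by (intro nn_integral_add) measurable
  also have "\<dots> \<le> ennreal a + ennreal b"
    using Bd_nn[OF u] Bd_nn[OF v] by (intro add_mono) (simp_all add: nn_integral_completion)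
  finally show "(\<integral>\<^sup>+x. ennreal (wt r x * \<bar>u x + v x\<bar>) \<partial>lborel) \<le> ennreal (a + b)"
    using Bd_nonneg[OF u] Bd_nonneg[OF v] by simp
qed (use Bd_nonneg[OF u] Bd_nonneg[OF v] in auto)

lemma Bd_diff: "Bd r u a \<Longrightarrow> Bd r v b \<Longrightarrow> r > 0 \<Longrightarrow> Bd r (\<lambda>x. u x - v x) (a + b)"
  using Bd_add[of r u a "\<lambda>x. (- 1) * v x" b] Bd_cmult[of r v b "-1"] by simp

lemma Bd_sum:
  assumes "finite A" "\<And>i. i \<in> A \<Longrightarrow> Bd r (u i) (a i)" "r > 0"
  shows "Bd r (\<lambda>x. \<Sum>i\<in>A. u i x) (\<Sum>i\<in>A. a i)"
  using assms
proof (induction A rule: finite_induct)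
  case empty
  then show ?case by (simp add: Bd_def)
next
  case (insert i A)
  then show ?case using Bd_add[of r "u i" "a i" "\<lambda>x. \<Sum>i\<in>A. u i x"] by simp
qed

lemma Bd_cong_AE:
  assumes "Bd r v B" "AE x in lborel. q x = v x" "r > 0"
  shows "Bd r q B"
proof -
  have "AE x in lebesgue. v x = q x" using assms(2) by (intro AE_completion) auto
  then have "q \<in> borel_measurable lebesgue"
    using borel_measurable_AE[of v q] Bd_measurable[OF assms(1)] by blast
  then show ?thesis
    using Bd_dominated[OF assms(1), of q 1] assms(3) eventually_mono[OF assms(2), of "\<lambda>x. \<bar>q x\<bar> \<le> 1 * \<bar>v x\<bar>"]
    by simp
qed

lemma Bd_dil:
  assumes r: "r > 0" and w: "length w \<le> \<gamma>"
  shows "Bd r (dil r (foldr partial_deriv w \<Gamma>)) (CB + conv_const)"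
  unfolding Bd_def
proof (intro conjI)
  have [measurable]: "foldr partial_deriv w \<Gamma> \<in> borel_measurable borel" using w by (rule deriv_measurable)
  show "dil r (foldr partial_deriv w \<Gamma>) \<in> borel_measurable lebesgue"
    by (intro measurable_completion) measurable
  have "\<bar>foldr partial_deriv w \<Gamma> x\<bar> \<le> CB + conv_const" for x
    using decay_W[OF w, of x] W_le_1[of x] CB_nonneg mult_left_mono[of "W x" 1 CB] conv_const_nonneg by simp
  then show "AE x in lborel. \<bar>dil r (foldr partial_deriv w \<Gamma>) x\<bar> \<le> (CB + conv_const) / r ^ CARD('n)"
    using r by (simp add: dil_def abs_divide divide_right_mono)
  have "(\<integral>\<^sup>+x. ennreal (wt r x * \<bar>dil r (foldr partial_deriv w \<Gamma>) x\<bar>) \<partial>lborel) \<le> ennreal conv_const"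
    using r nn_integral_weight_deriv[OF w] by (subst nn_integral_wt_dil) auto
  also have "\<dots> \<le> ennreal (CB + conv_const)" using CB_nonneg by (intro ennreal_leI) simp
  finally show "(\<integral>\<^sup>+x. ennreal (wt r x * \<bar>dil r (foldr partial_deriv w \<Gamma>) x\<bar>) \<partial>lborel) \<le> ennreal (CB + conv_const)" .
qed (use CB_nonneg conv_const_nonneg in simp)

lemma mi_power_le_wt:
  assumes "\<alpha> \<in> mi_le K" "r > 0"
  shows "\<bar>mi_power x \<alpha>\<bar> \<le> r ^ mi_abs \<alpha> * wt r x"
proof -
  have "\<bar>mi_power x \<alpha>\<bar> \<le> norm x ^ mi_abs \<alpha>" by (rule abs_mi_power_le)
  also have "\<dots> = r ^ mi_abs \<alpha> * (norm x / r) ^ mi_abs \<alpha>" using assms(2) by (simp add: power_divide)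
  also have "\<dots> \<le> r ^ mi_abs \<alpha> * (1 + norm x / r) ^ mi_abs \<alpha>"
    using assms(2) by (intro mult_left_mono power_mono) auto
  also have "(1 + norm x / r) ^ mi_abs \<alpha> = (1 + norm x / r) powr mi_abs \<alpha>"
    using assms(2) by (subst powr_realpow) (auto intro: add_pos_nonneg)
  also have "r ^ mi_abs \<alpha> * \<dots> \<le> r ^ mi_abs \<alpha> * wt r x"
    unfolding wt_def using assms by (intro mult_left_mono powr_mono) (auto simp: mi_le_def)
  finally show ?thesis .
qed

lemma Bd_moment:
  assumes h: "Bd r h B" and \<alpha>: "\<alpha> \<in> mi_le K" and r: "r > 0"
  shows "integrable lebesgue (\<lambda>x. mi_power x \<alpha> * h x)"
    and "\<bar>LINT x|lebesgue. mi_power x \<alpha> * h x\<bar> \<le> r ^ mi_abs \<alpha> * B"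
proof -
  have [measurable]: "h \<in> borel_measurable lebesgue" "(\<lambda>x. mi_power x \<alpha>) \<in> borel_measurable lebesgue"
    "wt r \<in> borel_measurable lebesgue"
    using Bd_measurable[OF h] by (auto intro: measurable_completion)
  have "(\<integral>\<^sup>+x. ennreal (norm (mi_power x \<alpha> * h x)) \<partial>lebesgue)
     \<le> (\<integral>\<^sup>+x. ennreal (r ^ mi_abs \<alpha>) * ennreal (wt r x * \<bar>h x\<bar>) \<partial>lebesgue)"
  proof (intro nn_integral_mono)
    fix x
    have "\<bar>mi_power x \<alpha>\<bar> * \<bar>h x\<bar> \<le> (r ^ mi_abs \<alpha> * wt r x) * \<bar>h x\<bar>"
      by (intro mult_right_mono mi_power_le_wt \<alpha> r) auto
    then show "ennreal (norm (mi_power x \<alpha> * h x)) \<le> ennreal (r ^ mi_abs \<alpha>) * ennreal (wt r x * \<bar>h x\<bar>)"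
      using r by (simp add: ennreal_mult'[symmetric] abs_mult mult_ac ennreal_leI)
  qed
  also have "\<dots> = ennreal (r ^ mi_abs \<alpha>) * (\<integral>\<^sup>+x. ennreal (wt r x * \<bar>h x\<bar>) \<partial>lebesgue)"
    by (intro nn_integral_cmult) measurable
  also have "\<dots> \<le> ennreal (r ^ mi_abs \<alpha>) * ennreal B"
    using Bd_nn[OF h] by (intro mult_left_mono) (simp_all add: nn_integral_completion)
  also have "\<dots> = ennreal (r ^ mi_abs \<alpha> * B)" using r Bd_nonneg[OF h] by (simp add: ennreal_mult)
  finally have le: "(\<integral>\<^sup>+x. ennreal (norm (mi_power x \<alpha> * h x)) \<partial>lebesgue) \<le> ennreal (r ^ mi_abs \<alpha> * B)" .
  then show i: "integrable lebesgue (\<lambda>x. mi_power x \<alpha> * h x)"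
    by (intro integrableI_bounded) (auto intro: order_le_less_trans)
  have "ennreal (norm (LINT x|lebesgue. mi_power x \<alpha> * h x)) \<le> ennreal (r ^ mi_abs \<alpha> * B)"
    using integral_norm_bound_ennreal[OF i] le by (rule order_trans)
  then show "\<bar>LINT x|lebesgue. mi_power x \<alpha> * h x\<bar> \<le> r ^ mi_abs \<alpha> * B"
    using r Bd_nonneg[OF h] by (simp add: ennreal_le_iff)
qed

lemma mi_power_scale: "mi_power (c *\<^sub>R x) \<alpha> = c ^ mi_abs \<alpha> * mi_power x \<alpha>"
  unfolding mi_power_def mi_abs_def by (simp add: power_mult_distrib prod.distrib power_sum)

lemma integral_moment_dil:
  assumes [measurable]: "h \<in> borel_measurable borel" and r: "r > 0"
  shows "(LINT x|lborel. mi_power x \<alpha> * dil r h x) = r ^ mi_abs \<alpha> * (LINT x|lborel. mi_power x \<alpha> * h x)"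
proof -
  have m: "(\<lambda>x. mi_power x \<alpha> * dil r h x) \<in> borel_measurable borel" by measurable
  have "(LINT x|lborel. mi_power x \<alpha> * dil r h x)
    = \<bar>r\<bar> ^ DIM(real^'n) * (LINT x|lborel. mi_power (0 + r *\<^sub>R x) \<alpha> * dil r h (0 + r *\<^sub>R x))"
    by (rule integral_lborel_affine[OF m]) (use r in simp)
  also have "\<dots> = r ^ CARD('n) * (LINT x|lborel. (r ^ mi_abs \<alpha> / r ^ CARD('n)) * (mi_power x \<alpha> * h x))"
    using r by (simp add: dil_def mi_power_scale mult_ac)
  also have "\<dots> = r ^ mi_abs \<alpha> * (LINT x|lborel. mi_power x \<alpha> * h x)"
    using r by simp
  finally show ?thesis .
qed

end

section \<open>Self-similar semigroups\<close>

locale self_similar_kernel = decaying_profile \<Gamma> \<gamma> L K CB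
  for \<Gamma> :: "real^'n::finite \<Rightarrow> real" and \<gamma> L K CB +
  fixes G :: "real^'n \<Rightarrow> real \<Rightarrow> real" and d :: real
  assumes d_pos: "d > 0"
    and G_dil: "\<And>x t. t > 0 \<Longrightarrow> G x t = dil (t powr (1 / d)) \<Gamma> x"
    and G_Ck: "\<And>t. t > 0 \<Longrightarrow> Ck_on \<gamma> (\<lambda>x. G x t) UNIV"
    and G_semigroup: "\<And>x s t. 0 < s \<Longrightarrow> s < t \<Longrightarrow> G x t = (LINT y|lebesgue. G (x - y) (t - s) * G y s)"
begin

text \<open>The natural length at time \<open>1 + t\<close>. The shift by 1 matches
  \<open>g (x, t) = G (x, t + 1)\<close> and keeps the length at least 1, so that bounds hold down
  to time 0.\<close>

definition rad :: "real \<Rightarrow> real" where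
  "rad t = (1 + t) powr (1 / d)"

lemma rad_pos: "t > -1 \<Longrightarrow> rad t > 0"
  by (simp add: rad_def)

lemma rad_ge_1: "t \<ge> 0 \<Longrightarrow> rad t \<ge> 1"
  unfolding rad_def using d_pos by (intro ge_one_powr_ge_zero) auto

lemma rad_measurable[measurable]: "rad \<in> borel_measurable borel"
  unfolding rad_def[abs_def] by measurable

lemma rad_mono: "0 \<le> s \<Longrightarrow> s \<le> t \<Longrightarrow> rad s \<le> rad t"
  unfolding rad_def using d_pos by (intro powr_mono2) auto

lemma rad_power: "t > -1 \<Longrightarrow> rad t ^ j = (1 + t) powr (real j / d)"
  by (simp add: rad_def powr_power)

lemma rad_powr: "t > -1 \<Longrightarrow> rad t powr a = (1 + t) powr (a / d)"
  by (simp add: rad_def powr_powr mult.commute)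

definition coef :: "'n multi_index \<Rightarrow> real" where
  "coef \<alpha> = (-1) ^ mi_abs \<alpha> / mi_fact \<alpha>"

lemma mi_fact_pos: "mi_fact \<alpha> > 0"
  unfolding mi_fact_def by (intro prod_pos) auto

lemma deriv_G:
  assumes t: "t > 0" and w: "length w \<le> \<gamma>"
  shows "foldr partial_deriv w (\<lambda>y. G y t) = (\<lambda>x. dil (t powr (1 / d)) (foldr partial_deriv w \<Gamma>) x / (t powr (1 / d)) ^ length w)"
proof -
  let ?r = "t powr (1 / d)"
  have "(\<lambda>y. G y t) = (\<lambda>y. (1 / ?r ^ CARD('n)) * \<Gamma> ((1 / ?r) *\<^sub>R y))"
    using t by (simp add: G_dil dil_def inverse_eq_divide)
  moreover have "Ck_on (length w) \<Gamma> UNIV" using Ck w by (rule Ck_on_antimono)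
  ultimately show ?thesis
    by (simp only: foldr_partial_deriv_dilation) (simp add: dil_def inverse_eq_divide power_divide)
qed

lemma g_fun_eq:
  assumes "t \<ge> 0" "mi_abs \<alpha> \<le> \<gamma>"
  shows "g_fun G \<alpha> x t = coef \<alpha> * dil (rad t) (foldr partial_deriv (mi_word \<alpha>) \<Gamma>) x / rad t ^ mi_abs \<alpha>"
  using deriv_G[of "t + 1" "mi_word \<alpha>"] assms
  by (simp add: g_fun_def mi_deriv_word coef_def rad_def length_mi_word add.commute)

lemma mi_le_gamma: "\<alpha> \<in> mi_le K \<Longrightarrow> mi_abs \<alpha> \<le> \<gamma>"
  using k_gamma k_gr unfolding mi_le_def mem_Collect_eq by linarith

lemma mi_word_gamma: "\<alpha> \<in> mi_le K \<Longrightarrow> length (mi_word \<alpha>) \<le> \<gamma>"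
  by (simp add: length_mi_word mi_le_gamma)

lemma g_measurable:
  assumes "t \<ge> 0" "\<alpha> \<in> mi_le K" shows "(\<lambda>x. g_fun G \<alpha> x t) \<in> borel_measurable borel"
proof -
  have [measurable]: "foldr partial_deriv (mi_word \<alpha>) \<Gamma> \<in> borel_measurable borel"
    using assms by (intro deriv_measurable mi_word_gamma)
  show ?thesis using assms by (simp add: g_fun_eq mi_le_gamma)
qed

lemma Bd_g:
  assumes "t \<ge> 0" "\<alpha> \<in> mi_le K"
  shows "Bd (rad t) (\<lambda>x. g_fun G \<alpha> x t) (\<bar>coef \<alpha>\<bar> / rad t ^ mi_abs \<alpha> * (CB + conv_const))"
proof -
  have r: "rad t > 0" using assms by (simp add: rad_pos)
  have "Bd (rad t) (\<lambda>x. coef \<alpha> / rad t ^ mi_abs \<alpha> * dil (rad t) (foldr partial_deriv (mi_word \<alpha>) \<Gamma>) x)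
     (\<bar>coef \<alpha> / rad t ^ mi_abs \<alpha>\<bar> * (CB + conv_const))"
    using assms by (intro Bd_cmult Bd_dil r mi_word_gamma)
  then show ?thesis using assms r by (simp add: g_fun_eq mi_le_gamma)
qed

definition mass :: real where "mass = (LINT x|lborel. \<Gamma> x)"

text \<open>Moments of \<open>g_\<beta>\<close> at unit scale. At time \<open>t\<close> they are
  only multiplied by a power of \<open>rad t\<close> with exponent
  \<open>|\<alpha>| - |\<beta>|\<close>, so triangularity has to be proved once, not for every
  \<open>t\<close>.\<close>

definition gmom :: "'n multi_index \<Rightarrow> 'n multi_index \<Rightarrow> real" where
  "gmom \<alpha> \<beta> = coef \<beta> * (LINT x|lborel. mi_power x \<alpha> * foldr partial_deriv (mi_word \<beta>) \<Gamma> x)"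

text \<open>The normalising factor \<open>(-1)^|\<alpha>| / \<alpha>!\<close> of
  \<open>g_\<alpha>\<close> is chosen to cancel sign and factorial produced by integrating by
  parts.\<close>

lemma gmom: assumes "\<alpha> \<in> mi_le K" "\<beta> \<in> mi_le K"
  shows "\<not> \<beta> \<le> \<alpha> \<Longrightarrow> gmom \<alpha> \<beta> = 0" "gmom \<alpha> \<alpha> = mass"
proof -
  show "\<not> \<beta> \<le> \<alpha> \<Longrightarrow> gmom \<alpha> \<beta> = 0"
    using moment_deriv_word(1)[OF assms(1) mi_word_gamma[OF assms(2)]] by (simp add: gmom_def count_mi_word)
  have "gmom \<alpha> \<alpha> = coef \<alpha> * ((-1) ^ mi_abs \<alpha> * mi_fact \<alpha> * mass)"
    using moment_deriv_word(2)[OF assms(1) mi_word_gamma[OF assms(1)]] by (simp add: gmom_def mass_def count_mi_word length_mi_word)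
  also have "\<dots> = ((-1) ^ mi_abs \<alpha> * (-1) ^ mi_abs \<alpha>) * mass"
    using mi_fact_pos[of \<alpha>] by (simp add: coef_def)
  finally show "gmom \<alpha> \<alpha> = mass" by (simp flip: power_mult_distrib)
qed

lemma moment_g:
  assumes "t \<ge> 0" "\<alpha> \<in> mi_le K" "\<beta> \<in> mi_le K"
  shows "(LINT x|lebesgue. mi_power x \<alpha> * g_fun G \<beta> x t) = rad t ^ mi_abs \<alpha> / rad t ^ mi_abs \<beta> * gmom \<alpha> \<beta>"
proof -
  have [measurable]: "(\<lambda>x. g_fun G \<beta> x t) \<in> borel_measurable borel"
    "foldr partial_deriv (mi_word \<beta>) \<Gamma> \<in> borel_measurable borel"
    using assms by (auto intro: g_measurable deriv_measurable mi_word_gamma)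
  have "(LINT x|lebesgue. mi_power x \<alpha> * g_fun G \<beta> x t) = (LINT x|lborel. mi_power x \<alpha> * g_fun G \<beta> x t)"
    by (intro integral_completion) measurable
  also have "\<dots> = (LINT x|lborel. coef \<beta> / rad t ^ mi_abs \<beta> * (mi_power x \<alpha> * dil (rad t) (foldr partial_deriv (mi_word \<beta>) \<Gamma>) x))"
    using assms by (simp add: g_fun_eq mi_le_gamma mult_ac)
  also have "\<dots> = coef \<beta> / rad t ^ mi_abs \<beta> * (rad t ^ mi_abs \<alpha> * (LINT x|lborel. mi_power x \<alpha> * foldr partial_deriv (mi_word \<beta>) \<Gamma> x))"
    using assms rad_pos[of t] by (subst integral_moment_dil[symmetric]) (auto simp: deriv_measurable mi_word_gamma)
  finally show ?thesis by (simp add: gmom_def)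
qed

lemma integrable_moment_g:
  assumes "t \<ge> 0" "\<alpha> \<in> mi_le K" "\<beta> \<in> mi_le K"
  shows "integrable lebesgue (\<lambda>x. mi_power x \<alpha> * g_fun G \<beta> x t)"
  using Bd_moment(1)[OF Bd_g[OF assms(1,3)] assms(2)] assms(1) by (simp add: rad_pos)

subsection \<open>The mass of the kernel\<close>

lemma integrable_Gam: "integrable lborel \<Gamma>"
proof -
  have "(\<lambda>i. 0) \<in> (mi_le K :: 'n multi_index set)" using K_nonneg by (simp add: mi_le_def mi_abs_def)
  from integrable_moment_deriv[OF this, of "[]"] show ?thesis by (simp add: mi_power_def)
qed

lemma integrable_dil_Gam: "a > 0 \<Longrightarrow> integrable lborel (dil a \<Gamma>)"
  using integrable_lborel_affine[OF integrable_Gam, of "inverse a" 0] unfolding dil_def[abs_def] by simp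

lemma integral_dil_Gam_shift:
  assumes [measurable]: "h \<in> borel_measurable borel" and a: "a > 0"
  shows "(LINT y|lborel. h y * dil a \<Gamma> y) = (LINT z|lborel. h (a *\<^sub>R z) * \<Gamma> z)"
proof -
  have m: "(\<lambda>y. h y * dil a \<Gamma> y) \<in> borel_measurable borel" by measurable
  have "(LINT y|lborel. h y * dil a \<Gamma> y) = \<bar>a\<bar> ^ DIM(real^'n) * (LINT z|lborel. h (0 + a *\<^sub>R z) * dil a \<Gamma> (0 + a *\<^sub>R z))"
    by (rule integral_lborel_affine[OF m]) (use a in simp)
  also have "\<dots> = a ^ CARD('n) * (LINT z|lborel. (1 / a ^ CARD('n)) * (h (a *\<^sub>R z) * \<Gamma> z))"
    using a by (simp add: dil_def mult_ac)
  also have "\<dots> = (LINT z|lborel. h (a *\<^sub>R z) * \<Gamma> z)" using a by (subst integral_mult_right_zero) simp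
  finally show ?thesis .
qed

lemma G_measurable[measurable (raw)]:
  assumes "t > 0" shows "(\<lambda>x. G x t) \<in> borel_measurable borel"
  using assms by (simp add: G_dil)

lemma Gam_continuous: "continuous_on UNIV \<Gamma>"
  using deriv_continuous[of "[]"] by simp

text \<open>Letting \<open>s \<rightarrow> 0\<close> in \<open>G(t) = G(t - s) * G(s)\<close> shows \<open>G = mass * G\<close>: a kernel of mass different from 1 vanishes.\<close>

lemma G_eq_mass_mult:
  assumes t: "t > 0" shows "G x t = G x t * mass"
proof -
  \<comment> \<open>Any null sequence below \<open>t / 2\<close> would do; the latter keeps the
    remaining time \<open>t - s n\<close> away from 0, which gives the majorant for dominated
    convergence.\<close>
  define s where "s n = t / (real n + 2)" for n :: nat
  have s: "0 < s n" "s n \<le> t / 2" "s n < t" for n using t by (auto simp: s_def field_simps intro!: add_pos_nonneg)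
  have s0: "s \<longlonglongrightarrow> 0" unfolding s_def by real_asymp
  define a where "a n = s n powr (1 / d)" for n
  define b where "b n = (t - s n) powr (1 / d)" for n
  have pos: "a n > 0" "b n > 0" "(t / 2) powr (1 / d) > 0" for n using s[of n] t by (auto simp: a_def b_def)
  have eq: "G x t = (LINT z|lborel. dil (b n) \<Gamma> (x - a n *\<^sub>R z) * \<Gamma> z)" for n
  proof -
    have "G x t = (LINT y|lebesgue. G (x - y) (t - s n) * G y (s n))"
      using G_semigroup[of "s n" t x] s[of n] by simp
    also have "\<dots> = (LINT y|lebesgue. dil (b n) \<Gamma> (x - y) * dil (a n) \<Gamma> y)"
      using s[of n] by (simp add: G_dil a_def b_def)
    also have "\<dots> = (LINT y|lborel. dil (b n) \<Gamma> (x - y) * dil (a n) \<Gamma> y)"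
      by (intro integral_completion) measurable
    \<comment> \<open>The substitution \<open>y = a n * z\<close> removes the concentrating factor:
      the small scale now sits in the argument of the continuous factor, where the limit can be
      taken pointwise.\<close>
    also have "\<dots> = (LINT z|lborel. dil (b n) \<Gamma> (x - a n *\<^sub>R z) * \<Gamma> z)"
      by (rule integral_dil_Gam_shift) (use pos in measurable)
    finally show ?thesis .
  qed
  have a0: "a \<longlonglongrightarrow> 0" unfolding a_def using s0 d_pos s(1)
    by (intro tendsto_zero_powrI[where b = "1 / d"]) (auto intro!: always_eventually less_imp_le)
  have b0: "b \<longlonglongrightarrow> t powr (1 / d)"
    unfolding b_def using t tendsto_diff[OF tendsto_const s0, of t] by (intro tendsto_powr tendsto_const) auto
  have "(\<lambda>n. LINT z|lborel. dil (b n) \<Gamma> (x - a n *\<^sub>R z) * \<Gamma> z) \<longlonglongrightarrow> (LINT z|lborel. G x t * \<Gamma> z)"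
  proof (rule integral_dominated_convergence[where w = "\<lambda>z. (CB / ((t / 2) powr (1 / d)) ^ CARD('n)) * \<bar>\<Gamma> z\<bar>"])
    show "AE z in lborel. (\<lambda>n. dil (b n) \<Gamma> (x - a n *\<^sub>R z) * \<Gamma> z) \<longlonglongrightarrow> G x t * \<Gamma> z"
    proof (rule AE_I2)
      fix z
      have bn: "t powr (1 / d) \<noteq> 0" using t by simp
      have "(\<lambda>n. (x - a n *\<^sub>R z) /\<^sub>R b n) \<longlonglongrightarrow> (x - 0 *\<^sub>R z) /\<^sub>R (t powr (1 / d))"
        by (intro tendsto_intros a0 b0 bn)
      then have "(\<lambda>n. \<Gamma> ((x - a n *\<^sub>R z) /\<^sub>R b n)) \<longlonglongrightarrow> \<Gamma> (x /\<^sub>R (t powr (1 / d)))"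
        using Gam_continuous by (auto simp: continuous_on_eq_continuous_at intro: isCont_tendsto_compose)
      then have "(\<lambda>n. \<Gamma> ((x - a n *\<^sub>R z) /\<^sub>R b n) / b n ^ CARD('n) * \<Gamma> z) \<longlonglongrightarrow> \<Gamma> (x /\<^sub>R (t powr (1 / d))) / (t powr (1 / d)) ^ CARD('n) * \<Gamma> z"
        using bn by (intro tendsto_intros b0) auto
      then show "(\<lambda>n. dil (b n) \<Gamma> (x - a n *\<^sub>R z) * \<Gamma> z) \<longlonglongrightarrow> G x t * \<Gamma> z"
        using t by (simp add: G_dil dil_def)
    qed
    have "\<bar>dil (b n) \<Gamma> y\<bar> \<le> CB / ((t / 2) powr (1 / d)) ^ CARD('n)" for n y
    proof -
      have "(t / 2) powr (1 / d) \<le> b n" unfolding b_def using s[of n] t d_pos by (intro powr_mono2) auto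
      then have "((t / 2) powr (1 / d)) ^ CARD('n) \<le> b n ^ CARD('n)" by (intro power_mono) auto
      then show ?thesis
        unfolding dil_def abs_divide using Gam_bounded[of "y /\<^sub>R b n"] pos CB_nonneg
        by (intro frac_le) auto
    qed
    then show "\<And>n. AE z in lborel. norm (dil (b n) \<Gamma> (x - a n *\<^sub>R z) * \<Gamma> z) \<le> (CB / ((t / 2) powr (1 / d)) ^ CARD('n)) * \<bar>\<Gamma> z\<bar>"
      unfolding real_norm_def abs_mult by (intro AE_I2 mult_right_mono) auto
  qed (use integrable_Gam in \<open>auto intro!: integrable_mult_right\<close>)
  then have "(\<lambda>n. G x t) \<longlonglongrightarrow> G x t * mass" by (simp add: eq[symmetric] mass_def)
  then show ?thesis using LIMSEQ_unique[OF tendsto_const] by blast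
qed

lemma mass_cases: "mass = 1 \<or> (\<forall>t>0. \<forall>x. G x t = 0)"
  using G_eq_mass_mult by force

subsection \<open>The semigroup property for derivatives of the kernel\<close>

text \<open>Induction on the word, each letter being a derivative under the integral. All
  derivatives fall on the factor at time \<open>\<sigma>\<close>, where they are bounded, while the
  factor at time \<open>\<tau>\<close> is integrable.\<close>

lemma deriv_semigroup:
  assumes \<tau>: "\<tau> > 0" and \<sigma>: "\<sigma> > 0" and w: "length w \<le> \<gamma>"
  shows "foldr partial_deriv w (\<lambda>y. G y (\<tau> + \<sigma>)) x = (LINT y|lborel. G y \<tau> * foldr partial_deriv w (\<lambda>y. G y \<sigma>) (x - y))"
  using w
proof (induction w arbitrary: x)
  case Nil
  have "G x (\<tau> + \<sigma>) = (LINT y|lebesgue. G (x - y) \<tau> * G y \<sigma>)"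
    using G_semigroup[of \<sigma> "\<tau> + \<sigma>" x] \<tau> \<sigma> by simp
  also have "\<dots> = (LINT y|lborel. G (x - y) \<tau> * G y \<sigma>)"
    using \<tau> \<sigma> by (intro integral_completion) (simp add: G_dil)
  \<comment> \<open>Reflection, so that \<open>x\<close> occurs only in the factor that is going to
    be differentiated.\<close>
  also have "\<dots> = (LINT y|lborel. G y \<tau> * G (x - y) \<sigma>)"
    using integral_lborel_affine[of "\<lambda>y. G (x - y) \<tau> * G y \<sigma>" "-1" x] \<tau> \<sigma> by (simp add: G_dil)
  finally show ?case by simp
next
  case (Cons i w)
  let ?e = "axis i 1 :: real^'n"
  define D where "D = foldr partial_deriv w (\<lambda>y. G y \<sigma>)"
  define D' where "D' = foldr partial_deriv (i # w) (\<lambda>y. G y \<sigma>)"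
  have wg: "length w \<le> \<gamma>" using Cons.prems by simp
  let ?b = "\<sigma> powr (1 / d)"
  have Deq: "D = (\<lambda>x. dil ?b (foldr partial_deriv w \<Gamma>) x / ?b ^ length w)"
    "D' = (\<lambda>x. dil ?b (foldr partial_deriv (i # w) \<Gamma>) x / ?b ^ length (i # w))"
    unfolding D_def D'_def using deriv_G[OF \<sigma> wg] deriv_G[OF \<sigma> Cons.prems] by auto
  have [measurable]: "foldr partial_deriv w \<Gamma> \<in> borel_measurable borel" "foldr partial_deriv (i # w) \<Gamma> \<in> borel_measurable borel"
    "(\<lambda>y. G y \<tau>) \<in> borel_measurable borel"
    using deriv_measurable[OF wg] deriv_measurable[OF Cons.prems] G_measurable[OF \<tau>] by auto
  have [measurable]: "D \<in> borel_measurable borel" "D' \<in> borel_measurable borel" unfolding Deq by measurable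
  have bb: "?b > 0" using \<sigma> by simp
  have bound: "\<bar>dil ?b (foldr partial_deriv v \<Gamma>) z / ?b ^ length v\<bar> \<le> CB / ?b ^ CARD('n) / ?b ^ length v" if "length v \<le> \<gamma>" for v z
  proof -
    have "\<bar>foldr partial_deriv v \<Gamma> (z /\<^sub>R ?b)\<bar> \<le> CB"
      using decay_W[OF that, of "z /\<^sub>R ?b"] W_le_1[of "z /\<^sub>R ?b"] CB_nonneg mult_left_mono[of "W (z /\<^sub>R ?b)" 1 CB] by simp
    then show ?thesis unfolding dil_def abs_divide using bb by (simp add: divide_right_mono)
  qed
  define B where "B = CB / ?b ^ CARD('n) / ?b ^ length (i # w)"
  have bD: "\<bar>D z\<bar> \<le> CB / ?b ^ CARD('n) / ?b ^ length w" and bD': "\<bar>D' z\<bar> \<le> B" for z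
    unfolding Deq B_def using bound[OF wg] bound[OF Cons.prems] by auto
  have CkG: "Ck_on (Suc 0) (foldr partial_deriv w (\<lambda>y. G y t)) UNIV" if "t > 0" for t
  proof -
    show ?thesis
      using G_Ck[OF that] Ck_on_foldr_partial_deriv[of w "Suc 0" "\<lambda>y. G y t"] Ck_on_antimono[of \<gamma> "\<lambda>y. G y t" UNIV "length w + Suc 0"] Cons.prems by simp
  qed
  have iG: "integrable lborel (\<lambda>y. G y \<tau>)"
    using integrable_dil_Gam[of "\<tau> powr (1 / d)"] \<tau> by (simp add: G_dil)
  have "((\<lambda>s. LINT y|lborel. G y \<tau> * D (x - y + s *\<^sub>R ?e)) has_real_derivative
      (LINT y|lborel. G y \<tau> * D' (x - y + 0 *\<^sub>R ?e))) (at 0)"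
  proof (rule DERIV_integral[where w = "\<lambda>y. B * \<bar>G y \<tau>\<bar>"])
    fix s :: real
    have "integrable lborel (\<lambda>y. D (x - y + s *\<^sub>R ?e) * G y \<tau>)"
      by (rule integrable_bounded_mult[OF _ iG bD]) measurable
    then show "integrable lborel (\<lambda>y. G y \<tau> * D (x - y + s *\<^sub>R ?e))" by (simp add: mult.commute)
    fix y
    show "((\<lambda>s. G y \<tau> * D (x - y + s *\<^sub>R ?e)) has_real_derivative G y \<tau> * D' (x - y + s *\<^sub>R ?e)) (at s)"
      unfolding D_def D'_def using DERIV_partial_axis[OF CkG[OF \<sigma>], of "x - y" i s] by (intro DERIV_cmult) simp
    show "\<bar>G y \<tau> * D' (x - y + s *\<^sub>R ?e)\<bar> \<le> B * \<bar>G y \<tau>\<bar>"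
      using mult_right_mono[OF bD'[of "x - y + s *\<^sub>R ?e"], of "\<bar>G y \<tau>\<bar>"] by (simp add: abs_mult mult.commute)
  qed (use iG in \<open>auto intro!: integrable_mult_right\<close>)
  moreover have "(LINT y|lborel. G y \<tau> * D (x - y + s *\<^sub>R ?e)) = foldr partial_deriv w (\<lambda>y. G y (\<tau> + \<sigma>)) (x + s *\<^sub>R ?e)" for s
    using Cons.IH[OF wg, of "x + s *\<^sub>R ?e"] by (simp add: D_def algebra_simps)
  moreover have "((\<lambda>s. foldr partial_deriv w (\<lambda>y. G y (\<tau> + \<sigma>)) (x + s *\<^sub>R ?e)) has_real_derivative
     foldr partial_deriv (i # w) (\<lambda>y. G y (\<tau> + \<sigma>)) (x + 0 *\<^sub>R ?e)) (at 0)"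
    using DERIV_partial_axis[OF CkG[of "\<tau> + \<sigma>"], of x i 0] \<tau> \<sigma> by simp
  ultimately show ?case using DERIV_unique by (fastforce simp: D'_def)
qed

text \<open>The semigroup law for derivatives at the times \<open>t - s\<close> and
  \<open>s + 1\<close>; thanks to the shift in \<open>g\<close> the second time is positive even for
  \<open>s = 0\<close>, which serves the initial value.\<close>

lemma semigroup_g:
  assumes "0 \<le> s" "s < t" "\<alpha> \<in> mi_le K"
  shows "(LINT y|lborel. G (x - y) (t - s) * g_fun G \<alpha> y s) = g_fun G \<alpha> x t"
proof -
  have "mi_deriv \<alpha> (\<lambda>y. G y (t + 1)) x = (LINT y|lborel. G y (t - s) * mi_deriv \<alpha> (\<lambda>y. G y (s + 1)) (x - y))"
    using deriv_semigroup[of "t - s" "s + 1" "mi_word \<alpha>" x] assms by (simp add: mi_word_gamma mi_deriv_word)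
  then have "g_fun G \<alpha> x t = (LINT y|lborel. (-1) ^ mi_abs \<alpha> / mi_fact \<alpha> * (G y (t - s) * mi_deriv \<alpha> (\<lambda>y. G y (s + 1)) (x - y)))"
    by (simp only: g_fun_def integral_mult_right_zero)
  then have "g_fun G \<alpha> x t = (LINT y|lborel. G y (t - s) * g_fun G \<alpha> (x - y) s)"
    by (simp only: g_fun_def mult.left_commute)
  also have "\<dots> = (LINT y|lborel. G (x - y) (t - s) * g_fun G \<alpha> y s)"
  proof -
    have [measurable]: "(\<lambda>y. G y (t - s)) \<in> borel_measurable borel" "(\<lambda>y. g_fun G \<alpha> y s) \<in> borel_measurable borel"
      using assms by (auto intro: G_measurable g_measurable)
    show ?thesis using integral_lborel_affine[of "\<lambda>y. G y (t - s) * g_fun G \<alpha> (x - y) s" "-1" x] by simp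
  qed
  finally show ?thesis ..
qed

end


section \<open>Passage to Borel representatives\<close>

text \<open>The notions of the theorem integrate over the completed measure, whereas Fubini
  arguments are carried out on Borel functions; every transfer between the two goes through this
  lemma.\<close>

lemma lebesgue_integral_cong_lborel:
  fixes f F :: "'a::euclidean_space \<Rightarrow> real"
  assumes F: "F \<in> borel_measurable borel" and ae: "AE x in lborel. f x = F x"
  shows "f \<in> borel_measurable lebesgue"
    and "(LINT x|lebesgue. f x) = (LINT x|lborel. F x)"
    and "integrable lebesgue f \<longleftrightarrow> integrable lborel F"
proof -
  have F': "F \<in> borel_measurable lebesgue" using F by (intro measurable_completion) simp
  have ae': "AE x in lebesgue. f x = F x" using ae by (rule AE_completion)
  then have "AE x in lebesgue. F x = f x" by (auto elim: eventually_mono)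
  with F' show f: "f \<in> borel_measurable lebesgue" by (rule borel_measurable_AE)
  have "(LINT x|lebesgue. f x) = (LINT x|lebesgue. F x)" by (rule integral_cong_AE[OF f F' ae'])
  also have "\<dots> = (LINT x|lborel. F x)" using F by (intro integral_completion) simp
  finally show "(LINT x|lebesgue. f x) = (LINT x|lborel. F x)" .
  have "integrable lebesgue f \<longleftrightarrow> integrable lebesgue F" by (rule integrable_cong_AE[OF f F' ae'])
  also have "\<dots> \<longleftrightarrow> integrable lborel F" using F by (intro integrable_completion) simp
  finally show "integrable lebesgue f \<longleftrightarrow> integrable lborel F" .
qed

text \<open>\<open>P\<close> is arbitrary, so the exceptional set is first enlarged to a Borel null
  set of the product; for that set the order of the two almost-everywhere quantifiers may be
  exchanged.\<close>

lemma AE_lborel_pair_swap: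
  fixes P :: "'a::euclidean_space \<Rightarrow> 'b::euclidean_space \<Rightarrow> bool"
  assumes "AE z in lborel. P (fst z) (snd z)"
  shows "AE s in lborel. AE y in lborel. P y s"
proof -
  from assms obtain N where N: "{z \<in> space lborel. \<not> P (fst z) (snd z)} \<subseteq> N" "emeasure lborel N = 0" "N \<in> sets lborel"
    by (rule AE_E)
  have NP: "P y s" if "(y, s) \<notin> N" for y s using N(1) that by force
  have sN: "N \<in> sets (lborel \<Otimes>\<^sub>M lborel)" using N(3) by (simp only: lborel_prod)
  have "AE z in lborel \<Otimes>\<^sub>M lborel. (fst z, snd z) \<notin> N"
  proof (rule AE_I[where N = N])
    show "emeasure (lborel \<Otimes>\<^sub>M lborel) N = 0" using N(2) by (simp only: lborel_prod)
  qed (use sN in auto)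
  then have "AE y in lborel. AE s in lborel. (y, s) \<notin> N"
    using lborel_pair.AE_pair[of "\<lambda>z. (fst z, snd z) \<notin> N"] by simp
  then have "AE s in lborel. AE y in lborel. (y, s) \<notin> N"
  proof (subst lborel_pair.AE_commute[symmetric])
    have "{z \<in> space (lborel \<Otimes>\<^sub>M lborel). (fst z, snd z) \<notin> N} = space (lborel \<Otimes>\<^sub>M lborel) - N" by auto
    then show "{z \<in> space (lborel \<Otimes>\<^sub>M lborel). (fst z, snd z) \<notin> N} \<in> sets (lborel \<Otimes>\<^sub>M lborel)"
      using sN by (simp only: sets.compl_sets)
  qed
  then show ?thesis
    by (rule eventually_mono) (rule eventually_mono, assumption, rule NP)
qed

context self_similar_kernel begin

section \<open>Moments and the projection\<close>

lemma moment_cong: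
  assumes "\<And>\<beta>. \<beta> \<le> \<alpha> \<Longrightarrow> (LINT x|lebesgue. mi_power x \<beta> * h x) = (LINT x|lebesgue. mi_power x \<beta> * h' x)"
  shows "moment G \<alpha> h t = moment G \<alpha> h' t"
  using assms
proof (induction \<alpha> rule: measure_induct_rule[where f = mi_abs])
  case (less \<alpha>)
  have "moment G \<beta> h t = moment G \<beta> h' t" if "\<beta> \<le> \<alpha>" "\<beta> \<noteq> \<alpha>" for \<beta>
    using that less by (intro less.IH mi_abs_strict_mono) (auto intro: order_trans)
  then show ?case using less.prems[of \<alpha>] by (subst (1 2) moment.simps) (auto intro!: sum.cong)
qed

lemma moment_diff:
  assumes "\<And>\<beta>. \<beta> \<le> \<alpha> \<Longrightarrow> integrable lebesgue (\<lambda>x. mi_power x \<beta> * h x)"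
    "\<And>\<beta>. \<beta> \<le> \<alpha> \<Longrightarrow> integrable lebesgue (\<lambda>x. mi_power x \<beta> * h' x)"
  shows "moment G \<alpha> (\<lambda>x. h x - h' x) t = moment G \<alpha> h t - moment G \<alpha> h' t"
  using assms
proof (induction \<alpha> rule: measure_induct_rule[where f = mi_abs])
  case (less \<alpha>)
  have "moment G \<beta> (\<lambda>x. h x - h' x) t = moment G \<beta> h t - moment G \<beta> h' t" if "\<beta> \<le> \<alpha>" "\<beta> \<noteq> \<alpha>" for \<beta>
    using that less by (intro less.IH mi_abs_strict_mono) (auto intro: order_trans)
  then show ?case using less.prems(1)[of \<alpha>] less.prems(2)[of \<alpha>]
    by (subst (1 2 3) moment.simps)
       (simp add: right_diff_distrib left_diff_distrib sum_subtractf)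
qed

text \<open>Induction along the recursion: a lower moment contributes \<open>rad t\<close> to the
  power \<open>|\<beta>|\<close>, and the moment of \<open>g_\<beta>\<close> it is multiplied with
  the power \<open>|\<alpha>| - |\<beta>|\<close>, so every term has the same growth.\<close>

lemma moment_bound_ex:
  "\<alpha> \<in> mi_le K \<Longrightarrow> \<exists>C\<ge>0. \<forall>t\<ge>0. \<forall>h B. Bd (rad t) h B \<longrightarrow> \<bar>moment G \<alpha> h t\<bar> \<le> C * rad t ^ mi_abs \<alpha> * B"
proof (induction \<alpha> rule: measure_induct_rule[where f = mi_abs])
  case (less \<alpha>)
  let ?S = "{\<beta>. \<beta> \<le> \<alpha> \<and> \<beta> \<noteq> \<alpha>}"
  have "\<forall>\<beta>\<in>?S. \<exists>C\<ge>0. \<forall>t\<ge>0. \<forall>h B. Bd (rad t) h B \<longrightarrow> \<bar>moment G \<beta> h t\<bar> \<le> C * rad t ^ mi_abs \<beta> * B"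
  proof
    fix \<beta> assume b: "\<beta> \<in> ?S"
    show "\<exists>C\<ge>0. \<forall>t\<ge>0. \<forall>h B. Bd (rad t) h B \<longrightarrow> \<bar>moment G \<beta> h t\<bar> \<le> C * rad t ^ mi_abs \<beta> * B"
      by (rule less.IH[OF mi_abs_strict_mono mi_le_downward[OF less.prems]]) (use b in simp_all)
  qed
  from bchoice[OF this] obtain C where C': "\<forall>\<beta>\<in>?S. 0 \<le> C \<beta> \<and> (\<forall>t\<ge>0. \<forall>h B. Bd (rad t) h B \<longrightarrow> \<bar>moment G \<beta> h t\<bar> \<le> C \<beta> * rad t ^ mi_abs \<beta> * B)"
    by blast
  have C: "\<And>\<beta>. \<beta> \<in> ?S \<Longrightarrow> C \<beta> \<ge> 0"
    "\<And>\<beta> t h B. \<beta> \<in> ?S \<Longrightarrow> t \<ge> 0 \<Longrightarrow> Bd (rad t) h B \<Longrightarrow> \<bar>moment G \<beta> h t\<bar> \<le> C \<beta> * rad t ^ mi_abs \<beta> * B"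
    using C' by blast+
  show ?case
  proof (intro exI[of _ "1 + (\<Sum>\<beta>\<in>?S. C \<beta> * \<bar>gmom \<alpha> \<beta>\<bar>)"] conjI allI impI)
    show "0 \<le> 1 + (\<Sum>\<beta>\<in>?S. C \<beta> * \<bar>gmom \<alpha> \<beta>\<bar>)" using C(1) by (intro add_nonneg_nonneg sum_nonneg) auto
    fix t h B assume t: "0 \<le> (t::real)" and h: "Bd (rad t) h B"
    have r: "rad t > 0" using t by (simp add: rad_pos)
    have "\<bar>moment G \<beta> h t * (LINT x|lebesgue. mi_power x \<alpha> * g_fun G \<beta> x t)\<bar> \<le> C \<beta> * \<bar>gmom \<alpha> \<beta>\<bar> * (rad t ^ mi_abs \<alpha> * B)" if "\<beta> \<in> ?S" for \<beta>
    proof -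
      have b: "\<beta> \<in> mi_le K" using that less.prems by (auto intro: mi_le_downward)
      have "\<bar>moment G \<beta> h t * (LINT x|lebesgue. mi_power x \<alpha> * g_fun G \<beta> x t)\<bar>
        \<le> (C \<beta> * rad t ^ mi_abs \<beta> * B) * (rad t ^ mi_abs \<alpha> / rad t ^ mi_abs \<beta> * \<bar>gmom \<alpha> \<beta>\<bar>)"
        unfolding abs_mult moment_g[OF t less.prems b] using r
        by (intro mult_mono C(2)[OF that t h]) (auto intro!: mult_nonneg_nonneg C(1)[OF that] Bd_nonneg[OF h])
      then show ?thesis using r by (simp add: field_simps)
    qed
    then have "\<bar>moment G \<alpha> h t\<bar> \<le> rad t ^ mi_abs \<alpha> * B + (\<Sum>\<beta>\<in>?S. C \<beta> * \<bar>gmom \<alpha> \<beta>\<bar> * (rad t ^ mi_abs \<alpha> * B))"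
      using Bd_moment(2)[OF h less.prems r]
      by (subst moment.simps) (intro order_trans[OF abs_triangle_ineq4] add_mono order_trans[OF sum_abs] sum_mono, auto)
    then show "\<bar>moment G \<alpha> h t\<bar> \<le> (1 + (\<Sum>\<beta>\<in>?S. C \<beta> * \<bar>gmom \<alpha> \<beta>\<bar>)) * rad t ^ mi_abs \<alpha> * B"
      by (simp only: sum_distrib_right[symmetric]) (simp only: distrib_right mult_1_left mult.assoc)
  qed
qed

lemma moment_bound_uniform:
  "\<exists>C\<ge>0. \<forall>\<alpha>\<in>mi_le K. \<forall>t\<ge>0. \<forall>h B. Bd (rad t) h B \<longrightarrow> \<bar>moment G \<alpha> h t\<bar> \<le> C * rad t ^ mi_abs \<alpha> * B"
proof -
  have "\<forall>\<alpha>\<in>mi_le K. \<exists>C\<ge>0. \<forall>t\<ge>0. \<forall>h B. Bd (rad t) h B \<longrightarrow> \<bar>moment G \<alpha> h t\<bar> \<le> C * rad t ^ mi_abs \<alpha> * B"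
    using moment_bound_ex by blast
  from bchoice[OF this] obtain C where C': "\<forall>\<alpha>\<in>mi_le K. 0 \<le> C \<alpha> \<and> (\<forall>t\<ge>0. \<forall>h B. Bd (rad t) h B \<longrightarrow> \<bar>moment G \<alpha> h t\<bar> \<le> C \<alpha> * rad t ^ mi_abs \<alpha> * B)"
    by blast
  have C: "\<And>\<alpha>. \<alpha> \<in> mi_le K \<Longrightarrow> C \<alpha> \<ge> 0"
    "\<And>\<alpha> t h B. \<alpha> \<in> mi_le K \<Longrightarrow> t \<ge> 0 \<Longrightarrow> Bd (rad t) h B \<Longrightarrow> \<bar>moment G \<alpha> h t\<bar> \<le> C \<alpha> * rad t ^ mi_abs \<alpha> * B"
    using C' by blast+
  show ?thesis
  proof (intro exI[of _ "\<Sum>\<alpha>\<in>mi_le K. C \<alpha>"] conjI ballI allI impI)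
    fix \<alpha> :: "'n multi_index" and t h B assume a: "\<alpha> \<in> mi_le K" "0 \<le> (t::real)" "Bd (rad t) h B"
    have "C \<alpha> \<le> (\<Sum>\<alpha>\<in>mi_le K. C \<alpha>)" using C(1) a by (intro member_le_sum) auto
    then have "C \<alpha> * (rad t ^ mi_abs \<alpha> * B) \<le> (\<Sum>\<alpha>\<in>mi_le K. C \<alpha>) * (rad t ^ mi_abs \<alpha> * B)"
      using rad_pos[of t] a Bd_nonneg[OF a(3)] by (intro mult_right_mono) auto
    then show "\<bar>moment G \<alpha> h t\<bar> \<le> (\<Sum>\<alpha>\<in>mi_le K. C \<alpha>) * rad t ^ mi_abs \<alpha> * B"
      using C(2)[OF a] by (simp add: mult.assoc)
  qed (use C(1) in \<open>auto intro: sum_nonneg\<close>)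
qed

definition moment_const :: real where
  "moment_const = (SOME C. C \<ge> 0 \<and> (\<forall>\<alpha>\<in>mi_le K. \<forall>t\<ge>0. \<forall>h B. Bd (rad t) h B \<longrightarrow> \<bar>moment G \<alpha> h t\<bar> \<le> C * rad t ^ mi_abs \<alpha> * B))"

lemma moment_const_nonneg: "moment_const \<ge> 0"
  and moment_bound: "\<alpha> \<in> mi_le K \<Longrightarrow> t \<ge> 0 \<Longrightarrow> Bd (rad t) h B \<Longrightarrow> \<bar>moment G \<alpha> h t\<bar> \<le> moment_const * rad t ^ mi_abs \<alpha> * B"
  using someI_ex[OF moment_bound_uniform, folded moment_const_def] by auto

definition proj_const :: real where "proj_const = 1 + (\<Sum>\<alpha>\<in>mi_le K. moment_const * \<bar>coef \<alpha>\<bar> * (CB + conv_const))"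

lemma proj_const_nonneg: "proj_const \<ge> 0"
  unfolding proj_const_def using moment_const_nonneg CB_nonneg conv_const_nonneg by (intro add_nonneg_nonneg sum_nonneg) auto

text \<open>The growth of the moment \<open>M_\<alpha>\<close> and the decay of
  \<open>g_\<alpha>\<close> are inverse powers of the scale, so subtracting the projection costs a
  constant independent of time.\<close>

lemma Bd_proj:
  assumes t: "t \<ge> 0" and h: "Bd (rad t) h B"
  shows "Bd (rad t) (proj_P G K t h) (proj_const * B)"
proof -
  have r: "rad t > 0" using t by (simp add: rad_pos)
  have "Bd (rad t) (\<lambda>x. moment G \<alpha> h t * g_fun G \<alpha> x t) (moment_const * \<bar>coef \<alpha>\<bar> * (CB + conv_const) * B)" if a: "\<alpha> \<in> mi_le K" for \<alpha>
  proof (rule Bd_mono[OF Bd_cmult[OF Bd_g[OF t a] r] _ r])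
    have "\<bar>moment G \<alpha> h t\<bar> * (\<bar>coef \<alpha>\<bar> / rad t ^ mi_abs \<alpha> * (CB + conv_const)) \<le> (moment_const * rad t ^ mi_abs \<alpha> * B) * (\<bar>coef \<alpha>\<bar> / rad t ^ mi_abs \<alpha> * (CB + conv_const))"
      using r CB_nonneg conv_const_nonneg by (intro mult_right_mono moment_bound a t h) auto
    also have "\<dots> = moment_const * \<bar>coef \<alpha>\<bar> * (CB + conv_const) * B" using r by simp
    finally show "\<bar>moment G \<alpha> h t\<bar> * (\<bar>coef \<alpha>\<bar> / rad t ^ mi_abs \<alpha> * (CB + conv_const)) \<le> moment_const * \<bar>coef \<alpha>\<bar> * (CB + conv_const) * B" .
  qed
  from Bd_diff[OF h Bd_sum[OF finite_mi_le this r] r]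
  show ?thesis unfolding proj_P_def proj_const_def by (simp add: sum_distrib_right distrib_right)
qed

text \<open>The recursion defining the moments makes the system \<open>\<integral>x\<^sup>\<alpha> g\<^sub>\<beta> = 0\<close> unless \<open>\<beta> \<le> \<alpha>\<close> triangular with diagonal 1.\<close>

lemma proj_moment_zero:
  assumes m: "mass = 1" and t: "t \<ge> 0" and h: "Bd (rad t) h B" and a: "\<alpha> \<in> mi_le K"
  shows "(LINT x|lebesgue. mi_power x \<alpha> * proj_P G K t h x) = 0"
proof -
  have r: "rad t > 0" using t by (simp add: rad_pos)
  let ?M = "\<lambda>\<beta>. moment G \<beta> h t * (LINT x|lebesgue. mi_power x \<alpha> * g_fun G \<beta> x t)"
  have "(LINT x|lebesgue. mi_power x \<alpha> * proj_P G K t h x)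
     = (LINT x|lebesgue. mi_power x \<alpha> * h x - (\<Sum>\<beta>\<in>mi_le K. moment G \<beta> h t * (mi_power x \<alpha> * g_fun G \<beta> x t)))"
    by (simp add: proj_P_def right_diff_distrib sum_distrib_left mult.left_commute)
  also have "\<dots> = (LINT x|lebesgue. mi_power x \<alpha> * h x) - (\<Sum>\<beta>\<in>mi_le K. ?M \<beta>)"
    using Bd_moment(1)[OF h a r] integrable_moment_g[OF t a]
    by (subst Bochner_Integration.integral_diff)
       (auto simp: Bochner_Integration.integral_sum)
  also have "(\<Sum>\<beta>\<in>mi_le K. ?M \<beta>) = ?M \<alpha> + (\<Sum>\<beta>\<in>mi_le K - {\<alpha>}. ?M \<beta>)"
    using a by (intro sum.remove) auto
  also have "(\<Sum>\<beta>\<in>mi_le K - {\<alpha>}. ?M \<beta>) = (\<Sum>\<beta> | \<beta> \<le> \<alpha> \<and> \<beta> \<noteq> \<alpha>. ?M \<beta>)"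
    using a gmom(1)[OF a] t by (intro sum.mono_neutral_right) (auto simp: moment_g intro: mi_le_downward)
  also have "?M \<alpha> = moment G \<alpha> h t"
    using moment_g[OF t a a] gmom(2)[OF a a] m r by simp
  also have "moment G \<alpha> h t = (LINT x|lebesgue. mi_power x \<alpha> * h x) - (\<Sum>\<beta> | \<beta> \<le> \<alpha> \<and> \<beta> \<noteq> \<alpha>. ?M \<beta>)"
    by (rule moment.simps)
  finally show ?thesis by simp
qed

section \<open>Admissible sources\<close>

text \<open>\<open>a\<close> is the surplus of the decay over the borderline rate \<open>1/s\<close>
  of time integrability. The bound is demanded at every positive time, which avoids exceptional
  times in the estimates.\<close>

definition borel_src :: "real \<Rightarrow> real \<Rightarrow> ((real^'n) \<times> real \<Rightarrow> real) \<Rightarrow> bool" where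
  "borel_src C a H \<longleftrightarrow> C \<ge> 0 \<and> H \<in> borel_measurable (borel \<Otimes>\<^sub>M borel) \<and>
     (\<forall>s>0. Bd (rad s) (\<lambda>y. H (y, s)) (C * (1 + s) powr (-1 - a)))"

text \<open>\<open>f\<close> is only Lebesgue measurable in space-time, so its time slices need not be measurable for a null set of times.
  It is therefore replaced by a Borel function.\<close>

definition rep :: "(real^'n \<Rightarrow> real \<Rightarrow> real) \<Rightarrow> ((real^'n) \<times> real \<Rightarrow> real) \<Rightarrow> bool" where
  "rep h H \<longleftrightarrow> (AE s in lborel. s > 0 \<longrightarrow> (AE y in lborel. h y s = H (y, s)))"

lemma borel_srcD:
  assumes "borel_src C a H"
  shows "C \<ge> 0" "H \<in> borel_measurable (borel \<Otimes>\<^sub>M borel)" "\<And>s. s > 0 \<Longrightarrow> Bd (rad s) (\<lambda>y. H (y, s)) (C * (1 + s) powr (-1 - a))"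
  using assms by (auto simp: borel_src_def)

lemma ex_src:
  fixes h :: "real^'n \<Rightarrow> real \<Rightarrow> real"
  assumes m: "(\<lambda>(x, t). h x t) \<in> borel_measurable spacetime" and C: "C \<ge> 0"
    and dom: "\<And>s. s > 0 \<Longrightarrow> \<exists>v. Bd (rad s) v (C * (1 + s) powr (-1 - a)) \<and> (AE y in lborel. \<bar>h y s\<bar> \<le> \<bar>v y\<bar>)"
  obtains H where "borel_src C a H" "rep h H"
proof -
  \<comment> \<open>Extension by 0 to nonpositive times, to obtain a Borel representative on the
    whole product space.\<close>
  define w where "w z = (if z \<in> UNIV \<times> {0<..} then h (fst z) (snd z) else 0)" for z :: "(real^'n) \<times> real"
  have S: "UNIV \<times> {0<..} \<in> sets (lebesgue :: ((real^'n) \<times> real) measure)"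
    by (intro sets_completionI_sets) (simp add: open_Times)
  have "w \<in> borel_measurable lebesgue"
    using m S unfolding w_def[abs_def] case_prod_unfold by (subst borel_measurable_if) auto
  then obtain H where H: "H \<in> borel_measurable lborel" "AE z in lborel. w z = H z"
    using completion_ex_borel_measurable_real by blast
  have Hm[measurable]: "H \<in> borel_measurable (borel \<Otimes>\<^sub>M borel)" using H(1) by (simp add: borel_prod)
  have "AE s in lborel. AE y in lborel. w (y, s) = H (y, s)"
    using AE_lborel_pair_swap[of "\<lambda>y s. w (y, s) = H (y, s)"] H(2) by simp
  then obtain N where N: "{s \<in> space lborel. \<not> (AE y in lborel. w (y, s) = H (y, s))} \<subseteq> N" "emeasure lborel N = 0" "N \<in> sets lborel"
    by (rule AE_E)
  have [measurable]: "N \<in> sets borel" using N(3) by simp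
  \<comment> \<open>Slices at the exceptional times need not satisfy the bound; setting them to 0
    makes it hold at all times and stays within the almost-everywhere class.\<close>
  define H' where "H' z = (if snd z \<in> N then 0 else H z)" for z
  have H'm: "H' \<in> borel_measurable (borel \<Otimes>\<^sub>M borel)" unfolding H'_def[abs_def] by measurable
  have good: "AE y in lborel. h y s = H (y, s)" if "s > 0" "s \<notin> N" for s
  proof -
    from that(2) N(1) have "AE y in lborel. w (y, s) = H (y, s)" by auto
    then show ?thesis using that(1) by (simp add: w_def)
  qed
  have "Bd (rad s) (\<lambda>y. H' (y, s)) (C * (1 + s) powr (-1 - a))" if s: "s > 0" for s
  proof -
    obtain v where v: "Bd (rad s) v (C * (1 + s) powr (-1 - a))" "AE y in lborel. \<bar>h y s\<bar> \<le> \<bar>v y\<bar>"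
      using dom[OF s] by blast
    have "AE y in lborel. \<bar>H' (y, s)\<bar> \<le> 1 * \<bar>v y\<bar>"
    proof (cases "s \<in> N")
      case False
      from good[OF s this] v(2) show ?thesis by eventually_elim (use False in \<open>simp add: H'_def\<close>)
    qed (simp add: H'_def)
    moreover have "(\<lambda>y. H' (y, s)) \<in> borel_measurable lebesgue"
      using H'm by (intro measurable_completion) simp
    ultimately show ?thesis using Bd_dominated[OF v(1), of "\<lambda>y. H' (y, s)" 1] rad_pos[of s] s by simp
  qed
  then have "borel_src C a H'" using C H'm by (simp add: borel_src_def)
  moreover have "rep h H'"
    unfolding rep_def
  proof (rule AE_I[of _ _ N])
    show "{s \<in> space lborel. \<not> (0 < s \<longrightarrow> (AE y in lborel. h y s = H' (y, s)))} \<subseteq> N"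
      using good by (auto simp: H'_def)
  qed (use N in auto)
  ultimately show ?thesis by (rule that)
qed

lemma slice_measurable: "borel_src C a H \<Longrightarrow> (\<lambda>y. H (y, s)) \<in> borel_measurable borel"
  by (drule borel_srcD(2)) simp

lemma integrable_slice_moment:
  assumes "borel_src C a H" "s > 0" "\<alpha> \<in> mi_le K"
  shows "integrable lborel (\<lambda>y. mi_power y \<alpha> * H (y, s))"
proof -
  have [measurable]: "(\<lambda>y. H (y, s)) \<in> borel_measurable borel" by (rule slice_measurable[OF assms(1)])
  show ?thesis
    using Bd_moment(1)[OF borel_srcD(3)[OF assms(1,2)] assms(3)] assms(2)
    by (subst integrable_completion[symmetric]) (auto simp: rad_pos)
qed

text \<open>The raw moments depend measurably on \<open>s\<close> by Fubini, and the recursion only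
  adds explicit powers of \<open>rad s\<close>. The indicator restricts to the times at which the
  formula for the moments of \<open>g_\<beta>\<close> is available.\<close>

lemma moment_src_measurable:
  assumes "borel_src C a H" "\<alpha> \<in> mi_le K"
  shows "(\<lambda>s. indicator {0<..} s * moment G \<alpha> (\<lambda>y. H (y, s)) s) \<in> borel_measurable borel"
  using assms(2)
proof (induction \<alpha> rule: measure_induct_rule[where f = mi_abs])
  case (less \<alpha>)
  let ?S = "{\<beta>. \<beta> \<le> \<alpha> \<and> \<beta> \<noteq> \<alpha>}"
  have [measurable]: "H \<in> borel_measurable (borel \<Otimes>\<^sub>M borel)" by (rule borel_srcD(2)[OF assms(1)])
  have [measurable]: "(\<lambda>s. indicator {0<..} s * moment G \<beta> (\<lambda>y. H (y, s)) s) \<in> borel_measurable borel" if "\<beta> \<in> ?S" for \<beta>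
    using that less.prems by (intro less.IH mi_abs_strict_mono) (auto intro: mi_le_downward)
  have "indicator {0<..} s * moment G \<alpha> (\<lambda>y. H (y, s)) s =
    indicator {0<..} s * (LINT y|lborel. mi_power y \<alpha> * H (y, s)) -
     (\<Sum>\<beta>\<in>?S. (indicator {0<..} s * moment G \<beta> (\<lambda>y. H (y, s)) s) * (rad s ^ mi_abs \<alpha> / rad s ^ mi_abs \<beta> * gmom \<alpha> \<beta>))" for s
  proof (cases "s > 0")
    case True
    have "(LINT y|lebesgue. mi_power y \<alpha> * H (y, s)) = (LINT y|lborel. mi_power y \<alpha> * H (y, s))"
      by (intro integral_completion) measurable
    moreover have "(LINT x|lebesgue. mi_power x \<alpha> * g_fun G \<beta> x s) = rad s ^ mi_abs \<alpha> / rad s ^ mi_abs \<beta> * gmom \<alpha> \<beta>" if "\<beta> \<in> ?S" for \<beta>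
      using True less.prems that by (intro moment_g) (auto intro: mi_le_downward)
    ultimately show ?thesis using True by (subst moment.simps) simp
  qed simp
  then show ?case by (simp only:) measurable
qed

lemma moment_src_bound:
  assumes "borel_src C a H" "\<alpha> \<in> mi_le K" "s > 0"
  shows "\<bar>moment G \<alpha> (\<lambda>y. H (y, s)) s\<bar> \<le> moment_const * C * (1 + s) powr (real (mi_abs \<alpha>) / d - 1 - a)"
proof -
  have "\<bar>moment G \<alpha> (\<lambda>y. H (y, s)) s\<bar> \<le> moment_const * rad s ^ mi_abs \<alpha> * (C * (1 + s) powr (-1 - a))"
    using assms by (intro moment_bound borel_srcD(3)) auto
  also have "\<dots> = moment_const * C * ((1 + s) powr (real (mi_abs \<alpha>) / d) * (1 + s) powr (-1 - a))"
    using assms by (simp add: rad_power)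
  also have "\<dots> = moment_const * C * (1 + s) powr (real (mi_abs \<alpha>) / d - 1 - a)"
    by (simp add: powr_add[symmetric] algebra_simps)
  finally show ?thesis .
qed

lemma rep_slices:
  assumes "borel_src C a H" "rep h H"
  shows "AE s in lborel. s > 0 \<longrightarrow> Bd (rad s) (\<lambda>y. h y s) (C * (1 + s) powr (-1 - a)) \<and>
     (\<forall>\<alpha>. moment G \<alpha> (\<lambda>y. h y s) s = moment G \<alpha> (\<lambda>y. H (y, s)) s) \<and>
     (\<forall>t>s. \<forall>x. kernel_semigroup G (t - s) (\<lambda>y. h y s) x = (LINT y|lborel. G (x - y) (t - s) * H (y, s)))"
  using assms(2)[unfolded rep_def]
proof (rule eventually_mono, intro impI)
  fix s :: real assume "s > 0 \<longrightarrow> (AE y in lborel. h y s = H (y, s))" and s: "s > 0"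
  then have ae: "AE y in lborel. h y s = H (y, s)" by simp
  have [measurable]: "(\<lambda>y. H (y, s)) \<in> borel_measurable borel" by (rule slice_measurable[OF assms(1)])
  have "Bd (rad s) (\<lambda>y. h y s) (C * (1 + s) powr (-1 - a))"
    using Bd_cong_AE[OF borel_srcD(3)[OF assms(1) s] ae] s by (simp add: rad_pos)
  moreover have "moment G \<alpha> (\<lambda>y. h y s) s = moment G \<alpha> (\<lambda>y. H (y, s)) s" for \<alpha>
  proof (rule moment_cong)
    fix \<beta>
    have "(LINT y|lebesgue. mi_power y \<beta> * h y s) = (LINT y|lborel. mi_power y \<beta> * H (y, s))"
      by (rule lebesgue_integral_cong_lborel(2)) (measurable, use ae in \<open>auto elim: eventually_mono\<close>)
    also have "\<dots> = (LINT y|lebesgue. mi_power y \<beta> * H (y, s))"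
      by (intro integral_completion[symmetric]) measurable
    finally show "(LINT y|lebesgue. mi_power y \<beta> * h y s) = (LINT y|lebesgue. mi_power y \<beta> * H (y, s))" .
  qed
  moreover have "kernel_semigroup G (t - s) (\<lambda>y. h y s) x = (LINT y|lborel. G (x - y) (t - s) * H (y, s))" if "t > s" for t x
  proof -
    have [measurable]: "(\<lambda>y. G y (t - s)) \<in> borel_measurable borel" using that by (intro G_measurable) simp
    show ?thesis
      unfolding kernel_semigroup_def
      by (rule lebesgue_integral_cong_lborel(2)) (measurable, use ae in \<open>auto elim: eventually_mono\<close>)
  qed
  ultimately show "Bd (rad s) (\<lambda>y. h y s) (C * (1 + s) powr (-1 - a)) \<and>
     (\<forall>\<alpha>. moment G \<alpha> (\<lambda>y. h y s) s = moment G \<alpha> (\<lambda>y. H (y, s)) s) \<and>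
     (\<forall>t>s. \<forall>x. kernel_semigroup G (t - s) (\<lambda>y. h y s) x = (LINT y|lborel. G (x - y) (t - s) * H (y, s)))"
    by blast
qed

definition proj_src :: "((real^'n) \<times> real \<Rightarrow> real) \<Rightarrow> (real^'n) \<times> real \<Rightarrow> real" where
  "proj_src H z = (if snd z > 0 then proj_P G K (snd z) (\<lambda>y. H (y, snd z)) (fst z) else 0)"

lemma g_joint_measurable:
  assumes "\<alpha> \<in> mi_le K"
  shows "(\<lambda>z. indicator {0<..} (snd z) * g_fun G \<alpha> (fst z) (snd z)) \<in> borel_measurable (borel \<Otimes>\<^sub>M borel)"
proof -
  have [measurable]: "foldr partial_deriv (mi_word \<alpha>) \<Gamma> \<in> borel_measurable borel"
    using assms by (intro deriv_measurable mi_word_gamma)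
  have "indicator {0<..} (snd z) * g_fun G \<alpha> (fst z) (snd z) = indicator {0<..} (snd z) *
    (coef \<alpha> * dil (rad (snd z)) (foldr partial_deriv (mi_word \<alpha>) \<Gamma>) (fst z) / rad (snd z) ^ mi_abs \<alpha>)" for z
    using g_fun_eq[of "snd z" \<alpha> "fst z"] mi_le_gamma[OF assms] by (auto simp: indicator_def)
  then show ?thesis by (simp only: dil_def) measurable
qed

lemma borel_src_proj_src:
  assumes H: "borel_src C a H" shows "borel_src (proj_const * C) a (proj_src H)"
  unfolding borel_src_def
proof (intro conjI allI impI)
  have [measurable]: "H \<in> borel_measurable (borel \<Otimes>\<^sub>M borel)" by (rule borel_srcD(2)[OF H])
  have "proj_src H = (\<lambda>z. indicator {0<..} (snd z) * H z - (\<Sum>\<alpha>\<in>mi_le K.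
     (indicator {0<..} (snd z) * moment G \<alpha> (\<lambda>y. H (y, snd z)) (snd z)) * (indicator {0<..} (snd z) * g_fun G \<alpha> (fst z) (snd z))))"
    by (auto simp: fun_eq_iff proj_src_def proj_P_def)
  moreover have "(\<lambda>z. indicator {0<..} (snd z) * H z - (\<Sum>\<alpha>\<in>mi_le K.
     (indicator {0<..} (snd z) * moment G \<alpha> (\<lambda>y. H (y, snd z)) (snd z)) * (indicator {0<..} (snd z) * g_fun G \<alpha> (fst z) (snd z))))
     \<in> borel_measurable (borel \<Otimes>\<^sub>M borel)"
  proof (intro borel_measurable_diff borel_measurable_sum)
    fix \<alpha> :: "'n multi_index" assume a: "\<alpha> \<in> mi_le K"
    show "(\<lambda>z. (indicator {0<..} (snd z) * moment G \<alpha> (\<lambda>y. H (y, snd z)) (snd z)) * (indicator {0<..} (snd z) * g_fun G \<alpha> (fst z) (snd z)))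
      \<in> borel_measurable (borel \<Otimes>\<^sub>M borel)"
      by (rule borel_measurable_times[OF measurable_compose[OF measurable_snd moment_src_measurable[OF H a]] g_joint_measurable[OF a]])
  qed measurable
  ultimately show "proj_src H \<in> borel_measurable (borel \<Otimes>\<^sub>M borel)" by simp
  fix s :: real assume s: "s > 0"
  then have "(\<lambda>y. proj_src H (y, s)) = proj_P G K s (\<lambda>y. H (y, s))"
    by (auto simp: proj_src_def fun_eq_iff)
  then show "Bd (rad s) (\<lambda>y. proj_src H (y, s)) (proj_const * C * (1 + s) powr (-1 - a))"
    using Bd_proj[OF _ borel_srcD(3)[OF H s]] s by (simp add: mult.assoc)
qed (use proj_const_nonneg borel_srcD(1)[OF H] in simp)

lemma proj_src_moment_zero:
  assumes H: "borel_src C a H" and "mass = 1" "s > 0" "\<alpha> \<in> mi_le K"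
  shows "(LINT y|lborel. mi_power y \<alpha> * proj_src H (y, s)) = 0"
proof -
  have [measurable]: "(\<lambda>y. proj_src H (y, s)) \<in> borel_measurable borel"
    by (rule slice_measurable[OF borel_src_proj_src[OF H]])
  have "(LINT y|lborel. mi_power y \<alpha> * proj_src H (y, s)) = (LINT y|lebesgue. mi_power y \<alpha> * proj_src H (y, s))"
    by (intro integral_completion[symmetric]) measurable
  also have "\<dots> = 0"
    using proj_moment_zero[OF assms(2) _ borel_srcD(3)[OF H assms(3)] assms(4)] assms(3) by (simp add: proj_src_def)
  finally show ?thesis .
qed

end


section \<open>Integrals of powers in time\<close>

lemma ennreal_abs_integral_le:
  fixes f :: "'a \<Rightarrow> real"
  shows "ennreal \<bar>LINT x|M. f x\<bar> \<le> (\<integral>\<^sup>+x. ennreal \<bar>f x\<bar> \<partial>M)"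
  using integral_norm_bound_ennreal[of M f] by (cases "integrable M f") (auto simp: not_integrable_integral_eq)

lemma nn_integral_one_plus_powr_Icc:
  fixes t c :: real
  assumes t: "0 \<le> t"
    and F: "\<And>s. 0 \<le> s \<Longrightarrow> (F has_real_derivative (1 + s) powr (c - 1)) (at s)"
  shows "(\<integral>\<^sup>+s. ennreal (indicator {0<..<t} s * (1 + s) powr (c - 1)) \<partial>lborel) \<le> ennreal (F t - F 0)"
proof -
  have "(\<integral>\<^sup>+s. ennreal (indicator {0<..<t} s * (1 + s) powr (c - 1)) \<partial>lborel)
    \<le> (\<integral>\<^sup>+s. ennreal ((1 + s) powr (c - 1)) * indicator {0..t} s \<partial>lborel)"
    by (intro nn_integral_mono) (auto simp: indicator_def)
  also have "\<dots> = ennreal (F t - F 0)"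
    using F t by (intro nn_integral_FTC_Icc) (auto intro: has_field_derivative_at_within has_real_derivative_iff_has_vector_derivative[THEN iffD1])
  finally show ?thesis .
qed

lemma DERIV_one_plus_powr:
  "c \<noteq> 0 \<Longrightarrow> 0 \<le> s \<Longrightarrow> ((\<lambda>s::real. (1 + s) powr c / c) has_real_derivative (1 + s) powr (c - 1)) (at s)"
  using DERIV_cdivide[OF DERIV_fun_powr[of "\<lambda>s. 1 + s" 1 s c], of c]
  by (auto intro!: derivative_eq_intros)

text \<open>The three signs of \<open>c\<close> are the origin of the case distinctions in both
  parts of the theorem: growth of a power, a logarithm, or a convergent integral with a
  tail.\<close>

lemma nn_integral_one_plus_powr:
  fixes t c :: real
  assumes t: "0 \<le> t"
  shows "c > 0 \<Longrightarrow> (\<integral>\<^sup>+s. ennreal (indicator {0<..<t} s * (1 + s) powr (c - 1)) \<partial>lborel) \<le> ennreal ((1 + t) powr c / c)"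
    and "c = 0 \<Longrightarrow> (\<integral>\<^sup>+s. ennreal (indicator {0<..<t} s * (1 + s) powr (c - 1)) \<partial>lborel) \<le> ennreal (ln (1 + t))"
    and "c < 0 \<Longrightarrow> (\<integral>\<^sup>+s. ennreal (indicator {t<..} s * (1 + s) powr (c - 1)) \<partial>lborel) \<le> ennreal ((1 + t) powr c / - c)"
proof -
  assume c: "c > 0"
  have "(\<integral>\<^sup>+s. ennreal (indicator {0<..<t} s * (1 + s) powr (c - 1)) \<partial>lborel) \<le> ennreal ((1 + t) powr c / c - (1 + 0) powr c / c)"
    using c t DERIV_one_plus_powr[of c] by (intro nn_integral_one_plus_powr_Icc[where F="\<lambda>s. (1 + s) powr c / c"]) auto
  also have "\<dots> \<le> ennreal ((1 + t) powr c / c)" using c by (intro ennreal_leI) simp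
  finally show "(\<integral>\<^sup>+s. ennreal (indicator {0<..<t} s * (1 + s) powr (c - 1)) \<partial>lborel) \<le> ennreal ((1 + t) powr c / c)" .
next
  assume c: "c = 0"
  have "(\<integral>\<^sup>+s. ennreal (indicator {0<..<t} s * (1 + s) powr (c - 1)) \<partial>lborel) \<le> ennreal (ln (1 + t) - ln (1 + 0))"
    using c t by (intro nn_integral_one_plus_powr_Icc[where F="\<lambda>s. ln (1 + s)"])
      (auto intro!: derivative_eq_intros simp: powr_minus divide_inverse)
  then show "(\<integral>\<^sup>+s. ennreal (indicator {0<..<t} s * (1 + s) powr (c - 1)) \<partial>lborel) \<le> ennreal (ln (1 + t))" by simp
next
  assume c: "c < 0"
  have "(\<integral>\<^sup>+s. ennreal (indicator {t<..} s * (1 + s) powr (c - 1)) \<partial>lborel)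
    \<le> (\<integral>\<^sup>+s. ennreal ((1 + s) powr (c - 1)) * indicator {t..} s \<partial>lborel)"
    by (intro nn_integral_mono) (auto simp: indicator_def)
  also have "\<dots> = ennreal (0 - (1 + t) powr c / c)"
  proof (rule nn_integral_FTC_atLeast)
    have "((\<lambda>s. (1 + s) powr c) \<longlongrightarrow> 0) at_top"
      using c by (intro tendsto_neg_powr filterlim_tendsto_add_at_top[OF tendsto_const filterlim_ident])
    then show "((\<lambda>s. (1 + s) powr c / c) \<longlongrightarrow> 0) at_top" using c tendsto_divide[OF _ tendsto_const, of _ 0 at_top c] by simp
  qed (use c t DERIV_one_plus_powr[of c] in auto)
  finally show "(\<integral>\<^sup>+s. ennreal (indicator {t<..} s * (1 + s) powr (c - 1)) \<partial>lborel) \<le> ennreal ((1 + t) powr c / - c)" by simp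
qed

context self_similar_kernel begin

section \<open>Smoothing estimates for one time slice\<close>

text \<open>A source slice living at scale \<open>rs\<close> counts as one at the larger scale
  \<open>r\<close> if the ratio is at most \<open>m\<close>. The sup bound pairs the
  \<open>L^1\<close> norm of the kernel with the sup of \<open>q\<close>, which costs
  \<open>m^N\<close>; the weighted bound is Fubini with \<open>dil_conv_weight\<close>.\<close>

lemma plain_slice:
  assumes q: "Bd rs q B" and [measurable]: "q \<in> borel_measurable borel"
    and \<rho>: "0 < \<rho>" "\<rho> \<le> r" and rs: "0 < rs" "rs \<le> r" "r \<le> m * rs"
  shows "(\<integral>\<^sup>+y. ennreal \<bar>dil \<rho> \<Gamma> (x - y) * q y\<bar> \<partial>lborel) \<le> ennreal (conv_const * m ^ CARD('n) * B / r ^ CARD('n))"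
    and "(\<integral>\<^sup>+x. ennreal (wt r x) * (\<integral>\<^sup>+y. ennreal \<bar>dil \<rho> \<Gamma> (x - y) * q y\<bar> \<partial>lborel) \<partial>lborel) \<le> ennreal (conv_const * m ^ CARD('n) * B)"
proof -
  have B: "B \<ge> 0" using Bd_nonneg[OF q] .
  have r: "r > 0" using rs by simp
  have m1: "m \<ge> 1"
  proof -
    have "1 * rs \<le> m * rs" using rs by linarith
    then show ?thesis using rs(1) by (simp only: mult_le_cancel_right_pos)
  qed
  have "(\<integral>\<^sup>+y. ennreal \<bar>dil \<rho> \<Gamma> (x - y) * q y\<bar> \<partial>lborel) \<le> (\<integral>\<^sup>+y. ennreal \<bar>dil \<rho> \<Gamma> (x - y)\<bar> * ennreal (B / rs ^ CARD('n)) \<partial>lborel)"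
    using Bd_AE[OF q]
  proof (intro nn_integral_mono_AE, eventually_elim)
    case (elim y)
    then have "\<bar>dil \<rho> \<Gamma> (x - y)\<bar> * \<bar>q y\<bar> \<le> \<bar>dil \<rho> \<Gamma> (x - y)\<bar> * (B / rs ^ CARD('n))" by (intro mult_left_mono) auto
    then show ?case using B rs by (simp add: abs_mult ennreal_mult'[symmetric] ennreal_leI)
  qed
  also have "\<dots> = (\<integral>\<^sup>+y. ennreal \<bar>dil \<rho> \<Gamma> (x - y)\<bar> \<partial>lborel) * ennreal (B / rs ^ CARD('n))"
    by (intro nn_integral_multc) measurable
  also have "\<dots> \<le> ennreal conv_const * ennreal (B / rs ^ CARD('n))"
    by (intro mult_right_mono Gam_conv_L1 \<rho>) auto
  also have "\<dots> = ennreal (conv_const * (B / rs ^ CARD('n)))" using B rs conv_const_nonneg by (intro ennreal_mult[symmetric]) auto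
  also have "\<dots> \<le> ennreal (conv_const * m ^ CARD('n) * B / r ^ CARD('n))"
  proof (rule ennreal_leI)
    have "r ^ CARD('n) \<le> (m * rs) ^ CARD('n)" using rs r by (intro power_mono) auto
    then have "1 / rs ^ CARD('n) \<le> m ^ CARD('n) / r ^ CARD('n)"
      using rs r by (simp add: field_simps power_mult_distrib)
    then have "(conv_const * B) * (1 / rs ^ CARD('n)) \<le> (conv_const * B) * (m ^ CARD('n) / r ^ CARD('n))"
      using B conv_const_nonneg by (intro mult_left_mono) auto
    then show "conv_const * (B / rs ^ CARD('n)) \<le> conv_const * m ^ CARD('n) * B / r ^ CARD('n)" by (simp add: mult_ac)
  qed
  finally show "(\<integral>\<^sup>+y. ennreal \<bar>dil \<rho> \<Gamma> (x - y) * q y\<bar> \<partial>lborel) \<le> ennreal (conv_const * m ^ CARD('n) * B / r ^ CARD('n))" .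
  have "(\<integral>\<^sup>+x. ennreal (wt r x) * (\<integral>\<^sup>+y. ennreal \<bar>dil \<rho> \<Gamma> (x - y) * q y\<bar> \<partial>lborel) \<partial>lborel)
     = (\<integral>\<^sup>+x. (\<integral>\<^sup>+y. ennreal \<bar>q y\<bar> * ennreal (wt r x * \<bar>dil \<rho> \<Gamma> (x - y)\<bar>) \<partial>lborel) \<partial>lborel)"
    by (subst nn_integral_cmult[symmetric], measurable)
       (intro nn_integral_cong, simp add: abs_mult ennreal_mult'[symmetric] mult_ac)
  also have "\<dots> = (\<integral>\<^sup>+y. (\<integral>\<^sup>+x. ennreal \<bar>q y\<bar> * ennreal (wt r x * \<bar>dil \<rho> \<Gamma> (x - y)\<bar>) \<partial>lborel) \<partial>lborel)"
    by (rule lborel_pair.Fubini'[symmetric]) measurable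
  also have "\<dots> = (\<integral>\<^sup>+y. ennreal \<bar>q y\<bar> * (\<integral>\<^sup>+x. ennreal (wt r x * \<bar>dil \<rho> \<Gamma> (x - y)\<bar>) \<partial>lborel) \<partial>lborel)"
    by (intro nn_integral_cong nn_integral_cmult) measurable
  also have "\<dots> \<le> (\<integral>\<^sup>+y. ennreal conv_const * ennreal (wt rs y * \<bar>q y\<bar>) \<partial>lborel)"
  proof (intro nn_integral_mono)
    fix y
    have "ennreal \<bar>q y\<bar> * (\<integral>\<^sup>+x. ennreal (wt r x * \<bar>dil \<rho> \<Gamma> (x - y)\<bar>) \<partial>lborel) \<le> ennreal \<bar>q y\<bar> * (ennreal conv_const * ennreal (wt rs y))"
      by (intro mult_left_mono order_trans[OF Gam_conv_weight[OF \<rho>]] ennreal_leI wt_antimono rs) auto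
    then show "ennreal \<bar>q y\<bar> * (\<integral>\<^sup>+x. ennreal (wt r x * \<bar>dil \<rho> \<Gamma> (x - y)\<bar>) \<partial>lborel) \<le> ennreal conv_const * ennreal (wt rs y * \<bar>q y\<bar>)"
      by (simp add: ennreal_mult' mult_ac)
  qed
  also have "\<dots> = ennreal conv_const * (\<integral>\<^sup>+y. ennreal (wt rs y * \<bar>q y\<bar>) \<partial>lborel)"
    by (intro nn_integral_cmult) measurable
  also have "\<dots> \<le> ennreal conv_const * ennreal B" by (intro mult_left_mono Bd_nn[OF q]) simp
  also have "\<dots> = ennreal (conv_const * B)" using B conv_const_nonneg by (simp add: ennreal_mult)
  also have "\<dots> \<le> ennreal (conv_const * m ^ CARD('n) * B)"
  proof (rule ennreal_leI)
    have "(conv_const * B) * 1 \<le> (conv_const * B) * m ^ CARD('n)" using B conv_const_nonneg m1 by (intro mult_left_mono one_le_power) auto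
    then show "conv_const * B \<le> conv_const * m ^ CARD('n) * B" by (simp add: mult_ac)
  qed
  finally show "(\<integral>\<^sup>+x. ennreal (wt r x) * (\<integral>\<^sup>+y. ennreal \<bar>dil \<rho> \<Gamma> (x - y) * q y\<bar> \<partial>lborel) \<partial>lborel) \<le> ennreal (conv_const * m ^ CARD('n) * B)" .
qed

text \<open>Here the ratio \<open>m\<close> compares \<open>r\<close> with the width
  \<open>\<rho>\<close> of the kernel. Both norms are controlled by one integral of
  \<open>|q|\<close> against the remainder profile, so no sup norm of \<open>q\<close>
  enters.\<close>

lemma Tay_slice:
  assumes [measurable]: "q \<in> borel_measurable borel" and \<rho>: "0 < \<rho>" "\<rho> \<le> r" "r \<le> m * \<rho>"
  shows "(\<integral>\<^sup>+y. ennreal \<bar>dil \<rho> (\<lambda>x. Tay x (y /\<^sub>R \<rho>)) x * q y\<bar> \<partial>lborel)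
      \<le> ennreal (1 / r ^ CARD('n)) * (ennreal (tay_const * m ^ CARD('n)) * (\<integral>\<^sup>+y. ennreal (psi (m * norm y / r) * \<bar>q y\<bar>) \<partial>lborel))"
    and "(\<integral>\<^sup>+x. ennreal (wt r x) * (\<integral>\<^sup>+y. ennreal \<bar>dil \<rho> (\<lambda>x. Tay x (y /\<^sub>R \<rho>)) x * q y\<bar> \<partial>lborel) \<partial>lborel)
      \<le> ennreal (tay_const * m ^ CARD('n)) * (\<integral>\<^sup>+y. ennreal (psi (m * norm y / r) * \<bar>q y\<bar>) \<partial>lborel)"
proof -
  have r: "r > 0" using \<rho> by simp
  have m1: "m \<ge> 1"
  proof -
    have "1 * \<rho> \<le> m * \<rho>" using \<rho> by linarith
    then show ?thesis using \<rho>(1) by (simp only: mult_le_cancel_right_pos)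
  qed
  have psi_le: "psi (norm y / \<rho>) \<le> psi (m * norm y / r)" for y :: "real^'n"
  proof (rule psi_mono)
    have "norm y * r \<le> norm y * (m * \<rho>)" using \<rho> by (intro mult_left_mono) auto
    then show "norm y / \<rho> \<le> m * norm y / r" using \<rho> r by (simp add: field_simps)
  qed (use \<rho> in simp)
  have psi0: "0 \<le> psi (m * norm y / r)" for y :: "real^'n" using m1 r by (intro psi_nonneg) auto
  have inv: "1 / \<rho> ^ CARD('n) \<le> m ^ CARD('n) / r ^ CARD('n)"
  proof -
    have "r ^ CARD('n) \<le> (m * \<rho>) ^ CARD('n)" using \<rho> r by (intro power_mono) auto
    then show ?thesis using \<rho> r by (simp add: field_simps power_mult_distrib)
  qed
  have "(\<integral>\<^sup>+y. ennreal \<bar>dil \<rho> (\<lambda>x. Tay x (y /\<^sub>R \<rho>)) x * q y\<bar> \<partial>lborel)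
      \<le> (\<integral>\<^sup>+y. ennreal (tay_const * (m ^ CARD('n) / r ^ CARD('n))) * ennreal (psi (m * norm y / r) * \<bar>q y\<bar>) \<partial>lborel)"
  proof (intro nn_integral_mono)
    fix y
    have "\<bar>dil \<rho> (\<lambda>x. Tay x (y /\<^sub>R \<rho>)) x\<bar> \<le> tay_const * psi (norm y / \<rho>) * (1 / \<rho> ^ CARD('n))"
      using Tay_dil_sup[OF \<rho>(1), of y x] by simp
    also have "\<dots> \<le> tay_const * psi (m * norm y / r) * (m ^ CARD('n) / r ^ CARD('n))"
      using tay_const_nonneg psi0 \<rho> by (intro mult_mono inv psi_le mult_left_mono) auto
    finally have "\<bar>dil \<rho> (\<lambda>x. Tay x (y /\<^sub>R \<rho>)) x\<bar> * \<bar>q y\<bar> \<le> tay_const * psi (m * norm y / r) * (m ^ CARD('n) / r ^ CARD('n)) * \<bar>q y\<bar>"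
      by (intro mult_right_mono) auto
    then show "ennreal \<bar>dil \<rho> (\<lambda>x. Tay x (y /\<^sub>R \<rho>)) x * q y\<bar>
       \<le> ennreal (tay_const * (m ^ CARD('n) / r ^ CARD('n))) * ennreal (psi (m * norm y / r) * \<bar>q y\<bar>)"
      using tay_const_nonneg m1 r psi0 by (simp only: ennreal_mult'[symmetric] abs_mult zero_le_mult_iff) (auto simp: mult_ac ennreal_mult'[symmetric] intro!: ennreal_leI)
  qed
  also have "\<dots> = ennreal (tay_const * (m ^ CARD('n) / r ^ CARD('n))) * (\<integral>\<^sup>+y. ennreal (psi (m * norm y / r) * \<bar>q y\<bar>) \<partial>lborel)"
    by (intro nn_integral_cmult) measurable
  also have "ennreal (tay_const * (m ^ CARD('n) / r ^ CARD('n))) = ennreal (1 / r ^ CARD('n)) * ennreal (tay_const * m ^ CARD('n))"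
    using r by (subst ennreal_mult'[symmetric]) auto
  finally show "(\<integral>\<^sup>+y. ennreal \<bar>dil \<rho> (\<lambda>x. Tay x (y /\<^sub>R \<rho>)) x * q y\<bar> \<partial>lborel)
      \<le> ennreal (1 / r ^ CARD('n)) * (ennreal (tay_const * m ^ CARD('n)) * (\<integral>\<^sup>+y. ennreal (psi (m * norm y / r) * \<bar>q y\<bar>) \<partial>lborel))"
    by (simp only: mult.assoc)
  have [measurable]: "(\<lambda>(x, y). dil \<rho> (\<lambda>x. Tay x (y /\<^sub>R \<rho>)) x) \<in> borel_measurable (borel \<Otimes>\<^sub>M borel)"
    unfolding dil_def by measurable
  have "(\<integral>\<^sup>+x. ennreal (wt r x) * (\<integral>\<^sup>+y. ennreal \<bar>dil \<rho> (\<lambda>x. Tay x (y /\<^sub>R \<rho>)) x * q y\<bar> \<partial>lborel) \<partial>lborel)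
     = (\<integral>\<^sup>+x. (\<integral>\<^sup>+y. ennreal \<bar>q y\<bar> * ennreal (wt r x * \<bar>dil \<rho> (\<lambda>x. Tay x (y /\<^sub>R \<rho>)) x\<bar>) \<partial>lborel) \<partial>lborel)"
    by (subst nn_integral_cmult[symmetric], measurable)
       (intro nn_integral_cong, simp add: abs_mult ennreal_mult'[symmetric] mult_ac)
  also have "\<dots> = (\<integral>\<^sup>+y. (\<integral>\<^sup>+x. ennreal \<bar>q y\<bar> * ennreal (wt r x * \<bar>dil \<rho> (\<lambda>x. Tay x (y /\<^sub>R \<rho>)) x\<bar>) \<partial>lborel) \<partial>lborel)"
    by (rule lborel_pair.Fubini'[symmetric]) measurable
  also have "\<dots> = (\<integral>\<^sup>+y. ennreal \<bar>q y\<bar> * (\<integral>\<^sup>+x. ennreal (wt r x * \<bar>dil \<rho> (\<lambda>x. Tay x (y /\<^sub>R \<rho>)) x\<bar>) \<partial>lborel) \<partial>lborel)"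
    by (intro nn_integral_cong nn_integral_cmult) measurable
  also have "\<dots> \<le> (\<integral>\<^sup>+y. ennreal (tay_const * m ^ CARD('n)) * ennreal (psi (m * norm y / r) * \<bar>q y\<bar>) \<partial>lborel)"
  proof (intro nn_integral_mono)
    fix y
    have "(\<integral>\<^sup>+x. ennreal (wt r x * \<bar>dil \<rho> (\<lambda>x. Tay x (y /\<^sub>R \<rho>)) x\<bar>) \<partial>lborel) \<le> ennreal (tay_const * psi (norm y / \<rho>))"
      by (rule Tay_dil_weight[OF \<rho>(1,2)])
    also have "\<dots> \<le> ennreal (tay_const * m ^ CARD('n) * psi (m * norm y / r))"
    proof (rule ennreal_leI)
      have "tay_const * 1 * psi (norm y / \<rho>) \<le> tay_const * m ^ CARD('n) * psi (m * norm y / r)"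
        using tay_const_nonneg m1 \<rho> psi0 by (intro mult_mono psi_le one_le_power mult_left_mono psi_nonneg) auto
      then show "tay_const * psi (norm y / \<rho>) \<le> tay_const * m ^ CARD('n) * psi (m * norm y / r)" by simp
    qed
    finally have "ennreal \<bar>q y\<bar> * (\<integral>\<^sup>+x. ennreal (wt r x * \<bar>dil \<rho> (\<lambda>x. Tay x (y /\<^sub>R \<rho>)) x\<bar>) \<partial>lborel) \<le> ennreal \<bar>q y\<bar> * ennreal (tay_const * m ^ CARD('n) * psi (m * norm y / r))"
      by (rule mult_left_mono) simp
    also have "\<dots> = ennreal (tay_const * m ^ CARD('n)) * ennreal (psi (m * norm y / r) * \<bar>q y\<bar>)"
      using tay_const_nonneg m1 by (subst (1 2) ennreal_mult'[symmetric]) (auto simp: mult_ac)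
    finally show "ennreal \<bar>q y\<bar> * (\<integral>\<^sup>+x. ennreal (wt r x * \<bar>dil \<rho> (\<lambda>x. Tay x (y /\<^sub>R \<rho>)) x\<bar>) \<partial>lborel) \<le> ennreal (tay_const * m ^ CARD('n)) * ennreal (psi (m * norm y / r) * \<bar>q y\<bar>)" .
  qed
  also have "\<dots> = ennreal (tay_const * m ^ CARD('n)) * (\<integral>\<^sup>+y. ennreal (psi (m * norm y / r) * \<bar>q y\<bar>) \<partial>lborel)"
    by (intro nn_integral_cmult) measurable
  finally show "(\<integral>\<^sup>+x. ennreal (wt r x) * (\<integral>\<^sup>+y. ennreal \<bar>dil \<rho> (\<lambda>x. Tay x (y /\<^sub>R \<rho>)) x * q y\<bar> \<partial>lborel) \<partial>lborel)
      \<le> ennreal (tay_const * m ^ CARD('n)) * (\<integral>\<^sup>+y. ennreal (psi (m * norm y / r) * \<bar>q y\<bar>) \<partial>lborel)" .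
qed

text \<open>Minkowski's inequality for \<open>Bd\<close>: \<open>v\<close> is a pointwise majorant
  of the time integrand and \<open>b\<close> a common bound for both of its scaled norms, so one
  time integral of \<open>b\<close> settles both.\<close>

lemma Bd_superpose:
  fixes v :: "real^'n \<Rightarrow> real \<Rightarrow> ennreal"
  assumes D: "D \<in> borel_measurable borel" and v[measurable]: "case_prod v \<in> borel_measurable (borel \<Otimes>\<^sub>M borel)"
    and b: "b \<in> borel_measurable borel"
    and Dv: "\<And>x. ennreal \<bar>D x\<bar> \<le> (\<integral>\<^sup>+s. v x s \<partial>lborel)"
    and sup: "\<And>x s. v x s \<le> ennreal (1 / r ^ CARD('n)) * b s"
    and int: "\<And>s. (\<integral>\<^sup>+x. ennreal (wt r x) * v x s \<partial>lborel) \<le> b s"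
    and B: "(\<integral>\<^sup>+s. b s \<partial>lborel) \<le> ennreal B" "B \<ge> 0" and r: "r > 0"
  shows "Bd r D B"
  unfolding Bd_def
proof (intro conjI)
  have "\<bar>D x\<bar> \<le> B / r ^ CARD('n)" for x
  proof -
    have "ennreal \<bar>D x\<bar> \<le> (\<integral>\<^sup>+s. ennreal (1 / r ^ CARD('n)) * b s \<partial>lborel)"
      using Dv[of x] by (rule order_trans) (intro nn_integral_mono sup)
    also have "\<dots> = ennreal (1 / r ^ CARD('n)) * (\<integral>\<^sup>+s. b s \<partial>lborel)"
      using b by (intro nn_integral_cmult) simp
    also have "\<dots> \<le> ennreal (1 / r ^ CARD('n)) * ennreal B" by (intro mult_left_mono B) simp
    also have "\<dots> = ennreal (B / r ^ CARD('n))" using r by (subst ennreal_mult'[symmetric]) auto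
    finally show ?thesis using B r by (subst (asm) ennreal_le_iff) auto
  qed
  then show "AE x in lborel. \<bar>D x\<bar> \<le> B / r ^ CARD('n)" by simp
  have "(\<integral>\<^sup>+x. ennreal (wt r x * \<bar>D x\<bar>) \<partial>lborel) \<le> (\<integral>\<^sup>+x. ennreal (wt r x) * (\<integral>\<^sup>+s. v x s \<partial>lborel) \<partial>lborel)"
    by (intro nn_integral_mono) (simp add: ennreal_mult' mult_left_mono Dv)
  also have "\<dots> = (\<integral>\<^sup>+x. (\<integral>\<^sup>+s. ennreal (wt r x) * v x s \<partial>lborel) \<partial>lborel)"
    by (intro nn_integral_cong nn_integral_cmult[symmetric]) measurable
  also have "\<dots> = (\<integral>\<^sup>+s. (\<integral>\<^sup>+x. ennreal (wt r x) * v x s \<partial>lborel) \<partial>lborel)"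
    by (rule lborel_pair.Fubini'[symmetric]) measurable
  also have "\<dots> \<le> (\<integral>\<^sup>+s. b s \<partial>lborel)" by (intro nn_integral_mono int)
  also have "\<dots> \<le> ennreal B" by (rule B)
  finally show "(\<integral>\<^sup>+x. ennreal (wt r x * \<bar>D x\<bar>) \<partial>lborel) \<le> ennreal B" .
  show "D \<in> borel_measurable lebesgue" using D by (intro measurable_completion) simp
qed (rule B)

text \<open>\<open>psi\<close> gains a little over the power \<open>K\<close> near the origin; this turns the bound \<open>O(r\<^sup>-\<^sup>K)\<close> into \<open>o(r\<^sup>-\<^sup>K)\<close>.\<close>

lemma psi_scaled_le:
  assumes "m \<ge> 0" "r > 0" "n \<ge> 0"
  shows "r powr K * psi (m * n / r) \<le> m powr K * n powr K"
proof -
  have "psi (m * n / r) \<le> (m * n / r) powr K" using assms by (intro psi_le_powr) auto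
  then have "r powr K * psi (m * n / r) \<le> r powr K * (m * n / r) powr K" by (intro mult_left_mono) auto
  also have "\<dots> = m powr K * n powr K" using assms by (simp add: powr_mult powr_divide)
  finally show ?thesis .
qed

text \<open>As \<open>R\<close> tends to infinity the argument of \<open>psi\<close> eventually
  falls into the branch of order \<open>k + 1\<close>; what remains is \<open>R\<close> to the
  negative power \<open>K - (k + 1)\<close>.\<close>

lemma psi_scaled_tendsto:
  assumes "m \<ge> 0" "n \<ge> 0" and R: "filterlim R at_top at_top"
  shows "((\<lambda>t. R t powr K * psi (m * n / R t)) \<longlongrightarrow> 0) at_top"
proof -
  have "((\<lambda>t. (m * n) ^ Suc k * R t powr (K - (real k + 1))) \<longlongrightarrow> (m * n) ^ Suc k * 0) at_top"
    using k_gr by (intro tendsto_intros tendsto_neg_powr R) auto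
  moreover have "\<forall>\<^sub>F t in at_top. (m * n) ^ Suc k * R t powr (K - (real k + 1)) = R t powr K * psi (m * n / R t)"
    using filterlim_at_top_dense[THEN iffD1, OF R, rule_format, of "m * n"]
      filterlim_at_top_dense[THEN iffD1, OF R, rule_format, of 0]
  proof eventually_elim
    case (elim t)
    then have "psi (m * n / R t) = (m * n) ^ Suc k / R t powr (real k + 1)"
      by (simp add: psi_def power_divide powr_realpow powr_add)
    then show ?case by (simp add: powr_diff)
  qed
  ultimately show ?thesis by (simp add: tendsto_cong)
qed

text \<open>Dominated convergence with the majorant of \<open>psi_scaled_le\<close>. The measure is
  arbitrary because the lemma serves initial values on space as well as sources on
  space-time.\<close>

lemma psi_scaled_integral_tendsto:
  fixes n q :: "'z \<Rightarrow> real" and R :: "real \<Rightarrow> real"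
  assumes [measurable]: "n \<in> borel_measurable M" "q \<in> borel_measurable M" and n: "\<And>z. n z \<ge> 0"
    and int: "integrable M (\<lambda>z. n z powr K * \<bar>q z\<bar>)" and m: "m \<ge> 0" and R: "filterlim R at_top at_top"
  shows "((\<lambda>t. R t powr K * (LINT z|M. psi (m * n z / R t) * \<bar>q z\<bar>)) \<longlongrightarrow> 0) at_top"
proof -
  have "((\<lambda>t. LINT z|M. R t powr K * psi (m * n z / R t) * \<bar>q z\<bar>) \<longlongrightarrow> (LINT z|M. 0)) at_top"
  proof (rule integral_dominated_convergence_at_top[where s = "\<lambda>t z. R t powr K * psi (m * n z / R t) * \<bar>q z\<bar>" and f = "\<lambda>z. 0" and w = "\<lambda>z. m powr K * (n z powr K * \<bar>q z\<bar>)"])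
    show "\<forall>\<^sub>F t in at_top. AE z in M. norm (R t powr K * psi (m * n z / R t) * \<bar>q z\<bar>) \<le> m powr K * (n z powr K * \<bar>q z\<bar>)"
      using filterlim_at_top_dense[THEN iffD1, OF R, rule_format, of 0]
    proof eventually_elim
      case (elim t)
      have "norm (R t powr K * psi (m * n z / R t) * \<bar>q z\<bar>) \<le> m powr K * (n z powr K * \<bar>q z\<bar>)" for z
        using mult_right_mono[OF psi_scaled_le[OF m elim n[of z]], of "\<bar>q z\<bar>"] psi_nonneg[of "m * n z / R t"] m n[of z] elim
        by (simp add: abs_mult mult.assoc)
      then show ?case by simp
    qed
    show "AE z in M. ((\<lambda>t. R t powr K * psi (m * n z / R t) * \<bar>q z\<bar>) \<longlongrightarrow> 0) at_top"
      using tendsto_mult_left_zero[OF psi_scaled_tendsto[OF m n R]] by simp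
  qed (use int in auto)
  then show ?thesis by (simp add: mult.assoc)
qed

lemma rad_at_top: "filterlim rad at_top at_top"
  unfolding rad_def[abs_def] using d_pos by real_asymp

end


context self_similar_kernel begin

section \<open>Decay of the Duhamel term\<close>

definition duhamel_kernel :: "((real^'n) \<times> real \<Rightarrow> real) \<Rightarrow> real^'n \<Rightarrow> real \<Rightarrow> real \<Rightarrow> real" where
  "duhamel_kernel Q x t s = (LINT y|lborel. dil ((t - s) powr (1 / d)) \<Gamma> (x - y) * Q (y, s))"

definition duhamel :: "((real^'n) \<times> real \<Rightarrow> real) \<Rightarrow> real^'n \<Rightarrow> real \<Rightarrow> real" where
  "duhamel Q x t = (LINT s|lborel. indicator {0<..<t} s * duhamel_kernel Q x t s)"

text \<open>Bounds the ratio of the scales that occur: for \<open>t >= 1\<close> and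
  \<open>s <= t/2\<close> one has \<open>1 + t <= 4 (t - s)\<close>, and in the remaining cases with
  \<open>0 < s < t\<close> one has \<open>1 + t <= 4 (1 + s)\<close>.\<close>

definition time_ratio :: real where "time_ratio = 4 powr (1 / d)"

lemma time_ratio_ge_1: "time_ratio \<ge> 1"
  unfolding time_ratio_def using d_pos by (intro ge_one_powr_ge_zero) auto

lemma powr_le_time_ratio_mult:
  assumes "0 \<le> b" "a \<le> 4 * b" "0 \<le> a" shows "a powr (1 / d) \<le> time_ratio * b powr (1 / d)"
proof -
  have "a powr (1 / d) \<le> (4 * b) powr (1 / d)" using assms d_pos by (intro powr_mono2) auto
  then show ?thesis using assms by (simp add: time_ratio_def powr_mult)
qed

lemma duhamel_measurable:
  assumes [measurable]: "Q \<in> borel_measurable (borel \<Otimes>\<^sub>M borel)"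
  shows "(\<lambda>(x, t). duhamel Q x t) \<in> borel_measurable (borel \<Otimes>\<^sub>M borel)"
proof -
  have "(\<lambda>p. duhamel_kernel Q (fst (fst p)) (snd (fst p)) (snd p)) \<in> borel_measurable ((borel \<Otimes>\<^sub>M borel) \<Otimes>\<^sub>M borel)"
    unfolding duhamel_kernel_def dil_def by measurable
  then have "(\<lambda>p. indicator {0<..<snd (fst p)} (snd p) * duhamel_kernel Q (fst (fst p)) (snd (fst p)) (snd p)) \<in> borel_measurable ((borel \<Otimes>\<^sub>M borel) \<Otimes>\<^sub>M lborel)"
    unfolding greaterThanLessThan_iff indicator_def[abs_def] by measurable
  then show ?thesis
    unfolding duhamel_def case_prod_unfold
    by (intro lborel.borel_measurable_lebesgue_integral) (simp add: case_prod_unfold)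
qed

text \<open>A crude bound that is uniform in \<open>s\<close>; it ensures that the time integrals
  exist, while the decay comes from the finer estimates below.\<close>

lemma duhamel_kernel_plain:
  assumes Q: "borel_src C a Q" and s: "0 < s" "s < t" and a: "a \<ge> 0"
  shows "integrable lborel (\<lambda>y. dil ((t - s) powr (1 / d)) \<Gamma> (x - y) * Q (y, s))" "\<bar>duhamel_kernel Q x t s\<bar> \<le> conv_const * C"
proof -
  have [measurable]: "(\<lambda>y. Q (y, s)) \<in> borel_measurable borel" by (rule slice_measurable[OF Q])
  have C: "C \<ge> 0" using borel_srcD(1)[OF Q] .
  have r: "0 < rad s" "rad s \<le> rad t" "rad t > 0" "rad s \<ge> 1" using s by (auto simp: rad_pos rad_mono rad_ge_1)
  have "(t - s) powr (1 / d) \<le> rad t" unfolding rad_def using s d_pos by (intro powr_mono2) auto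
  then have "(\<integral>\<^sup>+y. ennreal \<bar>dil ((t - s) powr (1 / d)) \<Gamma> (x - y) * Q (y, s)\<bar> \<partial>lborel)
    \<le> ennreal (conv_const * (rad t / rad s) ^ CARD('n) * (C * (1 + s) powr (-1 - a)) / rad t ^ CARD('n))"
    using r s by (intro plain_slice(1)[OF borel_srcD(3)[OF Q s(1)]]) auto
  also have "\<dots> \<le> ennreal (conv_const * C)"
  proof (rule ennreal_leI)
    have "(1 + s) powr (-1 - a) \<le> 1" using s a powr_mono[of "-1 - a" 0 "1 + s"] by simp
    moreover have "1 / rad s ^ CARD('n) \<le> 1" using r by (simp add: one_le_power)
    ultimately have "conv_const * C * ((1 + s) powr (-1 - a) * (1 / rad s ^ CARD('n))) \<le> conv_const * C * (1 * 1)"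
      using C conv_const_nonneg r by (intro mult_left_mono mult_mono) auto
    then show "conv_const * (rad t / rad s) ^ CARD('n) * (C * (1 + s) powr (-1 - a)) / rad t ^ CARD('n) \<le> conv_const * C"
      using r by (simp add: power_divide mult_ac)
  qed
  finally have le: "(\<integral>\<^sup>+y. ennreal \<bar>dil ((t - s) powr (1 / d)) \<Gamma> (x - y) * Q (y, s)\<bar> \<partial>lborel) \<le> ennreal (conv_const * C)" .
  have "(\<integral>\<^sup>+y. ennreal (norm (dil ((t - s) powr (1 / d)) \<Gamma> (x - y) * Q (y, s))) \<partial>lborel) < \<infinity>"
    using le_less_trans[OF le ennreal_less_top] by simp
  then show "integrable lborel (\<lambda>y. dil ((t - s) powr (1 / d)) \<Gamma> (x - y) * Q (y, s))"
    by (intro integrableI_bounded) measurable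
  have "ennreal \<bar>duhamel_kernel Q x t s\<bar> \<le> ennreal (conv_const * C)"
    unfolding duhamel_kernel_def using ennreal_abs_integral_le le by (rule order_trans)
  then show "\<bar>duhamel_kernel Q x t s\<bar> \<le> conv_const * C" using C conv_const_nonneg by (simp add: ennreal_le_iff)
qed

lemma duhamel_integrand_integrable:
  assumes Q: "borel_src C a Q" and a: "a \<ge> 0"
  shows "integrable lborel (\<lambda>s. indicator {0<..<t} s * duhamel_kernel Q x t s)"
proof (rule Bochner_Integration.integrable_bound[of lborel "\<lambda>s. conv_const * C * indicator {0<..<t} s"])
  show "integrable lborel (\<lambda>s. conv_const * C * indicator {0<..<t} s)"
    by (intro integrable_mult_right integrable_real_indicator; cases "0 \<le> t") auto
  have [measurable]: "Q \<in> borel_measurable (borel \<Otimes>\<^sub>M borel)" by (rule borel_srcD(2)[OF Q])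
  have "(\<lambda>s. duhamel_kernel Q x t s) \<in> borel_measurable borel"
    unfolding duhamel_kernel_def dil_def by measurable
  then show "(\<lambda>s. indicator {0<..<t} s * duhamel_kernel Q x t s) \<in> borel_measurable lborel" by measurable
  show "AE s in lborel. norm (indicator {0<..<t} s * duhamel_kernel Q x t s) \<le> norm (conv_const * C * indicator {0<..<t} s)"
    using duhamel_kernel_plain(2)[OF Q _ _ a] borel_srcD(1)[OF Q] conv_const_nonneg by (auto simp: indicator_def)
qed

text \<open>Bound for what the Taylor-corrected kernel makes of the source, expressed at the scale
  of time \<open>t\<close>; \<open>time_ratio\<close> absorbs that the kernel in use has the smaller
  width \<open>(t - s)^(1/d)\<close>.\<close>

definition early_mass :: "((real^'n) \<times> real \<Rightarrow> real) \<Rightarrow> real \<Rightarrow> ennreal" where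
  "early_mass Q t = (\<integral>\<^sup>+s. indicator {0<..<t} s * (\<integral>\<^sup>+y. ennreal (psi (time_ratio * norm y / rad t) * \<bar>Q (y, s)\<bar>) \<partial>lborel) \<partial>lborel)"

text \<open>For \<open>s \<le> t / 2\<close> the vanishing moments are used through the Taylor-corrected kernel, for later times
  the decay of the source itself suffices.\<close>

lemma duhamel_Bd:
  assumes Q: "borel_src C a Q" and a: "a > 0" and t: "t > 0"
    and Q0: "\<And>s \<alpha>. s > 0 \<Longrightarrow> \<alpha> \<in> mi_le K \<Longrightarrow> (LINT y|lborel. mi_power y \<alpha> * Q (y, s)) = 0"
    and j: "early_mass Q t \<le> ennreal j" "j \<ge> 0"
  shows "Bd (rad t) (\<lambda>x. duhamel Q x t)
    (tay_const * time_ratio ^ CARD('n) * j + conv_const * time_ratio ^ CARD('n) * C * 2 powr (1 + a) * (1 + t) powr (- a))"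
proof -
  have [measurable]: "Q \<in> borel_measurable (borel \<Otimes>\<^sub>M borel)" by (rule borel_srcD(2)[OF Q])
  have Qs[measurable]: "(\<lambda>y. Q (y, s)) \<in> borel_measurable borel" for s by (rule slice_measurable[OF Q])
  have C: "C \<ge> 0" using borel_srcD(1)[OF Q] .
  have r: "rad t > 0" using t by (simp add: rad_pos)
  define \<rho> where "\<rho> s = (t - s) powr (1 / d)" for s
  define vT where "vT x s = (\<integral>\<^sup>+y. ennreal \<bar>dil (\<rho> s) (\<lambda>x. Tay x (y /\<^sub>R \<rho> s)) x * Q (y, s)\<bar> \<partial>lborel)" for x s
  define vG where "vG x s = (\<integral>\<^sup>+y. ennreal \<bar>dil (\<rho> s) \<Gamma> (x - y) * Q (y, s)\<bar> \<partial>lborel)" for x s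
  \<comment> \<open>The corrected kernel is useful only where its width is comparable to
    \<open>rad t\<close>. For \<open>t < 1\<close> this fails, and all times are treated by the
    plain estimate.\<close>
  define v where "v x s = indicator {0<..<t} s * (if t \<ge> 1 \<and> s \<le> t / 2 then vT x s else vG x s)" for x s
  define J where "J s = (\<integral>\<^sup>+y. ennreal (psi (time_ratio * norm y / rad t) * \<bar>Q (y, s)\<bar>) \<partial>lborel)" for s
  define b where "b s = indicator {0<..<t} s * (if t \<ge> 1 \<and> s \<le> t / 2 then ennreal (tay_const * time_ratio ^ CARD('n)) * J s
     else ennreal (conv_const * time_ratio ^ CARD('n) * (C * (1 + s) powr (-1 - a))))" for s
  have [measurable]: "\<rho> \<in> borel_measurable borel" unfolding \<rho>_def[abs_def] by measurable
  have [measurable]: "case_prod vT \<in> borel_measurable (borel \<Otimes>\<^sub>M borel)"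
    unfolding vT_def[abs_def] dil_def case_prod_unfold by measurable
  have [measurable]: "case_prod vG \<in> borel_measurable (borel \<Otimes>\<^sub>M borel)"
    unfolding vG_def[abs_def] dil_def case_prod_unfold by measurable
  have [measurable]: "J \<in> borel_measurable borel"
    unfolding J_def[abs_def] by measurable
  have \<rho>: "0 < \<rho> s" "\<rho> s \<le> rad t" if "0 < s" "s < t" for s
    using that d_pos unfolding \<rho>_def rad_def by (auto intro!: powr_mono2)
  have early: "rad t \<le> time_ratio * \<rho> s" if "0 < s" "s < t" "t \<ge> 1" "s \<le> t / 2" for s
    unfolding rad_def \<rho>_def using that by (intro powr_le_time_ratio_mult) auto
  have late: "0 < rad s" "rad s \<le> rad t" "rad t \<le> time_ratio * rad s" if "0 < s" "s < t" "\<not> (t \<ge> 1 \<and> s \<le> t / 2)" for s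
    using that by (auto simp: rad_pos rad_mono) (auto simp: rad_def intro!: powr_le_time_ratio_mult)
  have case_late: "vG x s \<le> ennreal (conv_const * time_ratio ^ CARD('n) * (C * (1 + s) powr (-1 - a)) / rad t ^ CARD('n))"
    "(\<integral>\<^sup>+x. ennreal (wt (rad t) x) * vG x s \<partial>lborel) \<le> ennreal (conv_const * time_ratio ^ CARD('n) * (C * (1 + s) powr (-1 - a)))"
    if "0 < s" "s < t" "\<not> (t \<ge> 1 \<and> s \<le> t / 2)" for x s
    unfolding vG_def using plain_slice[OF borel_srcD(3)[OF Q that(1)] Qs \<rho>[OF that(1,2)] late[OF that]] by auto
  have case_early: "vT x s \<le> ennreal (1 / rad t ^ CARD('n)) * (ennreal (tay_const * time_ratio ^ CARD('n)) * J s)"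
    "(\<integral>\<^sup>+x. ennreal (wt (rad t) x) * vT x s \<partial>lborel) \<le> ennreal (tay_const * time_ratio ^ CARD('n)) * J s"
    if "0 < s" "s < t" "t \<ge> 1" "s \<le> t / 2" for x s
    unfolding vT_def J_def using Tay_slice[OF Qs[of s] \<rho>[OF that(1,2)] early[OF that]] by auto
  show ?thesis
  proof (rule Bd_superpose[where v = v and b = b])
    show "(\<lambda>x. duhamel Q x t) \<in> borel_measurable borel"
    proof -
      have "(\<lambda>x. (\<lambda>(x, t). duhamel Q x t) (x, t)) \<in> borel_measurable borel"
        by (rule measurable_compose[OF _ duhamel_measurable[OF borel_srcD(2)[OF Q]]]) measurable
      then show ?thesis by simp
    qed
    show "case_prod v \<in> borel_measurable (borel \<Otimes>\<^sub>M borel)"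
      unfolding v_def[abs_def] case_prod_unfold by measurable
    show "b \<in> borel_measurable borel" unfolding b_def[abs_def] by measurable
  next
    fix x
    have "ennreal \<bar>duhamel Q x t\<bar> \<le> (\<integral>\<^sup>+s. ennreal \<bar>indicator {0<..<t} s * duhamel_kernel Q x t s\<bar> \<partial>lborel)"
      unfolding duhamel_def by (rule ennreal_abs_integral_le)
    also have "\<dots> \<le> (\<integral>\<^sup>+s. v x s \<partial>lborel)"
    proof (intro nn_integral_mono)
      fix s
      show "ennreal \<bar>indicator {0<..<t} s * duhamel_kernel Q x t s\<bar> \<le> v x s"
      proof (cases "0 < s \<and> s < t")
        case True
        have kG: "ennreal \<bar>duhamel_kernel Q x t s\<bar> \<le> vG x s"
          unfolding duhamel_kernel_def vG_def \<rho>_def by (rule ennreal_abs_integral_le)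
        have "duhamel_kernel Q x t s = (LINT y|lborel. dil (\<rho> s) (\<lambda>x. Tay x (y /\<^sub>R \<rho> s)) x * Q (y, s))"
          unfolding duhamel_kernel_def \<rho>_def[symmetric]
          using True \<rho>[of s] by (intro conv_eq_Tay_conv integrable_slice_moment[OF Q] Q0) auto
        then have "ennreal \<bar>duhamel_kernel Q x t s\<bar> \<le> vT x s"
          unfolding vT_def by (simp only: ennreal_abs_integral_le)
        with kG True show ?thesis by (simp add: v_def)
      qed auto
    qed
    finally show "ennreal \<bar>duhamel Q x t\<bar> \<le> (\<integral>\<^sup>+s. v x s \<partial>lborel)" .
  next
    fix x s
    show "v x s \<le> ennreal (1 / rad t ^ CARD('n)) * b s"
    proof (cases "0 < s \<and> s < t")
      case True
      have "ennreal (conv_const * time_ratio ^ CARD('n) * (C * (1 + s) powr (-1 - a)) / rad t ^ CARD('n))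
        = ennreal (1 / rad t ^ CARD('n)) * ennreal (conv_const * time_ratio ^ CARD('n) * (C * (1 + s) powr (-1 - a)))"
        using r by (subst ennreal_mult'[symmetric]) auto
      then show ?thesis
        using True case_late(1)[of s x] case_early(1)[of s x] by (auto simp: v_def b_def)
    qed (auto simp: v_def)
    show "(\<integral>\<^sup>+x. ennreal (wt (rad t) x) * v x s \<partial>lborel) \<le> b s"
      using case_late(2)[of s] case_early(2)[of s]
      by (cases "0 < s \<and> s < t") (auto simp: v_def b_def)
  next
    \<comment> \<open>In the plain regime \<open>1 + s >= (1 + t) / 2\<close>, whence the factor
      \<open>2^(1 + a)\<close>. Integration over a time interval of length \<open>t <= 1 + t\<close>
      then raises the exponent from \<open>-1 - a\<close> to \<open>-a\<close>.\<close>
    let ?c = "conv_const * time_ratio ^ CARD('n) * C * 2 powr (1 + a) * (1 + t) powr (-1 - a)"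
    have c0: "?c \<ge> 0" using conv_const_nonneg C time_ratio_ge_1 by (intro mult_nonneg_nonneg) auto
    have "(\<integral>\<^sup>+s. b s \<partial>lborel) \<le> (\<integral>\<^sup>+s. ennreal (tay_const * time_ratio ^ CARD('n)) * (indicator {0<..<t} s * J s) + ennreal ?c * indicator {0<..<t} s \<partial>lborel)"
    proof (intro nn_integral_mono)
      fix s
      show "b s \<le> ennreal (tay_const * time_ratio ^ CARD('n)) * (indicator {0<..<t} s * J s) + ennreal ?c * indicator {0<..<t} s"
      proof (cases "0 < s \<and> s < t \<and> \<not> (t \<ge> 1 \<and> s \<le> t / 2)")
        case True
        have "(1 + s) powr (-1 - a) \<le> ((1 + t) / 2) powr (-1 - a)" using True a by (intro powr_mono2') auto
        also have "\<dots> = 2 powr (1 + a) * (1 + t) powr (-1 - a)"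
        proof -
          have "2 powr (-1 - a) * 2 powr (1 + a) = (1::real)" by (simp flip: powr_add)
          then show ?thesis using t by (simp add: powr_divide field_simps)
        qed
        finally have "conv_const * time_ratio ^ CARD('n) * C * (1 + s) powr (-1 - a) \<le> conv_const * time_ratio ^ CARD('n) * C * (2 powr (1 + a) * (1 + t) powr (-1 - a))"
          using conv_const_nonneg C time_ratio_ge_1 by (intro mult_left_mono mult_nonneg_nonneg) auto
        then have "b s \<le> ennreal ?c" using True by (auto simp: b_def mult.assoc intro!: ennreal_leI)
        then show ?thesis using True by (simp add: add_increasing)
      next
        case False
        then show ?thesis by (auto simp: b_def indicator_def intro: add_increasing2)
      qed
    qed
    also have "\<dots> = ennreal (tay_const * time_ratio ^ CARD('n)) * early_mass Q t + ennreal ?c * ennreal t"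
    proof -
      have "(\<integral>\<^sup>+s. ennreal ?c * indicator {0<..<t} s \<partial>lborel) = ennreal ?c * ennreal t"
        using t by (subst nn_integral_cmult_indicator) auto
      moreover have "(\<integral>\<^sup>+s. ennreal (tay_const * time_ratio ^ CARD('n)) * (indicator {0<..<t} s * J s) \<partial>lborel) = ennreal (tay_const * time_ratio ^ CARD('n)) * early_mass Q t"
        unfolding early_mass_def J_def[symmetric] by (intro nn_integral_cmult) measurable
      ultimately show ?thesis by (subst nn_integral_add) auto
    qed
    also have "\<dots> \<le> ennreal (tay_const * time_ratio ^ CARD('n)) * ennreal j + ennreal (?c * (1 + t))"
      using t c0 by (intro add_mono mult_left_mono j) (auto simp: ennreal_mult'[symmetric] intro!: ennreal_leI mult_left_mono)
    also have "\<dots> = ennreal (tay_const * time_ratio ^ CARD('n) * j + ?c * (1 + t))"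
      using t c0 j tay_const_nonneg time_ratio_ge_1 by (subst ennreal_mult[symmetric]) (auto intro!: mult_nonneg_nonneg)
    also have "?c * (1 + t) = conv_const * time_ratio ^ CARD('n) * C * 2 powr (1 + a) * (1 + t) powr (- a)"
      using t powr_mult_base[of "1 + t" "- 1 - a"] by (simp add: mult.assoc mult.commute[of _ "1 + t"])
    finally show "(\<integral>\<^sup>+s. b s \<partial>lborel) \<le> ennreal (tay_const * time_ratio ^ CARD('n) * j + conv_const * time_ratio ^ CARD('n) * C * 2 powr (1 + a) * (1 + t) powr (- a))" .
  qed (use r j tay_const_nonneg conv_const_nonneg C time_ratio_ge_1 in \<open>auto intro!: add_nonneg_nonneg mult_nonneg_nonneg\<close>)
qed

lemma Bd_K_moment:
  assumes q: "Bd r q B" and r: "r > 0"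
  shows "(\<integral>\<^sup>+y. ennreal (norm y powr K * \<bar>q y\<bar>) \<partial>lborel) \<le> ennreal (r powr K * B)"
proof -
  have [measurable]: "q \<in> borel_measurable lebesgue" "wt r \<in> borel_measurable lebesgue"
    using Bd_measurable[OF q] by (auto intro: measurable_completion)
  have "(\<integral>\<^sup>+y. ennreal (norm y powr K * \<bar>q y\<bar>) \<partial>lborel) \<le> (\<integral>\<^sup>+y. ennreal (r powr K) * ennreal (wt r y * \<bar>q y\<bar>) \<partial>lborel)"
  proof (intro nn_integral_mono)
    fix y :: "real^'n"
    have "norm y powr K = r powr K * (norm y / r) powr K" using r by (simp add: powr_divide)
    also have "\<dots> \<le> r powr K * wt r y"
      unfolding wt_def using r K_nonneg by (intro mult_left_mono powr_mono2) auto
    finally have "norm y powr K * \<bar>q y\<bar> \<le> r powr K * wt r y * \<bar>q y\<bar>" by (intro mult_right_mono) auto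
    then show "ennreal (norm y powr K * \<bar>q y\<bar>) \<le> ennreal (r powr K) * ennreal (wt r y * \<bar>q y\<bar>)"
      by (simp add: ennreal_mult'[symmetric] mult.assoc ennreal_leI)
  qed
  also have "\<dots> = (\<integral>\<^sup>+y. ennreal (r powr K) * ennreal (wt r y * \<bar>q y\<bar>) \<partial>lebesgue)" by (simp add: nn_integral_completion)
  also have "\<dots> = ennreal (r powr K) * (\<integral>\<^sup>+y. ennreal (wt r y * \<bar>q y\<bar>) \<partial>lebesgue)"
    by (intro nn_integral_cmult) measurable
  also have "\<dots> \<le> ennreal (r powr K) * ennreal B"
    using Bd_nn[OF q] by (intro mult_left_mono) (simp_all add: nn_integral_completion)
  also have "\<dots> = ennreal (r powr K * B)" by (simp add: ennreal_mult')
  finally show ?thesis .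
qed

lemma borel_src_K_moment:
  assumes Q: "borel_src C a Q" and s: "s > 0"
  shows "(\<integral>\<^sup>+y. ennreal (norm y powr K * \<bar>Q (y, s)\<bar>) \<partial>lborel) \<le> ennreal (C * (1 + s) powr (K / d - a - 1))"
proof -
  have r: "rad s > 0" using s by (simp add: rad_pos)
  have "rad s powr K * (C * (1 + s) powr (-1 - a)) = C * ((1 + s) powr (K / d) * (1 + s) powr (-1 - a))"
    using s by (simp add: rad_powr)
  also have "\<dots> = C * (1 + s) powr (K / d - a - 1)" by (simp add: powr_add[symmetric] algebra_simps)
  finally have eq: "rad s powr K * (C * (1 + s) powr (-1 - a)) = C * (1 + s) powr (K / d - a - 1)" .
  show ?thesis using Bd_K_moment[OF borel_srcD(3)[OF Q s] r] unfolding eq .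
qed

text \<open>Uses only \<open>psi \<rho> <= \<rho>^K\<close>: the factor
  \<open>(1 + t)^(-K/d)\<close> comes out and the time integral of the \<open>K\<close>-th moments
  of the source is left, whose growth decides between power and logarithm.\<close>

lemma early_mass_le:
  assumes Q: "borel_src C a Q" and t: "t > 0"
  shows "early_mass Q t \<le> ennreal (time_ratio powr K * C * (1 + t) powr (- K / d))
     * (\<integral>\<^sup>+s. ennreal (indicator {0<..<t} s * (1 + s) powr (K / d - a - 1)) \<partial>lborel)"
proof -
  have [measurable]: "Q \<in> borel_measurable (borel \<Otimes>\<^sub>M borel)" by (rule borel_srcD(2)[OF Q])
  have C: "C \<ge> 0" using borel_srcD(1)[OF Q] .
  have r: "rad t > 0" using t by (simp add: rad_pos)
  have e: "rad t powr (- K) = (1 + t) powr (- K / d)" using t by (simp add: rad_powr)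
  have "early_mass Q t \<le> (\<integral>\<^sup>+s. ennreal (time_ratio powr K * C * (1 + t) powr (- K / d)) * ennreal (indicator {0<..<t} s * (1 + s) powr (K / d - a - 1)) \<partial>lborel)"
    unfolding early_mass_def
  proof (intro nn_integral_mono)
    fix s
    show "indicator {0<..<t} s * (\<integral>\<^sup>+y. ennreal (psi (time_ratio * norm y / rad t) * \<bar>Q (y, s)\<bar>) \<partial>lborel)
       \<le> ennreal (time_ratio powr K * C * (1 + t) powr (- K / d)) * ennreal (indicator {0<..<t} s * (1 + s) powr (K / d - a - 1))"
    proof (cases "0 < s \<and> s < t")
      case True
      have [measurable]: "(\<lambda>y. Q (y, s)) \<in> borel_measurable borel" by (rule slice_measurable[OF Q])
      have "(\<integral>\<^sup>+y. ennreal (psi (time_ratio * norm y / rad t) * \<bar>Q (y, s)\<bar>) \<partial>lborel)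
        \<le> (\<integral>\<^sup>+y. ennreal (time_ratio powr K * rad t powr (- K)) * ennreal (norm y powr K * \<bar>Q (y, s)\<bar>) \<partial>lborel)"
      proof (intro nn_integral_mono)
        fix y :: "real^'n"
        have "psi (time_ratio * norm y / rad t) \<le> (time_ratio * norm y / rad t) powr K" using r time_ratio_ge_1 by (intro psi_le_powr) auto
        also have "\<dots> = time_ratio powr K * rad t powr (- K) * norm y powr K"
          using r time_ratio_ge_1 by (simp add: powr_mult powr_divide powr_minus_divide)
        finally have "psi (time_ratio * norm y / rad t) * \<bar>Q (y, s)\<bar> \<le> time_ratio powr K * rad t powr (- K) * norm y powr K * \<bar>Q (y, s)\<bar>"
          by (intro mult_right_mono) auto
        then show "ennreal (psi (time_ratio * norm y / rad t) * \<bar>Q (y, s)\<bar>) \<le> ennreal (time_ratio powr K * rad t powr (- K)) * ennreal (norm y powr K * \<bar>Q (y, s)\<bar>)"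
          by (simp add: ennreal_mult'[symmetric] mult.assoc ennreal_leI)
      qed
      also have "\<dots> = ennreal (time_ratio powr K * rad t powr (- K)) * (\<integral>\<^sup>+y. ennreal (norm y powr K * \<bar>Q (y, s)\<bar>) \<partial>lborel)"
        by (intro nn_integral_cmult) measurable
      also have "\<dots> \<le> ennreal (time_ratio powr K * rad t powr (- K)) * ennreal (C * (1 + s) powr (K / d - a - 1))"
        using True by (intro mult_left_mono borel_src_K_moment[OF Q]) auto
      also have "\<dots> = ennreal (time_ratio powr K * C * (1 + t) powr (- K / d)) * ennreal (indicator {0<..<t} s * (1 + s) powr (K / d - a - 1))"
        using True C by (simp add: ennreal_mult'[symmetric] e mult_ac)
      finally show ?thesis using True by simp
    qed simp
  qed
  also have "\<dots> = ennreal (time_ratio powr K * C * (1 + t) powr (- K / d)) * (\<integral>\<^sup>+s. ennreal (indicator {0<..<t} s * (1 + s) powr (K / d - a - 1)) \<partial>lborel)"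
    by (intro nn_integral_cmult) measurable
  finally show ?thesis .
qed

section \<open>Decay classes\<close>

text \<open>Besides the \<open>o\<close> at infinity a bound for all positive times is kept, since
  the error of one step becomes a source of the next and must be controlled from time 0 on.\<close>

definition little :: "(real \<Rightarrow> real) \<Rightarrow> bool" where
  "little E \<longleftrightarrow> (\<exists>C. \<forall>t>0. E t \<le> C * (1 + t) powr (- K / d)) \<and> ((\<lambda>t. (1 + t) powr (K / d) * E t) \<longlongrightarrow> 0) at_top"

text \<open>The alternatives of the theorem as one predicate: decay at rate \<open>b\<close>,
  saturated at \<open>K/d\<close>, with a logarithm at the threshold. Writing
  \<open>1 + ln (1 + t)\<close> keeps the factor at least 1 for small times.\<close>

definition rate :: "real \<Rightarrow> (real \<Rightarrow> real) \<Rightarrow> bool" where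
  "rate b E \<longleftrightarrow> (b < K / d \<longrightarrow> (\<exists>C. \<forall>t>0. E t \<le> C * (1 + t) powr (- b))) \<and>
     (b = K / d \<longrightarrow> (\<exists>C. \<forall>t>0. E t \<le> C * (1 + t) powr (- b) * (1 + ln (1 + t)))) \<and>
     (b > K / d \<longrightarrow> little E)"

lemma little_add:
  assumes "little E" "little E'" shows "little (\<lambda>t. E t + E' t)"
proof -
  obtain C C' where "\<And>t. t > 0 \<Longrightarrow> E t \<le> C * (1 + t) powr (- K / d)" "\<And>t. t > 0 \<Longrightarrow> E' t \<le> C' * (1 + t) powr (- K / d)"
    using assms unfolding little_def by blast
  then have "\<forall>t>0. E t + E' t \<le> (C + C') * (1 + t) powr (- K / d)" by (simp add: distrib_right add_mono)
  moreover have "((\<lambda>t. (1 + t) powr (K / d) * (E t + E' t)) \<longlongrightarrow> 0) at_top"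
    using assms tendsto_add[of "\<lambda>t. (1 + t) powr (K / d) * E t" 0 at_top "\<lambda>t. (1 + t) powr (K / d) * E' t" 0]
    unfolding little_def by (simp add: distrib_left)
  ultimately show ?thesis unfolding little_def by blast
qed

lemma little_cmult:
  assumes "little E" "c \<ge> 0" shows "little (\<lambda>t. c * E t)"
proof -
  obtain C where C: "\<And>t. t > 0 \<Longrightarrow> E t \<le> C * (1 + t) powr (- K / d)"
    using assms unfolding little_def by blast
  have "\<forall>t>0. c * E t \<le> (c * C) * (1 + t) powr (- K / d)"
    using mult_left_mono[OF C assms(2)] by (simp add: mult.assoc)
  moreover have "((\<lambda>t. (1 + t) powr (K / d) * (c * E t)) \<longlongrightarrow> 0) at_top"
    using assms tendsto_mult_right_zero[of "\<lambda>t. (1 + t) powr (K / d) * E t" at_top c]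
    unfolding little_def by (simp add: mult.left_commute)
  ultimately show ?thesis unfolding little_def by blast
qed

lemma little_powr: "a > K / d \<Longrightarrow> little (\<lambda>t. (1 + t) powr (- a))"
  unfolding little_def
proof (intro conjI exI[of _ 1] allI impI)
  assume a: "a > K / d"
  show "(1 + t) powr (- a) \<le> 1 * (1 + t) powr (- K / d)" if "t > 0" for t
    using a that by (simp add: powr_mono)
  have "((\<lambda>t::real. (1 + t) powr (K / d - a)) \<longlongrightarrow> 0) at_top"
    using a by (intro tendsto_neg_powr filterlim_tendsto_add_at_top[OF tendsto_const filterlim_ident]) simp
  then show "((\<lambda>t. (1 + t) powr (K / d) * (1 + t) powr (- a)) \<longlongrightarrow> 0) at_top"
    by (simp add: powr_add[symmetric])
qed

text \<open>The majorant \<open>|n|^K |q|\<close> gives the bound for all times, dominated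
  convergence the \<open>o\<close>. The other two facts translate between this integral and its
  extended nonnegative form.\<close>

lemma little_integral:
  fixes n q :: "'z \<Rightarrow> real"
  assumes [measurable]: "n \<in> borel_measurable M" "q \<in> borel_measurable M" and n: "\<And>z. n z \<ge> 0"
    and int: "integrable M (\<lambda>z. n z powr K * \<bar>q z\<bar>)"
  shows "little (\<lambda>t. LINT z|M. psi (time_ratio * n z / rad t) * \<bar>q z\<bar>)"
    and "\<And>t. t > 0 \<Longrightarrow> (\<integral>\<^sup>+z. ennreal (psi (time_ratio * n z / rad t) * \<bar>q z\<bar>) \<partial>M) = ennreal (LINT z|M. psi (time_ratio * n z / rad t) * \<bar>q z\<bar>)"
    and "\<And>t. t > 0 \<Longrightarrow> (LINT z|M. psi (time_ratio * n z / rad t) * \<bar>q z\<bar>) \<ge> 0"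
proof -
  have cc0: "time_ratio \<ge> 0" using time_ratio_ge_1 by simp
  have psi0: "psi (time_ratio * n z / rad t) \<ge> 0" if "t > 0" for t z
    using that cc0 n rad_pos[of t] by (intro psi_nonneg) auto
  have le: "psi (time_ratio * n z / rad t) * \<bar>q z\<bar> \<le> time_ratio powr K * (1 + t) powr (- K / d) * (n z powr K * \<bar>q z\<bar>)" if t: "t > 0" for t z
  proof -
    have r: "rad t > 0" using t by (simp add: rad_pos)
    have "rad t powr (- K) * (rad t powr K * psi (time_ratio * n z / rad t)) \<le> rad t powr (- K) * (time_ratio powr K * n z powr K)"
      by (intro mult_left_mono psi_scaled_le cc0 r n) auto
    moreover have "rad t powr (- K) * rad t powr K = 1" using r by (simp flip: powr_add)
    ultimately have "psi (time_ratio * n z / rad t) \<le> rad t powr (- K) * (time_ratio powr K * n z powr K)"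
      by (simp add: mult.assoc[symmetric])
    then have "psi (time_ratio * n z / rad t) * \<bar>q z\<bar> \<le> rad t powr (- K) * (time_ratio powr K * n z powr K) * \<bar>q z\<bar>"
      by (intro mult_right_mono) auto
    then show ?thesis using t by (simp add: rad_powr mult_ac)
  qed
  have i: "integrable M (\<lambda>z. psi (time_ratio * n z / rad t) * \<bar>q z\<bar>)" if t: "t > 0" for t
  proof (rule Bochner_Integration.integrable_bound[of M "\<lambda>z. time_ratio powr K * (1 + t) powr (- K / d) * (n z powr K * \<bar>q z\<bar>)"])
    show "AE z in M. norm (psi (time_ratio * n z / rad t) * \<bar>q z\<bar>) \<le> norm (time_ratio powr K * (1 + t) powr (- K / d) * (n z powr K * \<bar>q z\<bar>))"
      using le[OF t] psi0[OF t] by (auto simp: abs_mult)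
  qed (use int in auto)
  { fix t :: real assume t: "t > 0"
    show "(\<integral>\<^sup>+z. ennreal (psi (time_ratio * n z / rad t) * \<bar>q z\<bar>) \<partial>M) = ennreal (LINT z|M. psi (time_ratio * n z / rad t) * \<bar>q z\<bar>)"
      using psi0[OF t] by (intro nn_integral_eq_integral i t) auto
    show "(LINT z|M. psi (time_ratio * n z / rad t) * \<bar>q z\<bar>) \<ge> 0"
      using psi0[OF t] by (intro integral_nonneg_AE) auto }
  show "little (\<lambda>t. LINT z|M. psi (time_ratio * n z / rad t) * \<bar>q z\<bar>)"
    unfolding little_def
  proof (intro conjI exI allI impI)
    fix t :: real assume t: "t > 0"
    have "(LINT z|M. psi (time_ratio * n z / rad t) * \<bar>q z\<bar>) \<le> (LINT z|M. time_ratio powr K * (1 + t) powr (- K / d) * (n z powr K * \<bar>q z\<bar>))"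
      using int by (intro integral_mono i t le) auto
    also have "\<dots> = (time_ratio powr K * (1 + t) powr (- K / d)) * (LINT z|M. n z powr K * \<bar>q z\<bar>)"
      by (rule integral_mult_right_zero)
    finally show "(LINT z|M. psi (time_ratio * n z / rad t) * \<bar>q z\<bar>) \<le> (time_ratio powr K * (LINT z|M. n z powr K * \<bar>q z\<bar>)) * (1 + t) powr (- K / d)"
      by (simp only: mult_ac)
  next
    have "\<forall>\<^sub>F t in at_top. rad t powr K * (LINT z|M. psi (time_ratio * n z / rad t) * \<bar>q z\<bar>) = (1 + t) powr (K / d) * (LINT z|M. psi (time_ratio * n z / rad t) * \<bar>q z\<bar>)"
      using eventually_gt_at_top[of 0] by eventually_elim (simp add: rad_powr)
    then show "((\<lambda>t. (1 + t) powr (K / d) * (LINT z|M. psi (time_ratio * n z / rad t) * \<bar>q z\<bar>)) \<longlongrightarrow> 0) at_top"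
      using psi_scaled_integral_tendsto[OF assms(1,2) n int cc0 rad_at_top] by (rule Lim_transform_eventually[rotated])
  qed
qed

text \<open>The cases follow the sign of \<open>K/d - a\<close>. If \<open>a > K/d\<close>, the
  function \<open>|y|^K |Q|\<close> is integrable over space-time, so dominated convergence acts in
  space and time at once and yields \<open>o\<close>; otherwise only the crude bound on
  \<open>early_mass\<close> is available.\<close>

lemma duhamel_rate:
  assumes Q: "borel_src C a Q" and a: "a > 0"
    and Q0: "\<And>s \<alpha>. s > 0 \<Longrightarrow> \<alpha> \<in> mi_le K \<Longrightarrow> (LINT y|lborel. mi_power y \<alpha> * Q (y, s)) = 0"
  obtains E where "\<And>t. t > 0 \<Longrightarrow> Bd (rad t) (\<lambda>x. duhamel Q x t) (E t)" "rate a E"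
proof -
  have [measurable]: "Q \<in> borel_measurable (borel \<Otimes>\<^sub>M borel)" by (rule borel_srcD(2)[OF Q])
  have C: "C \<ge> 0" using borel_srcD(1)[OF Q] .
  define c1 where "c1 = tay_const * time_ratio ^ CARD('n)"
  define c2 where "c2 = conv_const * time_ratio ^ CARD('n) * C * 2 powr (1 + a)"
  define c3 where "c3 = time_ratio powr K * C"
  have c: "c1 \<ge> 0" "c2 \<ge> 0" "c3 \<ge> 0"
    unfolding c1_def c2_def c3_def using tay_const_nonneg conv_const_nonneg C time_ratio_ge_1 by auto
  have Bd: "Bd (rad t) (\<lambda>x. duhamel Q x t) (c1 * j + c2 * (1 + t) powr (- a))" if "t > 0" "early_mass Q t \<le> ennreal j" "j \<ge> 0" for t j
    using duhamel_Bd[OF Q a that(1) Q0 that(2,3)] by (simp add: c1_def c2_def)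
  have early_mass: "early_mass Q t \<le> ennreal (c3 * (1 + t) powr (- K / d) * I)"
    if "t > 0" "(\<integral>\<^sup>+s. ennreal (indicator {0<..<t} s * (1 + s) powr (K / d - a - 1)) \<partial>lborel) \<le> ennreal I" "I \<ge> 0" for t I
  proof -
    have "early_mass Q t \<le> ennreal (c3 * (1 + t) powr (- K / d)) * ennreal I"
      unfolding c3_def by (rule order_trans[OF early_mass_le[OF Q that(1)]]) (intro mult_left_mono that, simp)
    also have "\<dots> = ennreal (c3 * (1 + t) powr (- K / d) * I)" using c that by (subst ennreal_mult[symmetric]) auto
    finally show ?thesis .
  qed
  consider "a < K / d" | "a = K / d" | "a > K / d" by linarith
  then show ?thesis
  proof cases
    case 1
    define c4 where "c4 = c1 * (c3 / (K / d - a)) + c2"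
    show ?thesis
    proof (rule that[of "\<lambda>t. c4 * (1 + t) powr (- a)"])
      fix t :: real assume t: "t > 0"
      have "early_mass Q t \<le> ennreal (c3 * (1 + t) powr (- K / d) * ((1 + t) powr (K / d - a) / (K / d - a)))"
        using 1 t nn_integral_one_plus_powr(1)[of t "K / d - a"] by (intro early_mass) auto
      also have "c3 * (1 + t) powr (- K / d) * ((1 + t) powr (K / d - a) / (K / d - a)) = c3 / (K / d - a) * ((1 + t) powr (- K / d) * (1 + t) powr (K / d - a))"
        by simp
      also have "(1 + t) powr (- K / d) * (1 + t) powr (K / d - a) = (1 + t) powr (- a)" by (simp flip: powr_add)
      finally have "Bd (rad t) (\<lambda>x. duhamel Q x t) (c1 * (c3 / (K / d - a) * (1 + t) powr (- a)) + c2 * (1 + t) powr (- a))"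
        using c 1 t by (intro Bd) auto
      then show "Bd (rad t) (\<lambda>x. duhamel Q x t) (c4 * (1 + t) powr (- a))" by (simp add: c4_def distrib_right mult.assoc)
    qed (use 1 in \<open>auto simp: rate_def\<close>)
  next
    case 2
    define c4 where "c4 = c1 * c3 + c2"
    show ?thesis
    proof (rule that[of "\<lambda>t. c4 * (1 + t) powr (- a) * (1 + ln (1 + t))"])
      fix t :: real assume t: "t > 0"
      have "early_mass Q t \<le> ennreal (c3 * (1 + t) powr (- K / d) * ln (1 + t))"
        using 2 t nn_integral_one_plus_powr(2)[of t "K / d - a"] by (intro early_mass) auto
      then have "Bd (rad t) (\<lambda>x. duhamel Q x t) (c1 * (c3 * (1 + t) powr (- K / d) * ln (1 + t)) + c2 * (1 + t) powr (- a))"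
        using c t by (intro Bd) auto
      then show "Bd (rad t) (\<lambda>x. duhamel Q x t) (c4 * (1 + t) powr (- a) * (1 + ln (1 + t)))"
      proof (rule Bd_mono)
        have "c1 * c3 * (1 + t) powr (- a) * ln (1 + t) + c2 * (1 + t) powr (- a) * 1
           \<le> c1 * c3 * (1 + t) powr (- a) * (1 + ln (1 + t)) + c2 * (1 + t) powr (- a) * (1 + ln (1 + t))"
          using c t by (intro add_mono mult_left_mono) auto
        then show "c1 * (c3 * (1 + t) powr (- K / d) * ln (1 + t)) + c2 * (1 + t) powr (- a) \<le> c4 * (1 + t) powr (- a) * (1 + ln (1 + t))"
          using 2 by (simp add: c4_def distrib_right mult.assoc)
      qed (use t in \<open>simp add: rad_pos\<close>)
    qed (use 2 in \<open>auto simp: rate_def\<close>)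
  next
    case 3
    \<comment> \<open>Sources are controlled at positive times only, so the space-time integral is
      cut off there.\<close>
    define q where "q z = indicator {0<..} (snd z) * Q z" for z :: "(real^'n) \<times> real"
    have [measurable]: "q \<in> borel_measurable (borel \<Otimes>\<^sub>M borel)" unfolding q_def[abs_def] by measurable
    have fin: "(\<integral>\<^sup>+z. ennreal (norm (fst z) powr K * \<bar>q z\<bar>) \<partial>(lborel \<Otimes>\<^sub>M lborel)) < \<infinity>"
    proof -
      have "(\<integral>\<^sup>+z. ennreal (norm (fst z) powr K * \<bar>q z\<bar>) \<partial>(lborel \<Otimes>\<^sub>M lborel))
        = (\<integral>\<^sup>+s. (\<integral>\<^sup>+y. ennreal (norm (fst (y, s)) powr K * \<bar>q (y, s)\<bar>) \<partial>lborel) \<partial>lborel)"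
        by (rule lborel_pair.nn_integral_snd[symmetric]) measurable
      also have "\<dots> \<le> (\<integral>\<^sup>+s. ennreal C * ennreal (indicator {0<..} s * (1 + s) powr ((K / d - a) - 1)) \<partial>lborel)"
      proof (intro nn_integral_mono)
        fix s :: real
        show "(\<integral>\<^sup>+y. ennreal (norm (fst (y, s)) powr K * \<bar>q (y, s)\<bar>) \<partial>lborel) \<le> ennreal C * ennreal (indicator {0<..} s * (1 + s) powr ((K / d - a) - 1))"
          using borel_src_K_moment[OF Q, of s] C by (cases "s > 0") (auto simp: q_def ennreal_mult'[symmetric])
      qed
      also have "\<dots> = ennreal C * (\<integral>\<^sup>+s. ennreal (indicator {0<..} s * (1 + s) powr ((K / d - a) - 1)) \<partial>lborel)"
        by (intro nn_integral_cmult) measurable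
      also have "\<dots> \<le> ennreal C * ennreal ((1 + 0) powr (K / d - a) / - (K / d - a))"
        using 3 by (intro mult_left_mono nn_integral_one_plus_powr(3)) auto
      also have "\<dots> < \<infinity>" by (simp add: ennreal_mult_less_top)
      finally show ?thesis .
    qed
    have int: "integrable (lborel \<Otimes>\<^sub>M lborel) (\<lambda>z. norm (fst z) powr K * \<bar>q z\<bar>)"
      using fin by (intro integrableI_bounded) (auto simp: abs_mult)
    have qm: "(\<lambda>z. norm (fst z)) \<in> borel_measurable ((lborel :: (real^'n) measure) \<Otimes>\<^sub>M (lborel :: real measure))" "q \<in> borel_measurable (lborel \<Otimes>\<^sub>M lborel)" by measurable
    define j where "j t = (LINT z|(lborel \<Otimes>\<^sub>M lborel). psi (time_ratio * norm (fst z) / rad t) * \<bar>q z\<bar>)" for t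
    note LI = little_integral[OF qm norm_ge_zero int, folded j_def]
    show ?thesis
    proof (rule that[of "\<lambda>t. c1 * j t + c2 * (1 + t) powr (- a)"])
      fix t :: real assume t: "t > 0"
      have "early_mass Q t \<le> (\<integral>\<^sup>+s. (\<integral>\<^sup>+y. ennreal (psi (time_ratio * norm (fst (y, s)) / rad t) * \<bar>q (y, s)\<bar>) \<partial>lborel) \<partial>lborel)"
        unfolding early_mass_def by (intro nn_integral_mono) (auto simp: q_def indicator_def)
      also have "\<dots> = (\<integral>\<^sup>+z. ennreal (psi (time_ratio * norm (fst z) / rad t) * \<bar>q z\<bar>) \<partial>(lborel \<Otimes>\<^sub>M lborel))"
        by (rule lborel_pair.nn_integral_snd) measurable
      also have "\<dots> = ennreal (j t)" by (rule LI(2)[OF t])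
      finally show "Bd (rad t) (\<lambda>x. duhamel Q x t) (c1 * j t + c2 * (1 + t) powr (- a))"
        using LI(3)[OF t] t by (intro Bd)
    next
      have "little (\<lambda>t. c1 * j t + c2 * (1 + t) powr (- a))"
        by (intro little_add little_cmult LI(1) little_powr 3 c)
      then show "rate a (\<lambda>t. c1 * j t + c2 * (1 + t) powr (- a))" using 3 by (simp add: rate_def)
    qed
  qed
qed

section \<open>Decay of the linear part\<close>

definition hom :: "(real^'n \<Rightarrow> real) \<Rightarrow> real^'n \<Rightarrow> real \<Rightarrow> real" where
  "hom q x t = (LINT y|lborel. dil (t powr (1 / d)) \<Gamma> (x - y) * q y)"

text \<open>The same division as for the Duhamel term: the Taylor-corrected kernel once its width is
  comparable to \<open>rad t\<close>, and the plain estimate for \<open>t < 1\<close>, where only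
  boundedness is at stake.\<close>

lemma hom_little:
  assumes q: "Bd 1 q B" and qm[measurable]: "q \<in> borel_measurable borel"
    and q0: "\<And>\<alpha>. \<alpha> \<in> mi_le K \<Longrightarrow> (LINT y|lborel. mi_power y \<alpha> * q y) = 0"
  obtains E where "\<And>t. t > 0 \<Longrightarrow> Bd (rad t) (\<lambda>x. hom q x t) (E t)" "little E"
proof -
  have B: "B \<ge> 0" using Bd_nonneg[OF q] .
  have qi: "integrable lborel (\<lambda>y. mi_power y \<alpha> * q y)" if "\<alpha> \<in> mi_le K" for \<alpha>
    using Bd_moment(1)[OF q that] by (subst integrable_completion[symmetric]) auto
  have "(\<integral>\<^sup>+y. ennreal (norm (norm y powr K * \<bar>q y\<bar>)) \<partial>lborel) < \<infinity>"
    using le_less_trans[OF Bd_K_moment[OF q] ennreal_less_top] by (simp add: abs_mult)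
  then have int: "integrable lborel (\<lambda>y. norm y powr K * \<bar>q y\<bar>)"
    by (intro integrableI_bounded) measurable
  define j where "j t = (LINT y|lborel. psi (time_ratio * norm y / rad t) * \<bar>q y\<bar>)" for t
  have nm: "norm \<in> borel_measurable (lborel :: (real^'n) measure)" "q \<in> borel_measurable lborel" by measurable
  note LI = little_integral[OF nm norm_ge_zero int, folded j_def]
  define c1 where "c1 = tay_const * time_ratio ^ CARD('n)"
  define c2 where "c2 = conv_const * time_ratio ^ CARD('n) * B"
  have c: "c1 \<ge> 0" "c2 \<ge> 0" unfolding c1_def c2_def using tay_const_nonneg conv_const_nonneg B time_ratio_ge_1 by auto
  \<comment> \<open>The limit at infinity sees the second branch only; the first is absorbed into
    the bound for all times at the price of a factor \<open>2^(K/d)\<close>.\<close>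
  define E where "E t = (if t < 1 then c2 else c1 * j t)" for t
  have hm: "(\<lambda>x. hom q x t) \<in> borel_measurable borel" for t
    unfolding hom_def dil_def by measurable
  show ?thesis
  proof (rule that[of E])
    fix t :: real assume t: "t > 0"
    have r: "rad t > 0" "1 \<le> rad t" using t by (auto simp: rad_pos rad_ge_1)
    have \<rho>: "0 < t powr (1 / d)" "t powr (1 / d) \<le> rad t"
      using t d_pos by (auto simp: rad_def intro!: powr_mono2)
    show "Bd (rad t) (\<lambda>x. hom q x t) (E t)"
    proof (cases "t < 1")
      case True
      have rc: "rad t \<le> time_ratio * 1" using powr_le_time_ratio_mult[of 1 "1 + t"] True t by (simp add: rad_def)
      note ps = plain_slice[OF q qm \<rho> zero_less_one r(2) rc, folded c2_def]
      have le: "ennreal \<bar>hom q x t\<bar> \<le> (\<integral>\<^sup>+y. ennreal \<bar>dil (t powr (1 / d)) \<Gamma> (x - y) * q y\<bar> \<partial>lborel)" for x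
        unfolding hom_def by (rule ennreal_abs_integral_le)
      have "ennreal \<bar>hom q x t\<bar> \<le> ennreal (c2 / rad t ^ CARD('n))" for x
        by (rule order_trans[OF le ps(1)])
      then have "\<bar>hom q x t\<bar> \<le> c2 / rad t ^ CARD('n)" for x
        using c r by (subst (asm) ennreal_le_iff) auto
      moreover have "(\<integral>\<^sup>+x. ennreal (wt (rad t) x * \<bar>hom q x t\<bar>) \<partial>lborel) \<le> ennreal c2"
        by (rule order_trans[OF _ ps(2)]) (intro nn_integral_mono, simp add: ennreal_mult' mult_left_mono le)
      ultimately show ?thesis using True c hm[of t] unfolding Bd_def E_def by (auto intro: measurable_completion)
    next
      case False
      have rc: "rad t \<le> time_ratio * t powr (1 / d)" unfolding rad_def using False by (intro powr_le_time_ratio_mult) auto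
      have J: "(\<integral>\<^sup>+y. ennreal (psi (time_ratio * norm y / rad t) * \<bar>q y\<bar>) \<partial>lborel) = ennreal (j t)" by (rule LI(2)[OF t])
      have jt: "j t \<ge> 0" by (rule LI(3)[OF t])
      note ts = Tay_slice[OF qm \<rho> rc, folded c1_def, unfolded J]
      have le: "ennreal \<bar>hom q x t\<bar> \<le> (\<integral>\<^sup>+y. ennreal \<bar>dil (t powr (1 / d)) (\<lambda>x. Tay x (y /\<^sub>R t powr (1 / d))) x * q y\<bar> \<partial>lborel)" for x
      proof -
        have "hom q x t = (LINT y|lborel. dil (t powr (1 / d)) (\<lambda>x. Tay x (y /\<^sub>R t powr (1 / d))) x * q y)"
          unfolding hom_def by (rule conv_eq_Tay_conv[OF \<rho>(1) qi q0])
        then show ?thesis by (simp only: ennreal_abs_integral_le)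
      qed
      have "ennreal \<bar>hom q x t\<bar> \<le> ennreal (1 / rad t ^ CARD('n)) * (ennreal c1 * ennreal (j t))" for x
        by (rule order_trans[OF le ts(1)])
      also have "ennreal (1 / rad t ^ CARD('n)) * (ennreal c1 * ennreal (j t)) = ennreal (c1 * j t / rad t ^ CARD('n))"
        using c r jt by (simp add: ennreal_mult'[symmetric])
      finally have "\<bar>hom q x t\<bar> \<le> c1 * j t / rad t ^ CARD('n)" for x
        using c r jt by (subst (asm) ennreal_le_iff) auto
      moreover have "(\<integral>\<^sup>+x. ennreal (wt (rad t) x * \<bar>hom q x t\<bar>) \<partial>lborel) \<le> ennreal (c1 * j t)"
        using order_trans[OF _ ts(2), of "\<integral>\<^sup>+x. ennreal (wt (rad t) x * \<bar>hom q x t\<bar>) \<partial>lborel"] c jt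
        by (simp add: ennreal_mult nn_integral_mono mult_left_mono le)
      ultimately show ?thesis using False c jt hm[of t] unfolding Bd_def E_def by (auto intro: measurable_completion)
    qed
  next
    have L: "little (\<lambda>t. c1 * j t)" by (intro little_cmult LI(1) c)
    then obtain C where C: "\<And>t. t > 0 \<Longrightarrow> c1 * j t \<le> C * (1 + t) powr (- K / d)" unfolding little_def by blast
    have C0: "C \<ge> 0" using C[of 1] LI(3)[of 1] c by (smt (verit) mult_nonneg_nonneg powr_gt_zero zero_le_mult_iff)
    have "E t \<le> (C + c2 * 2 powr (K / d)) * (1 + t) powr (- K / d)" if t: "t > 0" for t
    proof (cases "t < 1")
      case True
      have "2 powr (- (K / d)) \<le> (1 + t) powr (- (K / d))" using True t K_nonneg d_pos by (intro powr_mono2') auto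
      then have "c2 * 2 powr (K / d) * 2 powr (- (K / d)) \<le> c2 * 2 powr (K / d) * (1 + t) powr (- (K / d))"
        using c by (intro mult_left_mono) auto
      moreover have "2 powr (K / d) * 2 powr (- (K / d)) = (1::real)" by (simp flip: powr_add)
      ultimately have "c2 \<le> c2 * 2 powr (K / d) * (1 + t) powr (- (K / d))" by (simp add: mult.assoc)
      then show ?thesis using True C0 by (simp add: E_def distrib_right add_increasing)
    next
      case False
      then show ?thesis using C[OF t] c by (simp add: E_def distrib_right add_increasing2)
    qed
    moreover have "((\<lambda>t. (1 + t) powr (K / d) * E t) \<longlongrightarrow> 0) at_top"
    proof (rule Lim_transform_eventually)
      show "((\<lambda>t. (1 + t) powr (K / d) * (c1 * j t)) \<longlongrightarrow> 0) at_top" using L by (simp add: little_def)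
      show "\<forall>\<^sub>F t in at_top. (1 + t) powr (K / d) * (c1 * j t) = (1 + t) powr (K / d) * E t"
        using eventually_ge_at_top[of 1] by eventually_elim (simp add: E_def)
    qed
    ultimately show "little E" unfolding little_def by blast
  qed
qed

end


context decaying_profile begin

section \<open>Lebesgue norms\<close>

lemma Bd_Linfty:
  assumes h: "Bd r h B" and r: "r > 0"
  shows "h \<in> Lp_space \<infinity>" "Lp_norm \<infinity> h \<le> B / r ^ CARD('n)"
proof -
  have [measurable]: "h \<in> borel_measurable lebesgue" by (rule Bd_measurable[OF h])
  have "AE x in lebesgue. ereal \<bar>h x\<bar> \<le> ereal (B / r ^ CARD('n))"
    using Bd_AE[OF h] by (intro AE_completion) simp
  then have le: "esssup lebesgue (\<lambda>x. ereal \<bar>h x\<bar>) \<le> ereal (B / r ^ CARD('n))"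
    by (intro esssup_I) measurable
  then show "h \<in> Lp_space \<infinity>" unfolding Lp_space_def by (auto intro: le_less_trans)
  have "0 \<le> B / r ^ CARD('n)" using Bd_nonneg[OF h] r by simp
  with le show "Lp_norm \<infinity> h \<le> B / r ^ CARD('n)"
    unfolding Lp_norm_def by (cases "esssup lebesgue (\<lambda>x. ereal \<bar>h x\<bar>)") auto
qed

lemma Bd_L1:
  assumes h: "Bd r h B" and r: "r > 0"
  shows "integrable lebesgue h" "(LINT x|lebesgue. \<bar>h x\<bar>) \<le> B"
proof -
  have [measurable]: "h \<in> borel_measurable lebesgue" by (rule Bd_measurable[OF h])
  have "(\<integral>\<^sup>+x. ennreal (norm (h x)) \<partial>lebesgue) \<le> (\<integral>\<^sup>+x. ennreal (wt r x * \<bar>h x\<bar>) \<partial>lebesgue)"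
  proof (intro nn_integral_mono ennreal_leI)
    fix x show "norm (h x) \<le> wt r x * \<bar>h x\<bar>"
      using mult_right_mono[OF wt_ge_1[OF r, of x], of "\<bar>h x\<bar>"] by simp
  qed
  then have le: "(\<integral>\<^sup>+x. ennreal (norm (h x)) \<partial>lebesgue) \<le> ennreal B"
    using Bd_nn[OF h] by (simp add: nn_integral_completion)
  then show i: "integrable lebesgue h" by (intro integrableI_bounded) (auto intro: le_less_trans)
  have "ennreal (LINT x|lebesgue. \<bar>h x\<bar>) \<le> ennreal B"
    using le nn_integral_eq_integral[OF integrable_abs[OF i]] by simp
  then show "(LINT x|lebesgue. \<bar>h x\<bar>) \<le> B" using Bd_nonneg[OF h] by (simp add: ennreal_le_iff)
qed

text \<open>Interpolation between the endpoints \<open>q = 1\<close> and \<open>q = \<infinity>\<close>.\<close>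

lemma Bd_Lp:
  assumes h: "Bd r h B" and r: "r > 0" and q: "1 \<le> q"
  shows "h \<in> Lp_space q" "Lp_norm q h \<le> B * r powr (- (real CARD('n) * (1 - real_of_ereal (1 / q))))"
proof -
  have hm[measurable]: "h \<in> borel_measurable lebesgue" by (rule Bd_measurable[OF h])
  have B: "B \<ge> 0" by (rule Bd_nonneg[OF h])
  have "h \<in> Lp_space q \<and> Lp_norm q h \<le> B * r powr (- (real CARD('n) * (1 - real_of_ereal (1 / q))))"
  proof (cases q)
    case PInf
    then show ?thesis
      using Bd_Linfty[OF h r] r by (simp add: powr_minus powr_realpow divide_inverse)
  next
    case MInf
    then show ?thesis using q by simp
  next
    case (real p)
    then have p: "p \<ge> 1" using q by (simp add: one_ereal_def)
    define M where "M = (B / r ^ CARD('n)) powr (p - 1)"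
    have ae: "AE x in lebesgue. \<bar>h x\<bar> powr p \<le> M * \<bar>h x\<bar>"
    proof -
      have "AE x in lebesgue. \<bar>h x\<bar> \<le> B / r ^ CARD('n)" using Bd_AE[OF h] by (rule AE_completion)
      then show ?thesis
      proof eventually_elim
        case (elim x)
        have "\<bar>h x\<bar> powr p = \<bar>h x\<bar> powr (p - 1) * \<bar>h x\<bar>"
          using powr_mult_base[of "\<bar>h x\<bar>" "p - 1"] by (simp add: mult.commute)
        also have "\<dots> \<le> M * \<bar>h x\<bar>"
          unfolding M_def using elim p by (intro mult_right_mono powr_mono2) auto
        finally show ?case .
      qed
    qed
    have iM: "integrable lebesgue (\<lambda>x. M * \<bar>h x\<bar>)" using Bd_L1(1)[OF h r] by simp
    have i: "integrable lebesgue (\<lambda>x. \<bar>h x\<bar> powr p)"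
      by (rule Bochner_Integration.integrable_bound[OF iM])
         (measurable, use ae in \<open>auto elim!: eventually_mono intro: order_trans[OF _ abs_ge_self]\<close>)
    have "(LINT x|lebesgue. \<bar>h x\<bar> powr p) \<le> (LINT x|lebesgue. M * \<bar>h x\<bar>)"
      by (rule integral_mono_AE[OF i iM ae])
    also have "\<dots> \<le> M * B" using Bd_L1(2)[OF h r] by (simp add: M_def mult_left_mono)
    also have "M * B = (B * r powr (- (real CARD('n) * (1 - 1 / p)))) powr p"
    proof (cases "B = 0")
      case False
      then have Bp: "B > 0" using B by simp
      have "M * B = (B * B powr (p - 1)) * inverse ((r ^ CARD('n)) powr (p - 1))"
        unfolding M_def using Bp r by (simp add: powr_divide divide_inverse[symmetric])
      also have "\<dots> = B powr p * (r ^ CARD('n)) powr (- (p - 1))"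
        unfolding powr_minus using Bp powr_mult_base[of B "p - 1"] by simp
      also have "(r ^ CARD('n)) powr (- (p - 1)) = r powr (- (real CARD('n) * (1 - 1 / p)) * p)"
      proof -
        have "real CARD('n) * - (p - 1) = - (real CARD('n) * (1 - 1 / p)) * p" using p by (simp add: field_simps)
        then show ?thesis using r by (simp only: powr_realpow[symmetric] powr_powr)
      qed
      finally show ?thesis using Bp r by (simp add: powr_mult powr_powr)
    qed (use p in simp)
    finally have "(LINT x|lebesgue. \<bar>h x\<bar> powr p) powr (1 / p) \<le> ((B * r powr (- (real CARD('n) * (1 - 1 / p)))) powr p) powr (1 / p)"
      using p by (intro powr_mono2) (auto intro: integral_nonneg_AE)
    also have "\<dots> = B * r powr (- (real CARD('n) * (1 - 1 / p)))"
      using p B by (simp add: powr_powr)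
    finally have "(LINT x|lebesgue. \<bar>h x\<bar> powr p) powr (1 / p) \<le> B * r powr (- (real CARD('n) * (1 - 1 / p)))" .
    moreover have "real_of_ereal (1 / ereal p) = 1 / p" using p by (simp add: one_ereal_def)
    ultimately show ?thesis
      using real i by (simp add: Lp_space_def Lp_norm_def)
  qed
  then show "h \<in> Lp_space q" "Lp_norm q h \<le> B * r powr (- (real CARD('n) * (1 - real_of_ereal (1 / q))))" by auto
qed

lemma Bd_L1w:
  assumes h: "Bd r h B" and r: "r \<ge> 1" and l: "0 \<le> l" "l \<le> K"
  shows "h \<in> L1w_space l" "L1w_norm l h \<le> 2 * B * r powr l"
proof -
  have hm[measurable]: "h \<in> borel_measurable lebesgue" by (rule Bd_measurable[OF h])
  have B: "B \<ge> 0" by (rule Bd_nonneg[OF h])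
  have [measurable]: "wt r \<in> borel_measurable lebesgue" "(\<lambda>x::real^'n. norm x) \<in> borel_measurable lebesgue"
    by (auto intro!: measurable_completion)
  \<comment> \<open>The constant 1 and the power \<open>|x|^l\<close> are each at most
    \<open>r^l\<close> times the weight, as \<open>r >= 1\<close> and \<open>l <= K\<close>; their
    sum explains the factor 2.\<close>
  have w: "1 + norm x powr l \<le> 2 * r powr l * wt r x" for x :: "real^'n"
  proof -
    have rl: "r powr l \<ge> 1" using r l by (intro ge_one_powr_ge_zero) auto
    have "norm x powr l = r powr l * (norm x / r) powr l" using r by (simp add: powr_divide)
    also have "\<dots> \<le> r powr l * (1 + norm x / r) powr l" using r l by (intro mult_left_mono powr_mono2) auto
    also have "\<dots> \<le> r powr l * wt r x" unfolding wt_def using r l by (intro mult_left_mono powr_mono) auto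
    finally have "norm x powr l \<le> r powr l * wt r x" .
    moreover have "1 * 1 \<le> r powr l * wt r x" using rl wt_ge_1[of r x] r by (intro mult_mono) auto
    ultimately show ?thesis by simp
  qed
  have "(\<integral>\<^sup>+x. ennreal (norm (\<bar>h x\<bar> * (1 + norm x powr l))) \<partial>lebesgue) \<le> (\<integral>\<^sup>+x. ennreal (2 * r powr l) * ennreal (wt r x * \<bar>h x\<bar>) \<partial>lebesgue)"
  proof (intro nn_integral_mono)
    fix x :: "real^'n"
    have "\<bar>h x\<bar> * (1 + norm x powr l) \<le> \<bar>h x\<bar> * (2 * r powr l * wt r x)" by (intro mult_left_mono w) auto
    then show "ennreal (norm (\<bar>h x\<bar> * (1 + norm x powr l))) \<le> ennreal (2 * r powr l) * ennreal (wt r x * \<bar>h x\<bar>)"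
      by (simp add: ennreal_mult'[symmetric] abs_mult mult_ac ennreal_leI)
  qed
  also have "\<dots> = ennreal (2 * r powr l) * (\<integral>\<^sup>+x. ennreal (wt r x * \<bar>h x\<bar>) \<partial>lebesgue)"
    by (intro nn_integral_cmult) measurable
  also have "\<dots> \<le> ennreal (2 * r powr l) * ennreal B"
    using Bd_nn[OF h] by (intro mult_left_mono) (simp_all add: nn_integral_completion)
  also have "\<dots> = ennreal (2 * B * r powr l)" by (subst ennreal_mult'[symmetric]) (auto simp: mult_ac)
  finally have le: "(\<integral>\<^sup>+x. ennreal (norm (\<bar>h x\<bar> * (1 + norm x powr l))) \<partial>lebesgue) \<le> ennreal (2 * B * r powr l)" .
  then have i: "integrable lebesgue (\<lambda>x. \<bar>h x\<bar> * (1 + norm x powr l))"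
    by (intro integrableI_bounded) (auto intro: le_less_trans)
  then show "h \<in> L1w_space l" by (simp add: L1w_space_def)
  have "ennreal (L1w_norm l h) \<le> ennreal (2 * B * r powr l)"
    using le nn_integral_eq_integral[OF i] by (simp add: L1w_norm_def)
  then show "L1w_norm l h \<le> 2 * B * r powr l" using B by (simp add: ennreal_le_iff)
qed

lemma Lp_norm_nonneg: "Lp_norm q h \<ge> 0" if "h \<in> borel_measurable lebesgue" for h :: "real^'n \<Rightarrow> real"
proof (cases "q = \<infinity>")
  case True
  have "0 \<le> esssup lebesgue (\<lambda>x::real^'n. ereal \<bar>h x\<bar>)"
  proof -
    have "esssup lebesgue (\<lambda>x::real^'n. 0::ereal) \<le> esssup lebesgue (\<lambda>x. ereal \<bar>h x\<bar>)"
      by (intro esssup_mono) auto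
    moreover have "emeasure lebesgue (UNIV :: (real^'n) set) \<noteq> 0" by simp
    ultimately show ?thesis by (simp add: esssup_const)
  qed
  then show ?thesis using True by (simp add: Lp_norm_def real_of_ereal_pos)
qed (simp add: Lp_norm_def)

lemma L1w_norm_nonneg: "L1w_norm l h \<ge> 0"
  unfolding L1w_norm_def by (intro integral_nonneg_AE) auto

lemma Linfty_AE:
  assumes "h \<in> Lp_space \<infinity>" "Lp_norm \<infinity> h \<le> c"
  shows "AE x in lborel. \<bar>h x\<bar> \<le> c"
proof -
  have f: "esssup lebesgue (\<lambda>x. ereal \<bar>h x\<bar>) < \<infinity>" using assms(1) by (simp add: Lp_space_def)
  have "AE x in lebesgue. ereal \<bar>h x\<bar> \<le> esssup lebesgue (\<lambda>x. ereal \<bar>h x\<bar>)" by (rule esssup_AE)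
  then have "AE x in lebesgue. \<bar>h x\<bar> \<le> c"
    using assms(2) f unfolding Lp_norm_def
    by (cases "esssup lebesgue (\<lambda>x. ereal \<bar>h x\<bar>)") (auto elim: eventually_mono)
  then show ?thesis by (simp add: AE_completion_iff)
qed

text \<open>Converse to the norm bounds above: \<open>wt r\<close> is at most
  \<open>2^K (1 + (|x|/r)^K)\<close>, so the sup norm and the weighted norms of orders 0 and
  \<open>K\<close> determine a bound. The maxima with 0 keep the constant nonnegative whatever signs
  the given bounds have.\<close>

lemma BdI_norms:
  assumes r: "r \<ge> 1" and h: "h \<in> Lp_space \<infinity>" "h \<in> L1w_space 0" "h \<in> L1w_space K"
    and c: "Lp_norm \<infinity> h \<le> c1 / r ^ CARD('n)" "L1w_norm 0 h \<le> c2" "L1w_norm K h \<le> c3 * r powr K"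
  shows "Bd r h (max 0 c1 + 2 powr K * (max 0 c2 + max 0 c3))"
proof -
  let ?B = "max 0 c1 + 2 powr K * (max 0 c2 + max 0 c3)"
  have [measurable]: "h \<in> borel_measurable lebesgue" using h by (simp add: Lp_space_def)
  have r0: "r > 0" using r by simp
  have "c1 / r ^ CARD('n) \<le> ?B / r ^ CARD('n)"
    using r by (intro divide_right_mono) (auto intro: add_increasing2 add_nonneg_nonneg)
  with Linfty_AE[OF h(1) c(1)] have ae: "AE x in lborel. \<bar>h x\<bar> \<le> ?B / r ^ CARD('n)"
    by (auto elim: eventually_mono)
  have nn: "(\<integral>\<^sup>+x. ennreal (\<bar>h x\<bar> * (1 + norm x powr l)) \<partial>lebesgue) = ennreal (L1w_norm l h)" if "h \<in> L1w_space l" for l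
    unfolding L1w_norm_def using that by (intro nn_integral_eq_integral) (auto simp: L1w_space_def)
  have [measurable]: "(\<lambda>x::real^'n. norm x) \<in> borel_measurable lebesgue"
    by (auto intro!: measurable_completion)
  have "(\<integral>\<^sup>+x. ennreal (wt r x * \<bar>h x\<bar>) \<partial>lborel) = (\<integral>\<^sup>+x. ennreal (wt r x * \<bar>h x\<bar>) \<partial>lebesgue)"
    by (simp add: nn_integral_completion)
  also have "\<dots> \<le> (\<integral>\<^sup>+x. ennreal (2 powr K) * ennreal (\<bar>h x\<bar> * (1 + norm x powr 0)) + ennreal (2 powr K / r powr K) * ennreal (\<bar>h x\<bar> * (1 + norm x powr K)) \<partial>lebesgue)"
  proof (intro nn_integral_mono)
    fix x :: "real^'n"
    have "wt r x \<le> 2 powr K * (1 + (norm x / r) powr K)"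
      unfolding wt_def using r K_nonneg by (intro powr_one_plus_le) auto
    also have "\<dots> = 2 powr K + 2 powr K / r powr K * norm x powr K" using r by (simp add: powr_divide distrib_left)
    also have "\<dots> \<le> 2 powr K * (1 + norm x powr 0) + 2 powr K / r powr K * (1 + norm x powr K)"
      by (intro add_mono mult_left_mono) (auto simp: distrib_left)
    finally have "wt r x * \<bar>h x\<bar> \<le> (2 powr K * (1 + norm x powr 0) + 2 powr K / r powr K * (1 + norm x powr K)) * \<bar>h x\<bar>"
      by (intro mult_right_mono) auto
    moreover have eqr: "ennreal a * ennreal (\<bar>h x\<bar> * v) + ennreal b * ennreal (\<bar>h x\<bar> * w) = ennreal ((a * v + b * w) * \<bar>h x\<bar>)"
      if "a \<ge> 0" "b \<ge> 0" "v \<ge> 0" "w \<ge> 0" for a b v w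
      using that by (simp add: ennreal_mult[symmetric] ennreal_plus[symmetric] algebra_simps del: ennreal_plus)
    have "ennreal (2 powr K) * ennreal (\<bar>h x\<bar> * (1 + norm x powr 0)) + ennreal (2 powr K / r powr K) * ennreal (\<bar>h x\<bar> * (1 + norm x powr K))
      = ennreal ((2 powr K * (1 + norm x powr 0) + 2 powr K / r powr K * (1 + norm x powr K)) * \<bar>h x\<bar>)"
      by (rule eqr) auto
    ultimately show "ennreal (wt r x * \<bar>h x\<bar>) \<le> ennreal (2 powr K) * ennreal (\<bar>h x\<bar> * (1 + norm x powr 0)) + ennreal (2 powr K / r powr K) * ennreal (\<bar>h x\<bar> * (1 + norm x powr K))"
      by (simp only: ennreal_leI)
  qed
  also have "\<dots> = ennreal (2 powr K) * ennreal (L1w_norm 0 h) + ennreal (2 powr K / r powr K) * ennreal (L1w_norm K h)"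
    unfolding nn[OF h(2), symmetric] nn[OF h(3), symmetric]
    by (subst nn_integral_add, measurable, subst (1 2) nn_integral_cmult, measurable)
  also have "\<dots> \<le> ennreal (2 powr K) * ennreal (max 0 c2) + ennreal (2 powr K / r powr K) * ennreal (max 0 c3 * r powr K)"
  proof (intro add_mono mult_left_mono ennreal_leI)
    show "L1w_norm 0 h \<le> max 0 c2" using c(2) by simp
    have "c3 * r powr K \<le> max 0 c3 * r powr K" by (intro mult_right_mono) auto
    with c(3) show "L1w_norm K h \<le> max 0 c3 * r powr K" by simp
  qed auto
  also have "\<dots> = ennreal (2 powr K * (max 0 c2 + max 0 c3))"
    using r0 by (simp add: ennreal_mult'[symmetric] ennreal_plus[symmetric] distrib_left del: ennreal_plus)
  also have "\<dots> \<le> ennreal ?B" by (intro ennreal_leI) simp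
  finally show ?thesis unfolding Bd_def using ae by (auto intro!: add_nonneg_nonneg)
qed

lemma Bd_1_of_spaces:
  assumes "h \<in> Lp_space \<infinity> \<inter> L1w_space K" obtains B where "Bd 1 h B"
proof -
  have hm[measurable]: "h \<in> borel_measurable lebesgue" using assms by (simp add: Lp_space_def)
  have [measurable]: "(\<lambda>x::real^'n. norm x) \<in> borel_measurable lebesgue"
    by (auto intro!: measurable_completion)
  have i: "integrable lebesgue (\<lambda>x. \<bar>h x\<bar> * (1 + norm x powr K))" using assms by (simp add: L1w_space_def)
  have "integrable lebesgue (\<lambda>x. \<bar>h x\<bar> * (1 + norm x powr 0))"
  proof (rule Bochner_Integration.integrable_bound[of _ "\<lambda>x. 2 * (\<bar>h x\<bar> * (1 + norm x powr K))"])
    show "AE x in lebesgue. norm (\<bar>h x\<bar> * (1 + norm x powr 0)) \<le> norm (2 * (\<bar>h x\<bar> * (1 + norm x powr K)))"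
    proof (rule AE_I2)
      fix x :: "real^'n"
      have "\<bar>h x\<bar> * (1 + norm x powr 0) \<le> \<bar>h x\<bar> * (2 * (1 + norm x powr K))" by (intro mult_left_mono) auto
      then show "norm (\<bar>h x\<bar> * (1 + norm x powr 0)) \<le> norm (2 * (\<bar>h x\<bar> * (1 + norm x powr K)))"
        by (simp add: abs_mult mult_ac)
    qed
  qed (simp add: i, measurable)
  then have "h \<in> L1w_space 0" by (simp add: L1w_space_def)
  then show ?thesis using assms that BdI_norms[of 1 h "Lp_norm \<infinity> h" "L1w_norm 0 h" "L1w_norm K h"] by auto
qed

end

context self_similar_kernel begin

section \<open>Representation of the integrals in space-time\<close>

definition moment_integral :: "((real^'n) \<times> real \<Rightarrow> real) \<Rightarrow> 'n multi_index \<Rightarrow> real \<Rightarrow> real" where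
  "moment_integral H \<alpha> t = (LINT s|lborel. indicator {0<..<t} s * moment G \<alpha> (\<lambda>y. H (y, s)) s)"

lemma moment_indicator_measurable:
  assumes "borel_src C a H" "\<alpha> \<in> mi_le K"
  shows "(\<lambda>s. indicator {0<..<t} s * moment G \<alpha> (\<lambda>y. H (y, s)) s) \<in> borel_measurable borel"
proof -
  have "(\<lambda>s. indicator {..<t} s * (indicator {0<..} s * moment G \<alpha> (\<lambda>y. H (y, s)) s)) \<in> borel_measurable borel"
    by (intro borel_measurable_times moment_src_measurable[OF assms]) measurable
  moreover have "indicator {..<t} s * (indicator {0<..} s * moment G \<alpha> (\<lambda>y. H (y, s)) s) = indicator {0<..<t} s * moment G \<alpha> (\<lambda>y. H (y, s)) s" for s
    by (auto simp: indicator_def)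
  ultimately show ?thesis by simp
qed

lemma rep_set_moment:
  assumes H: "borel_src C a H" and h: "rep h H" and al: "\<alpha> \<in> mi_le K"
  shows "(LINT s:{0<..<t}|lebesgue. moment G \<alpha> (\<lambda>y. h y s) s) = moment_integral H \<alpha> t"
  unfolding set_lebesgue_integral_def moment_integral_def
proof (rule lebesgue_integral_cong_lborel(2)[OF moment_indicator_measurable[OF H al]])
  show "AE s in lborel. indicat_real {0<..<t} s *\<^sub>R moment G \<alpha> (\<lambda>y. h y s) s = indicat_real {0<..<t} s * moment G \<alpha> (\<lambda>y. H (y, s)) s"
    using rep_slices[OF H h] by eventually_elim (auto simp: indicator_def)
qed

lemma G_kern: "s < t \<Longrightarrow> (LINT y|lborel. G (x - y) (t - s) * H (y, s)) = duhamel_kernel H x t s"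
  by (simp add: duhamel_kernel_def G_dil)

lemma duhamel_integrand_measurable:
  assumes "borel_src C a H"
  shows "(\<lambda>s. indicator {0<..<t} s * duhamel_kernel H x t s) \<in> borel_measurable borel"
proof -
  have [measurable]: "H \<in> borel_measurable (borel \<Otimes>\<^sub>M borel)" by (rule borel_srcD(2)[OF assms])
  have "(\<lambda>s. duhamel_kernel H x t s) \<in> borel_measurable borel"
    unfolding duhamel_kernel_def dil_def by measurable
  then show ?thesis by measurable
qed

lemma rep_set_semigroup:
  assumes H: "borel_src C a H" and h: "rep h H"
  shows "(LINT s:{0<..<t}|lebesgue. kernel_semigroup G (t - s) (\<lambda>y. h y s) x) = duhamel H x t"
  unfolding set_lebesgue_integral_def duhamel_def
proof (rule lebesgue_integral_cong_lborel(2)[OF duhamel_integrand_measurable[OF H]])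
  show "AE s in lborel. indicat_real {0<..<t} s *\<^sub>R kernel_semigroup G (t - s) (\<lambda>y. h y s) x = indicat_real {0<..<t} s * duhamel_kernel H x t s"
    using rep_slices[OF H h] by eventually_elim (auto simp: indicator_def G_kern)
qed

lemma rep_proj:
  assumes H: "borel_src C a H" and h: "rep h H"
  shows "rep (\<lambda>y s. proj_P G K s (\<lambda>y. h y s) y) (proj_src H)"
  unfolding rep_def
  using rep_slices[OF H h] h[unfolded rep_def]
proof (eventually_elim, intro impI)
  fix s :: real
  assume 1: "s > 0 \<longrightarrow> Bd (rad s) (\<lambda>y. h y s) (C * (1 + s) powr (-1 - a)) \<and>
     (\<forall>\<alpha>. moment G \<alpha> (\<lambda>y. h y s) s = moment G \<alpha> (\<lambda>y. H (y, s)) s) \<and>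
     (\<forall>t>s. \<forall>x. kernel_semigroup G (t - s) (\<lambda>y. h y s) x = (LINT y|lborel. G (x - y) (t - s) * H (y, s)))"
    and 2: "s > 0 \<longrightarrow> (AE y in lborel. h y s = H (y, s))" and s: "s > 0"
  have ae: "AE y in lborel. h y s = H (y, s)" using 2 s by blast
  have m: "moment G \<alpha> (\<lambda>y. h y s) s = moment G \<alpha> (\<lambda>y. H (y, s)) s" for \<alpha> using 1 s by blast
  show "AE y in lborel. proj_P G K s (\<lambda>y. h y s) y = proj_src H (y, s)"
    using ae by eventually_elim (simp add: proj_src_def proj_P_def m s)
qed

lemma moment_integrable:
  assumes H: "borel_src C a H" and a: "a \<ge> 0" and al: "\<alpha> \<in> mi_le K"
  shows "integrable lborel (\<lambda>s. indicator {0<..<t} s * moment G \<alpha> (\<lambda>y. H (y, s)) s)"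
proof (rule Bochner_Integration.integrable_bound[of lborel "\<lambda>s. moment_const * C * (1 + \<bar>t\<bar>) powr (real (mi_abs \<alpha>) / d) * indicator {0<..<t} s"])
  show "integrable lborel (\<lambda>s. moment_const * C * (1 + \<bar>t\<bar>) powr (real (mi_abs \<alpha>) / d) * indicator {0<..<t} s)"
    by (intro integrable_mult_right integrable_real_indicator; cases "0 \<le> t") auto
  show "AE s in lborel. norm (indicator {0<..<t} s * moment G \<alpha> (\<lambda>y. H (y, s)) s)
    \<le> norm (moment_const * C * (1 + \<bar>t\<bar>) powr (real (mi_abs \<alpha>) / d) * indicator {0<..<t} s)"
  proof (rule AE_I2)
    fix s
    show "norm (indicator {0<..<t} s * moment G \<alpha> (\<lambda>y. H (y, s)) s)
      \<le> norm (moment_const * C * (1 + \<bar>t\<bar>) powr (real (mi_abs \<alpha>) / d) * indicator {0<..<t} s)"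
    proof (cases "0 < s \<and> s < t")
      case True
      have "(1 + s) powr (real (mi_abs \<alpha>) / d - 1 - a) \<le> (1 + s) powr (real (mi_abs \<alpha>) / d)"
        using True a by (intro powr_mono) auto
      also have "\<dots> \<le> (1 + \<bar>t\<bar>) powr (real (mi_abs \<alpha>) / d)" using True d_pos by (intro powr_mono2) auto
      finally have "moment_const * C * (1 + s) powr (real (mi_abs \<alpha>) / d - 1 - a) \<le> moment_const * C * (1 + \<bar>t\<bar>) powr (real (mi_abs \<alpha>) / d)"
        using moment_const_nonneg borel_srcD(1)[OF H] by (intro mult_left_mono) auto
      then show ?thesis
        using moment_src_bound[OF H al, of s] True moment_const_nonneg borel_srcD(1)[OF H] by (simp add: abs_mult)
    qed auto
  qed
qed (use moment_indicator_measurable[OF H al] in simp)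

text \<open>\<open>e^((t-s)L)\<close> maps \<open>g_\<alpha>\<close> at time \<open>s\<close> to
  \<open>g_\<alpha>\<close> at time \<open>t\<close>, so the subtracted terms reappear with a
  spatial factor that no longer depends on \<open>s\<close>.\<close>

lemma duhamel_kernel_proj:
  assumes H: "borel_src C a H" and a: "a \<ge> 0" and s: "0 < s" "s < t"
  shows "duhamel_kernel (proj_src H) x t s = duhamel_kernel H x t s - (\<Sum>\<alpha>\<in>mi_le K. moment G \<alpha> (\<lambda>y. H (y, s)) s * g_fun G \<alpha> x t)"
proof -
  let ?\<rho> = "(t - s) powr (1 / d)"
  have ig: "integrable lborel (\<lambda>y. dil ?\<rho> \<Gamma> (x - y) * g_fun G \<alpha> y s)" if "\<alpha> \<in> mi_le K" for \<alpha>
  proof (rule integrable_bounded_mult)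
    show "(\<lambda>y. dil ?\<rho> \<Gamma> (x - y)) \<in> borel_measurable borel" by measurable
    show "integrable lborel (\<lambda>y. g_fun G \<alpha> y s)"
      using Bd_L1(1)[OF Bd_g[of s \<alpha>]] that s g_measurable[of s \<alpha>]
      by (subst integrable_completion[symmetric]) (auto simp: rad_pos)
    show "\<bar>dil ?\<rho> \<Gamma> (x - y)\<bar> \<le> CB / ?\<rho> ^ CARD('n)" for y
      using Gam_bounded[of "(x - y) /\<^sub>R ?\<rho>"] by (simp add: dil_def abs_divide divide_right_mono)
  qed
  have sg: "(LINT y|lborel. dil ?\<rho> \<Gamma> (x - y) * g_fun G \<alpha> y s) = g_fun G \<alpha> x t" if "\<alpha> \<in> mi_le K" for \<alpha>
    using semigroup_g[of s t \<alpha> x] that s by (simp add: G_dil)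
  have "duhamel_kernel (proj_src H) x t s = (LINT y|lborel. dil ?\<rho> \<Gamma> (x - y) * H (y, s)
     - (\<Sum>\<alpha>\<in>mi_le K. moment G \<alpha> (\<lambda>y. H (y, s)) s * (dil ?\<rho> \<Gamma> (x - y) * g_fun G \<alpha> y s)))"
    unfolding duhamel_kernel_def using s
    by (simp add: proj_src_def proj_P_def right_diff_distrib sum_distrib_left mult.left_commute)
  also have "\<dots> = duhamel_kernel H x t s - (\<Sum>\<alpha>\<in>mi_le K. moment G \<alpha> (\<lambda>y. H (y, s)) s * g_fun G \<alpha> x t)"
    unfolding duhamel_kernel_def using duhamel_kernel_plain(1)[OF H s a, of x] ig
    by (subst Bochner_Integration.integral_diff) (auto simp: Bochner_Integration.integral_sum sg)
  finally show ?thesis .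
qed

text \<open>Since that spatial factor leaves the time integral, the moments integrate to the source
  part of the coefficients \<open>c_\<alpha>\<close>; this ties the profiles to the Duhamel
  term.\<close>

lemma duhamel_proj:
  assumes H: "borel_src C a H" and a: "a \<ge> 0"
  shows "duhamel (proj_src H) x t = duhamel H x t - (\<Sum>\<alpha>\<in>mi_le K. moment_integral H \<alpha> t * g_fun G \<alpha> x t)"
proof -
  have "duhamel (proj_src H) x t = (LINT s|lborel. indicator {0<..<t} s * duhamel_kernel H x t s
     - (\<Sum>\<alpha>\<in>mi_le K. (indicator {0<..<t} s * moment G \<alpha> (\<lambda>y. H (y, s)) s) * g_fun G \<alpha> x t))"
    unfolding duhamel_def
  proof (rule Bochner_Integration.integral_cong[OF refl])
    fix s
    show "indicator {0<..<t} s * duhamel_kernel (proj_src H) x t s = indicator {0<..<t} s * duhamel_kernel H x t s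
     - (\<Sum>\<alpha>\<in>mi_le K. (indicator {0<..<t} s * moment G \<alpha> (\<lambda>y. H (y, s)) s) * g_fun G \<alpha> x t)"
      using duhamel_kernel_proj[OF H a, of s t x] by (cases "0 < s \<and> s < t") auto
  qed
  also have "\<dots> = duhamel H x t - (\<Sum>\<alpha>\<in>mi_le K. moment_integral H \<alpha> t * g_fun G \<alpha> x t)"
    unfolding duhamel_def moment_integral_def
    using duhamel_integrand_integrable[OF H a, of t x] moment_integrable[OF H a]
    by (subst Bochner_Integration.integral_diff) (auto simp: Bochner_Integration.integral_sum)
  finally show ?thesis .
qed

text \<open>The difference of two sources gets a representative of its own, because it decays faster
  than either of them. It agrees with the difference of their representatives only almost
  everywhere, so linearity has to be recovered for the integrals.\<close>

lemma rep_diff: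
  assumes H1: "borel_src C1 a1 H1" "rep h1 H1" and H2: "borel_src C2 a2 H2" "rep h2 H2"
    and H3: "borel_src C3 a3 H3" "rep (\<lambda>y s. h1 y s - h2 y s) H3" and a: "a1 \<ge> 0" "a2 \<ge> 0" "a3 \<ge> 0"
  shows "duhamel H3 x t = duhamel H1 x t - duhamel H2 x t"
    and "\<alpha> \<in> mi_le K \<Longrightarrow> moment_integral H3 \<alpha> t = moment_integral H1 \<alpha> t - moment_integral H2 \<alpha> t"
proof -
  have ae: "AE s in lborel. s > 0 \<longrightarrow> (AE y in lborel. H3 (y, s) = H1 (y, s) - H2 (y, s))"
    using H1(2) H2(2) H3(2) unfolding rep_def
  proof eventually_elim
    case (elim s)
    show ?case
    proof
      assume s: "s > 0"
      from elim s have "AE y in lborel. h1 y s = H1 (y, s)" "AE y in lborel. h2 y s = H2 (y, s)"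
        "AE y in lborel. h1 y s - h2 y s = H3 (y, s)" by auto
      then show "AE y in lborel. H3 (y, s) = H1 (y, s) - H2 (y, s)" by eventually_elim auto
    qed
  qed
  have k: "duhamel_kernel H3 x t s = duhamel_kernel H1 x t s - duhamel_kernel H2 x t s"
    if s: "0 < s" "s < t" and e: "AE y in lborel. H3 (y, s) = H1 (y, s) - H2 (y, s)" for s
  proof -
    note [measurable] = slice_measurable[OF H1(1), of s] slice_measurable[OF H2(1), of s] slice_measurable[OF H3(1), of s]
    have "duhamel_kernel H3 x t s = (LINT y|lborel. dil ((t - s) powr (1 / d)) \<Gamma> (x - y) * H1 (y, s) - dil ((t - s) powr (1 / d)) \<Gamma> (x - y) * H2 (y, s))"
      unfolding duhamel_kernel_def by (rule integral_cong_AE) (measurable, use e in \<open>auto elim!: eventually_mono simp: right_diff_distrib\<close>)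
    then show ?thesis
      unfolding duhamel_kernel_def using duhamel_kernel_plain(1)[OF H1(1) s a(1), of x] duhamel_kernel_plain(1)[OF H2(1) s a(2), of x] by simp
  qed
  have "duhamel H3 x t = (LINT s|lborel. indicator {0<..<t} s * duhamel_kernel H1 x t s - indicator {0<..<t} s * duhamel_kernel H2 x t s)"
    unfolding duhamel_def
  proof (rule integral_cong_AE)
    show "AE s in lborel. indicator {0<..<t} s * duhamel_kernel H3 x t s = indicator {0<..<t} s * duhamel_kernel H1 x t s - indicator {0<..<t} s * duhamel_kernel H2 x t s"
      using ae by eventually_elim (auto simp: indicator_def k)
  qed (use duhamel_integrand_measurable[OF H1(1)] duhamel_integrand_measurable[OF H2(1)] duhamel_integrand_measurable[OF H3(1)] in auto)
  then show "duhamel H3 x t = duhamel H1 x t - duhamel H2 x t"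
    unfolding duhamel_def using duhamel_integrand_integrable[OF H1(1) a(1), of t x] duhamel_integrand_integrable[OF H2(1) a(2), of t x] by simp
  assume al: "\<alpha> \<in> mi_le K"
  have m: "moment G \<alpha> (\<lambda>y. H3 (y, s)) s = moment G \<alpha> (\<lambda>y. H1 (y, s)) s - moment G \<alpha> (\<lambda>y. H2 (y, s)) s"
    if s: "0 < s" and e: "AE y in lborel. H3 (y, s) = H1 (y, s) - H2 (y, s)" for s
  proof -
    note [measurable] = slice_measurable[OF H1(1), of s] slice_measurable[OF H2(1), of s] slice_measurable[OF H3(1), of s]
    have r: "rad s > 0" using s by (simp add: rad_pos)
    have "moment G \<alpha> (\<lambda>y. H3 (y, s)) s = moment G \<alpha> (\<lambda>y. H1 (y, s) - H2 (y, s)) s"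
    proof (rule moment_cong)
      fix \<beta>
      have "(LINT y|lebesgue. mi_power y \<beta> * H3 (y, s)) = (LINT y|lborel. mi_power y \<beta> * (H1 (y, s) - H2 (y, s)))"
        by (rule lebesgue_integral_cong_lborel(2)) (measurable, use e in \<open>auto elim!: eventually_mono\<close>)
      also have "\<dots> = (LINT y|lebesgue. mi_power y \<beta> * (H1 (y, s) - H2 (y, s)))"
        by (intro integral_completion[symmetric]) measurable
      finally show "(LINT y|lebesgue. mi_power y \<beta> * H3 (y, s)) = (LINT y|lebesgue. mi_power y \<beta> * (H1 (y, s) - H2 (y, s)))" .
    qed
    also have "\<dots> = moment G \<alpha> (\<lambda>y. H1 (y, s)) s - moment G \<alpha> (\<lambda>y. H2 (y, s)) s"
      by (intro moment_diff Bd_moment(1)[OF borel_srcD(3)[OF H1(1) s] _ r] Bd_moment(1)[OF borel_srcD(3)[OF H2(1) s] _ r] mi_le_downward[OF al])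
    finally show ?thesis .
  qed
  have "moment_integral H3 \<alpha> t = (LINT s|lborel. indicator {0<..<t} s * moment G \<alpha> (\<lambda>y. H1 (y, s)) s - indicator {0<..<t} s * moment G \<alpha> (\<lambda>y. H2 (y, s)) s)"
    unfolding moment_integral_def
  proof (rule integral_cong_AE)
    show "AE s in lborel. indicator {0<..<t} s * moment G \<alpha> (\<lambda>y. H3 (y, s)) s = indicator {0<..<t} s * moment G \<alpha> (\<lambda>y. H1 (y, s)) s - indicator {0<..<t} s * moment G \<alpha> (\<lambda>y. H2 (y, s)) s"
      using ae by eventually_elim (auto simp: indicator_def m)
  qed (use moment_indicator_measurable[OF H1(1) al] moment_indicator_measurable[OF H2(1) al] moment_indicator_measurable[OF H3(1) al] in auto)
  then show "moment_integral H3 \<alpha> t = moment_integral H1 \<alpha> t - moment_integral H2 \<alpha> t"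
    unfolding moment_integral_def using moment_integrable[OF H1(1) a(1) al, of t] moment_integrable[OF H2(1) a(2) al, of t] by simp
qed

section \<open>Reduction to unit mass and splitting of the linear part\<close>

lemma Bd_zero: "0 \<le> B \<Longrightarrow> r > 0 \<Longrightarrow> Bd r (\<lambda>x. 0) B"
  by (simp add: Bd_def)

lemma little_zero: "little (\<lambda>t. 0)"
  by (auto simp: little_def intro!: exI[of _ 0])

lemma dil_zero: "\<forall>t>0. \<forall>x. G x t = 0 \<Longrightarrow> \<rho> > 0 \<Longrightarrow> dil \<rho> \<Gamma> x = 0"
  using G_dil[of "\<rho> powr d" x] d_pos by (simp add: powr_powr)

text \<open>For unit mass the projected source has vanishing moments and \<open>duhamel_rate\<close>
  applies; otherwise the kernel, and with it the Duhamel term, is identically 0.\<close>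

lemma duhamel_proj_rate:
  assumes H: "borel_src C a H" and a: "a > 0"
  obtains E where "\<And>t. t > 0 \<Longrightarrow> Bd (rad t) (\<lambda>x. duhamel (proj_src H) x t) (E t)" "rate a E"
proof (cases "mass = 1")
  case True
  then show ?thesis
    using duhamel_rate[OF borel_src_proj_src[OF H] a proj_src_moment_zero[OF H]] that by blast
next
  case False
  then have z: "\<forall>t>0. \<forall>x. G x t = 0" using mass_cases by blast
  have z0: "indicator {0<..<t} s * duhamel_kernel (proj_src H) x t s = 0" for x t s
    using dil_zero[OF z, of "(t - s) powr (1 / d)"] by (auto simp: duhamel_kernel_def indicator_def)
  have "duhamel (proj_src H) x t = 0" for x t unfolding duhamel_def by (simp only: z0) simp
  moreover have "rate a (\<lambda>t. 0)" by (auto simp: rate_def little_zero intro: exI[of _ 0])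
  ultimately show ?thesis using that[of "\<lambda>t. 0"] by (simp add: Bd_zero rad_pos)
qed

lemma hom_proj_little:
  assumes q: "Bd 1 q B" and [measurable]: "q \<in> borel_measurable borel"
  obtains E where "\<And>t. t > 0 \<Longrightarrow> Bd (rad t) (\<lambda>x. hom (proj_P G K 0 q) x t) (E t)" "little E"
proof (cases "mass = 1")
  case True
  \<comment> \<open>At time 0 the natural scale is 1, so the unscaled bound on the initial value
    fits the projection estimate.\<close>
  have r0: "rad 0 = 1" by (simp add: rad_def)
  have q': "Bd (rad 0) q B" using q r0 by simp
  have m: "proj_P G K 0 q \<in> borel_measurable borel"
    unfolding proj_P_def using g_measurable[of 0] by (intro borel_measurable_diff borel_measurable_sum borel_measurable_times) auto
  have "(LINT y|lborel. mi_power y \<alpha> * proj_P G K 0 q y) = 0" if "\<alpha> \<in> mi_le K" for \<alpha>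
    using proj_moment_zero[OF True _ q' that] m by (subst integral_completion[symmetric]) auto
  moreover have "Bd 1 (proj_P G K 0 q) (proj_const * B)" using Bd_proj[OF order_refl q'] r0 by simp
  ultimately show ?thesis using hom_little[OF _ m] that by blast
next
  case False
  then have z: "\<forall>t>0. \<forall>x. G x t = 0" using mass_cases by blast
  have "hom (proj_P G K 0 q) x t = 0" if "t > 0" for x t
    using dil_zero[OF z, of "t powr (1 / d)"] that by (simp add: hom_def)
  then show ?thesis using that[of "\<lambda>t. 0"] little_zero by (simp add: Bd_zero rad_pos)
qed

lemma hom_proj:
  assumes q: "Bd 1 q B" and [measurable]: "q \<in> borel_measurable borel" and t: "t > 0"
  shows "hom (proj_P G K 0 q) x t = hom q x t - (\<Sum>\<alpha>\<in>mi_le K. moment G \<alpha> q 0 * g_fun G \<alpha> x t)"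
proof -
  let ?\<rho> = "t powr (1 / d)"
  have bd: "\<bar>dil ?\<rho> \<Gamma> (x - y)\<bar> \<le> CB / ?\<rho> ^ CARD('n)" for y
    using Gam_bounded[of "(x - y) /\<^sub>R ?\<rho>"] by (simp add: dil_def abs_divide divide_right_mono)
  have m: "(\<lambda>y. dil ?\<rho> \<Gamma> (x - y)) \<in> borel_measurable borel" by measurable
  have ig: "integrable lborel (\<lambda>y. dil ?\<rho> \<Gamma> (x - y) * g_fun G \<alpha> y 0)" if "\<alpha> \<in> mi_le K" for \<alpha>
    using Bd_L1(1)[OF Bd_g[of 0 \<alpha>]] that g_measurable[of 0 \<alpha>]
    by (intro integrable_bounded_mult[OF m _ bd], subst integrable_completion[symmetric]) (auto simp: rad_pos)
  have iq: "integrable lborel (\<lambda>y. dil ?\<rho> \<Gamma> (x - y) * q y)"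
    using Bd_L1(1)[OF q]
    by (intro integrable_bounded_mult[OF m _ bd], subst integrable_completion[symmetric]) auto
  have sg: "(LINT y|lborel. dil ?\<rho> \<Gamma> (x - y) * g_fun G \<alpha> y 0) = g_fun G \<alpha> x t" if "\<alpha> \<in> mi_le K" for \<alpha>
    using semigroup_g[of 0 t \<alpha> x] that t by (simp add: G_dil)
  have "hom (proj_P G K 0 q) x t = (LINT y|lborel. dil ?\<rho> \<Gamma> (x - y) * q y
     - (\<Sum>\<alpha>\<in>mi_le K. moment G \<alpha> q 0 * (dil ?\<rho> \<Gamma> (x - y) * g_fun G \<alpha> y 0)))"
    unfolding hom_def proj_P_def by (simp add: right_diff_distrib sum_distrib_left mult.left_commute)
  also have "\<dots> = hom q x t - (\<Sum>\<alpha>\<in>mi_le K. moment G \<alpha> q 0 * g_fun G \<alpha> x t)"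
    unfolding hom_def using iq ig
    by (subst Bochner_Integration.integral_diff) (auto simp: Bochner_Integration.integral_sum sg)
  finally show ?thesis .
qed

lemma moment_integral_measurable:
  assumes "borel_src C a H" "\<alpha> \<in> mi_le K" shows "moment_integral H \<alpha> \<in> borel_measurable borel"
proof -
  have "(\<lambda>p. indicator {0<..} (snd p) * moment G \<alpha> (\<lambda>y. H (y, snd p)) (snd p)) \<in> borel_measurable (borel \<Otimes>\<^sub>M borel)"
    by (rule measurable_compose[OF measurable_snd moment_src_measurable[OF assms]])
  moreover have "(\<lambda>p::real \<times> real. if snd p < fst p then 1 else 0 :: real) \<in> borel_measurable (borel \<Otimes>\<^sub>M borel)" by measurable
  ultimately have "(\<lambda>p. (if snd p < fst p then 1 else 0) * (indicator {0<..} (snd p) * moment G \<alpha> (\<lambda>y. H (y, snd p)) (snd p))) \<in> borel_measurable (borel \<Otimes>\<^sub>M borel)"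
    by (rule borel_measurable_times[rotated])
  moreover have "(if s < t then 1 else 0) * (indicator {0<..} s * moment G \<alpha> (\<lambda>y. H (y, s)) s) = indicator {0<..<t} s * moment G \<alpha> (\<lambda>y. H (y, s)) s" for s t :: real
    by (auto simp: indicator_def)
  ultimately have "(\<lambda>(t, s). indicator {0<..<t} s * moment G \<alpha> (\<lambda>y. H (y, s)) s) \<in> borel_measurable (borel \<Otimes>\<^sub>M lborel)"
    by (simp add: case_prod_unfold)
  then show ?thesis unfolding moment_integral_def[abs_def] by (rule lborel.borel_measurable_lebesgue_integral)
qed

end


section \<open>The nonlinear problem\<close>

locale nonlinear_problem = self_similar_kernel \<Gamma> \<gamma> L K CB G d
  for \<Gamma> :: "real^'n::finite \<Rightarrow> real" and \<gamma> L K CB and G :: "real^'n \<Rightarrow> real \<Rightarrow> real" and d +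
  fixes \<phi> :: "real^'n \<Rightarrow> real" and F :: "real^'n \<Rightarrow> real \<Rightarrow> real \<Rightarrow> real" and u :: "real^'n \<Rightarrow> real \<Rightarrow> real"
    and Cs A p Ap :: real
  assumes \<phi>: "\<phi> \<in> Lp_space \<infinity> \<inter> L1w_space K"
    and F_measurable: "\<And>w. w \<in> borel_measurable spacetime \<Longrightarrow>
          (\<lambda>(x, t). F x t (w (x, t))) \<in> borel_measurable spacetime"
    and F_zero: "\<And>x t. t > 0 \<Longrightarrow> F x t 0 = 0"
    and Cs: "Cs > 0" and p: "p \<ge> 1"
    and F_lipschitz: "\<And>x t u1 u2. t > 0 \<Longrightarrow>
          \<bar>F x t u1 - F x t u2\<bar> \<le>
            Cs * (1 + t) powr A * max (abs_pow_pred p u1) (abs_pow_pred p u2) * \<bar>u1 - u2\<bar>"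
    and Ap_def: "Ap = - A + real CARD('n) * (p - 1) / d - 1" and Ap_pos: "Ap > 0"
    and u_measurable: "(\<lambda>(x, t). u x t) \<in> borel_measurable spacetime"
    and u_solution: "\<And>x t. t > 0 \<Longrightarrow>
          u x t = (LINT y|lebesgue. G (x - y) t * \<phi> y) +
            (LINT s:{0<..<t}|lebesgue. (LINT y|lebesgue. G (x - y) (t - s) * F y s (u y s)))"
    and u_bounds: "\<And>q l. 1 \<le> q \<Longrightarrow> 0 \<le> l \<Longrightarrow> l \<le> K \<Longrightarrow>
          (\<forall>t>0. (\<lambda>x. u x t) \<in> Lp_space q \<inter> L1w_space l) \<and>
          bdd_above ((\<lambda>t. (1 + t) powr (real CARD('n) / d * (1 - real_of_ereal (1 / q)))
                        * Lp_norm q (\<lambda>x. u x t)) ` {0<..}) \<and>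
          bdd_above ((\<lambda>t. (1 + t) powr (- l / d) * L1w_norm l (\<lambda>x. u x t)) ` {0<..})"
begin

abbreviation f :: "real^'n \<Rightarrow> real \<Rightarrow> real" where "f \<equiv> \<lambda>x t. F x t (u x t)"

lemma u_Bd: obtains B where "B > 0" "\<And>t. t > 0 \<Longrightarrow> Bd (rad t) (\<lambda>x. u x t) B"
proof -
  have ub: "bdd_above (g ` {0<..}) \<Longrightarrow> \<exists>c. \<forall>t>0. g t \<le> c" for g :: "real \<Rightarrow> real"
    unfolding bdd_above_def by blast
  have inf: "(1::ereal) \<le> \<infinity>" by simp
  note u0 = u_bounds[OF inf order_refl K_nonneg] and uK = u_bounds[OF inf K_nonneg order_refl]
  obtain c1 where c1': "\<forall>t>0. (1 + t) powr (real CARD('n) / d * (1 - real_of_ereal (1 / \<infinity>))) * Lp_norm \<infinity> (\<lambda>x. u x t) \<le> c1"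
    using ub[OF u0[THEN conjunct2, THEN conjunct1]] by blast
  have c1: "(1 + t) powr (real CARD('n) / d) * Lp_norm \<infinity> (\<lambda>x. u x t) \<le> c1" if "t > 0" for t
    using c1'[rule_format, OF that] by simp
  obtain c2 where c2: "\<forall>t>0. (1 + t) powr (- 0 / d) * L1w_norm 0 (\<lambda>x. u x t) \<le> c2"
    using ub[OF u0[THEN conjunct2, THEN conjunct2]] by blast
  obtain c3 where c3: "\<forall>t>0. (1 + t) powr (- K / d) * L1w_norm K (\<lambda>x. u x t) \<le> c3"
    using ub[OF uK[THEN conjunct2, THEN conjunct2]] by blast
  have sp: "(\<lambda>x. u x t) \<in> Lp_space \<infinity>" "(\<lambda>x. u x t) \<in> L1w_space 0" "(\<lambda>x. u x t) \<in> L1w_space K" if "t > 0" for t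
    using u0[THEN conjunct1] uK[THEN conjunct1] that by blast+
  have "Bd (rad t) (\<lambda>x. u x t) (max 0 c1 + 2 powr K * (max 0 c2 + max 0 c3))" if t: "t > 0" for t
  proof (rule BdI_norms)
    show "rad t \<ge> 1" using t by (simp add: rad_ge_1)
    show "(\<lambda>x. u x t) \<in> Lp_space \<infinity>" "(\<lambda>x. u x t) \<in> L1w_space 0" "(\<lambda>x. u x t) \<in> L1w_space K"
      using sp[OF t] by auto
    have r: "rad t ^ CARD('n) = (1 + t) powr (real CARD('n) / d)" "rad t powr K = (1 + t) powr (K / d)" "(1 + t) powr (K / d) > 0"
      using t by (simp_all add: rad_power rad_powr)
    show "Lp_norm \<infinity> (\<lambda>x. u x t) \<le> c1 / rad t ^ CARD('n)"
      unfolding r using c1[OF t] t by (simp add: field_simps)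
    show "L1w_norm 0 (\<lambda>x. u x t) \<le> c2" using c2 t by simp
    have le3: "(1 + t) powr (K / d) * ((1 + t) powr (- K / d) * L1w_norm K (\<lambda>x. u x t)) \<le> (1 + t) powr (K / d) * c3"
      using c3 t by (intro mult_left_mono) auto
    have eq: "(1 + t) powr (K / d) * ((1 + t) powr (- K / d) * L1w_norm K (\<lambda>x. u x t)) = L1w_norm K (\<lambda>x. u x t)"
      using t by (simp only: mult.assoc[symmetric] powr_add[symmetric]) simp
    show "L1w_norm K (\<lambda>x. u x t) \<le> c3 * rad t powr K"
      unfolding r mult.commute[of c3] using le3 unfolding eq .
  qed
  then obtain M where M: "\<And>t. t > 0 \<Longrightarrow> Bd (rad t) (\<lambda>x. u x t) M" by blast
  have "M \<ge> 0" using Bd_nonneg[OF M[of 1]] by simp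
  \<comment> \<open>Enlarged by 1 to be strictly positive, so that powers of the bound with exponent
    \<open>p - 1\<close> behave well for \<open>p = 1\<close> too.\<close>
  moreover have "Bd (rad t) (\<lambda>x. u x t) (M + 1)" if "t > 0" for t
    by (rule Bd_mono[OF M[OF that]]) (use that in \<open>simp_all add: rad_pos\<close>)
  ultimately show ?thesis using that[of "M + 1"] by simp
qed

section \<open>Sources produced by the nonlinearity\<close>

text \<open>The sup bound gives \<open>|v|^(p-1)\<close> the decay
  \<open>(1 + s)^(-N(p-1)/d)\<close>; together with \<open>(1 + s)^A\<close> from the Lipschitz
  condition the exponent is \<open>-1 - Ap\<close>, which is how \<open>Ap\<close> arises.\<close>

lemma F_diff_bound:
  assumes s: "s > 0" and B: "B > 0"
    and v1: "Bd (rad s) v1 B" and v2: "Bd (rad s) v2 B"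
  shows "AE y in lborel. \<bar>F y s (v1 y) - F y s (v2 y)\<bar> \<le> \<bar>Cs * B powr (p - 1) * (1 + s) powr (-1 - Ap) * (v1 y - v2 y)\<bar>"
  using Bd_AE[OF v1] Bd_AE[OF v2]
proof eventually_elim
  case (elim y)
  let ?b = "B / rad s ^ CARD('n)"
  have b0: "?b > 0" using B s by (simp add: rad_pos)
  \<comment> \<open>For \<open>p = 1\<close> the left side is 1 by convention, and so is the right
    side because the bound is positive.\<close>
  have le: "abs_pow_pred p v \<le> ?b powr (p - 1)" if "\<bar>v\<bar> \<le> ?b" for v
    unfolding abs_pow_pred_def using that p B rad_pos[of s] s by (auto intro: powr_mono2)
  have "\<bar>F y s (v1 y) - F y s (v2 y)\<bar> \<le> Cs * (1 + s) powr A * max (abs_pow_pred p (v1 y)) (abs_pow_pred p (v2 y)) * \<bar>v1 y - v2 y\<bar>"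
    by (rule F_lipschitz[OF s])
  also have "\<dots> \<le> Cs * (1 + s) powr A * ?b powr (p - 1) * \<bar>v1 y - v2 y\<bar>"
    using Cs le[OF elim(1)] le[OF elim(2)] by (intro mult_right_mono mult_left_mono) auto
  also have "?b powr (p - 1) = B powr (p - 1) * (1 + s) powr (- (real CARD('n) * (p - 1) / d))"
  proof -
    have "?b powr (p - 1) = B powr (p - 1) / (rad s ^ CARD('n)) powr (p - 1)"
      using B s by (simp add: powr_divide rad_pos)
    also have "(rad s ^ CARD('n)) powr (p - 1) = (1 + s) powr (real CARD('n) * (p - 1) / d)"
      using s by (simp add: rad_power powr_powr)
    finally show ?thesis by (simp add: powr_minus_divide)
  qed
  also have "Cs * (1 + s) powr A * (B powr (p - 1) * (1 + s) powr (- (real CARD('n) * (p - 1) / d)))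
    = Cs * B powr (p - 1) * ((1 + s) powr A * (1 + s) powr (- (real CARD('n) * (p - 1) / d)))" by (simp add: mult_ac)
  also have "(1 + s) powr A * (1 + s) powr (- (real CARD('n) * (p - 1) / d)) = (1 + s) powr (-1 - Ap)"
    unfolding powr_add[symmetric] Ap_def by simp
  finally show ?case using Cs by (simp add: abs_mult)
qed

lemma measurable_spacetime_diff:
  fixes v w :: "real^'n \<Rightarrow> real \<Rightarrow> real"
  assumes "(\<lambda>(x, t). v x t) \<in> borel_measurable spacetime" "(\<lambda>(x, t). w x t) \<in> borel_measurable spacetime"
  shows "(\<lambda>(x, t). v x t - w x t) \<in> borel_measurable spacetime"
  using borel_measurable_diff[OF assms] by (simp add: case_prod_unfold)

lemma F_spacetime:
  assumes "(\<lambda>(x, t). v x t) \<in> borel_measurable spacetime"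
  shows "(\<lambda>(x, t). F x t (v x t)) \<in> borel_measurable spacetime"
  using F_measurable[OF assms] by simp

text \<open>The mechanism of the iteration: an error of rate \<open>b\<close> produces a source of
  surplus \<open>Ap + b\<close>.\<close>

lemma F_diff_src:
  assumes v: "(\<lambda>(x, t). v x t) \<in> borel_measurable spacetime" and w: "(\<lambda>(x, t). w x t) \<in> borel_measurable spacetime"
    and B: "B > 0" "\<And>t. t > 0 \<Longrightarrow> Bd (rad t) (\<lambda>x. v x t) B" "\<And>t. t > 0 \<Longrightarrow> Bd (rad t) (\<lambda>x. w x t) B"
    and E: "\<And>t. t > 0 \<Longrightarrow> Bd (rad t) (\<lambda>x. v x t - w x t) (E t)" "\<And>t. t > 0 \<Longrightarrow> E t \<le> c * (1 + t) powr (- b)"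
  obtains C H where "borel_src C (Ap + b) H" "rep (\<lambda>y s. F y s (v y s) - F y s (w y s)) H"
proof -
  have c0: "c \<ge> 0"
  proof -
    have "0 \<le> c * (1 + 1) powr (- b)" using E(2)[of 1] Bd_nonneg[OF E(1)[of 1]] by simp
    then show ?thesis by (simp add: zero_le_mult_iff)
  qed
  let ?L = "Cs * B powr (p - 1)"
  have m: "(\<lambda>(y, s). F y s (v y s) - F y s (w y s)) \<in> borel_measurable spacetime"
    by (intro measurable_spacetime_diff F_spacetime v w)
  have "\<exists>g. Bd (rad s) g (?L * c * (1 + s) powr (-1 - (Ap + b))) \<and> (AE y in lborel. \<bar>F y s (v y s) - F y s (w y s)\<bar> \<le> \<bar>g y\<bar>)"
    if s: "s > 0" for s
  proof (intro exI conjI)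
    show "AE y in lborel. \<bar>F y s (v y s) - F y s (w y s)\<bar> \<le> \<bar>?L * (1 + s) powr (-1 - Ap) * (v y s - w y s)\<bar>"
      by (rule F_diff_bound[OF s B(1) B(2)[OF s] B(3)[OF s]])
    have r: "rad s > 0" using s by (simp add: rad_pos)
    have "Bd (rad s) (\<lambda>y. ?L * (1 + s) powr (-1 - Ap) * (v y s - w y s)) (\<bar>?L * (1 + s) powr (-1 - Ap)\<bar> * E s)"
      by (rule Bd_cmult[OF E(1)[OF s] r])
    then show "Bd (rad s) (\<lambda>y. ?L * (1 + s) powr (-1 - Ap) * (v y s - w y s)) (?L * c * (1 + s) powr (-1 - (Ap + b)))"
    proof (rule Bd_mono[OF _ _ r])
      have "\<bar>?L * (1 + s) powr (-1 - Ap)\<bar> * E s \<le> \<bar>?L * (1 + s) powr (-1 - Ap)\<bar> * (c * (1 + s) powr (- b))"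
        by (intro mult_left_mono E s) auto
      also have "\<dots> = ?L * c * ((1 + s) powr (-1 - Ap) * (1 + s) powr (- b))" using Cs by (simp add: abs_mult mult_ac)
      also have "(1 + s) powr (-1 - Ap) * (1 + s) powr (- b) = (1 + s) powr (-1 - (Ap + b))"
        unfolding powr_add[symmetric] by (simp add: algebra_simps)
      finally show "\<bar>?L * (1 + s) powr (-1 - Ap)\<bar> * E s \<le> ?L * c * (1 + s) powr (-1 - (Ap + b))" .
    qed
  qed
  note dom = this
  have "?L * c \<ge> 0" using c0 Cs by simp
  from ex_src[OF m this dom] obtain H where "borel_src (?L * c) (Ap + b) H" "rep (\<lambda>y s. F y s (v y s) - F y s (w y s)) H" .
  then show ?thesis by (rule that)
qed

text \<open>Comparison with the zero function, at which \<open>F\<close> vanishes; the error rate is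
  then 0, so the surplus is \<open>Ap\<close>.\<close>

lemma F_src:
  assumes v: "(\<lambda>(x, t). v x t) \<in> borel_measurable spacetime" and B: "\<And>t. t > 0 \<Longrightarrow> Bd (rad t) (\<lambda>x. v x t) B"
  obtains C H where "borel_src C Ap H" "rep (\<lambda>y s. F y s (v y s)) H"
proof -
  define B' where "B' = max B 1"
  have B': "Bd (rad t) (\<lambda>x. v x t) B'" if "t > 0" for t
    by (rule Bd_mono[OF B[OF that]]) (use that in \<open>simp_all add: B'_def rad_pos\<close>)
  have z: "(\<lambda>(x::real^'n, t::real). 0::real) \<in> borel_measurable spacetime" by (simp add: case_prod_unfold)
  have pos: "B' > 0" by (simp add: B'_def)
  have Bz: "Bd (rad t) (\<lambda>x. 0) B'" if "t > 0" for t
    using that pos by (intro Bd_zero) (auto simp: rad_pos)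
  have Bv: "Bd (rad t) (\<lambda>x. v x t - 0) B'" and e0: "B' \<le> B' * (1 + t) powr (- 0)" if "t > 0" for t
    using that B'[OF that] by simp_all
  from F_diff_src[OF v z pos B' Bz Bv e0] obtain C H
    where CH: "borel_src C (Ap + 0) H" "rep (\<lambda>y s. F y s (v y s) - F y s 0) H" .
  then have "rep (\<lambda>y s. F y s (v y s)) H" using F_zero by (simp add: rep_def)
  with CH(1) that show ?thesis by simp
qed

lemma \<phi>_rep: obtains q B where "q \<in> borel_measurable borel" "Bd 1 q B" "AE x in lborel. \<phi> x = q x"
proof -
  obtain B where B: "Bd 1 \<phi> B" using Bd_1_of_spaces[OF \<phi>] .
  obtain q where q: "q \<in> borel_measurable lborel" "AE x in lborel. \<phi> x = q x"
    using completion_ex_borel_measurable_real[OF Bd_measurable[OF B]] by blast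
  moreover have "Bd 1 q B"
    by (rule Bd_cong_AE[OF B]) (use q(2) in \<open>auto elim: eventually_mono\<close>)
  ultimately show ?thesis using that by simp
qed

lemma rate_add_little:
  assumes r: "rate b E" and l: "little E'"
  shows "rate b (\<lambda>t. E' t + E t)"
proof -
  obtain C' where C': "\<And>t. t > 0 \<Longrightarrow> E' t \<le> C' * (1 + t) powr (- K / d)" using l unfolding little_def by blast
  have C'': "E' t \<le> max 0 C' * (1 + t) powr (- b)" if t: "t > 0" and b: "b \<le> K / d" for t
  proof -
    have "E' t \<le> max 0 C' * (1 + t) powr (- K / d)" using C'[OF t] by (rule order_trans) (intro mult_right_mono, auto)
    also have "\<dots> \<le> max 0 C' * (1 + t) powr (- b)" using t b by (intro mult_left_mono powr_mono) auto
    finally show ?thesis .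
  qed
  show ?thesis
    unfolding rate_def
  proof (intro conjI impI)
    assume b: "b < K / d"
    then obtain C where C: "\<And>t. t > 0 \<Longrightarrow> E t \<le> C * (1 + t) powr (- b)" using r unfolding rate_def by blast
    show "\<exists>C. \<forall>t>0. E' t + E t \<le> C * (1 + t) powr (- b)"
      using C C'' b by (intro exI[of _ "max 0 C' + C"]) (auto simp: distrib_right intro!: add_mono)
  next
    assume b: "b = K / d"
    then obtain C where C: "\<And>t. t > 0 \<Longrightarrow> E t \<le> C * (1 + t) powr (- b) * (1 + ln (1 + t))" using r unfolding rate_def by blast
    show "\<exists>C. \<forall>t>0. E' t + E t \<le> C * (1 + t) powr (- b) * (1 + ln (1 + t))"
    proof (intro exI[of _ "max 0 C' + C"] allI impI)
      fix t :: real assume t: "t > 0"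
      have "E' t \<le> max 0 C' * (1 + t) powr (- b) * 1" using C''[OF t] b by simp
      also have "\<dots> \<le> max 0 C' * (1 + t) powr (- b) * (1 + ln (1 + t))" using t by (intro mult_left_mono) auto
      finally show "E' t + E t \<le> (max 0 C' + C) * (1 + t) powr (- b) * (1 + ln (1 + t))"
        using C[OF t] by (simp add: distrib_right)
    qed
  next
    assume "b > K / d"
    then show "little (\<lambda>t. E' t + E t)" using r l by (auto simp: rate_def intro: little_add)
  qed
qed

text \<open>Extracts a pure power, as sources require one. At the threshold the logarithm is
  absorbed by giving up an arbitrarily small part of the exponent, which is why \<open>c\<close>
  must be strictly smaller there.\<close>

lemma rate_decay:
  assumes r: "rate b E" and c: "c \<le> b" "c < K / d \<or> (c = b \<and> b < K / d) \<or> (c = K / d \<and> b > K / d)"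
  obtains C where "\<And>t. t > 0 \<Longrightarrow> E t \<le> C * (1 + t) powr (- c)"
proof -
  have mono: "C * (1 + t) powr (- b') \<le> max 0 C * (1 + t) powr (- c)" if "t > 0" "c \<le> b'" for C t b'
  proof -
    have "C * (1 + t) powr (- b') \<le> max 0 C * (1 + t) powr (- b')" by (intro mult_right_mono) auto
    also have "\<dots> \<le> max 0 C * (1 + t) powr (- c)" using that by (intro mult_left_mono powr_mono) auto
    finally show ?thesis .
  qed
  consider "b < K / d" | "b = K / d" | "b > K / d" by linarith
  then show ?thesis
  proof cases
    case 1
    then obtain C where "\<And>t. t > 0 \<Longrightarrow> E t \<le> C * (1 + t) powr (- b)" using r unfolding rate_def by blast
    then show ?thesis using mono[OF _ c(1), of _ C] that[of "max 0 C"] by (meson order_trans)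
  next
    case 2
    then obtain C where C: "\<And>t. t > 0 \<Longrightarrow> E t \<le> C * (1 + t) powr (- b) * (1 + ln (1 + t))" using r unfolding rate_def by blast
    define e where "e = b - c"
    have e: "e > 0" using c 2 by (auto simp: e_def)
    show ?thesis
    proof (rule that[of "max 0 C * (1 + 1 / e)"])
      fix t :: real assume t: "t > 0"
      have "ln (1 + t) \<le> (1 + t) powr e / e" using t e by (intro ln_powr_bound) auto
      moreover have "1 \<le> (1 + t) powr e" using t e by (intro ge_one_powr_ge_zero) auto
      ultimately have l: "1 + ln (1 + t) \<le> (1 + 1 / e) * (1 + t) powr e" by (simp add: distrib_right)
      have "E t \<le> max 0 C * (1 + t) powr (- b) * (1 + ln (1 + t))"
        using C[OF t] by (rule order_trans) (use t in \<open>intro mult_right_mono, auto\<close>)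
      also have "\<dots> \<le> max 0 C * (1 + t) powr (- b) * ((1 + 1 / e) * (1 + t) powr e)"
        by (intro mult_left_mono l) auto
      also have "\<dots> = max 0 C * (1 + 1 / e) * ((1 + t) powr (- b) * (1 + t) powr e)" by (simp only: mult_ac)
      also have "(1 + t) powr (- b) * (1 + t) powr e = (1 + t) powr (- c)" by (simp add: e_def flip: powr_add)
      finally show "E t \<le> max 0 C * (1 + 1 / e) * (1 + t) powr (- c)" .
    qed
  next
    case 3
    then obtain C where "\<And>t. t > 0 \<Longrightarrow> E t \<le> C * (1 + t) powr (- (K / d))" using r unfolding rate_def little_def by auto
    moreover have "c \<le> K / d" using c 3 by auto
    ultimately show ?thesis using mono[of _ "K / d" C] that[of "max 0 C"] by (meson order_trans)
  qed
qed

section \<open>The iteration\<close>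

context
  fixes q B\<phi> Hf Cf Bu
  assumes q: "q \<in> borel_measurable borel" "Bd 1 q B\<phi>" "AE x in lborel. \<phi> x = q x"
    and Hf: "borel_src Cf Ap Hf" "rep f Hf"
    and Bu: "Bu > 0" "\<And>t. t > 0 \<Longrightarrow> Bd (rad t) (\<lambda>x. u x t) Bu"
begin

abbreviation U :: "nat \<Rightarrow> real^'n \<Rightarrow> real \<Rightarrow> real" where "U n \<equiv> profile G F K \<phi> f n"

lemma moment_\<phi>: "moment G \<alpha> \<phi> 0 = moment G \<alpha> q 0"
proof (rule moment_cong)
  fix \<beta>
  note [measurable] = q(1)
  have "(LINT x|lebesgue. mi_power x \<beta> * \<phi> x) = (LINT x|lborel. mi_power x \<beta> * q x)"
    by (rule lebesgue_integral_cong_lborel(2)) (measurable, use q(3) in \<open>auto elim: eventually_mono\<close>)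
  also have "\<dots> = (LINT x|lebesgue. mi_power x \<beta> * q x)" by (intro integral_completion[symmetric]) measurable
  finally show "(LINT x|lebesgue. mi_power x \<beta> * \<phi> x) = (LINT x|lebesgue. mi_power x \<beta> * q x)" .
qed

lemma c_coeff_eq: "\<alpha> \<in> mi_le K \<Longrightarrow> c_coeff G \<phi> f \<alpha> t = moment G \<alpha> q 0 + moment_integral Hf \<alpha> t"
  unfolding c_coeff_def moment_\<phi> using rep_set_moment[OF Hf] by simp

lemma profile0_eq: "profile0 G K \<phi> f x t = (\<Sum>\<alpha>\<in>mi_le K. (moment G \<alpha> q 0 + moment_integral Hf \<alpha> t) * g_fun G \<alpha> x t)"
  by (simp add: profile0_def c_coeff_eq)

lemma u_eq: assumes t: "t > 0" shows "u x t = hom q x t + duhamel Hf x t"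
proof -
  note [measurable] = q(1)
  have "(LINT y|lebesgue. G (x - y) t * \<phi> y) = (LINT y|lborel. dil (t powr (1 / d)) \<Gamma> (x - y) * q y)"
    by (rule lebesgue_integral_cong_lborel(2)) (measurable, use q(3) t in \<open>auto elim!: eventually_mono simp: G_dil\<close>)
  moreover have "(LINT s:{0<..<t}|lebesgue. (LINT y|lebesgue. G (x - y) (t - s) * F y s (u y s))) = duhamel Hf x t"
    using rep_set_semigroup[OF Hf, of t x] by (simp add: kernel_semigroup_def)
  ultimately show ?thesis using u_solution[OF t, of x] by (simp add: hom_def)
qed

lemma u_profile0: assumes t: "t > 0"
  shows "u x t - U 0 x t = hom (proj_P G K 0 q) x t + duhamel (proj_src Hf) x t"
  using u_eq[OF t, of x] hom_proj[OF q(2,1) t, of x] duhamel_proj[OF Hf(1), of x t] Ap_pos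
  unfolding profile.simps(1) profile0_eq by (simp add: distrib_right sum.distrib)

lemma profile_Suc_eq:
  assumes H: "borel_src C Ap H" "rep (\<lambda>y s. F y s (U n y s)) H"
  shows "U (Suc n) x t = U 0 x t + duhamel (proj_src H) x t"
  using rep_set_semigroup[OF borel_src_proj_src[OF H(1)] rep_proj[OF H], of t x] by simp

text \<open>The factor \<open>c\<close> lets one statement serve both the initial profile, with
  \<open>c = 0\<close>, and its successors, with \<open>c = 1\<close>. For positive times the
  function equals an explicit Borel function.\<close>

lemma profile_spacetime_measurable:
  assumes H: "borel_src C Ap H" and U: "\<And>x t. t > 0 \<Longrightarrow> v x t = U 0 x t + c * duhamel (proj_src H) x t"
  shows "(\<lambda>(x, t). v x t) \<in> borel_measurable spacetime"
proof -
  note [measurable] = moment_integral_measurable[OF Hf(1)] g_joint_measurable duhamel_measurable[OF borel_srcD(2)[OF borel_src_proj_src[OF H]]]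
  have 1: "(\<lambda>z. \<Sum>\<alpha>\<in>mi_le K. (moment G \<alpha> q 0 + moment_integral Hf \<alpha> (snd z)) * (indicator {0<..} (snd z) * g_fun G \<alpha> (fst z) (snd z))) \<in> borel_measurable (borel \<Otimes>\<^sub>M borel)"
    by (intro borel_measurable_sum borel_measurable_times[OF borel_measurable_add[OF borel_measurable_const] g_joint_measurable]
        measurable_compose[OF measurable_snd moment_integral_measurable[OF Hf(1)]])
  have 2: "(\<lambda>z. c * duhamel (proj_src H) (fst z) (snd z)) \<in> borel_measurable (borel \<Otimes>\<^sub>M borel)"
    using duhamel_measurable[OF borel_srcD(2)[OF borel_src_proj_src[OF H]]] by (simp add: case_prod_unfold)
  define V where "V z = (\<Sum>\<alpha>\<in>mi_le K. (moment G \<alpha> q 0 + moment_integral Hf \<alpha> (snd z)) * (indicator {0<..} (snd z) * g_fun G \<alpha> (fst z) (snd z)))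
     + c * duhamel (proj_src H) (fst z) (snd z)" for z :: "(real^'n) \<times> real"
  have "V \<in> borel_measurable borel" unfolding V_def[abs_def] using borel_measurable_add[OF 1 2] by (simp add: borel_prod)
  then have "V \<in> borel_measurable spacetime" by (intro measurable_restrict_space1 measurable_completion) simp
  moreover have "(\<lambda>(x, t). v x t) z = V z" if "z \<in> space spacetime" for z
    using that U[of "snd z" "fst z"] by (auto simp: V_def profile0_eq space_restrict_space case_prod_unfold)
  ultimately show ?thesis by (simp only: measurable_cong[of spacetime "\<lambda>(x, t). v x t" V borel])
qed

lemma profile_bounds_of_error:
  assumes E: "\<And>t. t > 0 \<Longrightarrow> Bd (rad t) (\<lambda>x. u x t - U n x t) (E t)" "rate b E" and b: "b > 0"
  obtains B where "B > 0" "B \<ge> Bu" "\<And>t. t > 0 \<Longrightarrow> Bd (rad t) (\<lambda>x. U n x t) B"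
proof -
  \<comment> \<open>A nonnegative exponent admissible for \<open>rate_decay\<close> in each regime:
    \<open>b\<close> itself below the threshold, 0 where a logarithm has to be absorbed, and
    \<open>K/d\<close> above. Nonnegativity suffices to bound the error and hence the
    profile.\<close>
  define c where "c = (if b < K / d then b else if b = K / d then 0 else K / d)"
  have "c \<ge> 0" "c \<le> b" "c < K / d \<or> (c = b \<and> b < K / d) \<or> (c = K / d \<and> b > K / d)"
    using b K_nonneg d_pos by (auto simp: c_def)
  then obtain C where C: "\<And>t. t > 0 \<Longrightarrow> E t \<le> C * (1 + t) powr (- c)" using rate_decay[OF E(2)] by blast
  have EC: "E t \<le> max 0 C" if t: "t > 0" for t
  proof -
    have "C * (1 + t) powr (- c) \<le> max 0 C * 1"
      using t \<open>c \<ge> 0\<close> powr_mono[of "- c" 0 "1 + t"] by (intro mult_mono) auto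
    then show ?thesis using C[OF t] by simp
  qed
  show ?thesis
  proof (rule that[of "Bu + max 0 C"])
    fix t :: real assume t: "t > 0"
    have r: "rad t > 0" using t by (simp add: rad_pos)
    have "Bd (rad t) (\<lambda>x. u x t - (u x t - U n x t)) (Bu + E t)" by (rule Bd_diff[OF Bu(2)[OF t] E(1)[OF t] r])
    then have "Bd (rad t) (\<lambda>x. U n x t) (Bu + E t)" by simp
    then show "Bd (rad t) (\<lambda>x. U n x t) (Bu + max 0 C)" by (rule Bd_mono) (use EC[OF t] r in simp_all)
  qed (use Bu in auto)
qed

text \<open>Measurability is part of the induction because the next profile is built from a source
  in space-time. The size of \<open>U n\<close> is not: it follows from the error and the bound on
  \<open>u\<close>, and makes \<open>F (U n)\<close> an admissible source.\<close>

lemma profile_error: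
  "(\<lambda>(x, t). U n x t) \<in> borel_measurable spacetime \<and>
   (\<exists>E. (\<forall>t>0. Bd (rad t) (\<lambda>x. u x t - U n x t) (E t)) \<and> rate ((real n + 1) * Ap) E)"
proof (induction n)
  case 0
  obtain E0 where E0: "\<And>t. t > 0 \<Longrightarrow> Bd (rad t) (\<lambda>x. hom (proj_P G K 0 q) x t) (E0 t)" "little E0"
    using hom_proj_little[OF q(2,1)] by blast
  obtain E1 where E1: "\<And>t. t > 0 \<Longrightarrow> Bd (rad t) (\<lambda>x. duhamel (proj_src Hf) x t) (E1 t)" "rate Ap E1"
    using duhamel_proj_rate[OF Hf(1) Ap_pos] by blast
  have bd: "Bd (rad t) (\<lambda>x. u x t - U 0 x t) (E0 t + E1 t)" if t: "t > 0" for t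
    unfolding u_profile0[OF t] using t by (intro Bd_add E0 E1) (auto simp: rad_pos)
  have rt: "rate ((real 0 + 1) * Ap) (\<lambda>t. E0 t + E1 t)" using rate_add_little[OF E1(2) E0(2)] by simp
  have ms: "(\<lambda>(x, t). U 0 x t) \<in> borel_measurable spacetime"
    by (rule profile_spacetime_measurable[OF Hf(1), of _ 0]) simp
  show ?case by (intro conjI exI[of _ "\<lambda>t. E0 t + E1 t"] allI impI ms rt bd)
next
  case (Suc n)
  define b where "b = (real n + 1) * Ap"
  have b: "b > 0" using Ap_pos by (simp add: b_def)
  from Suc obtain E where m: "(\<lambda>(x, t). U n x t) \<in> borel_measurable spacetime"
    and E': "\<forall>t>0. Bd (rad t) (\<lambda>x. u x t - U n x t) (E t)" and Er: "rate b E" unfolding b_def by (elim conjE exE)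
  from E' have Eb: "Bd (rad t) (\<lambda>x. u x t - U n x t) (E t)" if "t > 0" for t using that by simp
  note E = Eb Er
  obtain B where B: "B > 0" "B \<ge> Bu" "\<And>t. t > 0 \<Longrightarrow> Bd (rad t) (\<lambda>x. U n x t) B"
    using profile_bounds_of_error[OF E b] by blast
  obtain Cn Hn where Hn: "borel_src Cn Ap Hn" "rep (\<lambda>y s. F y s (U n y s)) Hn" using F_src[OF m B(3)] by blast
  \<comment> \<open>Below the threshold the full error rate is used. Otherwise slightly less than
    \<open>K/d\<close> is asked for, which absorbs the logarithm, yet
    \<open>Ap + c = K/d + Ap/2\<close> still exceeds \<open>K/d\<close>. The exponent may be
    negative, but \<open>Ap + c\<close> is positive.\<close>
  define c where "c = (if b < K / d then b else K / d - Ap / 2)"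
  have c: "c \<le> b" "c < K / d \<or> (c = b \<and> b < K / d) \<or> (c = K / d \<and> b > K / d)" "Ap + c > 0"
    using b Ap_pos K_nonneg d_pos by (auto simp: c_def intro: add_pos_nonneg)
  obtain C where C: "\<And>t. t > 0 \<Longrightarrow> E t \<le> C * (1 + t) powr (- c)" using rate_decay[OF E(2) c(1,2)] by blast
  have uB: "Bd (rad t) (\<lambda>x. u x t) B" if "t > 0" for t using Bd_mono[OF Bu(2)[OF that] B(2)] that by (simp add: rad_pos)
  obtain Cd Hd where Hd: "borel_src Cd (Ap + c) Hd" "rep (\<lambda>y s. F y s (u y s) - F y s (U n y s)) Hd"
    using F_diff_src[OF u_measurable m B(1) uB B(3) E(1) C] .
  obtain E0 where E0: "\<And>t. t > 0 \<Longrightarrow> Bd (rad t) (\<lambda>x. hom (proj_P G K 0 q) x t) (E0 t)" "little E0"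
    using hom_proj_little[OF q(2,1)] by blast
  obtain E1 where E1: "\<And>t. t > 0 \<Longrightarrow> Bd (rad t) (\<lambda>x. duhamel (proj_src Hd) x t) (E1 t)" "rate (Ap + c) E1"
    using duhamel_proj_rate[OF Hd(1) c(3)] by blast
  have dd: "duhamel (proj_src Hd) x t = duhamel (proj_src Hf) x t - duhamel (proj_src Hn) x t" for x t
  proof -
    have ge: "Ap \<ge> 0" "Ap + c \<ge> 0" using Ap_pos c(3) by auto
    note rd = rep_diff[OF Hf Hn Hd ge(1) ge(1) ge(2)]
    show ?thesis
      unfolding duhamel_proj[OF Hd(1) ge(2)] duhamel_proj[OF Hf(1) ge(1)] duhamel_proj[OF Hn(1) ge(1)]
      by (simp add: rd left_diff_distrib sum_subtractf)
  qed
  have "u x t - U (Suc n) x t = hom (proj_P G K 0 q) x t + duhamel (proj_src Hd) x t" if t: "t > 0" for x t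
    using u_profile0[OF t, of x] profile_Suc_eq[OF Hn, of x t] dd[of x t] by (simp del: profile.simps)
  then have bd: "Bd (rad t) (\<lambda>x. u x t - U (Suc n) x t) (E0 t + E1 t)" if t: "t > 0" for t
    using that Bd_add[OF E0(1)[OF t] E1(1)[OF t]] by (simp add: rad_pos del: profile.simps)
  \<comment> \<open>Once the threshold is reached, the rate obtained and the rate claimed both lie
    above \<open>K/d\<close> and therefore mean the same.\<close>
  have rt: "rate ((real (Suc n) + 1) * Ap) (\<lambda>t. E0 t + E1 t)"
  proof (cases "b < K / d")
    case True
    then have "Ap + c = (real (Suc n) + 1) * Ap" by (simp add: c_def b_def algebra_simps)
    then show ?thesis using rate_add_little[OF E1(2) E0(2)] by simp
  next
    case False
    then have "Ap + c > K / d" "(real (Suc n) + 1) * Ap > K / d" using Ap_pos by (auto simp: c_def b_def algebra_simps)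
    then show ?thesis using E1(2) E0(2) by (auto simp: rate_def intro: little_add)
  qed
  have ms: "(\<lambda>(x, t). U (Suc n) x t) \<in> borel_measurable spacetime"
    by (rule profile_spacetime_measurable[OF Hn(1), of _ 1]) (simp only: profile_Suc_eq[OF Hn] mult_1_left)
  show ?case by (intro conjI exI[of _ "\<lambda>t. E0 t + E1 t"] allI impI ms rt bd)
qed

lemma profile_bounds:
  obtains B E where "\<And>t. t > 0 \<Longrightarrow> Bd (rad t) (\<lambda>x. U n x t) B"
    "\<And>t. t > 0 \<Longrightarrow> Bd (rad t) (\<lambda>x. u x t - U n x t) (E t)" "rate ((real n + 1) * Ap) E"
proof -
  obtain E where E: "\<And>t. t > 0 \<Longrightarrow> Bd (rad t) (\<lambda>x. u x t - U n x t) (E t)" "rate ((real n + 1) * Ap) E"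
    using profile_error[of n] by blast
  have "(real n + 1) * Ap > 0" using Ap_pos by simp
  then obtain B where "\<And>t. t > 0 \<Longrightarrow> Bd (rad t) (\<lambda>x. U n x t) B" using profile_bounds_of_error[OF E] by blast
  from that[OF this E] show ?thesis .
qed

text \<open>Removing the projection turns the Duhamel term of \<open>P_K F_n\<close> into the one of
  \<open>F_n\<close> minus its integrated moments, and these combine with the coefficients
  \<open>c_\<alpha>\<close> by linearity of the moments.\<close>

lemma profile_Suc_formula:
  assumes t: "t > 0"
  shows "U (Suc n) x t =
          (\<Sum>\<alpha>\<in>mi_le K.
             (moment G \<alpha> \<phi> 0 +
              (LINT s:{0<..<t}|lebesgue.
                 moment G \<alpha> (\<lambda>y. f y s - F y s (U n y s)) s)) * g_fun G \<alpha> x t) +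
          (LINT s:{0<..<t}|lebesgue.
             kernel_semigroup G (t - s) (\<lambda>y. F y s (U n y s)) x)"
proof -
  obtain B E where B: "\<And>t. t > 0 \<Longrightarrow> Bd (rad t) (\<lambda>x. U n x t) B"
    and E: "\<And>t. t > 0 \<Longrightarrow> Bd (rad t) (\<lambda>x. u x t - U n x t) (E t)" "rate ((real n + 1) * Ap) E"
    using that by (rule profile_bounds[of n])
  have m: "(\<lambda>(x, t). U n x t) \<in> borel_measurable spacetime" using profile_error[of n] by blast
  obtain Cn Hn where Hn: "borel_src Cn Ap Hn" "rep (\<lambda>y s. F y s (U n y s)) Hn" using F_src[OF m B] by blast
  define B' where "B' = max Bu B"
  have pos: "B' > 0" using Bu(1) by (simp add: B'_def)
  have Bu': "Bd (rad t) (\<lambda>x. u x t) B'" if "t > 0" for t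
    by (rule Bd_mono[OF Bu(2)[OF that]]) (use that in \<open>simp_all add: B'_def rad_pos\<close>)
  have BU': "Bd (rad t) (\<lambda>x. U n x t) B'" if "t > 0" for t
    by (rule Bd_mono[OF B[OF that]]) (use that in \<open>simp_all add: B'_def rad_pos\<close>)
  \<comment> \<open>Only the existence of a representative of the difference matters here, so the
    trivial error rate 0 is enough.\<close>
  have d1: "Bd (rad t) (\<lambda>x. u x t - U n x t) (B' + B')" if "t > 0" for t
    by (rule Bd_diff[OF Bu'[OF that] BU'[OF that]]) (use that in \<open>simp add: rad_pos\<close>)
  have d2: "B' + B' \<le> (B' + B') * (1 + t) powr (- 0)" if "t > 0" for t
    using that by simp
  obtain Cd Hd where Hd: "borel_src Cd (Ap + 0) Hd" "rep (\<lambda>y s. F y s (u y s) - F y s (U n y s)) Hd"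
    using F_diff_src[OF u_measurable m pos Bu' BU' d1 d2] .
  have ge: "Ap \<ge> 0" "Ap + 0 \<ge> 0" using Ap_pos by auto
  note rd = rep_diff[OF Hf Hn Hd ge(1) ge(1) ge(2)]
  have "U (Suc n) x t = (\<Sum>\<alpha>\<in>mi_le K. (moment G \<alpha> q 0 + moment_integral Hf \<alpha> t) * g_fun G \<alpha> x t) + (duhamel Hn x t - (\<Sum>\<alpha>\<in>mi_le K. moment_integral Hn \<alpha> t * g_fun G \<alpha> x t))"
    unfolding profile_Suc_eq[OF Hn] duhamel_proj[OF Hn(1) ge(1)] profile.simps(1) profile0_eq ..
  also have "\<dots> = (\<Sum>\<alpha>\<in>mi_le K. (moment G \<alpha> q 0 + moment_integral Hd \<alpha> t) * g_fun G \<alpha> x t) + duhamel Hn x t"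
    by (simp add: rd distrib_right left_diff_distrib sum.distrib sum_subtractf)
  also have "(\<Sum>\<alpha>\<in>mi_le K. (moment G \<alpha> q 0 + moment_integral Hd \<alpha> t) * g_fun G \<alpha> x t) = (\<Sum>\<alpha>\<in>mi_le K.
             (moment G \<alpha> \<phi> 0 + (LINT s:{0<..<t}|lebesgue. moment G \<alpha> (\<lambda>y. f y s - F y s (U n y s)) s)) * g_fun G \<alpha> x t)"
    using rep_set_moment[OF Hd] by (intro sum.cong) (auto simp: moment_\<phi>)
  also have "duhamel Hn x t = (LINT s:{0<..<t}|lebesgue. kernel_semigroup G (t - s) (\<lambda>y. F y s (U n y s)) x)"
    by (rule rep_set_semigroup[OF Hn, symmetric])
  finally show ?thesis .
qed

end

end


context nonlinear_problem begin

lemma borel_data: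
  obtains q B\<phi> Cf Hf Bu where "q \<in> borel_measurable borel" "Bd 1 q B\<phi>" "AE x in lborel. \<phi> x = q x"
    "borel_src Cf Ap Hf" "rep f Hf" "Bu > 0" "\<And>t. t > 0 \<Longrightarrow> Bd (rad t) (\<lambda>x. u x t) Bu"
proof -
  obtain q B\<phi> where q: "q \<in> borel_measurable borel" "Bd 1 q B\<phi>" "AE x in lborel. \<phi> x = q x" by (rule \<phi>_rep)
  obtain Bu where Bu: "Bu > 0" "\<And>t. t > 0 \<Longrightarrow> Bd (rad t) (\<lambda>x. u x t) Bu" using that by (rule u_Bd)
  obtain Cf Hf where "borel_src Cf Ap Hf" "rep f Hf" by (rule F_src[OF u_measurable Bu(2)])
  from that[OF q this Bu] show ?thesis .
qed

section \<open>Asymptotics of the coefficients\<close>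

lemma moment_tail:
  assumes H: "borel_src C a H" and al: "\<alpha> \<in> mi_le K" and e: "real (mi_abs \<alpha>) / d - a < 0" and t: "t \<ge> 0"
  shows "(\<integral>\<^sup>+s. ennreal \<bar>indicator {t..} s * (indicator {0<..} s * moment G \<alpha> (\<lambda>y. H (y, s)) s)\<bar> \<partial>lborel)
    \<le> ennreal (moment_const * C * ((1 + t) powr (real (mi_abs \<alpha>) / d - a) / - (real (mi_abs \<alpha>) / d - a)))"
proof -
  let ?e = "real (mi_abs \<alpha>) / d - a"
  have C: "moment_const * C \<ge> 0" using moment_const_nonneg borel_srcD(1)[OF H] by simp
  have "(\<integral>\<^sup>+s. ennreal \<bar>indicator {t..} s * (indicator {0<..} s * moment G \<alpha> (\<lambda>y. H (y, s)) s)\<bar> \<partial>lborel)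
    \<le> (\<integral>\<^sup>+s. ennreal (moment_const * C) * ennreal (indicator {t<..} s * (1 + s) powr (?e - 1)) \<partial>lborel)"
    \<comment> \<open>The single time \<open>s = t\<close> is discarded, since the two indicators
      differ there.\<close>
    using AE_lborel_singleton[of t]
  proof (intro nn_integral_mono_AE, eventually_elim)
    case (elim s)
    show ?case
    proof (cases "s > t")
      case True
      have ex: "real (mi_abs \<alpha>) / d - 1 - a = ?e - 1" by simp
      show ?thesis
        using True t moment_src_bound[OF H al, of s, unfolded ex] C by (simp add: ennreal_mult'[symmetric] ennreal_leI)
    qed (use elim in auto)
  qed
  also have "\<dots> = ennreal (moment_const * C) * (\<integral>\<^sup>+s. ennreal (indicator {t<..} s * (1 + s) powr (?e - 1)) \<partial>lborel)"
    by (intro nn_integral_cmult) measurable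
  also have "\<dots> \<le> ennreal (moment_const * C) * ennreal ((1 + t) powr ?e / - ?e)"
    by (intro mult_left_mono nn_integral_one_plus_powr(3) t e) simp
  also have "\<dots> = ennreal (moment_const * C * ((1 + t) powr ?e / - ?e))" by (rule ennreal_mult'[OF C, symmetric])
  finally show ?thesis .
qed

lemma moment_integral_bound:
  assumes H: "borel_src C a H" and al: "\<alpha> \<in> mi_le K" and t: "t \<ge> 0"
    and I: "(\<integral>\<^sup>+s. ennreal (indicator {0<..<t} s * (1 + s) powr (real (mi_abs \<alpha>) / d - a - 1)) \<partial>lborel) \<le> ennreal I" "I \<ge> 0"
  shows "\<bar>moment_integral H \<alpha> t\<bar> \<le> moment_const * C * I"
proof -
  let ?e = "real (mi_abs \<alpha>) / d - a"
  have C: "moment_const * C \<ge> 0" using moment_const_nonneg borel_srcD(1)[OF H] by simp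
  have "ennreal \<bar>moment_integral H \<alpha> t\<bar> \<le> (\<integral>\<^sup>+s. ennreal \<bar>indicator {0<..<t} s * moment G \<alpha> (\<lambda>y. H (y, s)) s\<bar> \<partial>lborel)"
    unfolding moment_integral_def by (rule ennreal_abs_integral_le)
  also have "\<dots> \<le> (\<integral>\<^sup>+s. ennreal (moment_const * C) * ennreal (indicator {0<..<t} s * (1 + s) powr (?e - 1)) \<partial>lborel)"
  proof (intro nn_integral_mono)
    fix s
    have ex: "real (mi_abs \<alpha>) / d - 1 - a = ?e - 1" by simp
    show "ennreal \<bar>indicator {0<..<t} s * moment G \<alpha> (\<lambda>y. H (y, s)) s\<bar> \<le> ennreal (moment_const * C) * ennreal (indicator {0<..<t} s * (1 + s) powr (?e - 1))"
      using moment_src_bound[OF H al, of s, unfolded ex] C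
      by (cases "0 < s \<and> s < t") (auto simp: ennreal_mult'[symmetric] intro!: ennreal_leI)
  qed
  also have "\<dots> = ennreal (moment_const * C) * (\<integral>\<^sup>+s. ennreal (indicator {0<..<t} s * (1 + s) powr (?e - 1)) \<partial>lborel)"
    by (intro nn_integral_cmult) measurable
  also have "\<dots> \<le> ennreal (moment_const * C) * ennreal I" by (intro mult_left_mono I) simp
  also have "\<dots> = ennreal (moment_const * C * I)" by (rule ennreal_mult'[OF C, symmetric])
  finally show ?thesis using C I by (simp add: ennreal_le_iff)
qed

lemma c_coeff_converges:
  assumes al: "\<alpha> \<in> mi_le K" and e: "Ap > real (mi_abs \<alpha>) / d"
  shows "\<exists>c. (\<lambda>t. \<bar>c_coeff G \<phi> f \<alpha> t - c\<bar>) \<in> O[at_top](\<lambda>t. t powr (- Ap + real (mi_abs \<alpha>) / d))"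
proof -
  obtain q B\<phi> Cf Hf Bu where q: "q \<in> borel_measurable borel" "Bd 1 q B\<phi>" "AE x in lborel. \<phi> x = q x"
    and Hf: "borel_src Cf Ap Hf" "rep f Hf" and Bu: "Bu > 0" "\<And>t. t > 0 \<Longrightarrow> Bd (rad t) (\<lambda>x. u x t) Bu"
    using that by (rule borel_data)
  have coeff: "c_coeff G \<phi> f \<alpha> t = moment G \<alpha> q 0 + moment_integral Hf \<alpha> t" for t
    by (rule c_coeff_eq[OF q Hf Bu al])
  define e where "e = real (mi_abs \<alpha>) / d - Ap"
  have e0: "e < 0" using e by (simp add: e_def)
  define m where "m s = indicator {0<..} s * moment G \<alpha> (\<lambda>y. Hf (y, s)) s" for s
  have mm: "m \<in> borel_measurable borel" unfolding m_def[abs_def] by (rule moment_src_measurable[OF Hf(1) al])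
  note tail = moment_tail[OF Hf(1) al, folded m_def e_def, OF e0]
  have int: "integrable lborel m"
  proof (rule integrableI_bounded)
    have "(\<integral>\<^sup>+s. ennreal (norm (m s)) \<partial>lborel) = (\<integral>\<^sup>+s. ennreal \<bar>indicator {0..} s * m s\<bar> \<partial>lborel)"
      by (intro nn_integral_cong) (auto simp: m_def indicator_def)
    also have "\<dots> < \<infinity>" using le_less_trans[OF tail[of 0] ennreal_less_top] by simp
    finally show "(\<integral>\<^sup>+s. ennreal (norm (m s)) \<partial>lborel) < \<infinity>" .
  qed (use mm in simp)
  \<comment> \<open>The limit is the moment of the initial value plus the integral over all times.
    It exists because \<open>|\<alpha>|/d - 1 - Ap < -1\<close>, and the error is the tail beyond
    \<open>t\<close>.\<close>
  define I where "I = (LINT s|lborel. m s)"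
  have "\<bar>c_coeff G \<phi> f \<alpha> t - (moment G \<alpha> q 0 + I)\<bar> \<le> moment_const * Cf / - e * t powr e" if t: "t > 0" for t
  proof -
    have Mi: "moment_integral Hf \<alpha> t = (LINT s|lborel. indicator {..<t} s * m s)"
      unfolding moment_integral_def m_def by (intro Bochner_Integration.integral_cong) (auto simp: indicator_def)
    have i1: "integrable lborel (\<lambda>s. indicator {..<t} s * m s)" "integrable lborel (\<lambda>s. indicator {t..} s * m s)"
      using integrable_mult_indicator[OF _ int, of "{..<t}"] integrable_mult_indicator[OF _ int, of "{t..}"] by auto
    have "I = (LINT s|lborel. indicator {..<t} s * m s + indicator {t..} s * m s)"
      unfolding I_def by (intro Bochner_Integration.integral_cong) (auto simp: indicator_def)
    also have "\<dots> = moment_integral Hf \<alpha> t + (LINT s|lborel. indicator {t..} s * m s)" using i1 by (simp add: Mi)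
    finally have eq: "c_coeff G \<phi> f \<alpha> t - (moment G \<alpha> q 0 + I) = - (LINT s|lborel. indicator {t..} s * m s)"
      unfolding coeff by simp
    have nn: "moment_const * Cf * ((1 + t) powr e / - e) \<ge> 0"
      using moment_const_nonneg borel_srcD(1)[OF Hf(1)] e0 by (intro mult_nonneg_nonneg) (auto simp: divide_nonneg_neg)
    have "ennreal \<bar>LINT s|lborel. indicator {t..} s * m s\<bar> \<le> ennreal (moment_const * Cf * ((1 + t) powr e / - e))"
      by (rule order_trans[OF ennreal_abs_integral_le tail]) (use t in simp)
    then have "\<bar>LINT s|lborel. indicator {t..} s * m s\<bar> \<le> moment_const * Cf * ((1 + t) powr e / - e)"
      using nn by (simp only: ennreal_le_iff)
    also have "\<dots> \<le> moment_const * Cf * (t powr e / - e)"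
      using moment_const_nonneg borel_srcD(1)[OF Hf(1)] e0 t by (intro mult_left_mono divide_right_mono powr_mono2') auto
    finally show ?thesis unfolding eq by simp
  qed
  then have "(\<lambda>t. \<bar>c_coeff G \<phi> f \<alpha> t - (moment G \<alpha> q 0 + I)\<bar>) \<in> O[at_top](\<lambda>t. t powr e)"
    by (intro bigoI[where c = "moment_const * Cf / - e"] eventually_mono[OF eventually_gt_at_top[of 0]]) simp
  moreover have "e = - Ap + real (mi_abs \<alpha>) / d" by (simp add: e_def)
  ultimately show ?thesis by auto
qed

lemma c_coeff_grows:
  assumes al: "\<alpha> \<in> mi_le K"
  shows "Ap < real (mi_abs \<alpha>) / d \<Longrightarrow> c_coeff G \<phi> f \<alpha> \<in> O[at_top](\<lambda>t. t powr (- Ap + real (mi_abs \<alpha>) / d))"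
    and "Ap = real (mi_abs \<alpha>) / d \<Longrightarrow> c_coeff G \<phi> f \<alpha> \<in> O[at_top](\<lambda>t. ln t)"
proof -
  obtain q B\<phi> Cf Hf Bu where q: "q \<in> borel_measurable borel" "Bd 1 q B\<phi>" "AE x in lborel. \<phi> x = q x"
    and Hf: "borel_src Cf Ap Hf" "rep f Hf" and Bu: "Bu > 0" "\<And>t. t > 0 \<Longrightarrow> Bd (rad t) (\<lambda>x. u x t) Bu"
    using that by (rule borel_data)
  have coeff: "c_coeff G \<phi> f \<alpha> t = moment G \<alpha> q 0 + moment_integral Hf \<alpha> t" for t
    by (rule c_coeff_eq[OF q Hf Bu al])
  define e where "e = real (mi_abs \<alpha>) / d - Ap"
  let ?M = "\<bar>moment G \<alpha> q 0\<bar>"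
  have C: "moment_const * Cf \<ge> 0" using moment_const_nonneg borel_srcD(1)[OF Hf(1)] by simp
  note Mb = moment_integral_bound[OF Hf(1) al, folded e_def]
  { assume "Ap < real (mi_abs \<alpha>) / d"
    then have e: "e > 0" by (simp add: e_def)
    have "\<bar>c_coeff G \<phi> f \<alpha> t\<bar> \<le> (?M + moment_const * Cf * (2 powr e / e)) * t powr e" if t: "t \<ge> 1" for t
    proof -
      have "\<bar>moment_integral Hf \<alpha> t\<bar> \<le> moment_const * Cf * ((1 + t) powr e / e)"
        using t e nn_integral_one_plus_powr(1)[of t e] by (intro Mb) auto
      also have "\<dots> \<le> moment_const * Cf * ((2 * t) powr e / e)" using t e C by (intro mult_left_mono divide_right_mono powr_mono2) auto
      also have "\<dots> = moment_const * Cf * (2 powr e / e) * t powr e" using t by (simp add: powr_mult)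
      finally have 1: "\<bar>moment_integral Hf \<alpha> t\<bar> \<le> moment_const * Cf * (2 powr e / e) * t powr e" .
      have "?M * 1 \<le> ?M * t powr e" using t e by (intro mult_left_mono ge_one_powr_ge_zero) auto
      then have "?M + \<bar>moment_integral Hf \<alpha> t\<bar> \<le> (?M + moment_const * Cf * (2 powr e / e)) * t powr e" using 1 by (simp add: distrib_right)
      then show ?thesis unfolding coeff using abs_triangle_ineq[of "moment G \<alpha> q 0" "moment_integral Hf \<alpha> t"] by linarith
    qed
    then have "c_coeff G \<phi> f \<alpha> \<in> O[at_top](\<lambda>t. t powr e)"
      by (intro bigoI[where c = "?M + moment_const * Cf * (2 powr e / e)"] eventually_mono[OF eventually_ge_at_top[of 1]]) simp
    moreover have "e = - Ap + real (mi_abs \<alpha>) / d" by (simp add: e_def)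
    ultimately show "c_coeff G \<phi> f \<alpha> \<in> O[at_top](\<lambda>t. t powr (- Ap + real (mi_abs \<alpha>) / d))" by simp }
  { assume "Ap = real (mi_abs \<alpha>) / d"
    then have e: "e = 0" by (simp add: e_def)
    have "\<bar>c_coeff G \<phi> f \<alpha> t\<bar> \<le> ?M + moment_const * Cf * ln (1 + t)" if t: "t \<ge> 1" for t
    proof -
      have "\<bar>moment_integral Hf \<alpha> t\<bar> \<le> moment_const * Cf * ln (1 + t)"
        using t e nn_integral_one_plus_powr(2)[of t e] by (intro Mb) auto
      then show ?thesis unfolding coeff using abs_triangle_ineq[of "moment G \<alpha> q 0" "moment_integral Hf \<alpha> t"] by linarith
    qed
    note bnd = this
    \<comment> \<open>The constant contribution of the initial value is absorbed into the logarithm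
      once \<open>ln t >= 1\<close>.\<close>
    have l1: "\<forall>\<^sub>F t::real in at_top. 1 \<le> ln t" and l2: "\<forall>\<^sub>F t::real in at_top. ln (1 + t) \<le> 2 * ln t"
      by real_asymp+
    have "\<forall>\<^sub>F t in at_top. norm (c_coeff G \<phi> f \<alpha> t) \<le> (?M + moment_const * Cf * 2) * norm (ln t)"
      using l1 l2 eventually_ge_at_top[of 1]
    proof eventually_elim
      case (elim t)
      have "?M + moment_const * Cf * ln (1 + t) \<le> ?M * ln t + moment_const * Cf * (2 * ln t)"
        using elim C mult_left_mono[of 1 "ln t" ?M] by (intro add_mono mult_left_mono) auto
      then show ?case using bnd[OF elim(3)] elim(1) by (simp add: distrib_right)
    qed
    then show "c_coeff G \<phi> f \<alpha> \<in> O[at_top](\<lambda>t. ln t)" by (rule bigoI) }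
qed

section \<open>Asymptotics of the error\<close>

lemma real_inverse_le_1: "1 \<le> (q::ereal) \<Longrightarrow> real_of_ereal (1 / q) \<le> 1"
  by (cases q) (auto simp: one_ereal_def)

text \<open>The scaled bounds are in terms of \<open>1 + t\<close>, the norm bound of the theorem in
  terms of \<open>t\<close>; the exponent of the first factor is nonnegative, so passing to
  \<open>t\<close> only makes it smaller.\<close>

lemma Bd_norms:
  assumes v: "Bd (rad t) v E" and t: "t > 0" and q: "1 \<le> q" and l: "0 \<le> l" "l \<le> K"
  shows "v \<in> Lp_space q \<inter> L1w_space l"
    and "t powr (real CARD('n) / d * (1 - real_of_ereal (1 / q))) * Lp_norm q v \<le> E"
    and "(1 + t) powr (- l / d) * L1w_norm l v \<le> 2 * E"
proof -
  have r: "rad t > 0" "rad t \<ge> 1" using t by (auto simp: rad_pos rad_ge_1)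
  have E: "E \<ge> 0" by (rule Bd_nonneg[OF v])
  show "v \<in> Lp_space q \<inter> L1w_space l" using Bd_Lp(1)[OF v r(1) q] Bd_L1w(1)[OF v r(2) l] by simp
  let ?\<theta> = "real CARD('n) / d * (1 - real_of_ereal (1 / q))"
  have \<theta>: "?\<theta> \<ge> 0" using real_inverse_le_1[OF q] d_pos by simp
  have e: "rad t powr (- (real CARD('n) * (1 - real_of_ereal (1 / q)))) = (1 + t) powr (- ?\<theta>)"
    using t by (simp add: rad_powr)
  have "t powr ?\<theta> * Lp_norm q v \<le> (1 + t) powr ?\<theta> * (E * (1 + t) powr (- ?\<theta>))"
    using t \<theta> Bd_Lp(2)[OF v r(1) q] E Lp_norm_nonneg[OF Bd_measurable[OF v], of q] unfolding e
    by (intro mult_mono powr_mono2) auto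
  also have "\<dots> = E * ((1 + t) powr ?\<theta> * (1 + t) powr (- ?\<theta>))" by (simp only: mult_ac)
  also have "(1 + t) powr ?\<theta> * (1 + t) powr (- ?\<theta>) = 1" using t by (simp only: powr_add[symmetric]) simp
  finally show "t powr ?\<theta> * Lp_norm q v \<le> E" by simp
  have e2: "rad t powr l = (1 + t) powr (l / d)" using t by (simp add: rad_powr)
  have "(1 + t) powr (- l / d) * L1w_norm l v \<le> (1 + t) powr (- l / d) * (2 * E * (1 + t) powr (l / d))"
    using Bd_L1w(2)[OF v r(2) l] unfolding e2 by (intro mult_left_mono) auto
  also have "\<dots> = 2 * E * ((1 + t) powr (- l / d) * (1 + t) powr (l / d))" by (simp only: mult_ac)
  also have "(1 + t) powr (- l / d) * (1 + t) powr (l / d) = 1" using t by (simp only: powr_add[symmetric]) simp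
  finally show "(1 + t) powr (- l / d) * L1w_norm l v \<le> 2 * E" by simp
qed

text \<open>Here the weight \<open>t^(-l/d)\<close> may be singular at 0, hence the restriction to
  \<open>t >= 1\<close>, where \<open>1 + t <= 2 t\<close> costs the factor
  \<open>2^(l/d)\<close>.\<close>

lemma Bd_err:
  assumes v: "Bd (rad t) v E" and t: "t \<ge> 1" and q: "1 \<le> q" and l: "0 \<le> l" "l \<le> K"
  defines "err \<equiv> t powr (real CARD('n) / d * (1 - real_of_ereal (1 / q))) * Lp_norm q v + t powr (- l / d) * L1w_norm l v"
  shows "0 \<le> err" "err \<le> (1 + 2 * 2 powr (l / d)) * E"
proof -
  have t0: "t > 0" using t by simp
  show "0 \<le> err" unfolding err_def
    using Lp_norm_nonneg[OF Bd_measurable[OF v], of q] L1w_norm_nonneg[of l v] by simp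
  have "t powr (- l / d) \<le> 2 powr (l / d) * (1 + t) powr (- l / d)"
  proof -
    have "((1 + t) / 2) powr (- (l / d)) \<ge> t powr (- (l / d))" using t l d_pos by (intro powr_mono2') auto
    moreover have "((1 + t) / 2) powr (- (l / d)) = 2 powr (l / d) * (1 + t) powr (- (l / d))"
    proof -
      have "((1 + t) / 2) powr (- (l / d)) = (1 + t) powr (- (l / d)) / 2 powr (- (l / d))"
        by (rule powr_divide)
      then show ?thesis unfolding powr_minus[of 2] by (simp only: divide_inverse inverse_inverse_eq mult.commute)
    qed
    ultimately show ?thesis by simp
  qed
  then have "t powr (- l / d) * L1w_norm l v \<le> 2 powr (l / d) * (1 + t) powr (- l / d) * L1w_norm l v"
    by (rule mult_right_mono) (rule L1w_norm_nonneg)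
  also have "\<dots> = 2 powr (l / d) * ((1 + t) powr (- l / d) * L1w_norm l v)" by (simp only: mult_ac)
  also have "\<dots> \<le> 2 powr (l / d) * (2 * E)" by (intro mult_left_mono Bd_norms(3)[OF v t0 q l]) simp
  finally show "err \<le> (1 + 2 * 2 powr (l / d)) * E"
    unfolding err_def using Bd_norms(2)[OF v t0 q l] by (simp add: distrib_right)
qed

lemma rate_asymptotics:
  assumes r: "rate b E" and c: "c \<ge> 0" and err: "\<And>t. t \<ge> 1 \<Longrightarrow> 0 \<le> err t" "\<And>t. t \<ge> 1 \<Longrightarrow> err t \<le> c * E t"
  shows "b < K / d \<Longrightarrow> err \<in> O[at_top](\<lambda>t. t powr (- b))"
    and "b = K / d \<Longrightarrow> err \<in> O[at_top](\<lambda>t. t powr (- K / d) * ln t)"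
    and "b > K / d \<Longrightarrow> err \<in> o[at_top](\<lambda>t. t powr (- K / d))"
proof -
  have le: "\<bar>err t\<bar> \<le> c * C * g t" if "t \<ge> 1" "E t \<le> C * g t" for t C and g :: "real \<Rightarrow> real"
  proof -
    have "err t \<le> c * (C * g t)" using err(2)[OF that(1)] mult_left_mono[OF that(2) c] by linarith
    then show ?thesis using err(1)[OF that(1)] by (simp add: mult.assoc)
  qed
  { assume "b < K / d"
    then obtain C where C: "\<And>t. t > 0 \<Longrightarrow> E t \<le> C * (1 + t) powr (- b)" using r unfolding rate_def by blast
    then have "err \<in> O[at_top](\<lambda>t. (1 + t) powr (- b))"
      using le[of _ C "\<lambda>t. (1 + t) powr (- b)"]
      by (intro bigoI[where c = "c * C"] eventually_mono[OF eventually_ge_at_top[of 1]]) auto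
    also have "(\<lambda>t. (1 + t) powr (- b)) \<in> O[at_top](\<lambda>t. t powr (- b))" by real_asymp
    finally show "err \<in> O[at_top](\<lambda>t. t powr (- b))" . }
  { assume b: "b = K / d"
    then obtain C where C: "\<And>t. t > 0 \<Longrightarrow> E t \<le> C * (1 + t) powr (- b) * (1 + ln (1 + t))" using r unfolding rate_def by blast
    then have "err \<in> O[at_top](\<lambda>t. (1 + t) powr (- b) * (1 + ln (1 + t)))"
      using le[of _ C "\<lambda>t. (1 + t) powr (- b) * (1 + ln (1 + t))"]
      by (intro bigoI[where c = "c * C"] eventually_mono[OF eventually_ge_at_top[of 1]]) (auto simp: abs_mult mult.assoc)
    also have "(\<lambda>t. (1 + t) powr (- b) * (1 + ln (1 + t))) \<in> O[at_top](\<lambda>t. t powr (- b) * ln t)" by real_asymp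
    finally show "err \<in> O[at_top](\<lambda>t. t powr (- K / d) * ln t)" using b by simp }
  { assume "b > K / d"
    then have L: "((\<lambda>t. (1 + t) powr (K / d) * E t) \<longlongrightarrow> 0) at_top" using r by (simp add: rate_def little_def)
    have "((\<lambda>t. err t / t powr (- K / d)) \<longlongrightarrow> 0) at_top"
    proof (rule tendsto_sandwich[of "\<lambda>_. 0" _ _ "\<lambda>t. c * ((1 + t) powr (K / d) * E t)"])
      show "\<forall>\<^sub>F t in at_top. 0 \<le> err t / t powr (- K / d)"
        using eventually_ge_at_top[of 1] by eventually_elim (simp add: err)
      show "\<forall>\<^sub>F t in at_top. err t / t powr (- K / d) \<le> c * ((1 + t) powr (K / d) * E t)"
        using eventually_ge_at_top[of 1]
      proof eventually_elim
        case (elim t)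
        have "err t / t powr (- K / d) = t powr (K / d) * err t" using elim by (simp add: powr_minus divide_inverse)
        also have "\<dots> \<le> (1 + t) powr (K / d) * (c * E t)"
          using elim err(1,2)[OF elim] K_nonneg d_pos by (intro mult_mono powr_mono2) auto
        finally show ?case by (simp only: mult_ac)
      qed
      show "((\<lambda>t. c * ((1 + t) powr (K / d) * E t)) \<longlongrightarrow> 0) at_top" by (rule tendsto_mult_right_zero[OF L])
    qed simp
    then show "err \<in> o[at_top](\<lambda>t. t powr (- K / d))"
      by (rule smalloI_tendsto) (use eventually_gt_at_top[of 0] in \<open>eventually_elim, simp\<close>) }
qed

lemma profile_asymptotics:
  assumes q: "1 \<le> q" and l: "0 \<le> l" "l \<le> K"
  shows "let U = profile G F K \<phi> f n;
             err = (\<lambda>t. t powr (real CARD('n) / d * (1 - real_of_ereal (1 / q)))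
                          * Lp_norm q (\<lambda>x. u x t - U x t)
                        + t powr (- l / d) * L1w_norm l (\<lambda>x. u x t - U x t))
         in
          (\<forall>t>0. (\<lambda>x. U x t) \<in> Lp_space q \<inter> L1w_space l) \<and>
          bdd_above ((\<lambda>t. t powr (real CARD('n) / d * (1 - real_of_ereal (1 / q)))
                        * Lp_norm q (\<lambda>x. U x t)) ` {0<..}) \<and>
          bdd_above ((\<lambda>t. (1 + t) powr (- l / d) * L1w_norm l (\<lambda>x. U x t)) ` {0<..}) \<and>
          ((real n + 1) * Ap \<noteq> K / d \<longrightarrow>
             (\<exists>r1 \<in> o[at_top](\<lambda>t. t powr (- K / d)).
              \<exists>r2 \<in> O[at_top](\<lambda>t. t powr (- (real n + 1) * Ap)).
                \<forall>\<^sub>F t in at_top. err t = r1 t + r2 t)) \<and>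
          ((real n + 1) * Ap = K / d \<longrightarrow>
             err \<in> O[at_top](\<lambda>t. t powr (- K / d) * ln t))"
proof -
  obtain q0 B\<phi> Cf Hf Bu where q0: "q0 \<in> borel_measurable borel" "Bd 1 q0 B\<phi>" "AE x in lborel. \<phi> x = q0 x"
    and Hf: "borel_src Cf Ap Hf" "rep f Hf" and Bu: "Bu > 0" "\<And>t. t > 0 \<Longrightarrow> Bd (rad t) (\<lambda>x. u x t) Bu"
    using that by (rule borel_data)
  define U where "U = profile G F K \<phi> f n"
  obtain B E where B: "\<And>t. t > 0 \<Longrightarrow> Bd (rad t) (\<lambda>x. U x t) B"
    and E: "\<And>t. t > 0 \<Longrightarrow> Bd (rad t) (\<lambda>x. u x t - U x t) (E t)" and r: "rate ((real n + 1) * Ap) E"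
    by (rule profile_bounds[OF q0 Hf Bu, of n, folded U_def]) (assumption, rule that)
  define err where "err = (\<lambda>t. t powr (real CARD('n) / d * (1 - real_of_ereal (1 / q))) * Lp_norm q (\<lambda>x. u x t - U x t)
                        + t powr (- l / d) * L1w_norm l (\<lambda>x. u x t - U x t))"
  have err: "0 \<le> err t" "err t \<le> (1 + 2 * 2 powr (l / d)) * E t" if "t \<ge> 1" for t
    unfolding err_def using Bd_err[OF E[of t] that q l] that by auto
  have c: "1 + 2 * 2 powr (l / d) \<ge> 0" by simp
  note as = rate_asymptotics[OF r c err]
  have 1: "\<forall>t>0. (\<lambda>x. U x t) \<in> Lp_space q \<inter> L1w_space l" using Bd_norms(1)[OF B _ q l] by blast
  have 2: "bdd_above ((\<lambda>t. t powr (real CARD('n) / d * (1 - real_of_ereal (1 / q))) * Lp_norm q (\<lambda>x. U x t)) ` {0<..})"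
    using Bd_norms(2)[OF B _ q l] unfolding bdd_above_def by (intro exI[of _ B]) auto
  have 3: "bdd_above ((\<lambda>t. (1 + t) powr (- l / d) * L1w_norm l (\<lambda>x. U x t)) ` {0<..})"
    using Bd_norms(3)[OF B _ q l] unfolding bdd_above_def by (intro exI[of _ "2 * B"]) auto
  \<comment> \<open>One of the two summands may be taken to be 0: below the threshold the error is
    purely \<open>O\<close>, above it purely \<open>o\<close>.\<close>
  have 4: "\<exists>r1 \<in> o[at_top](\<lambda>t. t powr (- K / d)). \<exists>r2 \<in> O[at_top](\<lambda>t. t powr (- (real n + 1) * Ap)).
                \<forall>\<^sub>F t in at_top. err t = r1 t + r2 t" if ne: "(real n + 1) * Ap \<noteq> K / d"
  proof (cases "(real n + 1) * Ap < K / d")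
    case True
    then have "err \<in> O[at_top](\<lambda>t. t powr (- (real n + 1) * Ap))" using as(1) by (simp only: minus_mult_left)
    then show ?thesis by (intro bexI[of _ "\<lambda>_. 0"] bexI[of _ err]) auto
  next
    case False
    then have "err \<in> o[at_top](\<lambda>t. t powr (- K / d))" using as(3) ne by simp
    then show ?thesis by (intro bexI[of _ err] bexI[of _ "\<lambda>_. 0"]) auto
  qed
  have 5: "err \<in> O[at_top](\<lambda>t. t powr (- K / d) * ln t)" if "(real n + 1) * Ap = K / d"
    using as(2) that by simp
  show ?thesis
    unfolding Let_def U_def[symmetric]
    by (intro conjI impI 1 2 3 4[unfolded err_def] 5[unfolded err_def])
qed

lemma profile_formula:
  assumes "t > 0"
  shows "profile G F K \<phi> f (Suc n) x t =
          (\<Sum>\<alpha>\<in>mi_le K.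
             (moment G \<alpha> \<phi> 0 +
              (LINT s:{0<..<t}|lebesgue.
                 moment G \<alpha> (\<lambda>y. f y s - F y s (profile G F K \<phi> f n y s)) s)) * g_fun G \<alpha> x t) +
          (LINT s:{0<..<t}|lebesgue.
             kernel_semigroup G (t - s) (\<lambda>y. F y s (profile G F K \<phi> f n y s)) x)"
proof -
  obtain q B\<phi> Cf Hf Bu where q: "q \<in> borel_measurable borel" "Bd 1 q B\<phi>" "AE x in lborel. \<phi> x = q x"
    and Hf: "borel_src Cf Ap Hf" "rep f Hf" and Bu: "Bu > 0" "\<And>t. t > 0 \<Longrightarrow> Bd (rad t) (\<lambda>x. u x t) Bu"
    using that by (rule borel_data)
  show ?thesis by (rule profile_Suc_formula[OF q Hf Bu assms])
qed

end

section \<open>From condition (G) to the abstract setting\<close>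

lemma condition_G_kernel:
  fixes G :: "real ^ 'n::finite \<Rightarrow> real \<Rightarrow> real"
  assumes d: "d > 0" and L: "L > 0" and G: "condition_G \<gamma> d L G" and K: "0 \<le> K" "K < L" "\<lfloor>K\<rfloor> + 1 \<le> int \<gamma>"
  obtains CB where "self_similar_kernel (\<lambda>x. G x 1) \<gamma> L K CB G d"
proof -
  let ?\<Gamma> = "\<lambda>x. G x 1"
  note G' = G[unfolded condition_G_def]
  note G1 = G'[THEN conjunct1] and G2 = G'[THEN conjunct2, THEN conjunct1]
    and G3 = G'[THEN conjunct2, THEN conjunct2, THEN conjunct1] and G4 = G'[THEN conjunct2, THEN conjunct2, THEN conjunct2]
  have Ck: "Ck_on \<gamma> (\<lambda>x. G x t) UNIV" if "t > 0" for t
    using Ck_on_slice[OF G1 that] by (simp only: prod.case)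
  have "\<forall>j\<in>{..\<gamma>}. \<exists>M. \<forall>x. (1 + norm x) powr (real CARD('n) + L + real j) * grad_norm j ?\<Gamma> x \<le> M"
    using G3 unfolding bdd_above_def by blast
  from bchoice[OF this] obtain M where M: "\<forall>j\<in>{..\<gamma>}. \<forall>x. (1 + norm x) powr (real CARD('n) + L + real j) * grad_norm j ?\<Gamma> x \<le> M j"
    by blast
  \<comment> \<open>One constant for all orders up to \<open>\<gamma>\<close>; the absolute values
    allow each summand to be bounded by the sum.\<close>
  define CB where "CB = (\<Sum>j\<le>\<gamma>. \<bar>M j\<bar>)"
  have dec: "\<bar>foldr partial_deriv w ?\<Gamma> x\<bar> \<le> CB * (1 + norm x) powr (- (real CARD('n) + L))" if w: "length w \<le> \<gamma>" for w x
  proof -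
    define j where "j = length w"
    have fin: "finite {\<alpha> :: 'n multi_index. mi_abs \<alpha> = j}"
      by (rule finite_subset[OF _ finite_mi_le[of "real j"]]) (auto simp: mi_le_def)
    have "foldr partial_deriv w ?\<Gamma> = mi_deriv (count (mset w)) ?\<Gamma>"
      using Ck_on_antimono[OF Ck[OF zero_less_one] w] by (rule foldr_partial_deriv_eq_mi_deriv)
    then have "\<bar>foldr partial_deriv w ?\<Gamma> x\<bar> = sqrt ((mi_deriv (count (mset w)) ?\<Gamma> x)\<^sup>2)" by simp
    also have "\<dots> \<le> grad_norm j ?\<Gamma> x"
      unfolding grad_norm_def using fin
      by (intro real_sqrt_le_mono member_le_sum) (auto simp: mi_abs_count_word j_def)
    finally have 1: "\<bar>foldr partial_deriv w ?\<Gamma> x\<bar> \<le> grad_norm j ?\<Gamma> x" .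
    let ?p = "(1 + norm x) powr (real CARD('n) + L)"
    have p: "?p > 0" by (smt (verit) norm_ge_zero powr_gt_zero)
    \<comment> \<open>A single derivative is at most the norm of all derivatives of its order, and
      the weight in condition (G) with exponent \<open>N + L + j\<close> dominates the common weight
      with exponent \<open>N + L\<close>.\<close>
    have "?p * \<bar>foldr partial_deriv w ?\<Gamma> x\<bar> \<le> (1 + norm x) powr (real CARD('n) + L + real j) * grad_norm j ?\<Gamma> x"
      using 1 by (intro mult_mono powr_mono) auto
    also have "\<dots> \<le> M j" using M w by (simp add: j_def)
    also have "M j \<le> \<bar>M j\<bar>" by simp
    also have "\<dots> \<le> CB" unfolding CB_def using w by (intro member_le_sum) (auto simp: j_def)
    finally have "\<bar>foldr partial_deriv w ?\<Gamma> x\<bar> \<le> CB / ?p" using p by (simp add: field_simps)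
    then show ?thesis by (simp only: powr_minus divide_inverse)
  qed
  have dp: "decaying_profile ?\<Gamma> \<gamma> L K CB"
    using K Ck[OF zero_less_one] dec by unfold_locales auto
  have dil: "G x t = decaying_profile.dil (t powr (1 / d)) ?\<Gamma> x" if t: "t > 0" for x t
  proof -
    have "t powr (- real CARD('n) / d) = inverse ((t powr (1 / d)) ^ CARD('n))"
      using t by (simp add: powr_power powr_minus[symmetric])
    moreover have "G x t = t powr (- real CARD('n) / d) * G (x /\<^sub>R (t powr (1 / d))) 1"
      using G2 t by blast
    ultimately show ?thesis unfolding decaying_profile.dil_def[OF dp] by (simp add: divide_inverse mult.commute)
  qed
  have "self_similar_kernel ?\<Gamma> \<gamma> L K CB G d"
    unfolding self_similar_kernel_def self_similar_kernel_axioms_def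
    by (intro conjI allI impI dp d dil Ck G4[rule_format])
  then show ?thesis by (rule that)
qed

theorem theorem5p1:
  fixes G :: "real ^ 'n::finite \<Rightarrow> real \<Rightarrow> real"
    and \<gamma> :: nat and d L K Cs A p Ap :: real
    and \<phi> :: "real ^ 'n \<Rightarrow> real"
    and F :: "real ^ 'n \<Rightarrow> real \<Rightarrow> real \<Rightarrow> real"
    and u f :: "real ^ 'n \<Rightarrow> real \<Rightarrow> real"
  assumes "\<gamma> \<ge> 1" "d > 0" "L > 0" "condition_G \<gamma> d L G"
    and "0 \<le> K" "K < L" "\<lfloor>K\<rfloor> + 1 \<le> int \<gamma>"
    and "\<phi> \<in> Lp_space \<infinity> \<inter> L1w_space K"
    and F_measurable: "\<And>w. w \<in> borel_measurable spacetime \<Longrightarrow>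
          (\<lambda>(x, t). F x t (w (x, t))) \<in> borel_measurable spacetime"
    and F_zero: "\<And>x t. t > 0 \<Longrightarrow> F x t 0 = 0"
    and "Cs > 0" "p \<ge> 1"
    and F_lipschitz: "\<And>x t u1 u2. t > 0 \<Longrightarrow>
          \<bar>F x t u1 - F x t u2\<bar> \<le>
            Cs * (1 + t) powr A * max (abs_pow_pred p u1) (abs_pow_pred p u2) * \<bar>u1 - u2\<bar>"
    and Ap_def: "Ap = - A + real CARD('n) * (p - 1) / d - 1" and "Ap > 0"
    and u_measurable: "(\<lambda>(x, t). u x t) \<in> borel_measurable spacetime"
    and u_solution: "\<And>x t. t > 0 \<Longrightarrow>
          u x t = (LINT y|lebesgue. G (x - y) t * \<phi> y) +
            (LINT s:{0<..<t}|lebesgue. (LINT y|lebesgue. G (x - y) (t - s) * F y s (u y s)))"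
    and u_bounds: "\<And>q l. 1 \<le> q \<Longrightarrow> 0 \<le> l \<Longrightarrow> l \<le> K \<Longrightarrow>
          (\<forall>t>0. (\<lambda>x. u x t) \<in> Lp_space q \<inter> L1w_space l) \<and>
          bdd_above ((\<lambda>t. (1 + t) powr (real CARD('n) / d * (1 - real_of_ereal (1 / q)))
                        * Lp_norm q (\<lambda>x. u x t)) ` {0<..}) \<and>
          bdd_above ((\<lambda>t. (1 + t) powr (- l / d) * L1w_norm l (\<lambda>x. u x t)) ` {0<..})"
    and f_def: "f = (\<lambda>x t. F x t (u x t))"
  shows
    "(\<forall>\<alpha>\<in>mi_le K.
        (Ap > real (mi_abs \<alpha>) / d \<longrightarrow>
           (\<exists>c. (\<lambda>t. \<bar>c_coeff G \<phi> f \<alpha> t - c\<bar>)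
                  \<in> O[at_top](\<lambda>t. t powr (- Ap + real (mi_abs \<alpha>) / d)))) \<and>
        (Ap < real (mi_abs \<alpha>) / d \<longrightarrow>
           c_coeff G \<phi> f \<alpha> \<in> O[at_top](\<lambda>t. t powr (- Ap + real (mi_abs \<alpha>) / d))) \<and>
        (Ap = real (mi_abs \<alpha>) / d \<longrightarrow>
           c_coeff G \<phi> f \<alpha> \<in> O[at_top](\<lambda>t. ln t)))
     \<and>
     (\<forall>n x t. t > 0 \<longrightarrow>
        profile G F K \<phi> f (Suc n) x t =
          (\<Sum>\<alpha>\<in>mi_le K.
             (moment G \<alpha> \<phi> 0 +
              (LINT s:{0<..<t}|lebesgue.
                 moment G \<alpha> (\<lambda>y. f y s - F y s (profile G F K \<phi> f n y s)) s)) * g_fun G \<alpha> x t) +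
          (LINT s:{0<..<t}|lebesgue.
             kernel_semigroup G (t - s) (\<lambda>y. F y s (profile G F K \<phi> f n y s)) x))
     \<and>
     (\<forall>q l n. 1 \<le> q \<longrightarrow> 0 \<le> l \<longrightarrow> l \<le> K \<longrightarrow>
        (let U = profile G F K \<phi> f n;
             err = (\<lambda>t. t powr (real CARD('n) / d * (1 - real_of_ereal (1 / q)))
                          * Lp_norm q (\<lambda>x. u x t - U x t)
                        + t powr (- l / d) * L1w_norm l (\<lambda>x. u x t - U x t))
         in
          (\<forall>t>0. (\<lambda>x. U x t) \<in> Lp_space q \<inter> L1w_space l) \<and>
          bdd_above ((\<lambda>t. t powr (real CARD('n) / d * (1 - real_of_ereal (1 / q)))
                        * Lp_norm q (\<lambda>x. U x t)) ` {0<..}) \<and>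
          bdd_above ((\<lambda>t. (1 + t) powr (- l / d) * L1w_norm l (\<lambda>x. U x t)) ` {0<..}) \<and>
          ((real n + 1) * Ap \<noteq> K / d \<longrightarrow>
             (\<exists>r1 \<in> o[at_top](\<lambda>t. t powr (- K / d)).
              \<exists>r2 \<in> O[at_top](\<lambda>t. t powr (- (real n + 1) * Ap)).
                \<forall>\<^sub>F t in at_top. err t = r1 t + r2 t)) \<and>
          ((real n + 1) * Ap = K / d \<longrightarrow>
             err \<in> O[at_top](\<lambda>t. t powr (- K / d) * ln t))))"
proof -
  obtain CB where "self_similar_kernel (\<lambda>x. G x 1) \<gamma> L K CB G d"
    using condition_G_kernel[OF assms(2,3,4,5,6,7)] .
  then interpret nonlinear_problem "\<lambda>x. G x 1" \<gamma> L K CB G d \<phi> F u Cs A p Ap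
    using assms by (intro nonlinear_problem.intro nonlinear_problem_axioms.intro)
  show ?thesis
    unfolding f_def
    by (intro conjI ballI allI impI c_coeff_converges c_coeff_grows profile_formula profile_asymptotics)
qed

end
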